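(* Let $K$ be a field, let $A=K[a_1,\dots,a_m]$, let $R=P/I$ be a positive $A$-algebra of dimension $d$, let $\Theta:\operatorname{Spec}(R)\to\mathbb{A}^m_K$ be its canonical morphism, let $G=(g_1,\dots,g_s)$ be a tuple of $W$-homogeneous polynomials which generate $I$, let $\mathcal{L}_A(G)$ be the $A$-linear coefficient matrix of $G$, and let $J_{n-d}$ be the ideal of $A$ generated by all minors of size $n-d$ of $\mathcal{L}_A(G)$. (a) For every $\Gamma\in K^m$, we have $$\operatorname{rk}(\mathcal{L}_K(G_\Gamma))=n-\dim_K(\operatorname{Cot}_{\mathfrak{M}_{\Gamma_0}}(R))\le n-d_{\Gamma_0}.$$ (b) $\operatorname{Sing}_0(\Theta)=\{\Gamma\in K^m\mid\operatorname{rk}(\mathcal{L}_K(G_\Gamma))<n-d_{\Gamma_0}\}$. (c) If $\operatorname{rk}(\mathcal{L}_A(G))<n-d$ then $\operatorname{Sing}_0(\Theta)=\mathbb{A}^m_K$, i.e., the zero section $Z_R$ is contained in the singular locus of $\operatorname{Spec}(R)$. (d) If $\operatorname{rk}(\mathcal{L}_A(G))=n-d$ then $\mathcal{Z}(J_{n-d})\subseteq\operatorname{Sing}_0(\Theta)$. (e) Assume that $\operatorname{Spec}(R)$ is equidimensional. Then $\operatorname{rk}(\mathcal{L}_A(G))\le n-d$ and $\operatorname{Sing}_0(\Theta)=\mathcal{Z}(J_{n-d})$, i.e., the set of zeros of $J_{n-d}$.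
   Context: $A=K[a_1,\dots,a_m]$ is a trivially graded polynomial ring over the field $K$, and $P=A[x_1,\dots,x_k]$ is graded by $\deg(a_i)=0$ and $\deg(x_j)=w_j$, with positive integers $w_j$; $W=(w_1,\dots,w_k)$, $n=m+k$, $X=\{x_1,\dots,x_k\}$. A positive $A$-algebra is a ring $R=P/I$ where $I$ is a $W$-homogeneous ideal of $P$ with $I\cap A=\{0\}$ (hence $I\subseteq\langle x_1,\dots,x_k\rangle$). The canonical morphism $\Theta:\operatorname{Spec}(R)\to\mathbb{A}^m_K=\operatorname{Spec}(A)$ is induced by $A\to R$. The zero section $Z_R$ is the image of the morphism $\mathbb{A}^m_K\to\operatorname{Spec}(R)$ induced by $R\to P/\langle x_1,\dots,x_k\rangle\cong A$. For $\Gamma=(\gamma_1,\dots,\gamma_m)\in K^m$: $\Gamma_0=(\gamma_1,\dots,\gamma_m,0,\dots,0)$ is the zero point over $\Gamma$, with maximal ideal $\mathfrak{M}_{\Gamma_0}=\langle a_1-\gamma_1,\dots,a_m-\gamma_m,x_1,\dots,x_k\rangle$ of $P$; $R_{\Gamma_0}$ is the localization of $R$ at $\mathfrak{M}_{\Gamma_0}/I$ and $d_{\Gamma_0}$ its Krull dimension; $\operatorname{Cot}_{\mathfrak{M}_{\Gamma_0}}(R)=\overline{\mathfrak M}/\overline{\mathfrak M}^2$ with $\overline{\mathfrak M}=\mathfrak{M}_{\Gamma_0}/I$ is the cotangent space of $R$ at $\Gamma_0$. $\operatorname{Sing}_0(\Theta)$ is the set of all $\Gamma\in K^m$ such that $R_{\Gamma_0}$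 has positive embedding codimension $\dim_K(\mathfrak{m}/\mathfrak{m}^2)-\dim(R_{\Gamma_0})$ ($\mathfrak m$ its maximal ideal), i.e. such that $\Gamma_0$ is a singular point of $\operatorname{Spec}(R)$. Only $K$-rational points are considered: $\mathbb{A}^m_K$ in (c) stands for $K^m$, and $\mathcal{Z}(J)$ is the set of zeros in $K^m$ of an ideal $J\subseteq A$. For $f\in P$ written as $f=f_0+f_1x_1+\cdots+f_kx_k+g$ with $f_0,\dots,f_k\in A$ and $g\in\langle X\rangle^2$, the $A$-linear part is $\operatorname{Lin}_A(f)=f_1x_1+\cdots+f_kx_k$. Writing $\operatorname{Lin}_A(g_i)=g_{i1}x_1+\cdots+g_{ik}x_k$ with $g_{ij}\in A$, the $A$-linear coefficient matrix of $G$ is $\mathcal{L}_A(G)=(g_{ij})\in\operatorname{Mat}_{s,k}(A)$ (its rank is taken over the quotient field of $A$), and $\mathcal{L}_K(G_\Gamma)=(g_{ij}(\gamma_1,\dots,\gamma_m))\in\operatorname{Mat}_{s,k}(K)$. Equidimensional means that all irreducible components have the same dimension. *)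

theory Defs
  imports
    "HOL-Library.Poly_Mapping"
    "HOL-Library.Extended_Nat"
    "HOL-Computational_Algebra.Fraction_Field"
    "HOL-Algebra.QuotRing"
    "HOL-Algebra.Ideal_Product"
    "HOL-Analysis.Abstract_Topology"
    "Jordan_Normal_Form.DL_Rank"
    "Jordan_Normal_Form.DL_Submatrix"
begin

section \<open>Polynomial rings in finitely many indeterminates\<close>

type_synonym 'a mpol = "(nat \<Rightarrow>\<^sub>0 nat) \<Rightarrow>\<^sub>0 'a"

text \<open>
  \<open>mpol_ring B l\<close> is the ring of polynomials in the indeterminates with indices \<open>0, \<dots>, l - 1\<close> and
  with coefficients in the subring \<open>B\<close> of the coefficient type. The type \<open>'a mpol\<close> itself has
  infinitely many indeterminates; the carrier cuts them down to \<open>l\<close>.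
\<close>

definition mpol_ring :: "'a::comm_ring_1 set \<Rightarrow> nat \<Rightarrow> 'a mpol ring" where
  "mpol_ring B l =
     \<lparr>carrier = {f. \<forall>t\<in>Poly_Mapping.keys f. Poly_Mapping.keys t \<subseteq> {..<l} \<and> Poly_Mapping.lookup f t \<in> B},
      monoid.mult = (*), one = 1, zero = 0, add = (+)\<rparr>"

definition const :: "'a::comm_ring_1 \<Rightarrow> 'a mpol" where
  "const c = Poly_Mapping.single 0 c"

definition indet :: "nat \<Rightarrow> 'a::comm_ring_1 mpol" where
  "indet i = Poly_Mapping.single (Poly_Mapping.single i 1) 1"

text \<open>The rings \<open>A = K[a\<^sub>1, \<dots>, a\<^sub>m]\<close> and \<open>P = A[x\<^sub>1, \<dots>, x\<^sub>k]\<close>. Here \<open>P\<close> is literally a polynomial ring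
  over \<open>A\<close>, so \<open>A\<close> sits in \<open>P\<close> via \<^const>\<open>const\<close>, and \<open>K\<close> via \<open>const \<circ> const\<close>. Indices start at 0.\<close>

definition A_ring :: "nat \<Rightarrow> 'k::field mpol ring" where
  "A_ring m = mpol_ring UNIV m"

definition P_ring :: "nat \<Rightarrow> nat \<Rightarrow> 'k::field mpol mpol ring" where
  "P_ring m k = mpol_ring (carrier (A_ring m)) k"

definition eval_at :: "'k::field vec \<Rightarrow> 'k mpol \<Rightarrow> 'k" where
  "eval_at \<Gamma> p =
     (\<Sum>t\<in>Poly_Mapping.keys p. Poly_Mapping.lookup p t * (\<Prod>i\<in>Poly_Mapping.keys t. (\<Gamma> $ i) ^ Poly_Mapping.lookup t i))"


section \<open>Positive algebras\<close>

text \<open>The elements of \<open>A\<close> have degree 0, so only the exponents of the \<open>x\<^sub>j\<close> contribute to the degree.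
  The zero polynomial counts as homogeneous.\<close>

definition W_homogeneous :: "nat list \<Rightarrow> 'k::field mpol mpol \<Rightarrow> bool" where
  "W_homogeneous W f \<longleftrightarrow>
     (\<exists>e. \<forall>t\<in>Poly_Mapping.keys f. (\<Sum>j<length W. W ! j * Poly_Mapping.lookup t j) = e)"

text \<open>\<open>R = P/I\<close> is a positive \<open>A\<close>-algebra. The ideal is homogeneous, i.e. generated by homogeneous
  elements.\<close>

definition positive_algebra :: "nat \<Rightarrow> nat \<Rightarrow> nat list \<Rightarrow> 'k::field mpol mpol set \<Rightarrow> bool" where
  "positive_algebra m k W I \<longleftrightarrow>
     length W = k \<and> (\<forall>w\<in>set W. 0 < w) \<and>
     ideal I (P_ring m k) \<and>
     (\<exists>H \<subseteq> carrier (P_ring m k). (\<forall>h\<in>H. W_homogeneous W h) \<and> I = genideal (P_ring m k) H) \<and>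
     I \<inter> const ` carrier (A_ring m) = {0}"

definition R_ring :: "nat \<Rightarrow> nat \<Rightarrow> 'k::field mpol mpol set \<Rightarrow> 'k mpol mpol set ring" where
  "R_ring m k I = P_ring m k Quot I"

definition R_of_K :: "nat \<Rightarrow> nat \<Rightarrow> 'k::field mpol mpol set \<Rightarrow> 'k \<Rightarrow> 'k mpol mpol set" where
  "R_of_K m k I c = I +>\<^bsub>P_ring m k\<^esub> const (const c)"


section \<open>Dimension, spectrum, localization\<close>

definition krull_dim :: "('a, 'b) ring_scheme \<Rightarrow> enat" where
  "krull_dim R =
     Sup {enat r | r. \<exists>\<pp> :: nat \<Rightarrow> 'a set.
       (\<forall>i\<le>r. primeideal (\<pp> i) R) \<and> (\<forall>i<r. \<pp> i \<subset> \<pp> (Suc i))}"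

definition Spec :: "('a, 'b) ring_scheme \<Rightarrow> 'a set topology" where
  "Spec R = topology (\<lambda>U. \<exists>S \<subseteq> carrier R. U = {\<pp>. primeideal \<pp> R \<and> \<not> S \<subseteq> \<pp>})"

lemma istopology_Spec:
  "istopology (\<lambda>U. \<exists>S \<subseteq> carrier R. U = {\<pp>. primeideal \<pp> R \<and> \<not> S \<subseteq> \<pp>})"
  (is "istopology ?op")
  unfolding istopology_def
proof (intro conjI allI impI)
  fix U V assume "?op U" "?op V"
  then obtain S T where S: "S \<subseteq> carrier R" "U = {\<pp>. primeideal \<pp> R \<and> \<not> S \<subseteq> \<pp>}"
    and T: "T \<subseteq> carrier R" "V = {\<pp>. primeideal \<pp> R \<and> \<not> T \<subseteq> \<pp>}" by blast
  define Q where "Q = (\<lambda>(s, t). s \<otimes>\<^bsub>R\<^esub> t) ` (S \<times> T) \<inter> carrier R"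
  have "S \<subseteq> \<pp> \<or> T \<subseteq> \<pp> \<longleftrightarrow> Q \<subseteq> \<pp>" if \<pp>: "primeideal \<pp> R" for \<pp>
  proof -
    interpret primeideal \<pp> R by (fact \<pp>)
    show ?thesis
    proof
      assume or: "S \<subseteq> \<pp> \<or> T \<subseteq> \<pp>"
      show "Q \<subseteq> \<pp>"
      proof
        fix q assume "q \<in> Q"
        then obtain s t where q: "q = s \<otimes>\<^bsub>R\<^esub> t" and st: "s \<in> S" "t \<in> T" by (auto simp: Q_def)
        have "s \<in> carrier R" "t \<in> carrier R" using st S(1) T(1) by auto
        with or st show "q \<in> \<pp>" unfolding q by (meson I_l_closed I_r_closed subsetD)
      qed
    next
      assume *: "Q \<subseteq> \<pp>"
      show "S \<subseteq> \<pp> \<or> T \<subseteq> \<pp>"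
      proof (rule ccontr)
        assume "\<not> (S \<subseteq> \<pp> \<or> T \<subseteq> \<pp>)"
        then obtain s t where st: "s \<in> S" "s \<notin> \<pp>" "t \<in> T" "t \<notin> \<pp>" by blast
        have c: "s \<in> carrier R" "t \<in> carrier R" using st S(1) T(1) by auto
        then have "s \<otimes>\<^bsub>R\<^esub> t \<in> carrier R" by (rule m_closed)
        moreover have "s \<otimes>\<^bsub>R\<^esub> t \<in> (\<lambda>(s, t). s \<otimes>\<^bsub>R\<^esub> t) ` (S \<times> T)" using st by force
        ultimately have "s \<otimes>\<^bsub>R\<^esub> t \<in> \<pp>" using * unfolding Q_def by blast
        then show False using I_prime[OF c] st by blast
      qed
    qed
  qed
  then have "U \<inter> V = {\<pp>. primeideal \<pp> R \<and> \<not> Q \<subseteq> \<pp>}" unfolding S(2) T(2) by blast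
  moreover have "Q \<subseteq> carrier R" by (simp add: Q_def)
  ultimately show "?op (U \<inter> V)" by blast
next
  fix \<K> assume "\<forall>K\<in>\<K>. ?op K"
  then obtain S where S: "\<forall>K\<in>\<K>. S K \<subseteq> carrier R \<and> K = {\<pp>. primeideal \<pp> R \<and> \<not> S K \<subseteq> \<pp>}"
    unfolding bchoice_iff by blast
  have "\<pp> \<in> \<Union>\<K> \<longleftrightarrow> primeideal \<pp> R \<and> \<not> \<Union> (S ` \<K>) \<subseteq> \<pp>" for \<pp>
  proof -
    have "\<pp> \<in> K \<longleftrightarrow> primeideal \<pp> R \<and> \<not> S K \<subseteq> \<pp>" if "K \<in> \<K>" for K
    proof -
      have "K = {\<pp>. primeideal \<pp> R \<and> \<not> S K \<subseteq> \<pp>}" using S that by blast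
      then have "\<pp> \<in> K \<longleftrightarrow> \<pp> \<in> {\<pp>. primeideal \<pp> R \<and> \<not> S K \<subseteq> \<pp>}" by (rule arg_cong)
      then show ?thesis by simp
    qed
    then show ?thesis by (simp add: UN_subset_iff)
  qed
  then have "\<Union>\<K> = {\<pp>. primeideal \<pp> R \<and> \<not> \<Union> (S ` \<K>) \<subseteq> \<pp>}" by blast
  moreover have "\<Union> (S ` \<K>) \<subseteq> carrier R" using S by blast
  ultimately show "?op (\<Union>\<K>)" by blast
qed

lemma openin_Spec:
  "openin (Spec R) U \<longleftrightarrow> (\<exists>S \<subseteq> carrier R. U = {\<pp>. primeideal \<pp> R \<and> \<not> S \<subseteq> \<pp>})"
  by (simp add: Spec_def istopology_Spec topology_inverse')

lemma topspace_Spec: "topspace (Spec R) = {\<pp>. primeideal \<pp> R}"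
proof -
  have "carrier R \<noteq> \<pp> \<and> \<pp> \<subseteq> carrier R" if "primeideal \<pp> R" for \<pp>
  proof -
    interpret primeideal \<pp> R by (fact that)
    show ?thesis using I_notcarr a_subset by blast
  qed
  then have "{\<pp>. primeideal \<pp> R} = {\<pp>. primeideal \<pp> R \<and> \<not> carrier R \<subseteq> \<pp>}" by blast
  then have "openin (Spec R) {\<pp>. primeideal \<pp> R}" unfolding openin_Spec by blast
  moreover have "U \<subseteq> {\<pp>. primeideal \<pp> R}" if "openin (Spec R) U" for U
    using that by (auto simp: openin_Spec)
  ultimately show ?thesis by (auto simp: topspace_def)
qed

definition irreducible_in :: "'a topology \<Rightarrow> 'a set \<Rightarrow> bool" where
  "irreducible_in X Z \<longleftrightarrow>
     Z \<noteq> {} \<and> Z \<subseteq> topspace X \<and>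
     (\<forall>F G. closedin X F \<longrightarrow> closedin X G \<longrightarrow> Z \<subseteq> F \<union> G \<longrightarrow> Z \<subseteq> F \<or> Z \<subseteq> G)"

definition irreducible_components :: "'a topology \<Rightarrow> 'a set set" where
  "irreducible_components X =
     {Z. irreducible_in X Z \<and> (\<forall>Z'. irreducible_in X Z' \<and> Z \<subseteq> Z' \<longrightarrow> Z' = Z)}"

definition topological_dim :: "'a topology \<Rightarrow> enat" where
  "topological_dim X =
     Sup {enat r | r. \<exists>Z :: nat \<Rightarrow> 'a set.
       (\<forall>i\<le>r. closedin X (Z i) \<and> irreducible_in X (Z i)) \<and> (\<forall>i<r. Z i \<subset> Z (Suc i))}"

definition equidimensional :: "'a topology \<Rightarrow> bool" where
  "equidimensional X \<longleftrightarrow>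
     (\<forall>C \<in> irreducible_components X. \<forall>C' \<in> irreducible_components X.
        topological_dim (subtopology X C) = topological_dim (subtopology X C'))"

text \<open>Localization of a commutative ring at a prime ideal \<open>\<pp>\<close>: classes of pairs \<open>(a, s)\<close>, read as
  \<open>a/s\<close>.\<close>

definition loc_rel :: "('a, 'b) ring_scheme \<Rightarrow> 'a set \<Rightarrow> (('a \<times> 'a) \<times> ('a \<times> 'a)) set" where
  "loc_rel R \<pp> =
     {((a, s), (b, t)) | a s b t.
        a \<in> carrier R \<and> b \<in> carrier R \<and> s \<in> carrier R - \<pp> \<and> t \<in> carrier R - \<pp> \<and>
        (\<exists>u \<in> carrier R - \<pp>. u \<otimes>\<^bsub>R\<^esub> (t \<otimes>\<^bsub>R\<^esub> a \<ominus>\<^bsub>R\<^esub> s \<otimes>\<^bsub>R\<^esub> b) = \<zero>\<^bsub>R\<^esub>)}"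

definition loc_frac :: "('a, 'b) ring_scheme \<Rightarrow> 'a set \<Rightarrow> 'a \<Rightarrow> 'a \<Rightarrow> ('a \<times> 'a) set" where
  "loc_frac R \<pp> a s = loc_rel R \<pp> `` {(a, s)}"

definition localization :: "('a, 'b) ring_scheme \<Rightarrow> 'a set \<Rightarrow> ('a \<times> 'a) set ring" where
  "localization R \<pp> =
     \<lparr>carrier = (carrier R \<times> (carrier R - \<pp>)) // loc_rel R \<pp>,
      monoid.mult = (\<lambda>X Y. \<Union>(a, s)\<in>X. \<Union>(b, t)\<in>Y. loc_frac R \<pp> (a \<otimes>\<^bsub>R\<^esub> b) (s \<otimes>\<^bsub>R\<^esub> t)),
      one = loc_frac R \<pp> \<one>\<^bsub>R\<^esub> \<one>\<^bsub>R\<^esub>,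
      zero = loc_frac R \<pp> \<zero>\<^bsub>R\<^esub> \<one>\<^bsub>R\<^esub>,
      add = (\<lambda>X Y. \<Union>(a, s)\<in>X. \<Union>(b, t)\<in>Y.
               loc_frac R \<pp> ((t \<otimes>\<^bsub>R\<^esub> a) \<oplus>\<^bsub>R\<^esub> (s \<otimes>\<^bsub>R\<^esub> b)) (s \<otimes>\<^bsub>R\<^esub> t))\<rparr>"


section \<open>Cotangent spaces and singular points\<close>

text \<open>For an ideal \<open>M\<close> of a \<open>K\<close>-algebra \<open>S\<close> with structure morphism \<open>\<iota> : K \<rightarrow> S\<close>: the \<open>K\<close>-vector space
  \<open>M/M\<^sup>2\<close>, as a subspace of \<open>S/M\<^sup>2\<close>. The fields \<open>mult\<close> and \<open>one\<close> of the record play no role in a module.\<close>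

definition cotangent_space ::
  "('k::field \<Rightarrow> 'a) \<Rightarrow> ('a, 'b) ring_scheme \<Rightarrow> 'a set \<Rightarrow> ('k, 'a set) module" where
  "cotangent_space \<iota> S M =
     \<lparr>carrier = (\<lambda>x. (M \<cdot>\<^bsub>S\<^esub> M) +>\<^bsub>S\<^esub> x) ` M,
      monoid.mult = undefined, one = undefined,
      zero = M \<cdot>\<^bsub>S\<^esub> M,
      add = set_add S,
      smult = (\<lambda>c X. rcoset_mult S (M \<cdot>\<^bsub>S\<^esub> M) ((M \<cdot>\<^bsub>S\<^esub> M) +>\<^bsub>S\<^esub> \<iota> c) X)\<rparr>"

definition cotangent_dim :: "('k::field \<Rightarrow> 'a) \<Rightarrow> ('a, 'b) ring_scheme \<Rightarrow> 'a set \<Rightarrow> nat" where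
  "cotangent_dim \<iota> S M = vectorspace.dim (class_ring :: 'k ring) (cotangent_space \<iota> S M)"

text \<open>Embedding codimension of a local \<open>K\<close>-algebra \<open>S\<close> of finite Krull dimension and with residue
  field \<open>K\<close>.\<close>

definition embcodim :: "('k::field \<Rightarrow> 'a) \<Rightarrow> ('a, 'b) ring_scheme \<Rightarrow> int" where
  "embcodim \<iota> S = int (cotangent_dim \<iota> S (THE M. maximalideal M S)) - int (the_enat (krull_dim S))"

text \<open>Only \<open>K\<close>-rational points are considered: maximal ideals whose residue field is \<open>K\<close>.\<close>

definition rational_points :: "('k::field \<Rightarrow> 'a) \<Rightarrow> ('a, 'b) ring_scheme \<Rightarrow> 'a set set" where
  "rational_points \<iota> R =
     {\<mm>. maximalideal \<mm> R \<and> (\<forall>r \<in> carrier R. \<exists>c. r \<ominus>\<^bsub>R\<^esub> \<iota> c \<in> \<mm>)}"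

definition singular_locus :: "('k::field \<Rightarrow> 'a) \<Rightarrow> ('a, 'b) ring_scheme \<Rightarrow> 'a set set" where
  "singular_locus \<iota> R =
     {\<mm> \<in> rational_points \<iota> R.
        embcodim (\<lambda>c. loc_frac R \<mm> (\<iota> c) \<one>\<^bsub>R\<^esub>) (localization R \<mm>) > 0}"


section \<open>The zero section\<close>

text \<open>The maximal ideal \<open>\<langle>a\<^sub>1 - \<gamma>\<^sub>1, \<dots>, a\<^sub>m - \<gamma>\<^sub>m\<rangle>\<close> of \<open>A\<close>.\<close>

definition A_point :: "nat \<Rightarrow> 'k::field vec \<Rightarrow> 'k mpol set" where
  "A_point m \<Gamma> = genideal (A_ring m) {indet i - const (\<Gamma> $ i) | i. i < m}"

text \<open>The maximal ideal \<open>\<MM>\<close> of \<open>P\<close> belonging to the zero point over \<open>\<Gamma>\<close>, and its image in \<open>R\<close>.\<close>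

definition P_zero_point :: "nat \<Rightarrow> nat \<Rightarrow> 'k::field vec \<Rightarrow> 'k mpol mpol set" where
  "P_zero_point m k \<Gamma> =
     genideal (P_ring m k)
       ({const (indet i - const (\<Gamma> $ i)) | i. i < m} \<union> {indet j | j. j < k})"

definition R_zero_point ::
  "nat \<Rightarrow> nat \<Rightarrow> 'k::field mpol mpol set \<Rightarrow> 'k vec \<Rightarrow> 'k mpol mpol set set" where
  "R_zero_point m k I \<Gamma> = (\<lambda>f. I +>\<^bsub>P_ring m k\<^esub> f) ` P_zero_point m k \<Gamma>"

definition R_loc ::
  "nat \<Rightarrow> nat \<Rightarrow> 'k::field mpol mpol set \<Rightarrow> 'k vec \<Rightarrow> ('k mpol mpol set \<times> 'k mpol mpol set) set ring" where
  "R_loc m k I \<Gamma> = localization (R_ring m k I) (R_zero_point m k I \<Gamma>)"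

definition R_loc_of_K ::
  "nat \<Rightarrow> nat \<Rightarrow> 'k::field mpol mpol set \<Rightarrow> 'k vec \<Rightarrow> 'k \<Rightarrow> ('k mpol mpol set \<times> 'k mpol mpol set) set" where
  "R_loc_of_K m k I \<Gamma> c =
     loc_frac (R_ring m k I) (R_zero_point m k I \<Gamma>) (R_of_K m k I c) \<one>\<^bsub>R_ring m k I\<^esub>"

definition loc_dim :: "nat \<Rightarrow> nat \<Rightarrow> 'k::field mpol mpol set \<Rightarrow> 'k vec \<Rightarrow> nat" where
  "loc_dim m k I \<Gamma> = the_enat (krull_dim (R_loc m k I \<Gamma>))"

definition Cot_dim :: "nat \<Rightarrow> nat \<Rightarrow> 'k::field mpol mpol set \<Rightarrow> 'k vec \<Rightarrow> nat" where
  "Cot_dim m k I \<Gamma> = cotangent_dim (R_of_K m k I) (R_ring m k I) (R_zero_point m k I \<Gamma>)"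

definition Sing0 :: "nat \<Rightarrow> nat \<Rightarrow> 'k::field mpol mpol set \<Rightarrow> 'k vec set" where
  "Sing0 m k I =
     {\<Gamma> \<in> carrier_vec m. embcodim (R_loc_of_K m k I \<Gamma>) (R_loc m k I \<Gamma>) > 0}"

text \<open>The morphism \<open>R \<rightarrow> P/\<langle>x\<^sub>1, \<dots>, x\<^sub>k\<rangle> \<cong> A\<close> sends the class of \<open>f\<close> to \<open>f(0, \<dots>, 0)\<close>, the constant
  coefficient of \<open>f\<close> as a polynomial over \<open>A\<close>; this is the same for all elements of a class since
  \<open>I \<subseteq> \<langle>x\<^sub>1, \<dots>, x\<^sub>k\<rangle>\<close>. The zero section is the image of the rational points of \<open>Spec A\<close> under the
  contraction along it.\<close>

definition zero_map :: "'k::field mpol mpol set \<Rightarrow> 'k mpol" where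
  "zero_map X = the_elem ((\<lambda>f. Poly_Mapping.lookup f 0) ` X)"

definition zero_section :: "nat \<Rightarrow> nat \<Rightarrow> 'k::field mpol mpol set \<Rightarrow> 'k mpol mpol set set set" where
  "zero_section m k I =
     (\<lambda>\<Gamma>. {X \<in> carrier (R_ring m k I). zero_map X \<in> A_point m \<Gamma>}) ` carrier_vec m"


section \<open>The linear coefficient matrix\<close>

text \<open>If \<open>f = f\<^sub>0 + f\<^sub>1 x\<^sub>1 + \<dots> + f\<^sub>k x\<^sub>k + g\<close> with \<open>f\<^sub>i \<in> A\<close> and \<open>g \<in> \<langle>X\<rangle>\<^sup>2\<close>, then \<open>f\<^sub>j\<close> is the coefficient of the
  monomial \<open>x\<^sub>j\<close> of \<open>f\<close>, as a polynomial over \<open>A\<close>.\<close>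

definition lin_coeff :: "'k::field mpol mpol \<Rightarrow> nat \<Rightarrow> 'k mpol" where
  "lin_coeff f j = Poly_Mapping.lookup f (Poly_Mapping.single j 1)"

definition lin_mat_A :: "nat \<Rightarrow> 'k::field mpol mpol list \<Rightarrow> 'k mpol mat" where
  "lin_mat_A k G = mat (length G) k (\<lambda>(i, j). lin_coeff (G ! i) j)"

definition lin_mat_K :: "nat \<Rightarrow> 'k::field mpol mpol list \<Rightarrow> 'k vec \<Rightarrow> 'k mat" where
  "lin_mat_K k G \<Gamma> = map_mat (eval_at \<Gamma>) (lin_mat_A k G)"

definition rank_K :: "'k::field mat \<Rightarrow> nat" where
  "rank_K M = vec_space.rank (dim_row M) M"

text \<open>The quotient field of \<open>A\<close>, inside the (larger) field of fractions of the type \<open>'k mpol\<close>.\<close>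

definition quotient_field :: "'a::idom set \<Rightarrow> 'a fract ring" where
  "quotient_field B =
     \<lparr>carrier = {Fract a b | a b. a \<in> B \<and> b \<in> B \<and> b \<noteq> 0}, monoid.mult = (*), one = 1, zero = 0, add = (+)\<rparr>"

text \<open>Rank over a subfield \<open>F\<close> of a field type: the dimension of the \<open>F\<close>-span of the columns in \<open>F\<^sup>s\<close>,
  as in the definition of \<^const>\<open>vec_space.rank\<close>.\<close>

definition vec_module :: "'a::field ring \<Rightarrow> nat \<Rightarrow> ('a, 'a vec) module" where
  "vec_module F s =
     \<lparr>carrier = {v \<in> carrier_vec s. \<forall>i<s. v $ i \<in> carrier F},
      monoid.mult = undefined, one = undefined,
      zero = 0\<^sub>v s, add = (+), smult = (\<cdot>\<^sub>v)\<rparr>"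

definition rank_over :: "'a::field ring \<Rightarrow> 'a mat \<Rightarrow> nat" where
  "rank_over F M =
     (let V = vec_module F (dim_row M)
      in vectorspace.dim F (V\<lparr>carrier := LinearCombinations.module.span F V (set (cols M))\<rparr>))"

definition rank_A :: "nat \<Rightarrow> 'k::field mpol mat \<Rightarrow> nat" where
  "rank_A m M = rank_over (quotient_field (carrier (A_ring m))) (map_mat (\<lambda>p. Fract p 1) M)"

text \<open>The minor of size 0 is 1, and the ideal is zero if the matrix has no minors of size \<open>r\<close>.\<close>

definition minors_ideal :: "nat \<Rightarrow> nat \<Rightarrow> 'k::field mpol mat \<Rightarrow> 'k mpol set" where
  "minors_ideal m r M =
     genideal (A_ring m)
       {det (submatrix M S T) | S T.
          S \<subseteq> {..<dim_row M} \<and> T \<subseteq> {..<dim_col M} \<and> card S = r \<and> card T = r}"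

definition zero_set :: "nat \<Rightarrow> 'k::field mpol set \<Rightarrow> 'k vec set" where
  "zero_set m J = {\<Gamma> \<in> carrier_vec m. \<forall>f\<in>J. eval_at \<Gamma> f = 0}"

end

theory Submission
  imports Defs "Jordan_Normal_Form.DL_Rank_Submatrix" "HOL-Combinatorics.Permutations"
begin

text \<open>Write \<open>\<rho>(\<Gamma>)\<close> for the rank of \<open>L\<^sub>K(G\<^sub>\<Gamma>)\<close>, \<open>r\<close> for the rank of \<open>L\<^sub>A(G)\<close> and \<open>\<langle>x\<rangle>\<close> for the ideal of \<open>P\<close> generated by
  all \<open>x\<^sub>j\<close>. Dimensions are lengths of chains of primes of \<open>P\<close> that contain \<open>I\<close>; for the local ring at
  the zero point the chains have to end inside the maximal ideal \<open>\<MM>\<close> of \<open>\<Gamma>\<^sub>0\<close>. The theorem follows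
  from three facts about such chains and about \<open>\<MM>\<close>.

  \<^bold>\<open>The cotangent space.\<close> Modulo \<open>\<MM>\<^sup>2\<close> every \<open>f \<in> I\<close> equals \<open>\<Sum>\<^sub>j f\<^sub>j(\<Gamma>) x\<^sub>j\<close>, where \<open>f\<^sub>j\<close> are the coefficients of its
  \<open>A\<close>-linear part. So \<open>\<MM>/(\<MM>\<^sup>2 + I)\<close> is \<open>K\<^sup>n\<close> modulo the row space of \<open>L\<^sub>K(G\<^sub>\<Gamma>)\<close>, and its dimension is
  \<open>n - \<rho>(\<Gamma>)\<close>: Cramer's rule for a nonzero minor of size \<open>\<rho>(\<Gamma>)\<close> shows that the \<open>a\<^sub>i - \<gamma>\<^sub>i\<close> and the \<open>x\<^sub>l\<close>
  outside the columns of that minor span, and first order deformations of the zero point along kernel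
  vectors of \<open>L\<^sub>K(G\<^sub>\<Gamma>)\<close> show that they are independent (\<open>zero_point_cot_basis\<close>).

  \<^bold>\<open>The upper bound.\<close> Let \<open>\<delta>\<close> be a minor of \<open>L\<^sub>A(G)\<close> of size \<open>e\<close> with columns \<open>T\<close>. If the first prime of a chain
  does not contain \<open>\<delta>\<close>, then the chain has length at most \<open>n - e\<close> (\<open>minor_chain_bound\<close>). By Cramer's rule \<open>I\<close>
  contains, for every \<open>t \<in> T\<close>, a homogeneous polynomial of weight \<open>w\<^sub>t\<close> that consists of \<open>\<delta> x\<^sub>t\<close>, of linear
  terms in variables outside \<open>T\<close>, and of products of variables of weight less than \<open>w\<^sub>t\<close>. Induction on the
  weight expresses \<open>\<delta>\<^sup>N x\<^sub>t\<close> modulo \<open>I\<close> by the \<open>n - e\<close> elements \<open>a\<^sub>i\<close> and \<open>x\<^sub>l\<close> with \<open>l \<notin> T\<close>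
  (\<open>elimination_chain_bound\<close>), and a counting argument bounds chains by the number of these elements.
  A minor that does not vanish at \<open>\<Gamma>\<close> lies outside all primes inside \<open>\<MM>\<close>, so \<open>d\<^sub>\<Gamma>\<^sub>0 + \<rho>(\<Gamma>) \<le> n\<close>. Together with
  the cotangent space this is (a) and (b); since \<open>\<rho>(\<Gamma>) \<le> r\<close> and \<open>d\<^sub>\<Gamma>\<^sub>0 \<le> d\<close>, it gives (c) and (d).

  \<^bold>\<open>The equidimensional case.\<close> For (e) it remains to see that \<open>d + r \<le> n\<close> and that \<open>d\<^sub>\<Gamma>\<^sub>0 = d\<close> for every \<open>\<Gamma>\<close>. Let \<open>q\<close>
  be a minimal prime over \<open>I\<close> inside \<open>\<langle>x\<rangle>\<close>. It is homogeneous, it meets \<open>A\<close> only in \<open>0\<close>, and equidimensionality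
  provides a chain of length \<open>d\<close> that starts at \<open>q\<close>; the upper bound for a nonzero minor of size \<open>r\<close>
  yields \<open>d + r \<le> n\<close>. Let \<open>T\<close> be a largest set of variables that is algebraically independent over \<open>A\<close> modulo \<open>q\<close>;
  the counting argument gives \<open>d \<le> m + |T|\<close> (\<open>alg_indep_maximal_bound\<close>). Because \<open>q\<close> is homogeneous, the rank
  over \<open>A\<close> of \<open>P/(q + \<langle>x\<rangle>\<^sup>s)\<close> grows at least like \<open>s\<close> to the power \<open>|T|\<close>. If no chain of length \<open>|T|\<close> led from above \<open>q\<close>
  into \<open>\<langle>x\<rangle>\<close>, then all iterated boundary ideals of \<open>q\<close> along \<open>|T|\<close> variables would contain an element outside
  \<open>\<langle>x\<rangle>\<close>, and the rank would grow more slowly. Hence such a chain exists (\<open>graded_chain\<close>); prolonged by the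
  \<open>m\<close> steps of adding \<open>a\<^sub>1 - \<gamma>\<^sub>1, \<dots>, a\<^sub>m - \<gamma>\<^sub>m\<close> to \<open>\<langle>x\<rangle>\<close> it shows \<open>d \<le> d\<^sub>\<Gamma>\<^sub>0\<close> (\<open>equidimensional_case\<close>).\<close>

section \<open>Rings, ideals and polynomials as subsets of a type\<close>

text \<open>All rings of the argument are subsets \<open>B\<close> of a commutative ring type, so that computations can use the
  operations of the type; the record \<open>set_ring B\<close> links them to the algebraic structures with a carrier.
  The predicates below are the corresponding notions of subring, ideal, prime ideal and generated ideal.\<close>

definition set_ring :: "'a::comm_ring_1 set \<Rightarrow> 'a ring" where
  "set_ring B = \<lparr>carrier = B, monoid.mult = (*), one = 1, zero = 0, add = (+)\<rparr>"

definition subring_set :: "'a::comm_ring_1 set \<Rightarrow> bool" where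
  "subring_set B \<longleftrightarrow> 1 \<in> B \<and> (\<forall>x\<in>B. \<forall>y\<in>B. x - y \<in> B \<and> x * y \<in> B)"

definition ideal_in :: "'a::comm_ring_1 set \<Rightarrow> 'a set \<Rightarrow> bool" where
  "ideal_in B J \<longleftrightarrow> J \<subseteq> B \<and> 0 \<in> J \<and> (\<forall>x\<in>J. \<forall>y\<in>J. x + y \<in> J) \<and> (\<forall>x\<in>J. \<forall>b\<in>B. b * x \<in> J)"

definition prime_in :: "'a::comm_ring_1 set \<Rightarrow> 'a set \<Rightarrow> bool" where
  "prime_in B p \<longleftrightarrow> ideal_in B p \<and> 1 \<notin> p \<and> (\<forall>x\<in>B. \<forall>y\<in>B. x * y \<in> p \<longrightarrow> x \<in> p \<or> y \<in> p)"

lemma set_ring_simps [simp]: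
  "carrier (set_ring B) = B" "x \<otimes>\<^bsub>set_ring B\<^esub> y = x * y" "\<one>\<^bsub>set_ring B\<^esub> = 1"
  "\<zero>\<^bsub>set_ring B\<^esub> = 0" "x \<oplus>\<^bsub>set_ring B\<^esub> y = x + y"
  by (simp_all add: set_ring_def)

lemma subring_setD:
  assumes "subring_set B"
  shows "1 \<in> B" "0 \<in> B" "x \<in> B \<Longrightarrow> y \<in> B \<Longrightarrow> x - y \<in> B" "x \<in> B \<Longrightarrow> y \<in> B \<Longrightarrow> x * y \<in> B"
    "x \<in> B \<Longrightarrow> y \<in> B \<Longrightarrow> x + y \<in> B" "x \<in> B \<Longrightarrow> - x \<in> B"
proof -
  show 1: "1 \<in> B" and d: "\<And>x y. x \<in> B \<Longrightarrow> y \<in> B \<Longrightarrow> x - y \<in> B"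
    and m: "x \<in> B \<Longrightarrow> y \<in> B \<Longrightarrow> x * y \<in> B" for x y
    using assms by (auto simp: subring_set_def)
  show 0: "0 \<in> B" using d[OF 1 1] by simp
  show n: "- x \<in> B" if "x \<in> B" for x using d[OF 0 that] by simp
  show "x + y \<in> B" if "x \<in> B" "y \<in> B" using d[OF that(1) n[OF that(2)]] by simp
qed

lemma subring_sum: "subring_set B \<Longrightarrow> (\<And>i. i \<in> S \<Longrightarrow> f i \<in> B) \<Longrightarrow> sum f S \<in> B"
  by (induct S rule: infinite_finite_induct) (auto simp: subring_setD)

lemma subring_prod: "subring_set B \<Longrightarrow> (\<And>i. i \<in> S \<Longrightarrow> f i \<in> B) \<Longrightarrow> prod f S \<in> B"
  by (induct S rule: infinite_finite_induct) (auto simp: subring_setD)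

lemma subring_power: "subring_set B \<Longrightarrow> x \<in> B \<Longrightarrow> x ^ n \<in> B"
  by (induct n) (auto simp: subring_setD)

lemma set_ring_cring: assumes "subring_set B" shows "cring (set_ring B)"
proof (rule cringI)
  show "abelian_group (set_ring B)"
    by (rule abelian_groupI)
      (use assms in \<open>auto simp: subring_setD algebra_simps intro!: bexI[where x = "- _"]\<close>)
  show "comm_monoid (set_ring B)"
    by (rule comm_monoidI) (use assms in \<open>auto simp: subring_setD algebra_simps\<close>)
qed (auto simp: algebra_simps)

lemma set_ring_uminus: assumes "subring_set B" "x \<in> B" shows "\<ominus>\<^bsub>set_ring B\<^esub> x = - x"
proof -
  interpret cring "set_ring B" by (rule set_ring_cring[OF assms(1)])
  show ?thesis using minus_equality[of "- x" x] assms by (simp add: subring_setD)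
qed

lemma set_ring_minus: "subring_set B \<Longrightarrow> x \<in> B \<Longrightarrow> y \<in> B \<Longrightarrow> x \<ominus>\<^bsub>set_ring B\<^esub> y = x - y"
  by (simp add: a_minus_def set_ring_uminus)

lemma ideal_inD:
  assumes "ideal_in B J"
  shows "J \<subseteq> B" "0 \<in> J" "x \<in> J \<Longrightarrow> y \<in> J \<Longrightarrow> x + y \<in> J" "x \<in> J \<Longrightarrow> b \<in> B \<Longrightarrow> b * x \<in> J"
    "x \<in> J \<Longrightarrow> b \<in> B \<Longrightarrow> x * b \<in> J"
  using assms by (auto simp: ideal_in_def mult.commute)

lemma ideal_in_uminus: "subring_set B \<Longrightarrow> ideal_in B J \<Longrightarrow> x \<in> J \<Longrightarrow> - x \<in> J"
  using ideal_inD(4)[of B J x "-1"] subring_setD[of B] by simp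

lemma ideal_in_diff: "subring_set B \<Longrightarrow> ideal_in B J \<Longrightarrow> x \<in> J \<Longrightarrow> y \<in> J \<Longrightarrow> x - y \<in> J"
  using ideal_inD(3)[of B J x "- y"] ideal_in_uminus[of B J y] by simp

lemma ideal_in_sum: "ideal_in B J \<Longrightarrow> (\<And>i. i \<in> S \<Longrightarrow> f i \<in> J) \<Longrightarrow> sum f S \<in> J"
  by (induct S rule: infinite_finite_induct) (auto simp: ideal_inD)

lemma ideal_iff_ideal_in:
  assumes B: "subring_set B"
  shows "ideal J (set_ring B) \<longleftrightarrow> ideal_in B J"
proof
  assume "ideal J (set_ring B)"
  then interpret ideal J "set_ring B" .
  show "ideal_in B J"
    unfolding ideal_in_def using a_subset additive_subgroup.zero_closed[OF additive_subgroup_axioms]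
      additive_subgroup.a_closed[OF additive_subgroup_axioms] I_l_closed by auto
next
  assume J: "ideal_in B J"
  interpret cring "set_ring B" by (rule set_ring_cring[OF B])
  show "ideal J (set_ring B)"
  proof (rule idealI)
    show "ring (set_ring B)" by unfold_locales
    show "subgroup J (add_monoid (set_ring B))"
    proof (rule subgroup.intro)
      fix x assume x: "x \<in> J"
      then have "x \<in> B" using ideal_inD(1)[OF J] by auto
      then have "\<ominus>\<^bsub>set_ring B\<^esub> x = - x" by (rule set_ring_uminus[OF B])
      then show "inv\<^bsub>add_monoid (set_ring B)\<^esub> x \<in> J"
        using ideal_in_uminus[OF B J x] by (simp add: a_inv_def)
    qed (use ideal_inD[OF J] in auto)
  qed (use ideal_inD[OF J] in auto)
qed

lemma primeideal_iff_prime_in: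
  assumes B: "subring_set B"
  shows "primeideal p (set_ring B) \<longleftrightarrow> prime_in B p"
proof
  assume p: "primeideal p (set_ring B)"
  then interpret primeideal p "set_ring B" .
  have "ideal p (set_ring B)" ..
  then show "prime_in B p"
    unfolding prime_in_def using ideal_iff_ideal_in[OF B] I_prime I_notcarr one_imp_carrier by auto
next
  assume p: "prime_in B p"
  interpret cring "set_ring B" by (rule set_ring_cring[OF B])
  show "primeideal p (set_ring B)"
    by (rule primeidealI)
      (use p subring_setD(1)[OF B] in \<open>auto simp: prime_in_def ideal_iff_ideal_in[OF B] is_cring\<close>)
qed

lemma prime_inD:
  assumes "prime_in B p"
  shows "ideal_in B p" "1 \<notin> p" "x \<in> B \<Longrightarrow> y \<in> B \<Longrightarrow> x * y \<in> p \<Longrightarrow> x \<in> p \<or> y \<in> p"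
  using assms by (auto simp: prime_in_def)

lemma prime_in_power:
  assumes "prime_in B p" "subring_set B" "x \<in> B" "x ^ n \<in> p" shows "x \<in> p"
  using assms(4) by (induct n) (use prime_inD[OF assms(1)] assms subring_power[OF assms(2,3)] in auto)

definition span_in :: "'a::comm_ring_1 set \<Rightarrow> 'a set \<Rightarrow> 'a set" where
  "span_in B H = {\<Sum>h\<in>F. c h * h | F c. finite F \<and> F \<subseteq> H \<and> (\<forall>h\<in>F. c h \<in> B)}"

lemma span_in_ideal_in:
  assumes B: "subring_set B" and H: "H \<subseteq> B"
  shows "ideal_in B (span_in B H)"
  unfolding ideal_in_def
proof (intro conjI ballI)
  show "span_in B H \<subseteq> B" using H by (auto simp: span_in_def intro!: subring_sum[OF B] subring_setD(4)[OF B])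
  show "0 \<in> span_in B H" unfolding span_in_def by (rule CollectI, rule exI[of _ "{}"]) simp
next
  fix x y assume "x \<in> span_in B H" "y \<in> span_in B H"
  then obtain F c F' c' where F: "finite F" "F \<subseteq> H" "\<forall>h\<in>F. c h \<in> B" "x = (\<Sum>h\<in>F. c h * h)"
    and F': "finite F'" "F' \<subseteq> H" "\<forall>h\<in>F'. c' h \<in> B" "y = (\<Sum>h\<in>F'. c' h * h)"
    unfolding span_in_def by blast
  let ?d = "\<lambda>h. (if h \<in> F then c h else 0) + (if h \<in> F' then c' h else 0)"
  have "x = (\<Sum>h\<in>F \<union> F'. (if h \<in> F then c h else 0) * h)"
    unfolding F(4) by (rule sum.mono_neutral_cong_left) (use F F' in auto)
  moreover have "y = (\<Sum>h\<in>F \<union> F'. (if h \<in> F' then c' h else 0) * h)"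
    unfolding F'(4) by (rule sum.mono_neutral_cong_left) (use F F' in auto)
  ultimately have "x + y = (\<Sum>h\<in>F \<union> F'. ?d h * h)" by (simp add: distrib_right sum.distrib)
  moreover have "\<forall>h\<in>F \<union> F'. ?d h \<in> B" using F(3) F'(3) by (auto simp: subring_setD[OF B])
  ultimately show "x + y \<in> span_in B H"
    unfolding span_in_def using F(1,2) F'(1,2) by (intro CollectI exI[of _ "F \<union> F'"] exI[of _ ?d]) auto
next
  fix x b assume "x \<in> span_in B H" and b: "b \<in> B"
  then obtain F c where F: "finite F" "F \<subseteq> H" "\<forall>h\<in>F. c h \<in> B" "x = (\<Sum>h\<in>F. c h * h)"
    unfolding span_in_def by blast
  have "b * x = (\<Sum>h\<in>F. (b * c h) * h)" by (simp add: F(4) sum_distrib_left mult.assoc)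
  then show "b * x \<in> span_in B H"
    unfolding span_in_def using F(1-3) b subring_setD(4)[OF B] by (intro CollectI exI[of _ F] exI[of _ "\<lambda>h. b * c h"]) auto
qed

lemma genideal_eq_span_in:
  assumes B: "subring_set B" and H: "H \<subseteq> B"
  shows "genideal (set_ring B) H = span_in B H"
proof
  interpret cring "set_ring B" by (rule set_ring_cring[OF B])
  have "H \<subseteq> span_in B H"
  proof
    fix h assume "h \<in> H"
    then show "h \<in> span_in B H" unfolding span_in_def
      by (intro CollectI exI[of _ "{h}"] exI[of _ "\<lambda>_. 1"]) (auto simp: subring_setD[OF B])
  qed
  then show "genideal (set_ring B) H \<subseteq> span_in B H"
    using genideal_minimal span_in_ideal_in[OF B H] ideal_iff_ideal_in[OF B] by blast
  have i: "ideal_in B (genideal (set_ring B) H)" using genideal_ideal[of H] H ideal_iff_ideal_in[OF B] by simp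
  have s: "H \<subseteq> genideal (set_ring B) H" using genideal_self[of H] H by simp
  show "span_in B H \<subseteq> genideal (set_ring B) H"
    unfolding span_in_def using s by (auto intro!: ideal_in_sum[OF i] ideal_inD(4)[OF i])
qed

lemma span_in_minimal: "ideal_in B J \<Longrightarrow> H \<subseteq> J \<Longrightarrow> span_in B H \<subseteq> J"
  unfolding span_in_def by (auto intro!: ideal_in_sum ideal_inD(4))

lemma span_in_superset: "subring_set B \<Longrightarrow> H \<subseteq> span_in B H"
proof
  fix h assume "subring_set B" "h \<in> H"
  then show "h \<in> span_in B H" unfolding span_in_def
    by (intro CollectI exI[of _ "{h}"] exI[of _ "\<lambda>_. 1"]) (auto simp: subring_setD)
qed

abbreviation "lk \<equiv> Poly_Mapping.lookup"
abbreviation "ks \<equiv> Poly_Mapping.keys"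

text \<open>Polynomials in the first \<open>l\<close> indeterminates with coefficients in \<open>C\<close>. The rings \<open>A\<close> and \<open>P\<close> arise by
  using this construction once and twice.\<close>

definition mpol_over :: "'a::comm_ring_1 set \<Rightarrow> nat \<Rightarrow> 'a mpol set" where
  "mpol_over C l = {f. \<forall>t\<in>ks f. ks t \<subseteq> {..<l} \<and> lk f t \<in> C}"

lemma mpol_ring_eq: "mpol_ring C l = set_ring (mpol_over C l)"
  by (simp add: mpol_ring_def set_ring_def mpol_over_def)

lemma mpol_over_iff:
  assumes "subring_set C"
  shows "f \<in> mpol_over C l \<longleftrightarrow> (\<forall>t. lk f t \<in> C \<and> (\<not> ks t \<subseteq> {..<l} \<longrightarrow> lk f t = 0))"
  using subring_setD(2)[OF assms] unfolding mpol_over_def by (auto simp: in_keys_iff)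

lemma pm_sum_single: "f = (\<Sum>t\<in>ks f. Poly_Mapping.single t (lk f t))"
  by (rule poly_mapping_eqI) (auto simp: lookup_sum lookup_single when_def in_keys_iff)

lemma pm_times:
  "f * g = (\<Sum>t\<in>ks f. \<Sum>u\<in>ks g. Poly_Mapping.single (t + u) (lk f t * lk g u))"
proof -
  have "f * g = (\<Sum>t\<in>ks f. Poly_Mapping.single t (lk f t)) * (\<Sum>t\<in>ks g. Poly_Mapping.single t (lk g t))"
    using pm_sum_single[of f] pm_sum_single[of g] by simp
  then show ?thesis by (simp add: sum_product mult_single)
qed

lemma mpol_over_add:
  assumes "subring_set C" "f \<in> mpol_over C l" "g \<in> mpol_over C l" shows "f + g \<in> mpol_over C l"
  using assms(2,3) unfolding mpol_over_iff[OF assms(1)] by (auto simp: lookup_add subring_setD[OF assms(1)])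

lemma mpol_over_sum:
  assumes "subring_set C" "\<And>i. i \<in> S \<Longrightarrow> f i \<in> mpol_over C l" shows "sum f S \<in> mpol_over C l"
  using assms(2)
proof (induct S rule: infinite_finite_induct)
  case (insert x F)
  then show ?case using mpol_over_add[OF assms(1), of "f x" l "sum f F"] by simp
qed (simp_all add: mpol_over_def)

lemma mpol_over_single:
  "subring_set C \<Longrightarrow> c \<in> C \<Longrightarrow> ks t \<subseteq> {..<l} \<Longrightarrow> Poly_Mapping.single t c \<in> mpol_over C l"
  by (auto simp: mpol_over_def)

lemma keys_plus_nat: "ks (t + u :: nat \<Rightarrow>\<^sub>0 nat) = ks t \<union> ks u"
  by (auto simp: in_keys_iff lookup_add)

lemma subring_mpol_over: assumes C: "subring_set C" shows "subring_set (mpol_over C l)"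
  unfolding subring_set_def
proof (intro conjI ballI)
  show "1 \<in> mpol_over C l"
    using mpol_over_single[OF C subring_setD(1)[OF C], of 0 l] by simp
  fix f g assume f: "f \<in> mpol_over C l" and g: "g \<in> mpol_over C l"
  show "f - g \<in> mpol_over C l"
    using f g unfolding mpol_over_iff[OF C] by (auto simp: lookup_minus subring_setD[OF C])
  show "f * g \<in> mpol_over C l" unfolding pm_times
    by (intro mpol_over_sum[OF C] mpol_over_single[OF C] subring_setD(4)[OF C])
      (use f g in \<open>auto simp: mpol_over_def keys_plus_nat\<close>)
qed

lemma const_simps:
  "const 0 = 0" "const 1 = 1" "const (a + b) = const a + const b" "const (a - b) = const a - const b"
  "const (a * b) = const a * const b" "const (- a) = - const a"
  by (simp_all add: const_def single_add single_diff single_uminus mult_single)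

lemma const_power: "const (a ^ n) = const a ^ n"
  by (induct n) (simp_all add: const_simps)

lemma const_sum: "const (sum f S) = (\<Sum>i\<in>S. const (f i))"
  by (induct S rule: infinite_finite_induct) (simp_all add: const_simps)

lemma lookup_const: "lk (const c) t = (if t = 0 then c else 0)"
  by (simp add: const_def lookup_single when_def)

lemma const_eq_iff [simp]: "const a = const b \<longleftrightarrow> a = b"
  by (metis lookup_const)

lemma const_eq_0_iff [simp]: "const a = 0 \<longleftrightarrow> a = 0"
  using const_eq_iff[of a 0] by (simp add: const_simps)

lemma const_mpol_over: "subring_set C \<Longrightarrow> c \<in> C \<Longrightarrow> const c \<in> mpol_over C l"
  unfolding const_def by (rule mpol_over_single) auto

lemma indet_mpol_over: "subring_set C \<Longrightarrow> i < l \<Longrightarrow> indet i \<in> mpol_over C l"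
  unfolding indet_def by (rule mpol_over_single) (auto simp: subring_setD)

lemma single_single_power: "Poly_Mapping.single (Poly_Mapping.single i e) 1 = (indet i :: 'a::comm_ring_1 mpol) ^ e"
proof (induct e)
  case (Suc e)
  have "Poly_Mapping.single i (Suc e) = Poly_Mapping.single i 1 + Poly_Mapping.single i e"
    by (simp add: single_add[symmetric])
  then have "Poly_Mapping.single (Poly_Mapping.single i (Suc e)) (1::'a) =
      indet i * Poly_Mapping.single (Poly_Mapping.single i e) 1"
    by (simp add: indet_def mult_single)
  then show ?case using Suc by simp
qed simp

lemma single_sum_prod:
  "Poly_Mapping.single (sum g S) (1::'a::comm_ring_1) = (\<Prod>i\<in>S. Poly_Mapping.single (g i :: nat \<Rightarrow>\<^sub>0 nat) 1)"
proof (induct S rule: infinite_finite_induct)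
  case (insert x F)
  have "Poly_Mapping.single (g x + sum g F) (1::'a) = Poly_Mapping.single (g x) 1 * Poly_Mapping.single (sum g F) 1"
    by (simp add: mult_single)
  then show ?case using insert by simp
qed simp_all

lemma single_monom: "Poly_Mapping.single t (1::'a::comm_ring_1) = (\<Prod>i\<in>ks t. indet i ^ lk t i)"
proof -
  have "t = (\<Sum>i\<in>ks t. Poly_Mapping.single i (lk t i))" by (rule pm_sum_single)
  then have "Poly_Mapping.single t (1::'a) = Poly_Mapping.single (\<Sum>i\<in>ks t. Poly_Mapping.single i (lk t i)) 1"
    by simp
  also have "\<dots> = (\<Prod>i\<in>ks t. indet i ^ lk t i)" by (simp only: single_sum_prod single_single_power)
  finally show ?thesis .
qed

lemma single_const_monom: "Poly_Mapping.single t c = const c * Poly_Mapping.single t 1"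
  by (simp add: const_def mult_single)

lemma mpol_over_induct [consumes 2, case_names const indet add mult]:
  assumes C: "subring_set C" and f: "f \<in> mpol_over C l"
    and c: "\<And>c. c \<in> C \<Longrightarrow> Q (const c)" and i: "\<And>i. i < l \<Longrightarrow> Q (indet i)"
    and add: "\<And>f g. f \<in> mpol_over C l \<Longrightarrow> g \<in> mpol_over C l \<Longrightarrow> Q f \<Longrightarrow> Q g \<Longrightarrow> Q (f + g)"
    and mult: "\<And>f g. f \<in> mpol_over C l \<Longrightarrow> g \<in> mpol_over C l \<Longrightarrow> Q f \<Longrightarrow> Q g \<Longrightarrow> Q (f * g)"
  shows "Q f"
proof -
  note S = subring_mpol_over[OF C, of l]
  have Q01: "Q 0" "Q 1" using c[of 0] c[of 1] subring_setD[OF C] by (auto simp: const_simps)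
  have pw: "Q (g ^ n)" if "Q g" "g \<in> mpol_over C l" for g n
    by (induct n) (use Q01 mult that subring_power[OF S that(2)] in auto)
  have pr: "Q (prod g T) \<and> prod g T \<in> mpol_over C l" if "\<And>i. i \<in> T \<Longrightarrow> Q (g i) \<and> g i \<in> mpol_over C l" for g and T :: "nat set"
    using that by (induct T rule: infinite_finite_induct) (use Q01 mult subring_setD[OF S] in auto)
  have sm: "Q (sum g T) \<and> sum g T \<in> mpol_over C l" if "\<And>i. i \<in> T \<Longrightarrow> Q (g i) \<and> g i \<in> mpol_over C l" for g and T :: "(nat \<Rightarrow>\<^sub>0 nat) set"
    using that by (induct T rule: infinite_finite_induct) (use Q01 add subring_setD[OF S] in auto)
  have "Q (\<Sum>t\<in>ks f. Poly_Mapping.single t (lk f t)) \<and> (\<Sum>t\<in>ks f. Poly_Mapping.single t (lk f t)) \<in> mpol_over C l"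
  proof (rule sm)
    fix t assume t: "t \<in> ks f"
    then have t: "ks t \<subseteq> {..<l}" "lk f t \<in> C" using f by (auto simp: mpol_over_def)
    have "Q (Poly_Mapping.single t 1) \<and> Poly_Mapping.single t 1 \<in> mpol_over C l" unfolding single_monom
      by (rule pr) (use t i pw indet_mpol_over[OF C] subring_power[OF S] in auto)
    then show "Q (Poly_Mapping.single t (lk f t)) \<and> Poly_Mapping.single t (lk f t) \<in> mpol_over C l"
      using mult[of "const (lk f t)" "Poly_Mapping.single t 1"] c t const_mpol_over[OF C] mpol_over_single[OF C]
      unfolding single_const_monom[of t "lk f t"] by (auto simp: subring_setD[OF S])
  qed
  then show ?thesis using pm_sum_single[of f] by simp
qed

text \<open>Unital homomorphisms between types. The polynomials of a type contain all coefficient subrings, so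
  homomorphisms on \<open>A\<close> and \<open>P\<close> are restrictions of such maps.\<close>

definition ring_map :: "('a::comm_ring_1 \<Rightarrow> 'b::comm_ring_1) \<Rightarrow> bool" where
  "ring_map \<kappa> \<longleftrightarrow> \<kappa> 1 = 1 \<and> (\<forall>x y. \<kappa> (x + y) = \<kappa> x + \<kappa> y \<and> \<kappa> (x * y) = \<kappa> x * \<kappa> y)"

lemma ring_mapD:
  assumes "ring_map \<kappa>"
  shows "\<kappa> 1 = 1" "\<kappa> (x + y) = \<kappa> x + \<kappa> y" "\<kappa> (x * y) = \<kappa> x * \<kappa> y" "\<kappa> 0 = 0" "\<kappa> (- x) = - \<kappa> x"
    "\<kappa> (x - y) = \<kappa> x - \<kappa> y" "\<kappa> (x ^ n) = \<kappa> x ^ n" "\<kappa> (sum f S) = (\<Sum>i\<in>S. \<kappa> (f i))"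
    "\<kappa> (prod f S) = (\<Prod>i\<in>S. \<kappa> (f i))"
proof -
  show 1: "\<kappa> 1 = 1" and a: "\<And>x y. \<kappa> (x + y) = \<kappa> x + \<kappa> y" and m: "\<And>x y. \<kappa> (x * y) = \<kappa> x * \<kappa> y"
    using assms by (auto simp: ring_map_def)
  show 0: "\<kappa> 0 = 0" using a[of 0 0] by simp
  show n: "\<kappa> (- x) = - \<kappa> x" for x using a[of x "- x"] 0 by (simp add: eq_neg_iff_add_eq_0 add.commute)
  show "\<kappa> (x - y) = \<kappa> x - \<kappa> y" using a[of x "- y"] n by simp
  show "\<kappa> (x ^ n) = \<kappa> x ^ n" by (induct n) (auto simp: 1 m)
  show "\<kappa> (sum f S) = (\<Sum>i\<in>S. \<kappa> (f i))" by (induct S rule: infinite_finite_induct) (auto simp: 0 a)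
  show "\<kappa> (prod f S) = (\<Prod>i\<in>S. \<kappa> (f i))" by (induct S rule: infinite_finite_induct) (auto simp: 1 m)
qed

lemma ring_map_const: "ring_map const" by (simp add: ring_map_def const_simps)
lemma ring_map_id: "ring_map (\<lambda>x. x)" by (simp add: ring_map_def)
lemma ring_map_comp: "ring_map f \<Longrightarrow> ring_map g \<Longrightarrow> ring_map (\<lambda>x. f (g x))" by (simp add: ring_map_def)

text \<open>The universal property of polynomial rings: coefficients are mapped by \<open>\<kappa>\<close> and the indeterminates are
  sent to arbitrary values.\<close>

definition eval_hom :: "('a::comm_ring_1 \<Rightarrow> 'b::comm_ring_1) \<Rightarrow> (nat \<Rightarrow> 'b) \<Rightarrow> 'a mpol \<Rightarrow> 'b" where
  "eval_hom \<kappa> v p = (\<Sum>t\<in>ks p. \<kappa> (lk p t) * (\<Prod>i\<in>ks t. v i ^ lk t i))"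

lemma eval_hom_superset:
  assumes "ring_map \<kappa>" "finite S" "ks p \<subseteq> S"
  shows "eval_hom \<kappa> v p = (\<Sum>t\<in>S. \<kappa> (lk p t) * (\<Prod>i\<in>ks t. v i ^ lk t i))"
  unfolding eval_hom_def by (rule sum.mono_neutral_left) (use assms in \<open>auto simp: in_keys_iff ring_mapD\<close>)

lemma eval_hom_single: "ring_map \<kappa> \<Longrightarrow> eval_hom \<kappa> v (Poly_Mapping.single t c) = \<kappa> c * (\<Prod>i\<in>ks t. v i ^ lk t i)"
  by (subst eval_hom_superset[where S = "{t}"]) auto

lemma mev_superset: "finite S \<Longrightarrow> ks t \<subseteq> S \<Longrightarrow> (\<Prod>i\<in>ks t. v i ^ lk t i) = (\<Prod>i\<in>S. (v i::'b::comm_ring_1) ^ lk t i)"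
  by (rule prod.mono_neutral_left) (auto simp: in_keys_iff)

lemma mev_add: "(\<Prod>i\<in>ks (t + u :: nat \<Rightarrow>\<^sub>0 nat). v i ^ lk (t + u) i) = (\<Prod>i\<in>ks t. v i ^ lk t i) * (\<Prod>i\<in>ks u. (v i::'b::comm_ring_1) ^ lk u i)"
proof -
  have f: "finite (ks t \<union> ks u)" by simp
  show ?thesis
    using mev_superset[OF f, of "t + u" v] mev_superset[OF f, of t v] mev_superset[OF f, of u v]
    by (simp only: keys_plus_nat lookup_add power_add prod.distrib) simp
qed

lemma eval_hom_ring_map: assumes "ring_map \<kappa>" shows "ring_map (eval_hom \<kappa> v)"
proof -
  have a: "eval_hom \<kappa> v (f + g) = eval_hom \<kappa> v f + eval_hom \<kappa> v g" for f g
  proof -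
    have f: "finite (ks f \<union> ks g)" by simp
    have "ks (f + g) \<subseteq> ks f \<union> ks g" by (rule keys_add)
    then show ?thesis
      using eval_hom_superset[OF assms f, of "f + g" v] eval_hom_superset[OF assms f, of f v] eval_hom_superset[OF assms f, of g v]
      by (simp add: lookup_add ring_mapD[OF assms] distrib_right sum.distrib)
  qed
  have 0: "eval_hom \<kappa> v 0 = 0" by (simp add: eval_hom_def)
  have s: "eval_hom \<kappa> v (sum f S) = (\<Sum>i\<in>S. eval_hom \<kappa> v (f i))" for f and S :: "(nat \<Rightarrow>\<^sub>0 nat) set"
    by (induct S rule: infinite_finite_induct) (auto simp: a 0)
  have "eval_hom \<kappa> v (f * g) = eval_hom \<kappa> v f * eval_hom \<kappa> v g" for f g
    unfolding pm_times s eval_hom_single[OF assms] mev_add ring_mapD[OF assms]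
    unfolding eval_hom_def by (simp add: sum_product mult_ac)
  moreover have "eval_hom \<kappa> v 1 = 1"
    using eval_hom_single[OF assms, of v 0 1] by (simp add: ring_mapD[OF assms])
  ultimately show ?thesis by (simp add: ring_map_def a)
qed

lemma eval_hom_const: "ring_map \<kappa> \<Longrightarrow> eval_hom \<kappa> v (const c) = \<kappa> c"
  by (simp add: const_def eval_hom_single)

lemma eval_hom_indet: "ring_map \<kappa> \<Longrightarrow> eval_hom \<kappa> v (indet i) = v i"
  by (simp add: indet_def eval_hom_single ring_mapD)

lemma eval_at_eval_hom: "eval_at \<Gamma> = eval_hom (\<lambda>x. x) (\<lambda>i. \<Gamma> $ i)"
  by (simp add: eval_at_def eval_hom_def fun_eq_iff)

lemma ring_map_eval_at: "ring_map (eval_at \<Gamma>)"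
  unfolding eval_at_eval_hom by (rule eval_hom_ring_map[OF ring_map_id])

lemma eval_at_const [simp]: "eval_at \<Gamma> (const c) = c" and eval_at_indet [simp]: "eval_at \<Gamma> (indet i) = \<Gamma> $ i"
  unfolding eval_at_eval_hom by (simp_all add: eval_hom_const eval_hom_indet ring_map_id)

abbreviation "AC m \<equiv> mpol_over UNIV m"
abbreviation "PC m k \<equiv> mpol_over (mpol_over UNIV m) k"

lemma subring_UNIV: "subring_set UNIV" by (simp add: subring_set_def)
lemma subring_AC: "subring_set (AC m)" by (rule subring_mpol_over[OF subring_UNIV])
lemma subring_PC: "subring_set (PC m k)" by (rule subring_mpol_over[OF subring_AC])

lemma A_ring_eq: "A_ring m = set_ring (AC m)" by (simp add: A_ring_def mpol_ring_eq)
lemma P_ring_eq: "P_ring m k = set_ring (PC m k)" by (simp add: P_ring_def A_ring_eq mpol_ring_eq)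

text \<open>Every element of \<open>P\<close> is built from scalars and the \<open>a\<^sub>i\<close> and \<open>x\<^sub>j\<close> by sums and products. This rule
  proves identities between homomorphisms by comparing them on generators.\<close>

lemma PC_induct [consumes 1, case_names const a x add mult]:
  assumes f: "f \<in> PC m k"
    and c: "\<And>c. Q (const (const c))" and a: "\<And>i. i < m \<Longrightarrow> Q (const (indet i))" and x: "\<And>i. i < k \<Longrightarrow> Q (indet i)"
    and add: "\<And>f g. f \<in> PC m k \<Longrightarrow> g \<in> PC m k \<Longrightarrow> Q f \<Longrightarrow> Q g \<Longrightarrow> Q (f + g)"
    and mult: "\<And>f g. f \<in> PC m k \<Longrightarrow> g \<in> PC m k \<Longrightarrow> Q f \<Longrightarrow> Q g \<Longrightarrow> Q (f * g)"
  shows "Q f"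
  using subring_AC f
proof (induct rule: mpol_over_induct)
  case (const c)
  show ?case using subring_UNIV const
  proof (induct c rule: mpol_over_induct)
    case (add f g)
    then show ?case unfolding const_simps by (intro assms(5)) (auto intro: const_mpol_over[OF subring_AC])
  next
    case (mult f g)
    then show ?case unfolding const_simps by (intro assms(6)) (auto intro: const_mpol_over[OF subring_AC])
  qed (use c a in auto)
qed (use x add mult in auto)

section \<open>Algebraic independence along chains of primes\<close>

text \<open>Fraction-free Gaussian elimination: a pivot \<open>c e0 b \<noteq> 0\<close> removes the coordinate \<open>b\<close> from the other vectors by
  cross multiplication, which keeps all coefficients inside the subring \<open>C\<close>.\<close>

lemma linear_dependence:
  fixes C :: "'a::idom set"
  assumes C: "subring_set C" and "finite B" "finite E" "card B < card E"
    and "\<And>e b. e \<in> E \<Longrightarrow> b \<in> B \<Longrightarrow> c e b \<in> C"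
  shows "\<exists>l. (\<forall>e. l e \<in> C) \<and> (\<exists>e\<in>E. l e \<noteq> 0) \<and> (\<forall>b\<in>B. (\<Sum>e\<in>E. l e * c e b) = 0)"
  using assms(2-)
proof (induct B arbitrary: E c rule: finite_induct)
  case empty
  then have "E \<noteq> {}" by auto
  then show ?case using subring_setD(1)[OF C] by (intro exI[of _ "\<lambda>_. 1"]) auto
next
  case (insert b B)
  show ?case
  proof (cases "\<forall>e\<in>E. c e b = 0")
    case True
    obtain l where "\<forall>e. l e \<in> C" "\<exists>e\<in>E. l e \<noteq> 0" "\<forall>b\<in>B. (\<Sum>e\<in>E. l e * c e b) = 0"
      using insert(3)[of E c] insert(1,2,4,5,6) by (metis card_insert_disjoint insert_iff Suc_lessD)
    then show ?thesis using True by (intro exI[of _ l]) auto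
  next
    case False
    then obtain e0 where e0: "e0 \<in> E" "c e0 b \<noteq> 0" by auto
    define E' where "E' = E - {e0}"
    have E: "E = insert e0 E'" "e0 \<notin> E'" "finite E'" using e0 insert(4) by (auto simp: E'_def)
    define c' where "c' = (\<lambda>e b'. c e0 b * c e b' - c e b * c e0 b')"
    have "card B < card E'" using insert E by simp
    moreover have "c' e b' \<in> C" if "e \<in> E'" "b' \<in> B" for e b'
      unfolding c'_def by (intro subring_setD[OF C] insert(6)) (use that E in auto)
    ultimately obtain l' where l': "\<forall>e. l' e \<in> C" "\<exists>e\<in>E'. l' e \<noteq> 0" "\<forall>b\<in>B. (\<Sum>e\<in>E'. l' e * c' e b) = 0"
      using insert(3)[of E' c'] E by auto
    define l where "l = (\<lambda>e. if e = e0 then - (\<Sum>e\<in>E'. l' e * c e b) else if e \<in> E' then c e0 b * l' e else 0)"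
    have "(\<Sum>e\<in>E'. l' e * c e b) \<in> C"
      by (intro subring_sum[OF C] subring_setD(4)[OF C]) (use l' insert(6) E in auto)
    then have "\<forall>e. l e \<in> C" using l' insert(6)[OF e0(1), of b] by (auto simp: l_def subring_setD[OF C])
    moreover have "\<exists>e\<in>E. l e \<noteq> 0" using l'(2) e0(2) E by (force simp: l_def)
    moreover have "(\<Sum>e\<in>E. l e * c e b') = 0" if "b' \<in> insert b B" for b'
    proof -
      have "(\<Sum>e\<in>E. l e * c e b') = (\<Sum>e\<in>E'. l e * c e b') - (\<Sum>e\<in>E'. l' e * c e b) * c e0 b'"
        using E by (simp add: l_def)
      also have "(\<Sum>e\<in>E'. l e * c e b') = (\<Sum>e\<in>E'. c e0 b * l' e * c e b')"
        by (rule sum.cong) (use E in \<open>auto simp: l_def\<close>)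
      also have "\<dots> - (\<Sum>e\<in>E'. l' e * c e b) * c e0 b' = (\<Sum>e\<in>E'. l' e * c' e b')"
        by (simp add: c'_def sum_distrib_right sum_distrib_left right_diff_distrib sum_subtractf mult_ac)
      also have "\<dots> = 0" using that l'(3) by (auto simp: c'_def)
      finally show ?thesis .
    qed
    ultimately show ?thesis by blast
  qed
qed

text \<open>Exponent vectors with entries below \<open>s\<close>. A box of exponents, unlike a bound on the total degree, splits as a product
  when a variable is added, and it contains exactly \<open>s\<^sup>r\<close> vectors.\<close>

definition exponents :: "nat \<Rightarrow> nat \<Rightarrow> nat list set" where
  "exponents r s = {es. set es \<subseteq> {..<s} \<and> length es = r}"

definition monom_of :: "'a::comm_ring_1 list \<Rightarrow> nat list \<Rightarrow> 'a" where
  "monom_of ys es = prod_list (map (\<lambda>(y, e). y ^ e) (zip ys es))"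

lemma monom_of_simps [simp]: "monom_of [] es = 1" "monom_of (y # ys) (e # es) = y ^ e * monom_of ys es"
  by (simp_all add: monom_of_def)

lemma finite_exponents [simp]: "finite (exponents r s)" by (simp add: exponents_def finite_lists_length_eq)
lemma card_exponents: "card (exponents r s) = s ^ r" by (simp add: exponents_def card_lists_length_eq)
lemma exponents_0 [simp]: "exponents 0 s = {[]}" by (auto simp: exponents_def)

lemma sum_exponents_Suc: "(\<Sum>es\<in>exponents (Suc r) s. f es) = (\<Sum>e<s. \<Sum>es\<in>exponents r s. f (e # es))"
proof -
  have "exponents (Suc r) s = (\<lambda>(e, es). e # es) ` ({..<s} \<times> exponents r s)"
    by (auto simp: exponents_def length_Suc_conv image_iff)
  moreover have "inj_on (\<lambda>(e, es). e # es) ({..<s} \<times> exponents r s)" by (auto simp: inj_on_def)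
  ultimately have "(\<Sum>es\<in>exponents (Suc r) s. f es) = (\<Sum>(e, es)\<in>{..<s} \<times> exponents r s. f (e # es))"
    by (simp add: sum.reindex case_prod_unfold)
  then show ?thesis by (simp add: sum.cartesian_product)
qed

lemma monom_of_in: "subring_set B \<Longrightarrow> set ys \<subseteq> B \<Longrightarrow> monom_of ys es \<in> B"
proof (induct ys arbitrary: es)
  case (Cons y ys)
  then show ?case by (cases es) (auto simp: subring_setD subring_power monom_of_def)
qed (auto simp: subring_setD)

lemma monom_of_mult:
  "length es = length ys \<Longrightarrow> length es' = length ys \<Longrightarrow>
   monom_of ys es * monom_of ys es' = monom_of ys (map2 (+) es es')"
proof (induct ys arbitrary: es es')
  case (Cons y ys)
  then obtain e fs e' fs' where "es = e # fs" "es' = e' # fs'" by (metis length_Suc_conv)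
  then show ?case using Cons(1)[of fs fs', symmetric] Cons(2,3) by (simp add: power_add mult_ac)
qed auto

text \<open>Algebraic independence of the residue classes of \<open>ys\<close> modulo \<open>q\<close> over the image of \<open>C\<close>.\<close>

definition alg_indep :: "('c::comm_ring_1 \<Rightarrow> 'p::comm_ring_1) \<Rightarrow> 'c set \<Rightarrow> 'p list \<Rightarrow> 'p set \<Rightarrow> bool" where
  "alg_indep \<kappa> C ys q \<longleftrightarrow> (\<forall>s c. (\<forall>es. c es \<in> C) \<longrightarrow>
     (\<Sum>es\<in>exponents (length ys) s. \<kappa> (c es) * monom_of ys es) \<in> q \<longrightarrow> (\<forall>es\<in>exponents (length ys) s. c es = 0))"

lemma alg_indepD:
  assumes "alg_indep \<kappa> C ys q" "\<And>es. c es \<in> C"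
    "(\<Sum>es\<in>exponents (length ys) s. \<kappa> (c es) * monom_of ys es) \<in> q" "es \<in> exponents (length ys) s"
  shows "c es = 0"
  using assms unfolding alg_indep_def by blast

text \<open>In a relation of \<open>y\<^sub>1, \<dots>, y\<^sub>r\<close> modulo \<open>p\<^sub>0\<close> the lowest power of \<open>y\<^sub>1\<close> can be cancelled, because \<open>y\<^sub>1 \<notin> p\<^sub>0\<close>. All
  remaining terms except the lowest one then contain \<open>y\<^sub>1 \<in> p\<^sub>1\<close>, so the lowest coefficient is a relation of
  \<open>y\<^sub>2, \<dots>, y\<^sub>r\<close> modulo \<open>p\<^sub>1\<close>, and induction shows that it vanishes.\<close>

lemma chain_alg_indep:
  fixes \<kappa> :: "'c::comm_ring_1 \<Rightarrow> 'p::comm_ring_1"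
  assumes B: "subring_set B" and C: "subring_set C" and \<kappa>: "ring_map \<kappa>" "\<And>c. c \<in> C \<Longrightarrow> \<kappa> c \<in> B"
    and unit: "\<And>c. c \<in> C \<Longrightarrow> c \<noteq> 0 \<Longrightarrow> \<exists>c'\<in>C. c' * c = 1"
    and "\<And>i. i \<le> length ys \<Longrightarrow> prime_in B (p i)"
    and "\<And>i. i < length ys \<Longrightarrow> p i \<subseteq> p (Suc i) \<and> ys ! i \<in> p (Suc i) - p i"
  shows "alg_indep \<kappa> C ys (p 0)"
  using assms(6-)
proof (induct ys arbitrary: p)
  case Nil
  have p: "prime_in B (p 0)" using Nil(1)[of 0] by simp
  have "c = 0" if "\<kappa> c \<in> p 0" "c \<in> C" for c
  proof (rule ccontr)
    assume "c \<noteq> 0"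
    with unit[OF \<open>c \<in> C\<close>] obtain c' where c': "c' \<in> C" "c' * c = 1" by blast
    then have "\<kappa> c' * \<kappa> c = 1" using ring_mapD(1,3)[OF \<kappa>(1)] by metis
    moreover have "\<kappa> c' * \<kappa> c \<in> p 0" by (rule ideal_inD(4)[OF prime_inD(1)[OF p] that(1) \<kappa>(2)[OF c'(1)]])
    ultimately show False using prime_inD(2)[OF p] by simp
  qed
  then show ?case by (simp add: alg_indep_def)
next
  case (Cons y ys)
  have IH: "alg_indep \<kappa> C ys (p 1)"
    using Cons(1)[of "\<lambda>i. p (Suc i)"] Cons(2,3)[of "Suc _"] by simp
  have p: "prime_in B (p 0)" "prime_in B (p 1)" using Cons(2)[of 0] Cons(2)[of 1] by auto
  have y: "y \<in> p 1" "y \<notin> p 0" "p 0 \<subseteq> p 1" using Cons(3)[of 0] by auto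
  have yB: "y \<in> B" using y(1) ideal_inD(1)[OF prime_inD(1)[OF p(2)]] by auto
  have ysB: "set ys \<subseteq> B"
  proof
    fix z assume "z \<in> set ys"
    then obtain i where i: "i < length ys" "z = ys ! i" by (auto simp: in_set_conv_nth)
    then have "z \<in> p (Suc (Suc i))" using Cons(3)[of "Suc i"] by simp
    moreover have "prime_in B (p (Suc (Suc i)))" using Cons(2)[of "Suc (Suc i)"] i by simp
    ultimately show "z \<in> B" using ideal_inD(1)[OF prime_inD(1)] by blast
  qed
  show ?case unfolding alg_indep_def
  proof (intro allI impI)
    fix s and c :: "nat list \<Rightarrow> 'c"
    assume cC: "\<forall>es. c es \<in> C" and *: "(\<Sum>es\<in>exponents (length (y # ys)) s. \<kappa> (c es) * monom_of (y # ys) es) \<in> p 0"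
    define Q where "Q = (\<lambda>e. \<Sum>es\<in>exponents (length ys) s. \<kappa> (c (e # es)) * monom_of ys es)"
    have QB: "Q e \<in> B" for e unfolding Q_def
      by (intro subring_sum[OF B] subring_setD(4)[OF B] \<kappa>(2) cC[rule_format] monom_of_in[OF B ysB])
    have s: "(\<Sum>e<s. y ^ e * Q e) \<in> p 0"
      using * by (simp add: sum_exponents_Suc Q_def sum_distrib_left mult_ac)
    \<comment> \<open>Induction on the exponent of \<open>y\<close>: all coefficients below \<open>e\<close> are already known to vanish.\<close>
    have zero: "c (e # es) = 0" if "e < s" "es \<in> exponents (length ys) s" for e es
      using that
    proof (induct e arbitrary: es rule: less_induct)
      case (less e)
      have "Q e' = 0" if "e' < e" for e' unfolding Q_def
        by (rule sum.neutral) (use less that in \<open>auto simp: ring_mapD[OF \<kappa>(1)]\<close>)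
      then have "(\<Sum>e<s. y ^ e * Q e) = (\<Sum>e'\<in>{e..<s}. y ^ e' * Q e')"
        by (intro sum.mono_neutral_right) auto
      also have "\<dots> = (\<Sum>e'\<in>{e..<s}. y ^ e * (y ^ (e' - e) * Q e'))"
        by (rule sum.cong) (auto simp: mult.assoc[symmetric] power_add[symmetric])
      also have "\<dots> = y ^ e * (\<Sum>e'\<in>{e..<s}. y ^ (e' - e) * Q e')" by (simp add: sum_distrib_left)
      finally have "y ^ e * (\<Sum>e'\<in>{e..<s}. y ^ (e' - e) * Q e') \<in> p 0" using s by simp
      moreover have "(\<Sum>e'\<in>{e..<s}. y ^ (e' - e) * Q e') \<in> B"
        by (intro subring_sum[OF B] subring_setD(4)[OF B] subring_power[OF B] yB QB)
      ultimately have S0: "(\<Sum>e'\<in>{e..<s}. y ^ (e' - e) * Q e') \<in> p 0"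
        using prime_inD(3)[OF p(1) subring_power[OF B yB], of "\<Sum>e'\<in>{e..<s}. y ^ (e' - e) * Q e'" e]
          prime_in_power[OF p(1) B yB, of e] y(2) by blast
      have S1: "(\<Sum>e'\<in>{e..<s}. y ^ (e' - e) * Q e') = Q e + (\<Sum>e'\<in>{Suc e..<s}. y ^ (e' - e) * Q e')"
        using sum.atLeast_Suc_lessThan[OF less(2), of "\<lambda>e'. y ^ (e' - e) * Q e'"] by simp
      have S2: "(\<Sum>e'\<in>{Suc e..<s}. y ^ (e' - e) * Q e') \<in> p 1"
      proof (rule ideal_in_sum[OF prime_inD(1)[OF p(2)]])
        fix e' assume "e' \<in> {Suc e..<s}"
        then have "e' - e = Suc (e' - Suc e)" by auto
        then have "y ^ (e' - e) = y ^ (e' - Suc e) * y" by simp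
        then have "y ^ (e' - e) \<in> p 1"
          using ideal_inD(4)[OF prime_inD(1)[OF p(2)] y(1) subring_power[OF B yB]] by simp
        then show "y ^ (e' - e) * Q e' \<in> p 1" by (rule ideal_inD(5)[OF prime_inD(1)[OF p(2)] _ QB])
      qed
      have "Q e + (\<Sum>e'\<in>{Suc e..<s}. y ^ (e' - e) * Q e') \<in> p 1"
        using subsetD[OF y(3) S0] by (simp only: S1)
      from ideal_in_diff[OF B prime_inD(1)[OF p(2)] this S2] have "Q e \<in> p 1" by (simp only: add_diff_cancel_right')
      then show ?case
        unfolding Q_def by (rule alg_indepD[OF IH cC[rule_format] _ less(3)])
    qed
    show "\<forall>es\<in>exponents (length (y # ys)) s. c es = 0"
    proof
      fix es assume "es \<in> exponents (length (y # ys)) s"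
      then obtain e fs where "es = e # fs" "e < s" "fs \<in> exponents (length ys) s"
        by (auto simp: exponents_def length_Suc_conv)
      then show "c es = 0" using zero by simp
    qed
  qed
qed

section \<open>Algebras that are generically finite over few elements\<close>

text \<open>The counting argument. Suppose that all generators of \<open>B\<close> are algebraic modulo \<open>q\<close> over the algebra of
  polynomials in \<open>ts\<close>. After inverting one element \<open>d \<notin> q\<close>, the ring \<open>B/q\<close> is then a module over that algebra with
  finitely many generators \<open>E\<close>. Elements obtained by \<open>u\<close> multiplications lie in a module spanned by
  \<open>O(u\<^sup>N)\<close> elements, where \<open>N\<close> is the length of \<open>ts\<close>, so more than \<open>N\<close> elements of \<open>B\<close> have too many monomials to
  be algebraically independent.\<close>

definition setmul :: "'a::comm_ring_1 set \<Rightarrow> 'a set \<Rightarrow> 'a set" (infixl "\<odot>\<odot>" 70) where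
  "X \<odot>\<odot> Y = (\<lambda>(x, y). x * y) ` (X \<times> Y)"

lemma setmulI: "x \<in> X \<Longrightarrow> y \<in> Y \<Longrightarrow> x * y \<in> X \<odot>\<odot> Y" by (auto simp: setmul_def)
lemma finite_setmul [simp]: "finite X \<Longrightarrow> finite Y \<Longrightarrow> finite (X \<odot>\<odot> Y)" by (simp add: setmul_def)

text \<open>Generation is expressed by the induction principle that is used, for sums and products of elements of \<open>B\<close>.\<close>

definition alg_gen :: "'p::comm_ring_1 set \<Rightarrow> 'c set \<Rightarrow> ('c \<Rightarrow> 'p) \<Rightarrow> 'p set \<Rightarrow> bool" where
  "alg_gen B C \<kappa> Z \<longleftrightarrow> (\<forall>S. \<kappa> ` C \<subseteq> S \<longrightarrow> Z \<subseteq> S \<longrightarrow>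
     (\<forall>f\<in>B \<inter> S. \<forall>g\<in>B \<inter> S. f + g \<in> S \<and> f * g \<in> S) \<longrightarrow> B \<subseteq> S)"

text \<open>The residue ring \<open>B/q\<close> as a \<open>C\<close>-algebra. The constants are either the field \<open>K\<close> or the ring \<open>A\<close>, which is why
  \<open>C\<close> is a subset together with a map \<open>\<kappa>\<close> into \<open>B\<close>.\<close>

locale alg_mod =
  fixes B :: "'p::comm_ring_1 set" and C :: "'c::idom set" and \<kappa> :: "'c \<Rightarrow> 'p" and q :: "'p set"
  assumes B: "subring_set B" and C: "subring_set C" and \<kappa>: "ring_map \<kappa>" and \<kappa>B: "\<And>c. c \<in> C \<Longrightarrow> \<kappa> c \<in> B"
    and q: "ideal_in B q"
begin

text \<open>Representatives of the \<open>C\<close>-span of \<open>X\<close> in \<open>B/q\<close>.\<close>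

definition Sp :: "'p set \<Rightarrow> 'p set" where
  "Sp X = {f. \<exists>l. (\<forall>b. l b \<in> C) \<and> f - (\<Sum>b\<in>X. \<kappa> (l b) * b) \<in> q}"

lemma Sp_q: "f \<in> q \<Longrightarrow> f \<in> Sp X"
  unfolding Sp_def by (intro CollectI exI[of _ "\<lambda>_. 0"]) (simp add: ring_mapD[OF \<kappa>] subring_setD(2)[OF C])

lemma Sp_self: assumes "finite X" "x \<in> X" shows "x \<in> Sp X"
proof -
  have "(\<Sum>b\<in>X. \<kappa> (if b = x then 1 else 0) * b) = (\<Sum>b\<in>X. if b = x then b else 0)"
    by (rule sum.cong) (simp_all add: ring_mapD[OF \<kappa>])
  then have "x - (\<Sum>b\<in>X. \<kappa> (if b = x then 1 else 0) * b) = 0" using assms by simp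
  then have "x - (\<Sum>b\<in>X. \<kappa> (if b = x then 1 else 0) * b) \<in> q" using ideal_inD(2)[OF q] by (simp only:)
  then show ?thesis unfolding Sp_def
    by (intro CollectI exI[of _ "\<lambda>b. if b = x then 1 else 0"] conjI) (simp_all add: subring_setD(1,2)[OF C])
qed

lemma Sp_add: assumes "f \<in> Sp X" "g \<in> Sp X" shows "f + g \<in> Sp X"
proof -
  obtain l l' where l0: "\<And>b. l b \<in> C" "\<And>b. l' b \<in> C" and l: "f - (\<Sum>b\<in>X. \<kappa> (l b) * b) \<in> q" "g - (\<Sum>b\<in>X. \<kappa> (l' b) * b) \<in> q"
    using assms by (auto simp: Sp_def)
  have "(f + g) - (\<Sum>b\<in>X. \<kappa> (l b + l' b) * b) = (f - (\<Sum>b\<in>X. \<kappa> (l b) * b)) + (g - (\<Sum>b\<in>X. \<kappa> (l' b) * b))"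
    by (simp add: ring_mapD[OF \<kappa>] algebra_simps sum.distrib)
  then have "(f + g) - (\<Sum>b\<in>X. \<kappa> (l b + l' b) * b) \<in> q" using ideal_inD(3)[OF q l] by (simp only:)
  then show ?thesis unfolding Sp_def
    by (intro CollectI exI[of _ "\<lambda>b. l b + l' b"] conjI) (simp_all add: subring_setD(5)[OF C] l0)
qed

lemma Sp_scale: assumes "f \<in> Sp X" "c \<in> C" shows "\<kappa> c * f \<in> Sp X"
proof -
  obtain l where l0: "\<And>b. l b \<in> C" and l: "f - (\<Sum>b\<in>X. \<kappa> (l b) * b) \<in> q" using assms by (auto simp: Sp_def)
  have "\<kappa> c * f - (\<Sum>b\<in>X. \<kappa> (c * l b) * b) = \<kappa> c * (f - (\<Sum>b\<in>X. \<kappa> (l b) * b))"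
    by (simp add: ring_mapD[OF \<kappa>] right_diff_distrib sum_distrib_left mult_ac)
  then have "\<kappa> c * f - (\<Sum>b\<in>X. \<kappa> (c * l b) * b) \<in> q" using ideal_inD(4)[OF q l \<kappa>B[OF assms(2)]] by (simp only:)
  then show ?thesis unfolding Sp_def
    by (intro CollectI exI[of _ "\<lambda>b. c * l b"] conjI) (simp_all add: subring_setD(4)[OF C] l0 assms)
qed

lemma Sp_uminus: "f \<in> Sp X \<Longrightarrow> - f \<in> Sp X"
  using Sp_scale[of f X "-1"] subring_setD(6)[OF C subring_setD(1)[OF C]] by (simp add: ring_mapD[OF \<kappa>])

lemma Sp_0: "0 \<in> Sp X" using Sp_q ideal_inD(2)[OF q] by blast

lemma Sp_sum: "(\<And>i. i \<in> S \<Longrightarrow> f i \<in> Sp X) \<Longrightarrow> sum f S \<in> Sp X"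
  by (induct S rule: infinite_finite_induct) (auto simp: Sp_0 Sp_add)

lemma Sp_least:
  assumes "f \<in> Sp X" "finite X" "\<And>x. x \<in> X \<Longrightarrow> x \<in> S" "\<And>x. x \<in> q \<Longrightarrow> x \<in> S"
    "\<And>x y. x \<in> S \<Longrightarrow> y \<in> S \<Longrightarrow> x + y \<in> S" "\<And>c x. c \<in> C \<Longrightarrow> x \<in> S \<Longrightarrow> \<kappa> c * x \<in> S"
  shows "f \<in> S"
proof -
  obtain l where l0: "\<And>b. l b \<in> C" and l: "f - (\<Sum>b\<in>X. \<kappa> (l b) * b) \<in> q" using assms(1) by (auto simp: Sp_def)
  have 0: "0 \<in> S" using assms(4) ideal_inD(2)[OF q] by blast
  have "(\<Sum>b\<in>Y. \<kappa> (l b) * b) \<in> S" if "Y \<subseteq> X" for Y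
    using finite_subset[OF that assms(2)] that
  proof (induct Y rule: finite_induct)
    case (insert x Y)
    then show ?case using assms(5)[OF assms(6)[OF l0 assms(3)[of x]]] by simp
  qed (simp add: 0)
  from assms(5)[OF assms(4)[OF l] this[OF subset_refl]] show ?thesis by simp
qed

lemma Sp_subset: "f \<in> Sp X \<Longrightarrow> finite X \<Longrightarrow> (\<And>x. x \<in> X \<Longrightarrow> x \<in> Sp Y) \<Longrightarrow> f \<in> Sp Y"
  by (rule Sp_least[of f X "Sp Y"]) (auto simp: Sp_q Sp_add Sp_scale)

lemma Sp_mono: "f \<in> Sp X \<Longrightarrow> X \<subseteq> Y \<Longrightarrow> finite Y \<Longrightarrow> f \<in> Sp Y"
  by (rule Sp_subset[of f X Y]) (auto intro: Sp_self finite_subset)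

lemma Sp_B: assumes "f \<in> Sp X" "X \<subseteq> B" "finite X" shows "f \<in> B"
proof (rule Sp_least[OF assms(1,3)])
  show "x \<in> B" if "x \<in> X" for x using that assms(2) by blast
  show "x \<in> B" if "x \<in> q" for x using that ideal_inD(1)[OF q] by blast
qed (simp_all add: subring_setD[OF B] \<kappa>B)

lemma Sp_mult:
  assumes f: "f \<in> Sp X" "finite X" "X \<subseteq> B" and g: "g \<in> Sp Y" "finite Y" "Y \<subseteq> B"
    and XY: "\<And>x y. x \<in> X \<Longrightarrow> y \<in> Y \<Longrightarrow> x * y \<in> Sp Z"
  shows "f * g \<in> Sp Z"
proof -
  have 1: "f \<in> {f \<in> B. \<forall>y\<in>Y. f * y \<in> Sp Z}"
  proof (rule Sp_least[OF f(1,2)])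
    show "x \<in> {f \<in> B. \<forall>y\<in>Y. f * y \<in> Sp Z}" if "x \<in> q" for x
      using that ideal_inD(1)[OF q] g(3) by (auto intro!: Sp_q ideal_inD(5)[OF q])
  qed (use f(3) XY in \<open>auto simp: subring_setD[OF B] \<kappa>B distrib_right Sp_add Sp_scale mult.assoc\<close>)
  have "g \<in> {g \<in> B. f * g \<in> Sp Z}"
  proof (rule Sp_least[OF g(1,2)])
    show "x \<in> {g \<in> B. f * g \<in> Sp Z}" if "x \<in> q" for x
      using that ideal_inD(1)[OF q] 1 by (auto intro!: Sp_q ideal_inD(4)[OF q])
    show "\<kappa> c * x \<in> {g \<in> B. f * g \<in> Sp Z}" if "c \<in> C" "x \<in> {g \<in> B. f * g \<in> Sp Z}" for c x
      using that Sp_scale[of "f * x" Z c] by (auto simp: subring_setD[OF B] \<kappa>B mult_ac)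
  qed (use g(3) 1 in \<open>auto simp: subring_setD[OF B] \<kappa>B distrib_left Sp_add\<close>)
  then show ?thesis by simp
qed

end

locale alg_mod_tuple = alg_mod B C \<kappa> q
  for B :: "'p::comm_ring_1 set" and C :: "'c::idom set" and \<kappa> :: "'c \<Rightarrow> 'p" and q :: "'p set" +
  fixes ts :: "'p list"
  assumes ts: "set ts \<subseteq> B"
begin

text \<open>Monomials in \<open>ts\<close> with all exponents at most \<open>u\<close>; their spans filter the subalgebra \<open>Pol\<close> generated by \<open>ts\<close>
  modulo \<open>q\<close>.\<close>

definition MX :: "nat \<Rightarrow> 'p set" where
  "MX u = monom_of ts ` exponents (length ts) (Suc u)"

lemma MX_fin [simp]: "finite (MX u)" by (simp add: MX_def)
lemma MX_B: "MX u \<subseteq> B" by (auto simp: MX_def intro: monom_of_in[OF B ts])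
lemma card_MX: "card (MX u) \<le> Suc u ^ length ts"
  unfolding MX_def using card_image_le[OF finite_exponents] by (metis card_exponents)
lemma MX_mono: "u \<le> v \<Longrightarrow> MX u \<subseteq> MX v"
  unfolding MX_def by (rule image_mono) (auto simp: exponents_def)
lemma MX_mult: "x \<in> MX u \<Longrightarrow> y \<in> MX v \<Longrightarrow> x * y \<in> MX (u + v)"
proof -
  assume "x \<in> MX u" "y \<in> MX v"
  then obtain es es' where e: "es \<in> exponents (length ts) (Suc u)" "es' \<in> exponents (length ts) (Suc v)"
    "x = monom_of ts es" "y = monom_of ts es'" by (auto simp: MX_def)
  then have "x * y = monom_of ts (map2 (+) es es')" by (simp add: monom_of_mult exponents_def)
  moreover have "a + b < Suc (u + v)" if "(a, b) \<in> set (zip es es')" for a b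
  proof -
    have "a \<in> set es" "b \<in> set es'" using that by (auto dest: set_zip_leftD set_zip_rightD)
    then show ?thesis using e by (force simp: exponents_def)
  qed
  then have "map2 (+) es es' \<in> exponents (length ts) (Suc (u + v))"
    using e by (auto simp: exponents_def)
  ultimately show ?thesis by (auto simp: MX_def)
qed
lemma MX_1: "1 \<in> MX u"
proof -
  have "monom_of ts (replicate (length ts) 0) = 1"
    by (induct ts) simp_all
  moreover have "replicate (length ts) 0 \<in> exponents (length ts) (Suc u)" by (auto simp: exponents_def)
  ultimately show ?thesis unfolding MX_def by (metis imageI)
qed
lemma MX_ts: "t \<in> set ts \<Longrightarrow> t \<in> MX 1"
proof -
  have "\<exists>es\<in>exponents (length ts) 2. monom_of ts es = t" if "t \<in> set ts"
    using that
  proof (induct ts)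
    case (Cons a ts)
    have z: "monom_of ts (replicate (length ts) 0) = 1" by (induct ts) simp_all
    show ?case
    proof (cases "t = a")
      case True
      then show ?thesis using z by (intro bexI[of _ "1 # replicate (length ts) 0"]) (auto simp: exponents_def)
    next
      case False
      then obtain es where "es \<in> exponents (length ts) 2" "monom_of ts es = t" using Cons by auto
      then show ?thesis by (intro bexI[of _ "0 # es"]) (auto simp: exponents_def)
    qed
  qed simp
  moreover assume "t \<in> set ts"
  ultimately show ?thesis by (auto simp: MX_def numeral_2_eq_2)
qed

definition Pol :: "'p set" where "Pol = (\<Union>u. Sp (MX u))"

lemma Pol_common: "finite S \<Longrightarrow> S \<subseteq> Pol \<Longrightarrow> \<exists>u. S \<subseteq> Sp (MX u)"
proof (induct S rule: finite_induct)
  case (insert x S)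
  then obtain u v where "S \<subseteq> Sp (MX u)" "x \<in> Sp (MX v)" by (auto simp: Pol_def)
  then have "insert x S \<subseteq> Sp (MX (max u v))"
    using Sp_mono[OF _ MX_mono MX_fin] by (auto; meson max.cobounded1 max.cobounded2 subsetD)
  then show ?case by blast
qed auto

lemma Pol_B: "f \<in> Pol \<Longrightarrow> f \<in> B" by (auto simp: Pol_def intro: Sp_B[OF _ MX_B MX_fin])

lemma Pol_q: "f \<in> q \<Longrightarrow> f \<in> Pol" by (auto simp: Pol_def intro: Sp_q)

lemma Pol_add: assumes "f \<in> Pol" "g \<in> Pol" shows "f + g \<in> Pol"
  using Pol_common[of "{f, g}"] assms Sp_add by (auto simp: Pol_def)

lemma Sp_MX_mult: "f \<in> Sp (MX u) \<Longrightarrow> g \<in> Sp (MX v) \<Longrightarrow> f * g \<in> Sp (MX (u + v))"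
  by (rule Sp_mult[OF _ MX_fin MX_B _ MX_fin MX_B]) (auto intro: Sp_self[OF MX_fin] MX_mult)

lemma Pol_mult: assumes "f \<in> Pol" "g \<in> Pol" shows "f * g \<in> Pol"
proof -
  obtain u v where "f \<in> Sp (MX u)" "g \<in> Sp (MX v)" using assms by (auto simp: Pol_def)
  then have "f * g \<in> Sp (MX (u + v))" by (rule Sp_MX_mult)
  then show ?thesis by (auto simp: Pol_def)
qed

lemma Pol_\<kappa>: "c \<in> C \<Longrightarrow> \<kappa> c \<in> Pol"
  using Sp_scale[OF Sp_self[OF MX_fin MX_1, of 0], of c] by (auto simp: Pol_def)

lemma Pol_ts: "t \<in> set ts \<Longrightarrow> t \<in> Pol" using Sp_self[OF MX_fin MX_ts] by (auto simp: Pol_def)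

lemma Pol_subring: "subring_set Pol"
  unfolding subring_set_def
proof (intro conjI ballI)
  show "1 \<in> Pol" using Pol_\<kappa>[of 1] subring_setD(1)[OF C] by (simp add: ring_mapD[OF \<kappa>])
  show "x * y \<in> Pol" if "x \<in> Pol" "y \<in> Pol" for x y using Pol_mult that by blast
  show "x - y \<in> Pol" if "x \<in> Pol" "y \<in> Pol" for x y
    using Pol_add[OF that(1) Pol_mult[OF Pol_\<kappa>[of "-1"] that(2)]] subring_setD(6)[OF C subring_setD(1)[OF C]] by (simp add: ring_mapD[OF \<kappa>])
qed

text \<open>A common denominator \<open>d\<close> and a finite set \<open>E\<close> of module generators such that multiplication by \<open>d z\<close>, for all
  \<open>z \<in> Z\<close>, maps \<open>E\<close> into combinations of \<open>E\<close> with coefficients of bounded degree \<open>c\<close> in \<open>ts\<close>. The bound is uniform, so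
  degrees grow linearly with the number of multiplications.\<close>

definition finite_over :: "'p set \<Rightarrow> bool" where
  "finite_over Z \<longleftrightarrow> (\<exists>d E c. d \<in> B - q \<and> finite E \<and> E \<subseteq> B \<and> 1 \<in> E \<and> d \<in> Sp (MX c) \<and>
     (\<forall>z\<in>Z. \<forall>b\<in>E. d * z * b \<in> Sp (MX c \<odot>\<odot> E)))"

lemma finite_over_ts: assumes "1 \<notin> q" shows "finite_over (set ts)"
proof -
  have "t * 1 \<in> Sp (MX 1 \<odot>\<odot> {1})" if "t \<in> set ts" for t
    using setmulI[OF MX_ts[OF that], of 1 "{1}"] by (intro Sp_self) simp_all
  then show ?thesis unfolding finite_over_def
    by (intro exI[of _ 1] exI[of _ "{1}"]) (use assms Sp_self[OF MX_fin MX_1] in \<open>simp add: subring_setD(1)[OF B]\<close>)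
qed

lemma MXE_B: assumes "E \<subseteq> B" shows "MX c \<odot>\<odot> E \<subseteq> B"
proof
  fix z assume "z \<in> MX c \<odot>\<odot> E"
  then obtain x y where "x \<in> MX c" "y \<in> E" "z = x * y" by (auto simp: setmul_def)
  then show "z \<in> B" using subring_setD(4)[OF B, of x y] MX_B assms by auto
qed

lemma Sp_MXE:
  assumes E: "finite E" "E \<subseteq> B" "finite E'" and f: "f \<in> Sp (MX a)" and g: "g \<in> Sp (MX c \<odot>\<odot> E)"
    and h: "h \<in> B" "\<And>b. b \<in> E \<Longrightarrow> b * h \<in> E'" and u: "a + c \<le> u"
  shows "f * g * h \<in> Sp (MX u \<odot>\<odot> E')"
proof -
  have "g * h \<in> Sp ((\<lambda>x. x * h) ` (MX c \<odot>\<odot> E))"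
  proof (rule Sp_mult[OF g _ MXE_B[OF E(2)] Sp_self[of "{h}" h]])
    show "x * y \<in> Sp ((\<lambda>x. x * h) ` (MX c \<odot>\<odot> E))" if "x \<in> MX c \<odot>\<odot> E" "y \<in> {h}" for x y
      using that E(1) by (intro Sp_self) auto
  qed (use E(1) h(1) in simp_all)
  then have "f * (g * h) \<in> Sp (MX u \<odot>\<odot> E')"
  proof (rule Sp_mult[OF f MX_fin MX_B])
    fix x y assume x: "x \<in> MX a" and "y \<in> (\<lambda>x. x * h) ` (MX c \<odot>\<odot> E)"
    then obtain x' b where y: "x' \<in> MX c" "b \<in> E" "y = x' * b * h" by (auto simp: setmul_def)
    have "x * y = (x * x') * (b * h)" by (simp add: y mult_ac)
    also have "\<dots> \<in> MX u \<odot>\<odot> E'"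
      using MX_mult[OF x y(1)] MX_mono[OF u] h(2)[OF y(2)] by (intro setmulI) auto
    finally show "x * y \<in> Sp (MX u \<odot>\<odot> E')" using E by (intro Sp_self) auto
  next
    show "(\<lambda>x. x * h) ` (MX c \<odot>\<odot> E) \<subseteq> B"
      using MXE_B[OF E(2), of c] subring_setD(4)[OF B _ h(1)] by blast
  qed (use E(1) in simp)
  then show ?thesis by (simp add: mult_ac)
qed

text \<open>If \<open>dz z\<^sup>N\<close> is modulo \<open>q\<close> a combination of lower powers of \<open>z\<close>, then the products of \<open>E\<close> with
  \<open>1, z, \<dots>, z\<^bsup>N-1\<^esup>\<close> generate over the denominator \<open>d dz\<close>.\<close>

lemma finite_over_insert:
  assumes pq: "prime_in B q" and Z: "finite_over Z" and z: "z \<in> B" and dz: "dz \<in> Pol" "dz \<notin> q"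
    and di: "\<And>i. i < N \<Longrightarrow> di i \<in> Pol" and rel: "dz * z ^ N + (\<Sum>i<N. di i * z ^ i) \<in> q"
  shows "finite_over (insert z Z)"
proof -
  obtain d E c where d: "d \<in> B - q" "finite E" "E \<subseteq> B" "1 \<in> E" "d \<in> Sp (MX c)"
    "\<And>z b. z \<in> Z \<Longrightarrow> b \<in> E \<Longrightarrow> d * z * b \<in> Sp (MX c \<odot>\<odot> E)" using Z by (auto simp: finite_over_def)
  obtain a where a: "dz \<in> Sp (MX a)" "\<And>i. i < N \<Longrightarrow> di i \<in> Sp (MX a)"
  proof -
    have "insert dz (di ` {..<N}) \<subseteq> Pol" using dz di by auto
    from Pol_common[OF _ this] obtain a where "insert dz (di ` {..<N}) \<subseteq> Sp (MX a)" by auto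
    then show ?thesis by (intro that[of a]) auto
  qed
  \<comment> \<open>For \<open>N = 0\<close> the relation would put the leading coefficient into \<open>q\<close>.\<close>
  have N: "N \<noteq> 0" using rel dz by (cases N) auto
  define E' where "E' = (\<lambda>(b, i). b * z ^ i) ` (E \<times> {..<N})"
  have E'I: "b * z ^ i \<in> E'" if "b \<in> E" "i < N" for b i using that by (auto simp: E'_def)
  have dd: "d * dz \<in> B - q"
    using prime_inD(3)[OF pq, of d dz] d(1) dz Pol_B subring_setD(4)[OF B] by auto
  have ddS: "d * dz \<in> Sp (MX (a + c))"
    using Sp_MX_mult[OF d(5) a(1)] by (simp add: add.commute)
  have fin: "finite E'" "E' \<subseteq> B" using d(2,3) z
    by (auto simp: E'_def intro!: subring_setD(4)[OF B] subring_power[OF B])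
  have one: "1 \<in> E'" using E'I[OF d(4), of 0] N by simp
  have bE': "b' \<in> Sp (MX 0 \<odot>\<odot> E')" if "b' \<in> E'" for b'
    using Sp_self[of "MX 0 \<odot>\<odot> E'" "1 * b'"] setmulI[OF MX_1 that] fin by simp
  have main: "d * dz * z' * b' \<in> Sp (MX (a + c) \<odot>\<odot> E')" if z': "z' \<in> insert z Z" and b': "b' \<in> E'" for z' b'
  proof -
    obtain b i where b: "b' = b * z ^ i" "b \<in> E" "i < N" using b' by (auto simp: E'_def)
    show ?thesis
    proof (cases "z' = z")
      case False
      then have "z' \<in> Z" using z' by simp
      then have "dz * (d * z' * b) * z ^ i \<in> Sp (MX (a + c) \<odot>\<odot> E')"
        by (intro Sp_MXE[OF d(2,3) fin(1) a(1) d(6)]) (use b z E'I subring_power[OF B] in auto)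
      then show ?thesis by (simp add: b mult_ac)
    next
      case True
      show ?thesis
      proof (cases "Suc i < N")
        case True2: True
        have "d * dz * (b * z ^ Suc i) * 1 \<in> Sp (MX (a + c) \<odot>\<odot> E')"
          by (rule Sp_MXE[OF fin(1,2,1) ddS bE'[OF E'I[OF b(2) True2]]] )
            (use fin in \<open>auto simp: subring_setD[OF B]\<close>)
        then show ?thesis using True by (simp add: b mult_ac)
      next
        case False
        \<comment> \<open>The only product that leaves the range of exponents is rewritten by the relation.\<close>
        then have iN: "Suc i = N" using b by simp
        have bz: "b * z ^ N = z * (b * z ^ i)" using iN by (auto simp: mult_ac)
        have t: "d * di j * (b * z ^ j) * 1 \<in> Sp (MX (a + c) \<odot>\<odot> E')" if "j < N" for j
        proof -
          have "d * di j \<in> Sp (MX (a + c))"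
            using Sp_MX_mult[OF d(5) a(2)[OF that]] by (simp add: add.commute)
          then show ?thesis
            by (intro Sp_MXE[OF fin(1,2,1) _ bE'[OF E'I[OF b(2) that]]]) (auto simp: subring_setD[OF B])
        qed
        have "d * b * (dz * z ^ N + (\<Sum>i<N. di i * z ^ i)) \<in> q"
          by (rule ideal_inD(4)[OF q rel]) (use d b in \<open>auto intro!: subring_setD(4)[OF B]\<close>)
        then have "d * b * (dz * z ^ N + (\<Sum>i<N. di i * z ^ i)) - (\<Sum>j<N. d * di j * (b * z ^ j) * 1)
            \<in> Sp (MX (a + c) \<odot>\<odot> E')"
          using Sp_add[OF Sp_q Sp_uminus[OF Sp_sum[OF t]], of _ "{..<N}"] by simp
        moreover have "d * b * (dz * z ^ N + (\<Sum>i<N. di i * z ^ i)) - (\<Sum>j<N. d * di j * (b * z ^ j) * 1)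
            = d * dz * (b * z ^ N)"
          by (simp add: distrib_left sum_distrib_left mult_ac)
        ultimately show ?thesis using True b by (simp add: bz mult_ac)
      qed
    qed
  qed
  show ?thesis unfolding finite_over_def
    using dd fin one ddS main by (intro exI[of _ "d * dz"] exI[of _ E'] exI[of _ "a + c"]) auto
qed

text \<open>With \<open>H\<close> and \<open>s\<close> chosen as below, and \<open>N\<close> the length of \<open>ts\<close>, the \<open>s\<^sup>r\<close> monomials in \<open>ys\<close> with exponents below \<open>s\<close> lie, up to the
  factor \<open>d\<^sup>U\<close>, in the span of fewer than \<open>s\<^sup>r\<close> elements as soon as \<open>r > N\<close>; a linear dependence between them is an
  algebraic relation.\<close>

lemma finite_over_indep_bound:
  assumes pq: "prime_in B q" and Z: "finite_over Z"
    and gen: "alg_gen B C \<kappa> Z"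
    and ZB: "Z \<subseteq> B" and ys: "set ys \<subseteq> B" "alg_indep \<kappa> C ys q"
  shows "length ys \<le> length ts"
proof (rule ccontr)
  assume "\<not> length ys \<le> length ts"
  then have len: "Suc (length ts) \<le> length ys" by simp
  obtain d E c where d: "d \<in> B - q" "finite E" "E \<subseteq> B" "1 \<in> E" "d \<in> Sp (MX c)"
    "\<And>z b. z \<in> Z \<Longrightarrow> b \<in> E \<Longrightarrow> d * z * b \<in> Sp (MX c \<odot>\<odot> E)" using Z by (auto simp: finite_over_def)
  have dB: "d \<in> B" using d by simp
  \<comment> \<open>\<open>D u f\<close>: the element \<open>f\<close> needs at most \<open>u\<close> factors \<open>d\<close> to act on the module spanned by \<open>E\<close>.\<close>
  define D where "D = (\<lambda>u f. f \<in> B \<and> (\<forall>b\<in>E. d ^ u * f * b \<in> Sp (MX (c * u) \<odot>\<odot> E)))"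
  have bE: "b \<in> Sp (MX u \<odot>\<odot> E)" if "b \<in> E" for b u
    using Sp_self[of "MX u \<odot>\<odot> E" "1 * b"] setmulI[OF MX_1 that] d by simp
  have D\<kappa>: "D 0 (\<kappa> x)" if "x \<in> C" for x using that Sp_scale[OF bE] \<kappa>B by (auto simp: D_def)
  have DZ: "D 1 z" if "z \<in> Z" for z using that ZB d(6) by (auto simp: D_def)
  have Dsuc: "D (Suc u) f" if "D u f" for u f unfolding D_def
  proof (intro conjI ballI)
    show "f \<in> B" using that by (simp add: D_def)
    fix b assume "b \<in> E"
    then have "d ^ u * f * b \<in> Sp (MX (c * u) \<odot>\<odot> E)" using that by (simp add: D_def)
    then have "d * (d ^ u * f * b) * 1 \<in> Sp (MX (c * Suc u) \<odot>\<odot> E)"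
      by (intro Sp_MXE[OF d(2,3,2) d(5)]) (auto simp: subring_setD[OF B])
    then show "d ^ Suc u * f * b \<in> Sp (MX (c * Suc u) \<odot>\<odot> E)" by (simp add: mult_ac)
  qed
  have Dmono: "D v f" if "D u f" "u \<le> v" for u v f
    using that(2,1) by (induct rule: dec_induct) (auto intro: Dsuc)
  have Dadd: "D u (f + g)" if "D u f" "D u g" for u f g
    using that Sp_add by (auto simp: D_def subring_setD[OF B] distrib_left distrib_right)
  have Dmult: "D (u + v) (f * g)" if f: "D u f" and g: "D v g" for u v f g
    unfolding D_def
  proof (intro conjI ballI)
    show "f * g \<in> B" using f g by (simp add: D_def subring_setD[OF B])
    fix b assume "b \<in> E"
    then have "d ^ v * g * b \<in> Sp (MX (c * v) \<odot>\<odot> E)" using g by (simp add: D_def)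
    then have "(d ^ u * f) * (d ^ v * g * b) \<in> Sp (MX (c * (u + v)) \<odot>\<odot> E)"
    proof (rule Sp_mult[where X = "{d ^ u * f}", rotated 3])
      show "d ^ u * f \<in> Sp {d ^ u * f}" by (rule Sp_self) auto
      fix x y assume x: "x \<in> {d ^ u * f}" and "y \<in> MX (c * v) \<odot>\<odot> E"
      then obtain x' b' where y: "x' \<in> MX (c * v)" "b' \<in> E" "y = x' * b'" by (auto simp: setmul_def)
      have "x' * (d ^ u * f * b') * 1 \<in> Sp (MX (c * (u + v)) \<odot>\<odot> E)"
        by (intro Sp_MXE[OF d(2,3,2) Sp_self[OF MX_fin y(1)]])
          (use f y(2) in \<open>auto simp: D_def subring_setD[OF B] algebra_simps\<close>)
      then show "x * y \<in> Sp (MX (c * (u + v)) \<odot>\<odot> E)" using x y by (simp add: mult_ac)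
    next
      show "{d ^ u * f} \<subseteq> B" using f subring_setD(4)[OF B subring_power[OF B dB]] by (simp add: D_def)
      show "MX (c * v) \<odot>\<odot> E \<subseteq> B" by (rule MXE_B[OF d(3)])
      show "finite (MX (c * v) \<odot>\<odot> E)" using d(2) by simp
    qed simp
    then show "d ^ (u + v) * (f * g) * b \<in> Sp (MX (c * (u + v)) \<odot>\<odot> E)"
      by (simp add: power_add mult_ac)
  qed
  have ex: "\<exists>u. D u f" if "f \<in> B" for f
  proof -
    have "\<exists>u. D u (f + g)" if "\<exists>u. D u f" "\<exists>u. D u g" for f g
    proof -
      from that obtain u v where "D u f" "D v g" by blast
      then have "D (max u v) f" "D (max u v) g" using Dmono by auto
      then show ?thesis using Dadd by blast
    qed
    moreover have "\<exists>u. D u (f * g)" if "\<exists>u. D u f" "\<exists>u. D u g" for f g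
      using that Dmult by blast
    ultimately have "B \<subseteq> {f. \<exists>u. D u f}"
      using D\<kappa> DZ by (intro gen[unfolded alg_gen_def, rule_format]) blast+
    then show ?thesis using that by blast
  qed
  have "\<exists>u. \<forall>y\<in>S. D u y" if "finite S" "S \<subseteq> B" for S
    using that
  proof (induct S rule: finite_induct)
    case (insert x S)
    then obtain u where "\<forall>y\<in>S. D u y" by auto
    moreover obtain v where "D v x" using ex[of x] insert by auto
    ultimately show ?case using Dmono[of u _ "max u v"] Dmono[of v x "max u v"] by (intro exI[of _ "max u v"]) auto
  qed auto
  from this[OF finite_set ys(1)] obtain u where u: "\<And>y. y \<in> set ys \<Longrightarrow> D u y" by blast
  have Dpow: "D (u * e) (f ^ e)" if "D u f" for f e
  proof (induct e)
    case 0 then show ?case using D\<kappa>[OF subring_setD(1)[OF C]] by (simp add: ring_mapD[OF \<kappa>])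
  next
    case (Suc e) then show ?case using Dmult[OF that Suc] by simp
  qed
  have Dmon: "D (u * sum_list es) (monom_of ys' es)" if "set ys' \<subseteq> set ys" "length es = length ys'" for ys' es
    using that
  proof (induct ys' arbitrary: es)
    case Nil then show ?case using D\<kappa>[OF subring_setD(1)[OF C]] by (simp add: ring_mapD[OF \<kappa>])
  next
    case (Cons y ys')
    then obtain e fs where es: "es = e # fs" by (metis length_Suc_conv)
    show ?case using Dmult[OF Dpow[OF u[of y], of e] Cons(1)[of fs]] Cons(2,3) by (simp add: es distrib_left)
  qed
  define r where "r = length ys"
  \<comment> \<open>The degree bound \<open>c * U + 1\<close> is at most \<open>H * s\<close>, and \<open>s\<close> exceeds the constant \<open>H\<^sup>N * card E\<close>.\<close>
  define H where "H = c * u * r + 1"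
  define s where "s = H ^ length ts * card E + 1"
  define U where "U = u * (r * s)"
  define X where "X = MX (c * U) \<odot>\<odot> E"
  have DU: "D U (monom_of ys es)" if "es \<in> exponents r s" for es
  proof -
    have "sum_list es \<le> r * s" using that sum_list_mono[of es "\<lambda>x. x" "\<lambda>_. s"]
      by (force simp: exponents_def sum_list_triv)
    then show ?thesis using Dmono[OF Dmon[of ys es]] that by (auto simp: exponents_def r_def U_def)
  qed
  have "card X \<le> card (MX (c * U)) * card E"
    unfolding X_def setmul_def using card_image_le[of "MX (c * U) \<times> E"] d(2) by (simp add: card_cartesian_product)
  also have "\<dots> \<le> Suc (c * U) ^ length ts * card E" using card_MX by (intro mult_right_mono) auto
  also have "\<dots> \<le> (H * s) ^ length ts * card E"
  proof (intro mult_right_mono power_mono)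
    have "H * s = c * U + s" by (simp add: H_def U_def algebra_simps)
    then show "Suc (c * U) \<le> H * s" by (simp add: s_def)
  qed auto
  also have "\<dots> = s ^ length ts * (H ^ length ts * card E)" by (simp add: power_mult_distrib mult_ac)
  also have "\<dots> < s ^ length ts * s" by (simp add: s_def)
  also have "\<dots> = s ^ Suc (length ts)" by simp
  also have "\<dots> \<le> s ^ r" using len by (intro power_increasing) (auto simp: r_def s_def)
  finally have card: "card X < card (exponents r s)" by (simp add: card_exponents)
  have "\<forall>es\<in>exponents r s. \<exists>l. (\<forall>b. l b \<in> C) \<and> d ^ U * monom_of ys es - (\<Sum>b\<in>X. \<kappa> (l b) * b) \<in> q"
  proof
    fix es assume "es \<in> exponents r s"
    then have "d ^ U * monom_of ys es * 1 \<in> Sp X" using DU[of es] d(4) unfolding D_def X_def by blast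
    then show "\<exists>l. (\<forall>b. l b \<in> C) \<and> d ^ U * monom_of ys es - (\<Sum>b\<in>X. \<kappa> (l b) * b) \<in> q" by (simp add: Sp_def)
  qed
  then obtain l where l0: "\<And>es b. es \<in> exponents r s \<Longrightarrow> l es b \<in> C" and l: "\<And>es. es \<in> exponents r s \<Longrightarrow> d ^ U * monom_of ys es - (\<Sum>b\<in>X. \<kappa> (l es b) * b) \<in> q"
    unfolding bchoice_iff by blast
  obtain L where L0: "\<And>es. L es \<in> C" and L: "\<exists>es\<in>exponents r s. L es \<noteq> 0" "\<forall>b\<in>X. (\<Sum>es\<in>exponents r s. L es * l es b) = 0"
    using linear_dependence[OF C _ _ card, of l] d(2) l0 by (auto simp: X_def)
  have "(\<Sum>es\<in>exponents r s. \<kappa> (L es) * (d ^ U * monom_of ys es - (\<Sum>b\<in>X. \<kappa> (l es b) * b))) \<in> q"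
    by (intro ideal_in_sum[OF q] ideal_inD(4)[OF q] l \<kappa>B L0)
  also have "(\<Sum>es\<in>exponents r s. \<kappa> (L es) * (d ^ U * monom_of ys es - (\<Sum>b\<in>X. \<kappa> (l es b) * b))) =
      d ^ U * (\<Sum>es\<in>exponents r s. \<kappa> (L es) * monom_of ys es) - (\<Sum>es\<in>exponents r s. \<Sum>b\<in>X. \<kappa> (L es * l es b) * b)"
    by (simp add: right_diff_distrib sum_subtractf sum_distrib_left ring_mapD[OF \<kappa>] mult_ac)
  also have "(\<Sum>es\<in>exponents r s. \<Sum>b\<in>X. \<kappa> (L es * l es b) * b) = (\<Sum>b\<in>X. \<kappa> (\<Sum>es\<in>exponents r s. L es * l es b) * b)"
    by (subst sum.swap) (simp add: ring_mapD[OF \<kappa>] sum_distrib_right)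
  also have "\<dots> = 0" using L(2) by (simp add: ring_mapD[OF \<kappa>])
  finally have "d ^ U * (\<Sum>es\<in>exponents r s. \<kappa> (L es) * monom_of ys es) \<in> q" by simp
  moreover have "(\<Sum>es\<in>exponents r s. \<kappa> (L es) * monom_of ys es) \<in> B"
    by (intro subring_sum[OF B] subring_setD(4)[OF B] \<kappa>B L0 monom_of_in[OF B ys(1)])
  ultimately have "(\<Sum>es\<in>exponents r s. \<kappa> (L es) * monom_of ys es) \<in> q"
    using prime_inD(3)[OF pq subring_power[OF B dB]] prime_in_power[OF pq B dB] d(1) by blast
  then have "L es = 0" if "es \<in> exponents r s" for es
    using alg_indepD[where c = L, OF ys(2) L0] that unfolding r_def by blast
  then show False using L(1) by blast
qed

lemma finite_over_chain_bound:
  assumes unit: "\<And>c. c \<in> C \<Longrightarrow> c \<noteq> 0 \<Longrightarrow> \<exists>c'\<in>C. c' * c = 1" and pq: "prime_in B q" and Z: "finite_over Z" "Z \<subseteq> B"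
    and gen: "alg_gen B C \<kappa> Z"
    and p: "p 0 = q" "\<And>i. i \<le> r \<Longrightarrow> prime_in B (p i)" "\<And>i. i < r \<Longrightarrow> p i \<subset> p (Suc i)"
  shows "r \<le> length ts"
proof -
  have "\<exists>y. y \<in> p (Suc i) - p i" if "i < r" for i using p(3)[OF that] by auto
  then obtain y where y: "\<And>i. i < r \<Longrightarrow> y i \<in> p (Suc i) - p i" by metis
  define ys where "ys = map y [0..<r]"
  have "alg_indep \<kappa> C ys (p 0)"
    by (rule chain_alg_indep[OF B C \<kappa> \<kappa>B unit]) (use p y in \<open>auto simp: ys_def\<close>)
  moreover have "y i \<in> B" if "i < r" for i
    using y[OF that] ideal_inD(1)[OF prime_inD(1)[OF p(2)[of "Suc i"]]] that by auto
  then have "set ys \<subseteq> B" by (auto simp: ys_def)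
  ultimately show ?thesis using finite_over_indep_bound[OF pq Z(1) gen Z(2), of ys] p(1) by (simp add: ys_def)
qed

end

section \<open>Weighted homogeneous parts\<close>

text \<open>Only the first \<open>k\<close> indeterminates carry a weight.\<close>

definition wt :: "(nat \<Rightarrow> nat) \<Rightarrow> nat \<Rightarrow> (nat \<Rightarrow>\<^sub>0 nat) \<Rightarrow> nat" where
  "wt w k t = (\<Sum>j<k. w j * lk t j)"

text \<open>The homogeneous part of weight \<open>e\<close>.\<close>

definition gpart :: "(nat \<Rightarrow> nat) \<Rightarrow> nat \<Rightarrow> nat \<Rightarrow> 'a::comm_ring_1 mpol \<Rightarrow> 'a mpol" where
  "gpart w k e f = (\<Sum>t\<in>{t \<in> ks f. wt w k t = e}. Poly_Mapping.single t (lk f t))"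

lemma wt_add: "wt w k (t + u) = wt w k t + wt w k u"
  by (simp add: wt_def lookup_add distrib_left sum.distrib)

lemma wt_0 [simp]: "wt w k 0 = 0" by (simp add: wt_def)

lemma wt_single: "j < k \<Longrightarrow> wt w k (Poly_Mapping.single j n) = w j * n"
  by (simp add: wt_def lookup_single when_def if_distrib sum.delta cong: if_cong)

lemma lookup_filter:
  "lk (\<Sum>t\<in>{t \<in> ks f. R t}. Poly_Mapping.single t (lk f t)) t = (if R t then lk f t else 0)"
  by (auto simp: lookup_sum lookup_single when_def in_keys_iff)

lemma lookup_gpart: "lk (gpart w k e f) t = (if wt w k t = e then lk f t else 0)"
  unfolding gpart_def by (rule lookup_filter)

lemma gpart_add: "gpart w k e (f + g) = gpart w k e f + gpart w k e g"
  by (rule poly_mapping_eqI) (simp add: lookup_gpart lookup_add)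

lemma gpart_0 [simp]: "gpart w k e 0 = 0" by (rule poly_mapping_eqI) (simp add: lookup_gpart)

lemma gpart_sum: "gpart w k e (sum f S) = (\<Sum>i\<in>S. gpart w k e (f i))"
  by (induct S rule: infinite_finite_induct) (simp_all add: gpart_add)

definition homog :: "(nat \<Rightarrow> nat) \<Rightarrow> nat \<Rightarrow> nat \<Rightarrow> 'a::comm_ring_1 mpol \<Rightarrow> bool" where
  "homog w k e f \<longleftrightarrow> (\<forall>t\<in>ks f. wt w k t = e)"

lemma homog_gpart: "homog w k e (gpart w k e f)"
  by (auto simp: homog_def in_keys_iff lookup_gpart split: if_splits)

lemma gpart_homog: "homog w k a f \<Longrightarrow> gpart w k e f = (if a = e then f else 0)"
  by (rule poly_mapping_eqI) (auto simp: lookup_gpart homog_def in_keys_iff)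

lemma homog_mult: "homog w k a f \<Longrightarrow> homog w k b g \<Longrightarrow> homog w k (a + b) (f * g)"
  using keys_mult[of f g] by (force simp: homog_def wt_add)

lemma sum_gpart: "f = (\<Sum>e\<in>wt w k ` ks f. gpart w k e f)"
  by (rule poly_mapping_eqI) (auto simp: lookup_sum lookup_gpart in_keys_iff)

lemma mpol_over_keys_subset:
  assumes "f \<in> mpol_over C l" "\<And>t. t \<in> ks g \<Longrightarrow> t \<in> ks f \<and> lk g t = lk f t" shows "g \<in> mpol_over C l"
  using assms by (auto simp: mpol_over_def)

lemma gpart_mpol_over: "f \<in> mpol_over C l \<Longrightarrow> gpart w k e f \<in> mpol_over C l"
  by (erule mpol_over_keys_subset) (auto simp: in_keys_iff lookup_gpart split: if_splits)

definition homog_ideal :: "(nat \<Rightarrow> nat) \<Rightarrow> nat \<Rightarrow> 'a::comm_ring_1 mpol set \<Rightarrow> bool" where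
  "homog_ideal w k J \<longleftrightarrow> (\<forall>f\<in>J. \<forall>e. gpart w k e f \<in> J)"

text \<open>In a combination of homogeneous generators, taking the part of weight \<open>e\<close> amounts to taking the suitable homogeneous
  part of every coefficient.\<close>

lemma homog_ideal_span_in:
  assumes C: "subring_set C" and H: "H \<subseteq> mpol_over C l" "\<And>h. h \<in> H \<Longrightarrow> \<exists>e. homog w k e h"
  shows "homog_ideal w k (span_in (mpol_over C l) H)"
  unfolding homog_ideal_def
proof (intro ballI allI)
  let ?B = "mpol_over C l"
  have B: "subring_set ?B" by (rule subring_mpol_over[OF C])
  have T: "ideal_in ?B (span_in ?B H)" by (rule span_in_ideal_in[OF B H(1)])
  fix f e assume "f \<in> span_in ?B H"
  then obtain F c where F: "finite F" "F \<subseteq> H" "\<forall>h\<in>F. c h \<in> ?B" "f = (\<Sum>h\<in>F. c h * h)"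
    unfolding span_in_def by blast
  have "gpart w k e (c h * h) \<in> span_in ?B H" if h: "h \<in> F" for h
  proof -
    obtain a where a: "homog w k a h" using H(2) F(2) h by blast
    have "c h * h = (\<Sum>i\<in>wt w k ` ks (c h). gpart w k i (c h) * h)"
      using sum_gpart[of "c h" w k] by (metis sum_distrib_right)
    then have "gpart w k e (c h * h) = (\<Sum>i\<in>wt w k ` ks (c h). gpart w k e (gpart w k i (c h) * h))"
      by (simp add: gpart_sum)
    also have "\<dots> \<in> span_in ?B H"
    proof (rule ideal_in_sum[OF T])
      fix i
      have "gpart w k i (c h) * h \<in> span_in ?B H"
        using ideal_inD(4)[OF T, of h "gpart w k i (c h)"] span_in_superset[OF B, of H] gpart_mpol_over F h by blast
      then show "gpart w k e (gpart w k i (c h) * h) \<in> span_in ?B H"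
        using gpart_homog[OF homog_mult[OF homog_gpart a, of i "c h"], of e] ideal_inD(2)[OF T] by simp
    qed
    finally show ?thesis .
  qed
  then show "gpart w k e f \<in> span_in ?B H" unfolding F(4) gpart_sum by (rule ideal_in_sum[OF T])
qed

lemma wt_eq_0_iff: "(\<And>j. j < k \<Longrightarrow> 0 < w j) \<Longrightarrow> ks t \<subseteq> {..<k} \<Longrightarrow> wt w k t = 0 \<longleftrightarrow> t = 0"
proof
  assume w: "\<And>j. j < k \<Longrightarrow> 0 < w j" and t: "ks t \<subseteq> {..<k}" and "wt w k t = 0"
  then have "\<forall>j\<in>{..<k}. w j = 0 \<or> lk t j = 0" by (simp add: wt_def)
  then have "\<forall>j<k. w j = 0 \<or> lk t j = 0" by auto
  then have "lk t j = 0" for j using t w[of j] by (cases "j < k") (auto simp: in_keys_iff subset_iff)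
  then show "t = 0" by (intro poly_mapping_eqI) simp
qed simp

text \<open>Weights are positive, so only constant monomials have weight \<open>0\<close>.\<close>

lemma gpart_0_const:
  assumes "\<And>j. j < k \<Longrightarrow> 0 < w j" "f \<in> mpol_over C k"
  shows "gpart w k 0 f = const (lk f 0)"
proof (rule poly_mapping_eqI)
  fix t show "lk (gpart w k 0 f) t = lk (const (lk f 0)) t"
  proof (cases "t \<in> ks f")
    case True
    then have "ks t \<subseteq> {..<k}" using assms(2) by (auto simp: mpol_over_def)
    then show ?thesis using wt_eq_0_iff[of k w t] assms(1) by (auto simp: lookup_gpart lookup_const)
  qed (auto simp: lookup_gpart lookup_const in_keys_iff)
qed

abbreviation "xdeg \<equiv> wt (\<lambda>_. 1)"

text \<open>The part in \<open>\<langle>x\<rangle>\<^sup>2\<close>: all terms whose monomial in the \<open>x\<^sub>j\<close> has standard degree at least two.\<close>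

definition order2_part :: "nat \<Rightarrow> 'a::comm_ring_1 mpol \<Rightarrow> 'a mpol" where
  "order2_part k f = (\<Sum>t\<in>{t \<in> ks f. 2 \<le> xdeg k t}. Poly_Mapping.single t (lk f t))"

lemma lookup_order2_part: "lk (order2_part k f) t = (if 2 \<le> xdeg k t then lk f t else 0)"
  unfolding order2_part_def by (rule lookup_filter)

lemma xdeg_le_1:
  assumes "ks t \<subseteq> {..<k}" "xdeg k t = 1" shows "\<exists>j<k. t = Poly_Mapping.single j 1"
proof -
  have "t \<noteq> 0" using assms by auto
  then obtain j where j: "lk t j \<noteq> 0" by (metis lookup_zero poly_mapping_eqI)
  then have jk: "j < k" using assms(1) by (auto simp: in_keys_iff subset_iff)
  define u where "u = t - Poly_Mapping.single j 1"
  have t: "t = u + Poly_Mapping.single j 1"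
    using j by (intro poly_mapping_eqI) (auto simp: u_def lookup_add lookup_minus lookup_single when_def)
  then have "xdeg k u = 0" using assms(2) jk by (simp add: wt_add wt_single)
  moreover have "ks u \<subseteq> {..<k}" using assms(1) unfolding t keys_plus_nat by auto
  ultimately have "u = 0" using wt_eq_0_iff[of k "\<lambda>_. 1" u] by simp
  then show ?thesis using t jk by auto
qed

lemma single_1_eq_iff: "Poly_Mapping.single i (1::nat) = Poly_Mapping.single j 1 \<longleftrightarrow> i = j"
  by (metis lookup_single_eq lookup_single_not_eq one_neq_zero)

lemma const_indet: "const c * indet j = Poly_Mapping.single (Poly_Mapping.single j 1) c"
  by (simp add: indet_def const_def mult_single)

text \<open>The decomposition \<open>f = f\<^sub>0 + f\<^sub>1 x\<^sub>1 + \<dots> + f\<^sub>k x\<^sub>k + g\<close> with \<open>g \<in> \<langle>x\<rangle>\<^sup>2\<close>.\<close>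

lemma linear_decomposition:
  assumes f: "f \<in> mpol_over C k"
  shows "f = const (lk f 0) + (\<Sum>j<k. const (lk f (Poly_Mapping.single j 1)) * indet j) + order2_part k f"
proof (rule poly_mapping_eqI)
  fix t
  let ?s = "\<lambda>j::nat. Poly_Mapping.single j (1::nat)"
  have L: "lk (\<Sum>j<k. const (lk f (?s j)) * indet j) t = (\<Sum>j<k. if ?s j = t then lk f t else 0)"
    unfolding const_indet lookup_sum by (rule sum.cong) (auto simp: lookup_single when_def)
  show "lk f t = lk (const (lk f 0) + (\<Sum>j<k. const (lk f (?s j)) * indet j) + order2_part k f) t"
  proof (cases "t \<in> ks f")
    case False
    then show ?thesis unfolding lookup_add L by (auto simp: lookup_const lookup_order2_part in_keys_iff)
  next
    case True
    then have t: "ks t \<subseteq> {..<k}" using f by (auto simp: mpol_over_def)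
    consider "t = 0" | j where "j < k" "t = ?s j" | "2 \<le> xdeg k t"
      using wt_eq_0_iff[of k "\<lambda>_. 1" t] xdeg_le_1[of t k] t by fastforce
    then show ?thesis
    proof cases
      case 1
      have "?s j \<noteq> 0" for j by (metis lookup_single_eq lookup_zero one_neq_zero)
      then have "(\<Sum>j<k. if ?s j = t then lk f t else 0) = 0" using 1 by simp
      then show ?thesis unfolding lookup_add L using 1 by (simp add: lookup_const lookup_order2_part)
    next
      case 2
      have "t \<noteq> 0" using 2 by (metis lookup_single_eq lookup_zero one_neq_zero)
      moreover have "xdeg k t = 1" using 2 by (simp add: wt_single)
      moreover have "(\<Sum>j<k. if ?s j = t then lk f t else 0) = lk f t"
        using 2 by (simp add: single_1_eq_iff sum.delta' del: One_nat_def)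
      ultimately show ?thesis unfolding lookup_add L by (simp add: lookup_const lookup_order2_part)
    next
      case 3
      then have "t \<noteq> 0" "\<And>j. j < k \<Longrightarrow> ?s j \<noteq> t" by (auto simp: wt_single)
      then show ?thesis unfolding lookup_add L using 3 by (simp add: lookup_const lookup_order2_part)
    qed
  qed
qed

section \<open>Eliminating variables by linear relations\<close>

lemma PC_alg_gen:
  assumes "(\<lambda>i. const (indet i)) ` {..<m} \<union> indet ` {..<k} \<subseteq> (Z :: 'k::comm_ring_1 mpol mpol set)"
  shows "alg_gen (PC m k) UNIV (\<lambda>c. const (const (c::'k::comm_ring_1))) Z"
  unfolding alg_gen_def
proof (intro allI impI subsetI)
  fix S :: "'k mpol mpol set" and f :: "'k mpol mpol"
  assume S: "(\<lambda>c. const (const c)) ` UNIV \<subseteq> S" "Z \<subseteq> S"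
    "\<forall>f\<in>PC m k \<inter> S. \<forall>g\<in>PC m k \<inter> S. f + g \<in> S \<and> f * g \<in> S" and f: "f \<in> PC m k"
  show "f \<in> S" using f
    by (induct rule: PC_induct) (use S assms in auto)
qed

lemma ring_map_cc: "ring_map (\<lambda>c. const (const c))"
  by (rule ring_map_comp[OF ring_map_const ring_map_const])

lemma cc_PC: "const (const c) \<in> PC m k"
  by (intro const_mpol_over subring_AC subring_UNIV UNIV_I)

lemma ca_PC: "i < m \<Longrightarrow> const (indet i) \<in> PC m k"
  by (intro const_mpol_over[OF subring_AC] indet_mpol_over[OF subring_UNIV])

lemma x_PC: "j < k \<Longrightarrow> indet j \<in> PC m k"
  by (rule indet_mpol_over[OF subring_AC])

text \<open>The counting argument for \<open>P\<close> over the field of constants. All coordinates \<open>a\<^sub>i\<close> of \<open>A\<close> occur in \<open>ts\<close>, so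
  \<open>A \<subseteq> Pol\<close> and only the \<open>x\<^sub>j\<close> have to be shown algebraic.\<close>

locale poly_mod = alg_mod_tuple "PC m k" UNIV "\<lambda>c. const (const c)" q ts
  for m k :: nat and q :: "'k::field mpol mpol set" and ts +
  assumes a_ts: "\<And>i. i < m \<Longrightarrow> const (indet i) \<in> set ts"
begin

lemma constA_Pol: assumes "c \<in> AC m" shows "const c \<in> Pol"
  using subring_UNIV assms
proof (induct rule: mpol_over_induct)
  case (const c) show ?case by (rule Pol_\<kappa>) simp
next
  case (indet i) then show ?case by (intro Pol_ts a_ts)
next
  case (add f g) then show ?case by (simp add: const_simps Pol_add)
next
  case (mult f g) then show ?case by (simp add: const_simps Pol_mult)
qed

lemma chain_bound:
  assumes q: "prime_in (PC m k) q" and fin: "finite_over (indet ` {..<k} \<union> set ts)"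
    and p: "p 0 = q" "\<And>i. i \<le> r \<Longrightarrow> prime_in (PC m k) (p i)" "\<And>i. i < r \<Longrightarrow> p i \<subset> p (Suc i)"
  shows "r \<le> length ts"
proof (rule finite_over_chain_bound[OF _ q fin _ _ p])
  show "\<exists>c'\<in>UNIV. c' * c = 1" if "c \<noteq> 0" for c :: 'k
    using that by (intro bexI[of _ "inverse c"]) auto
  show "indet ` {..<k} \<union> set ts \<subseteq> PC m k" using ts x_PC by auto
  show "alg_gen (PC m k) UNIV (\<lambda>c. const (const c)) (indet ` {..<k} \<union> set ts)"
    by (rule PC_alg_gen) (use a_ts in auto)
qed

end

text \<open>A weighted form of Nakayama's lemma. The elements \<open>f\<close> for which some \<open>\<delta>\<^sup>N f\<close> is modulo \<open>q\<close> a polynomial in the \<open>a\<^sub>i\<close> and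
  the \<open>x\<^sub>l\<close> with \<open>l \<notin> T\<close> form a ring. It contains \<open>x\<^sub>j\<close> for \<open>j \<in> T\<close> by induction on \<open>w\<^sub>j\<close>: the part of weight \<open>w\<^sub>j\<close> of \<open>g\<^sub>j\<close> is
  \<open>\<delta> x\<^sub>j\<close> plus linear terms outside \<open>T\<close> plus products of at least two variables, each of smaller weight.\<close>

lemma elimination_chain_bound:
  fixes J :: "'k::field mpol mpol set"
  assumes pq: "prime_in (PC m k) q" and J: "J \<subseteq> q" "homog_ideal w k J" "\<And>f. f \<in> J \<Longrightarrow> lk f 0 = 0"
    and w: "\<And>j. j < k \<Longrightarrow> 0 < w j" and T: "T \<subseteq> {..<k}"
    and \<delta>: "\<delta> \<in> AC m" "const \<delta> \<notin> q"
    and g: "\<And>t. t \<in> T \<Longrightarrow> g t \<in> J"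
      "\<And>t t'. t \<in> T \<Longrightarrow> t' \<in> T \<Longrightarrow> lin_coeff (g t) t' = (if t = t' then \<delta> else 0)"
    and p: "p 0 = q" "\<And>i. i \<le> r \<Longrightarrow> prime_in (PC m k) (p i)" "\<And>i. i < r \<Longrightarrow> p i \<subset> p (Suc i)"
  shows "r \<le> m + k - card T"
proof -
  define L where "L = sorted_list_of_set ({..<k} - T)"
  define ts :: "'k mpol mpol list" where "ts = map (\<lambda>i. const (indet i)) [0..<m] @ map indet L"
  have setL: "set L = {..<k} - T" by (simp add: L_def)
  have lenL: "length L = k - card T"
    using T by (simp add: L_def card_Diff_subset finite_subset[OF T])
  have Tk: "card T \<le> k" using card_mono[OF _ T] by simp
  have tsB: "set ts \<subseteq> PC m k"
    using ca_PC x_PC setL by (auto simp: ts_def)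
  interpret poly_mod m k q ts
  proof unfold_locales
    show "subring_set (PC m k)" by (rule subring_PC)
    show "subring_set UNIV" by (rule subring_UNIV)
    show "ring_map (\<lambda>c. const (const c))" by (rule ring_map_cc)
    show "ideal_in (PC m k) q" using prime_inD(1)[OF pq] .
  qed (use tsB cc_PC in \<open>auto simp: ts_def\<close>)
  let ?d = "const \<delta> :: 'k mpol mpol"
  have dP: "?d \<in> Pol" by (rule constA_Pol[OF \<delta>(1)])
  have dnP: "?d ^ n \<in> Pol" for n by (rule subring_power[OF Pol_subring dP])
  \<comment> \<open>The ring of all \<open>f\<close> that become polynomials in \<open>ts\<close> after multiplication by a power of \<open>\<delta>\<close>.\<close>
  define S where "S = {f. \<exists>n. ?d ^ n * f \<in> Pol}"
  have PS: "f \<in> S" if "f \<in> Pol" for f unfolding S_def using that by (intro CollectI exI[of _ 0]) simp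
  have S_up: "?d ^ n' * f \<in> Pol" if "?d ^ n * f \<in> Pol" "n \<le> n'" for f n n'
  proof -
    have "?d ^ n' = ?d ^ (n' - n) * ?d ^ n" using that(2) by (simp add: power_add[symmetric])
    then have "?d ^ n' * f = ?d ^ (n' - n) * (?d ^ n * f)" by (simp only: mult.assoc)
    then show ?thesis using Pol_mult[OF dnP that(1)] by (simp only:)
  qed
  have S: "subring_set S" unfolding subring_set_def
  proof (intro conjI ballI)
    show "1 \<in> S" by (rule PS[OF subring_setD(1)[OF Pol_subring]])
    fix f g assume "f \<in> S" "g \<in> S"
    then obtain a b where ab: "?d ^ a * f \<in> Pol" "?d ^ b * g \<in> Pol" by (auto simp: S_def)
    have "?d ^ max a b * f \<in> Pol" "?d ^ max a b * g \<in> Pol" using S_up ab by auto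
    then have "?d ^ max a b * (f - g) \<in> Pol"
      using subring_setD(3)[OF Pol_subring] by (simp add: right_diff_distrib)
    then show "f - g \<in> S" by (auto simp: S_def)
    have "?d ^ (a + b) * (f * g) = (?d ^ a * f) * (?d ^ b * g)" by (simp only: power_add mult_ac)
    then have "?d ^ (a + b) * (f * g) \<in> Pol" using Pol_mult[OF ab] by (simp only:)
    then show "f * g \<in> S" by (auto simp: S_def)
  qed
  have S_div: "f \<in> S" if "?d * f \<in> S" for f
  proof -
    from that obtain n where "?d ^ n * (?d * f) \<in> Pol" unfolding S_def by blast
    then have "?d ^ Suc n * f \<in> Pol" by (simp only: power_Suc mult_ac)
    then show ?thesis unfolding S_def by blast
  qed
  have xS: "indet j \<in> S" if "j < k" for j
    using that
  proof (induct "w j" arbitrary: j rule: less_induct)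
    case less
    show ?case
    proof (cases "j \<in> T")
      case False
      then show ?thesis using less(2) setL by (intro PS Pol_ts) (auto simp: ts_def)
    next
      case True
      define h where "h = gpart w k (w j) (g j)"
      have hJ: "h \<in> J" using J(2) g(1)[OF True] by (auto simp: h_def homog_ideal_def)
      have hB: "h \<in> PC m k" using J(1) hJ ideal_inD(1)[OF prime_inD(1)[OF pq]] by auto
      have h0: "lk h 0 = 0" by (rule J(3)[OF hJ])
      have hl: "lk h (Poly_Mapping.single l 1) = (if w l = w j then lin_coeff (g j) l else 0)" if "l < k" for l
        using that by (simp add: h_def lookup_gpart wt_single lin_coeff_def)
      have A: "lk h t \<in> AC m" for t
        using hB subring_setD(2)[OF subring_AC] by (cases "t \<in> ks h") (auto simp: mpol_over_def in_keys_iff)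
      define c where "c = (\<lambda>l. const (lk h (Poly_Mapping.single l 1)) :: 'k mpol mpol)"
      have dec: "h = (\<Sum>l<k. c l * indet l) + order2_part k h"
        using linear_decomposition[OF hB] h0 by (simp add: c_def const_simps)
      have cj: "c j = ?d" using hl[OF less(2)] g(2)[OF True True] by (simp add: c_def)
      have rest: "c l * indet l \<in> S" if "l < k" "l \<noteq> j" for l
      proof (cases "l \<in> T")
        case lT: True
        then have "c l = 0" using hl[OF that(1)] g(2)[OF True lT] that(2) by (simp add: c_def const_simps)
        then show ?thesis using subring_setD(2)[OF S] by simp
      next
        case False
        have "c l \<in> S" unfolding c_def by (intro PS constA_Pol A)
        moreover have "indet l \<in> S" using False that(1) setL by (intro PS Pol_ts) (auto simp: ts_def)
        ultimately show ?thesis by (rule subring_setD(4)[OF S])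
      qed
      have rS: "order2_part k h \<in> S" unfolding order2_part_def
      proof (rule subring_sum[OF S])
        fix t assume "t \<in> {t \<in> ks h. 2 \<le> xdeg k t}"
        then have t: "t \<in> ks h" "2 \<le> xdeg k t" "ks t \<subseteq> {..<k}" using hB by (auto simp: mpol_over_def)
        have wtt: "wt w k t = w j"
          using t(1) homog_gpart[of w k "w j" "g j"] by (auto simp: h_def homog_def)
        \<comment> \<open>The cofactor of \<open>x\<^sub>i\<close> in a monomial of degree at least two has positive weight.\<close>
        have small: "i < k \<and> w i < w j" if i: "i \<in> ks t" for i
        proof -
          have ik: "i < k" using t(3) i by auto
          define u where "u = t - Poly_Mapping.single i 1"
          have tu: "t = u + Poly_Mapping.single i 1"
            using i by (intro poly_mapping_eqI) (auto simp: u_def lookup_add lookup_minus lookup_single when_def in_keys_iff)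
          have "u \<noteq> 0" using t(2) ik unfolding tu by (auto simp: wt_single)
          moreover have "ks u \<subseteq> {..<k}" using t(3) unfolding tu keys_plus_nat by auto
          ultimately have "wt w k u \<noteq> 0" using wt_eq_0_iff[of k w u] w by auto
          then show ?thesis using wtt ik unfolding tu by (simp add: wt_add wt_single)
        qed
        have "(\<Prod>i\<in>ks t. indet i ^ lk t i) \<in> S"
          by (intro subring_prod[OF S] subring_power[OF S]) (use small less(1) in auto)
        moreover have "const (lk h t) \<in> S" by (intro PS constA_Pol A)
        ultimately show "Poly_Mapping.single t (lk h t) \<in> S"
          unfolding single_const_monom[of t "lk h t"] single_monom[of t] by (intro subring_setD(4)[OF S])
      qed
      have "h \<in> S" using hJ J(1) by (intro PS Pol_q) auto
      moreover have "(\<Sum>l\<in>{..<k} - {j}. c l * indet l) \<in> S" by (rule subring_sum[OF S]) (use rest in auto)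
      ultimately have "h - (\<Sum>l\<in>{..<k} - {j}. c l * indet l) - order2_part k h \<in> S"
        using rS by (intro subring_setD(3)[OF S])
      moreover have "(\<Sum>l<k. c l * indet l) = c j * indet j + (\<Sum>l\<in>{..<k} - {j}. c l * indet l)"
        by (rule sum.remove) (use less(2) in auto)
      then have "h - (\<Sum>l\<in>{..<k} - {j}. c l * indet l) - order2_part k h = ?d * indet j"
        using arg_cong[OF dec, of "\<lambda>x. x - (\<Sum>l\<in>{..<k} - {j}. c l * indet l) - order2_part k h"] cj by simp
      ultimately show ?thesis using S_div by simp
    qed
  qed
  have "finite_over (indet ` U \<union> set ts)" if "U \<subseteq> {..<k}" "finite U" for U
    using that(2,1)
  proof (induct U rule: finite_induct)
    case empty
    then show ?case using finite_over_ts[OF prime_inD(2)[OF pq]] by simp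
  next
    case (insert j U)
    then obtain n where n: "?d ^ n * indet j \<in> Pol" using xS[of j] by (auto simp: S_def)
    have dB: "?d \<in> PC m k" by (rule const_mpol_over[OF subring_AC \<delta>(1)])
    have "finite_over (insert (indet j) (indet ` U \<union> set ts))"
    \<comment> \<open>The equation is linear in \<open>x\<^sub>j\<close> because \<open>\<delta>\<^sup>n x\<^sub>j\<close> itself is a polynomial in \<open>ts\<close>.\<close>
    proof (rule finite_over_insert[OF pq, where N = 1 and dz = "?d ^ n" and di = "\<lambda>_. - (?d ^ n * indet j)"])
      show "finite_over (indet ` U \<union> set ts)" using insert by simp
      show "?d ^ n \<notin> q" using prime_in_power[OF pq subring_PC dB] \<delta>(2) by blast
      show "- (?d ^ n * indet j) \<in> Pol" by (rule subring_setD(6)[OF Pol_subring n])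
      show "?d ^ n * indet j ^ 1 + (\<Sum>i<1. - (?d ^ n * indet j) * indet j ^ i) \<in> q"
        using ideal_inD(2)[OF prime_inD(1)[OF pq]] by simp
    qed (use insert dnP x_PC in auto)
    then show ?case by simp
  qed
  from this[of "{..<k}"] have "r \<le> length ts" by (intro chain_bound[OF pq _ p]) simp
  then show ?thesis using lenL Tk by (simp add: ts_def)
qed

section \<open>Boundary ideals\<close>

text \<open>An ideal maximal among those that contain \<open>J\<close> and avoid the multiplicative set \<open>S\<close> is prime.\<close>

lemma prime_avoiding:
  assumes B: "subring_set B" and J: "ideal_in B J" and S: "1 \<in> S" "S \<subseteq> B" "\<And>x y. x \<in> S \<Longrightarrow> y \<in> S \<Longrightarrow> x * y \<in> S"
    and JS: "J \<inter> S = {}"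
  shows "\<exists>p. prime_in B p \<and> J \<subseteq> p \<and> p \<inter> S = {}"
proof -
  define \<A> where "\<A> = {p. ideal_in B p \<and> J \<subseteq> p \<and> p \<inter> S = {}}"
  have "\<exists>M\<in>\<A>. \<forall>X\<in>\<A>. M \<subseteq> X \<longrightarrow> X = M"
  proof (rule subset_Zorn_nonempty)
    show "\<A> \<noteq> {}" using J JS by (auto simp: \<A>_def)
    fix \<C> assume C: "\<C> \<noteq> {}" "subset.chain \<A> \<C>"
    then have CA: "\<C> \<subseteq> \<A>" and ch: "\<And>X Y. X \<in> \<C> \<Longrightarrow> Y \<in> \<C> \<Longrightarrow> X \<subseteq> Y \<or> Y \<subseteq> X"
      by (auto simp: subset_chain_def)
    have t: "ideal_in B X" if "X \<in> \<C>" for X using that CA by (auto simp: \<A>_def)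
    obtain X0 where X0: "X0 \<in> \<C>" using C by blast
    have "ideal_in B (\<Union>\<C>)" unfolding ideal_in_def
    proof (intro conjI ballI)
      show "\<Union>\<C> \<subseteq> B" using t ideal_inD(1) by blast
      show "0 \<in> \<Union>\<C>" using X0 ideal_inD(2)[OF t[OF X0]] by blast
      fix x y assume "x \<in> \<Union>\<C>" "y \<in> \<Union>\<C>"
      then obtain X Y where XY: "X \<in> \<C>" "Y \<in> \<C>" "x \<in> X" "y \<in> Y" by blast
      show "x + y \<in> \<Union>\<C>"
      proof (cases "X \<subseteq> Y")
        case True
        then have "x + y \<in> Y" using ideal_inD(3)[OF t[OF XY(2)], of x y] XY by blast
        then show ?thesis using XY by blast
      next
        case False
        then have "Y \<subseteq> X" using ch XY by blast
        then have "x + y \<in> X" using ideal_inD(3)[OF t[OF XY(1)], of x y] XY by blast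
        then show ?thesis using XY by blast
      qed
    next
      fix x b assume "x \<in> \<Union>\<C>" "b \<in> B"
      then obtain X where X: "X \<in> \<C>" "x \<in> X" by blast
      then have "b * x \<in> X" using ideal_inD(4)[OF t[OF X(1)]] \<open>b \<in> B\<close> by blast
      then show "b * x \<in> \<Union>\<C>" using X by blast
    qed
    then show "\<Union>\<C> \<in> \<A>" using CA X0 by (auto simp: \<A>_def)
  qed
  then obtain M where M: "ideal_in B M" "J \<subseteq> M" "M \<inter> S = {}"
    and max: "\<And>X. ideal_in B X \<Longrightarrow> J \<subseteq> X \<Longrightarrow> X \<inter> S = {} \<Longrightarrow> M \<subseteq> X \<Longrightarrow> X = M"
    by (auto simp: \<A>_def)
  have ext: "\<exists>a\<in>M. \<exists>b\<in>B. a + b * x \<in> S" if x: "x \<in> B" "x \<notin> M" for x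
  proof (rule ccontr)
    assume n: "\<not> ?thesis"
    define X where "X = {a + b * x | a b. a \<in> M \<and> b \<in> B}"
    have MX: "M \<subseteq> X"
    proof
      fix a assume "a \<in> M"
      moreover have "a = a + 0 * x" by simp
      ultimately show "a \<in> X" unfolding X_def using subring_setD(2)[OF B] by blast
    qed
    have "ideal_in B X" unfolding ideal_in_def
    proof (intro conjI ballI)
      show "X \<subseteq> B" using ideal_inD(1)[OF M(1)] x(1) by (auto simp: X_def intro!: subring_setD[OF B])
      show "0 \<in> X" using MX ideal_inD(2)[OF M(1)] by blast
      fix u v assume "u \<in> X" "v \<in> X"
      then obtain a b a' b' where "u = a + b * x" "v = a' + b' * x" "a \<in> M" "a' \<in> M" "b \<in> B" "b' \<in> B"
        unfolding X_def by blast
      moreover from this have "u + v = (a + a') + (b + b') * x" by (simp add: algebra_simps)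
      ultimately show "u + v \<in> X" unfolding X_def using ideal_inD(3)[OF M(1)] subring_setD(5)[OF B] by blast
    next
      fix u c assume "u \<in> X" "c \<in> B"
      then obtain a b where "u = a + b * x" "a \<in> M" "b \<in> B" unfolding X_def by blast
      moreover from this have "c * u = c * a + (c * b) * x" by (simp add: algebra_simps)
      ultimately show "c * u \<in> X" unfolding X_def
        using ideal_inD(4)[OF M(1)] subring_setD(4)[OF B] \<open>c \<in> B\<close> by blast
    qed
    moreover have "X \<inter> S = {}" using n by (auto simp: X_def)
    ultimately have "X = M" using max[of X] MX M(2) by blast
    moreover have "x \<in> X"
    proof -
      have "x = 0 + 1 * x" by simp
      then show ?thesis unfolding X_def using ideal_inD(2)[OF M(1)] subring_setD(1)[OF B] by blast
    qed
    ultimately show False using x by simp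
  qed
  have "prime_in B M" unfolding prime_in_def
  proof (intro conjI ballI impI)
    show "1 \<notin> M" using M(3) S(1) by blast
    fix x y assume xy: "x \<in> B" "y \<in> B" "x * y \<in> M"
    show "x \<in> M \<or> y \<in> M"
    proof (rule ccontr)
      assume "\<not> (x \<in> M \<or> y \<in> M)"
      then obtain a b a' b' where *: "a \<in> M" "b \<in> B" "a + b * x \<in> S" "a' \<in> M" "b' \<in> B" "a' + b' * y \<in> S"
        using ext xy by blast
      have "(a + b * x) * (a' + b' * y) = a * (a' + b' * y) + (b * x) * a' + (b * b') * (x * y)"
        by (simp add: algebra_simps)
      also have "\<dots> \<in> M"
      proof -
        have "a' + b' * y \<in> B" "b * x \<in> B" "b * b' \<in> B" using * S(2) xy subring_setD(4)[OF B] by auto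
        then show ?thesis using ideal_inD(5)[OF M(1) *(1)] ideal_inD(4)[OF M(1) *(4)] ideal_inD(4)[OF M(1) xy(3)]
          by (intro ideal_inD(3)[OF M(1)])
      qed
      finally show False using S(3)[OF *(3,6)] M(3) by blast
    qed
  qed (rule M(1))
  then show ?thesis using M by blast
qed

text \<open>The ideal \<open>(J : z\<^sup>c) + (z)\<close>. For large \<open>c\<close> it is the Krull boundary ideal \<open>(J : z\<^sup>\<infinity>) + (z)\<close>, which
  describes the boundary of \<open>{z = 0}\<close> inside the zero set of \<open>J\<close>: each boundary lowers the dimension. The exponent is kept
  explicit since the growth estimate needs one that works for all lists of variables.\<close>

definition boundary :: "'a::comm_ring_1 set \<Rightarrow> nat \<Rightarrow> 'a set \<Rightarrow> 'a \<Rightarrow> 'a set" where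
  "boundary B c J z = {f \<in> B. \<exists>a\<in>B. z ^ c * (f - a * z) \<in> J}"

primrec boundaries :: "'a::comm_ring_1 set \<Rightarrow> nat \<Rightarrow> 'a list \<Rightarrow> 'a set \<Rightarrow> 'a set" where
  "boundaries B c [] J = J"
| "boundaries B c (z # zs) J = boundaries B c zs (boundary B c J z)"

lemma boundary_ideal_in:
  assumes B: "subring_set B" and J: "ideal_in B J" and z: "z \<in> B"
  shows "ideal_in B (boundary B c J z)"
  unfolding ideal_in_def
proof (intro conjI ballI)
  show "boundary B c J z \<subseteq> B" by (auto simp: boundary_def)
  show "0 \<in> boundary B c J z" using subring_setD(2)[OF B] ideal_inD(2)[OF J] by (auto simp: boundary_def intro!: bexI[of _ 0])
next
  fix f g assume "f \<in> boundary B c J z" "g \<in> boundary B c J z"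
  then obtain a b where ab: "f \<in> B" "g \<in> B" "a \<in> B" "b \<in> B" "z ^ c * (f - a * z) \<in> J" "z ^ c * (g - b * z) \<in> J"
    by (auto simp: boundary_def)
  have "z ^ c * (f + g - (a + b) * z) = z ^ c * (f - a * z) + z ^ c * (g - b * z)" by (simp add: algebra_simps)
  then have "z ^ c * (f + g - (a + b) * z) \<in> J" using ideal_inD(3)[OF J ab(5,6)] by (simp only:)
  then show "f + g \<in> boundary B c J z"
    unfolding boundary_def using ab subring_setD(5)[OF B ab(3,4)] subring_setD(5)[OF B ab(1,2)] by blast
next
  fix f b assume "f \<in> boundary B c J z" "b \<in> B"
  then obtain a where a: "f \<in> B" "a \<in> B" "z ^ c * (f - a * z) \<in> J" by (auto simp: boundary_def)
  have "z ^ c * (b * f - (b * a) * z) = b * (z ^ c * (f - a * z))" by (simp add: algebra_simps)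
  then have "z ^ c * (b * f - (b * a) * z) \<in> J" using ideal_inD(4)[OF J a(3) \<open>b \<in> B\<close>] by (simp only:)
  then show "b * f \<in> boundary B c J z"
    unfolding boundary_def using subring_setD(4)[OF B \<open>b \<in> B\<close> a(1)] subring_setD(4)[OF B \<open>b \<in> B\<close> a(2)] by blast
qed

lemma boundary_mono:
  assumes B: "subring_set B" and J': "ideal_in B J'" and z: "z \<in> B" and "J \<subseteq> J'" "c \<le> c'"
  shows "boundary B c J z \<subseteq> boundary B c' J' z"
proof
  fix f assume "f \<in> boundary B c J z"
  then obtain a where a: "f \<in> B" "a \<in> B" "z ^ c * (f - a * z) \<in> J'" using assms by (auto simp: boundary_def)
  have "z ^ c' = z ^ (c' - c) * z ^ c" using assms(5) by (simp add: power_add[symmetric])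
  then have "z ^ c' * (f - a * z) = z ^ (c' - c) * (z ^ c * (f - a * z))" by (simp only: mult.assoc)
  then have "z ^ c' * (f - a * z) \<in> J'" using ideal_inD(4)[OF J' a(3) subring_power[OF B z]] by (simp only:)
  then show "f \<in> boundary B c' J' z" using a by (auto simp: boundary_def)
qed

lemma boundaries_mono:
  assumes B: "subring_set B" and "ideal_in B J'" "set zs \<subseteq> B" "J \<subseteq> J'" "c \<le> c'"
  shows "boundaries B c zs J \<subseteq> boundaries B c' zs J'"
  using assms(2-4)
proof (induct zs arbitrary: J J')
  case (Cons z zs)
  then show ?case using boundary_mono[OF B Cons(2) _ Cons(4) assms(5), of z] boundary_ideal_in[OF B Cons(2), of z] by simp
qed simp

lemma boundaries_Union: "boundaries B c zs (\<Union>i::nat. J i) = (\<Union>i. boundaries B c zs (J i))"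
proof (induct zs arbitrary: J)
  case (Cons z zs)
  have "boundary B c (\<Union>i. J i) z = (\<Union>i. boundary B c (J i) z)" by (auto simp: boundary_def)
  then show ?case using Cons by simp
qed simp

text \<open>If a chain has been found above the boundary ideal of \<open>z\<close>, with first member \<open>p\<^sub>0\<close>, then \<open>J\<close> avoids all \<open>z\<^sup>i u\<close> with
  \<open>u \<notin> p\<^sub>0\<close>: otherwise \<open>u \<in> (J : z\<^sup>i) \<subseteq> p\<^sub>0\<close>. A prime over \<open>J\<close> that avoids these products is contained in \<open>p\<^sub>0\<close> and does
  not contain \<open>z \<in> p\<^sub>0\<close>, so it can be put in front of the chain.\<close>

lemma chain_from_boundaries:
  assumes B: "subring_set B" and MM: "prime_in B MM"
    and "ideal_in B J" "set zs \<subseteq> B" "\<And>c. boundaries B c zs J \<subseteq> MM"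
  shows "\<exists>p. (\<forall>i\<le>length zs. prime_in B (p i)) \<and> (\<forall>i<length zs. p i \<subset> p (Suc i)) \<and> J \<subseteq> p 0 \<and> p (length zs) \<subseteq> MM"
  using assms(3-)
proof (induct zs arbitrary: J)
  case Nil
  then show ?case using MM by (intro exI[of _ "\<lambda>_. MM"]) simp
next
  case (Cons z zs)
  have z: "z \<in> B" "set zs \<subseteq> B" using Cons(3) by auto
  define J' where "J' = (\<Union>c. boundary B c J z)"
  have inc: "boundary B c J z \<subseteq> boundary B c' J z" if "c \<le> c'" for c c'
    by (rule boundary_mono[OF B Cons(2) z(1) subset_refl that])
  have J': "ideal_in B J'" unfolding ideal_in_def
  proof (intro conjI ballI)
    note t = boundary_ideal_in[OF B Cons(2) z(1)]
    show "J' \<subseteq> B" using ideal_inD(1)[OF t] by (auto simp: J'_def)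
    show "0 \<in> J'" using ideal_inD(2)[OF t] by (auto simp: J'_def)
    fix x y assume "x \<in> J'" "y \<in> J'"
    then obtain c c' where "x \<in> boundary B c J z" "y \<in> boundary B c' J z" by (auto simp: J'_def)
    then have "x \<in> boundary B (max c c') J z" "y \<in> boundary B (max c c') J z" using inc[of c "max c c'"] inc[of c' "max c c'"] by auto
    then show "x + y \<in> J'" using ideal_inD(3)[OF t] by (auto simp: J'_def)
  next
    fix x b assume "x \<in> J'" "b \<in> B"
    then show "b * x \<in> J'" using ideal_inD(4)[OF boundary_ideal_in[OF B Cons(2) z(1)]] by (auto simp: J'_def)
  qed
  have "boundaries B c zs J' \<subseteq> MM" for c
  proof
    fix f assume "f \<in> boundaries B c zs J'"
    then obtain c' where "f \<in> boundaries B c zs (boundary B c' J z)" unfolding J'_def boundaries_Union by blast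
    then have "f \<in> boundaries B (max c c') zs (boundary B (max c c') J z)"
      using boundaries_mono[OF B boundary_ideal_in[OF B Cons(2) z(1)] z(2) inc[of c' "max c c'"], of c "max c c'"] by auto
    then have "f \<in> boundaries B (max c c') (z # zs) J" by simp
    then show "f \<in> MM" using Cons(4) by blast
  qed
  from Cons(1)[OF J' z(2) this] obtain p where p: "\<And>i. i \<le> length zs \<Longrightarrow> prime_in B (p i)"
    "\<And>i. i < length zs \<Longrightarrow> p i \<subset> p (Suc i)" "J' \<subseteq> p 0" "p (length zs) \<subseteq> MM" by blast
  have p0: "prime_in B (p 0)" using p(1) by simp
  define S where "S = {z ^ i * u | i u. u \<in> B - p 0}"
  have S1: "u \<in> S" if "u \<in> B - p 0" for u
  proof -
    have "u = z ^ 0 * u" by simp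
    then show ?thesis unfolding S_def using that by blast
  qed
  have "\<exists>p'. prime_in B p' \<and> J \<subseteq> p' \<and> p' \<inter> S = {}"
  proof (rule prime_avoiding[OF B Cons(2)])
    show "1 \<in> S" using S1[of 1] prime_inD(2)[OF p0] subring_setD(1)[OF B] by simp
    show "S \<subseteq> B" using z subring_power[OF B] subring_setD(4)[OF B] by (auto simp: S_def)
    fix x y assume "x \<in> S" "y \<in> S"
    then obtain i u j v where uv: "x = z ^ i * u" "y = z ^ j * v" "u \<in> B - p 0" "v \<in> B - p 0" by (auto simp: S_def)
    have "u * v \<in> B - p 0" using uv prime_inD(3)[OF p0, of u v] subring_setD(4)[OF B, of u v] by auto
    moreover have "x * y = z ^ (i + j) * (u * v)" by (simp add: uv power_add mult_ac)
    ultimately show "x * y \<in> S" unfolding S_def by blast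
  next
    show "J \<inter> S = {}"
    proof (rule ccontr)
      assume "J \<inter> S \<noteq> {}"
      then obtain i u where u: "z ^ i * u \<in> J" "u \<in> B" "u \<notin> p 0" by (auto simp: S_def)
      have "z ^ i * (u - 0 * z) \<in> J" using u(1) by simp
      then have "u \<in> boundary B i J z" using u(2) subring_setD(2)[OF B] unfolding boundary_def by blast
      then show False using u(3) p(3) by (auto simp: J'_def)
    qed
  qed
  then obtain p' where p': "prime_in B p'" "J \<subseteq> p'" "p' \<inter> S = {}" by blast
  have sub: "p' \<subseteq> p 0" using p'(3) S1 ideal_inD(1)[OF prime_inD(1)[OF p'(1)]] by blast
  have "z ^ 0 * (z - 1 * z) \<in> J" using ideal_inD(2)[OF Cons(2)] by simp
  then have "z \<in> boundary B 0 J z" using z(1) subring_setD(1)[OF B] unfolding boundary_def by blast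
  then have zp: "z \<in> p 0" using p(3) by (auto simp: J'_def)
  have "z ^ 1 * 1 \<in> S" using prime_inD(2)[OF p0] subring_setD(1)[OF B] unfolding S_def by blast
  then have "z \<notin> p'" using p'(3) by auto
  then have strict: "p' \<subset> p 0" using sub zp by blast
  let ?p = "case_nat p' p"
  have "\<forall>i\<le>length (z # zs). prime_in B (?p i)" using p'(1) p(1) by (auto split: nat.split)
  moreover have "\<forall>i<length (z # zs). ?p i \<subset> ?p (Suc i)" using strict p(2) by (auto split: nat.split)
  ultimately show ?case using p'(2) p(4) by (intro exI[of _ ?p]) simp
qed

section \<open>Growth of the generic rank along powers of the irrelevant ideal\<close>

text \<open>The power \<open>\<langle>x\<rangle>\<^sup>s\<close>, described by the degrees of the monomials.\<close>

definition x_power :: "nat \<Rightarrow> nat \<Rightarrow> nat \<Rightarrow> 'k::field mpol mpol set" where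
  "x_power m k s = {f \<in> PC m k. \<forall>t\<in>ks f. s \<le> xdeg k t}"

text \<open>The module \<open>P/U\<close> has rank at most \<open>h\<close> over \<open>A\<close>, that is, after tensoring with the quotient field of \<open>A\<close>. The
  denominator \<open>d\<close> may depend on \<open>f\<close>.\<close>

definition rank_le :: "nat \<Rightarrow> nat \<Rightarrow> 'k::field mpol mpol set \<Rightarrow> nat \<Rightarrow> bool" where
  "rank_le m k U h \<longleftrightarrow> (\<exists>X. finite X \<and> card X \<le> h \<and> X \<subseteq> PC m k \<and>
     (\<forall>f\<in>PC m k. \<exists>d\<in>AC m. d \<noteq> 0 \<and> const d * f \<in> alg_mod.Sp (AC m) const U X))"

lemma alg_mod_A: "ideal_in (PC m k) U \<Longrightarrow> alg_mod (PC m k) (AC m) (const :: _ \<Rightarrow> 'k::field mpol mpol) U"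
  by unfold_locales (simp_all add: subring_PC subring_AC ring_map_const const_mpol_over[OF subring_AC])

lemma rank_le_mono:
  assumes "rank_le m k U h" "ideal_in (PC m k) U" "ideal_in (PC m k) U'" "U \<subseteq> U'" "h \<le> h'" shows "rank_le m k U' h'"
proof -
  have "alg_mod.Sp (AC m) const U X \<subseteq> alg_mod.Sp (AC m) const U' X" for X
    unfolding alg_mod.Sp_def[OF alg_mod_A[OF assms(2)]] alg_mod.Sp_def[OF alg_mod_A[OF assms(3)]] using assms(4) by blast
  then show ?thesis using assms(1,5) unfolding rank_le_def by (meson order_trans subsetD)
qed

text \<open>Subadditivity of the rank: modulo \<open>U\<close> the elements of \<open>U1\<close> are multiples of \<open>z\<close>, and multiplication by \<open>z\<close> maps \<open>U2\<close>
  into \<open>U\<close>. So generators of \<open>P/U1\<close> together with the \<open>z\<close>-multiples of generators of \<open>P/U2\<close> generate \<open>P/U\<close> up to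
  denominators.\<close>

lemma rank_le_extension:
  assumes U: "ideal_in (PC m k) U" "ideal_in (PC m k) U1" "ideal_in (PC m k) U2"
    and h: "rank_le m k U1 h1" "rank_le m k U2 h2" and z: "z \<in> PC m k"
    and U1: "\<And>u. u \<in> U1 \<Longrightarrow> \<exists>b\<in>PC m k. u - z * b \<in> U" and U2: "\<And>u. u \<in> U2 \<Longrightarrow> z * u \<in> U"
  shows "rank_le m k U (h1 + h2)"
proof -
  let ?B = "PC m k" and ?A = "AC m"
  note B = subring_PC[of m k]
  interpret k0: alg_mod ?B ?A const U by (rule alg_mod_A[OF U(1)])
  obtain X1 where X1: "finite X1" "card X1 \<le> h1" "X1 \<subseteq> ?B"
    "\<And>f. f \<in> ?B \<Longrightarrow> \<exists>d\<in>?A. d \<noteq> 0 \<and> const d * f \<in> alg_mod.Sp ?A const U1 X1" using h(1) unfolding rank_le_def by blast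
  obtain X2 where X2: "finite X2" "card X2 \<le> h2" "X2 \<subseteq> ?B"
    "\<And>f. f \<in> ?B \<Longrightarrow> \<exists>d\<in>?A. d \<noteq> 0 \<and> const d * f \<in> alg_mod.Sp ?A const U2 X2" using h(2) unfolding rank_le_def by blast
  define X where "X = X1 \<union> (\<lambda>x. z * x) ` X2"
  have finX: "finite X" using X1 X2 by (simp add: X_def)
  have "card X \<le> card X1 + card ((\<lambda>x. z * x) ` X2)" unfolding X_def by (rule card_Un_le)
  also have "\<dots> \<le> h1 + h2" using X1(2) X2(2) card_image_le[OF X2(1), of "\<lambda>x. z * x"] by linarith
  finally have cX: "card X \<le> h1 + h2" .
  have XB: "X \<subseteq> ?B" using X1(3) X2(3) z subring_setD(4)[OF B] by (auto simp: X_def)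
  have "\<exists>d\<in>?A. d \<noteq> 0 \<and> const d * f \<in> k0.Sp X" if f: "f \<in> ?B" for f
  proof -
    obtain d1 where d1: "d1 \<in> ?A" "d1 \<noteq> 0" "const d1 * f \<in> alg_mod.Sp ?A const U1 X1" using X1(4)[OF f] by blast
    then obtain l1 where l1: "\<And>b. l1 b \<in> ?A" "const d1 * f - (\<Sum>b\<in>X1. const (l1 b) * b) \<in> U1"
      unfolding alg_mod.Sp_def[OF alg_mod_A[OF U(2)]] by blast
    obtain b where b: "b \<in> ?B" "const d1 * f - (\<Sum>b\<in>X1. const (l1 b) * b) - z * b \<in> U" using U1[OF l1(2)] by blast
    obtain d2 where d2: "d2 \<in> ?A" "d2 \<noteq> 0" "const d2 * b \<in> alg_mod.Sp ?A const U2 X2" using X2(4)[OF b(1)] by blast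
    then obtain l2 where l2: "\<And>b. l2 b \<in> ?A" "const d2 * b - (\<Sum>b\<in>X2. const (l2 b) * b) \<in> U2"
      unfolding alg_mod.Sp_def[OF alg_mod_A[OF U(3)]] by blast
    let ?s1 = "\<Sum>b\<in>X1. const (l1 b) * b" and ?s2 = "\<Sum>b\<in>X2. const (l2 b) * b"
    have u: "const d2 * (const d1 * f - ?s1 - z * b) + z * (const d2 * b - ?s2) \<in> U"
      by (intro ideal_inD(3)[OF U(1)] ideal_inD(4)[OF U(1) b(2)] U2[OF l2(2)] const_mpol_over[OF subring_AC d2(1)])
    have e: "const (d2 * d1) * f = (const d2 * (const d1 * f - ?s1 - z * b) + z * (const d2 * b - ?s2)) + const d2 * ?s1 + z * ?s2"
      by (simp add: algebra_simps const_simps)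
    have "?s1 \<in> k0.Sp X"
      using finX by (intro k0.Sp_sum k0.Sp_scale k0.Sp_self l1) (auto simp: X_def)
    moreover have "z * ?s2 = (\<Sum>b\<in>X2. const (l2 b) * (z * b))" by (simp add: sum_distrib_left mult_ac)
    moreover have "(\<Sum>b\<in>X2. const (l2 b) * (z * b)) \<in> k0.Sp X"
      using finX by (intro k0.Sp_sum k0.Sp_scale k0.Sp_self l2) (auto simp: X_def)
    ultimately have s: "?s1 \<in> k0.Sp X" "z * ?s2 \<in> k0.Sp X" by (simp_all only:)
    have "const (d2 * d1) * f \<in> k0.Sp X"
      unfolding e by (rule k0.Sp_add[OF k0.Sp_add[OF k0.Sp_q[OF u] k0.Sp_scale[OF s(1) d2(1)]] s(2)])
    moreover have "d2 * d1 \<in> ?A" "d2 * d1 \<noteq> 0" using d1 d2 subring_setD(4)[OF subring_AC] by auto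
    ultimately show ?thesis by blast
  qed
  then show ?thesis unfolding rank_le_def using finX cX XB by blast
qed

definition ideal_sum :: "'a::comm_ring_1 set \<Rightarrow> 'a set \<Rightarrow> 'a set" where
  "ideal_sum J F = {x + y | x y. x \<in> J \<and> y \<in> F}"

lemma ideal_sum_ideal_in:
  assumes "ideal_in B J" "ideal_in B F" "subring_set B" shows "ideal_in B (ideal_sum J F)"
  unfolding ideal_in_def
proof (intro conjI ballI)
  show "ideal_sum J F \<subseteq> B" using ideal_inD(1)[OF assms(1)] ideal_inD(1)[OF assms(2)] subring_setD(5)[OF assms(3)]
    by (auto simp: ideal_sum_def)
  show "0 \<in> ideal_sum J F" using ideal_inD(2)[OF assms(1)] ideal_inD(2)[OF assms(2)] by (force simp: ideal_sum_def)
next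
  fix x y assume "x \<in> ideal_sum J F" "y \<in> ideal_sum J F"
  then obtain a b a' b' where *: "x = a + b" "y = a' + b'" "a \<in> J" "b \<in> F" "a' \<in> J" "b' \<in> F" by (auto simp: ideal_sum_def)
  have "x + y = (a + a') + (b + b')" by (simp add: * algebra_simps)
  then show "x + y \<in> ideal_sum J F" unfolding ideal_sum_def using ideal_inD(3)[OF assms(1) *(3,5)] ideal_inD(3)[OF assms(2) *(4,6)] by blast
next
  fix x c assume "x \<in> ideal_sum J F" "c \<in> B"
  then obtain a b where *: "x = a + b" "a \<in> J" "b \<in> F" by (auto simp: ideal_sum_def)
  have "c * x = c * a + c * b" by (simp add: * algebra_simps)
  then show "c * x \<in> ideal_sum J F" unfolding ideal_sum_def
    using ideal_inD(4)[OF assms(1) *(2) \<open>c \<in> B\<close>] ideal_inD(4)[OF assms(2) *(3) \<open>c \<in> B\<close>] by blast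
qed

lemma ideal_sumI: "x \<in> J \<Longrightarrow> y \<in> F \<Longrightarrow> x + y \<in> ideal_sum J F" by (auto simp: ideal_sum_def)
lemma ideal_sum_left: "ideal_in B F \<Longrightarrow> J \<subseteq> ideal_sum J F" using ideal_sumI[of _ J 0 F] ideal_inD(2) by fastforce
lemma ideal_sum_right: "ideal_in B J \<Longrightarrow> F \<subseteq> ideal_sum J F" using ideal_sumI[of 0 J _ F] ideal_inD(2) by fastforce

lemma x_power_mult: assumes "f \<in> x_power m k a" "g \<in> x_power m k b" shows "f * g \<in> x_power m k (a + b)"
  unfolding x_power_def
proof (intro CollectI conjI ballI)
  show "f * g \<in> PC m k" by (rule subring_setD(4)[OF subring_PC]) (use assms in \<open>auto simp: x_power_def\<close>)
  fix t assume "t \<in> ks (f * g)"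
  then obtain u v where "t = u + v" "u \<in> ks f" "v \<in> ks g" using keys_mult[of f g] by blast
  then show "a + b \<le> xdeg k t" using assms by (auto simp: x_power_def wt_add intro!: add_mono)
qed

lemma x_power_0: "x_power m k 0 = PC m k" by (auto simp: x_power_def)

lemma x_power_ideal_in: "ideal_in (PC m k) (x_power m k s)" unfolding ideal_in_def
proof (intro conjI ballI)
  show "x_power m k s \<subseteq> PC m k" by (auto simp: x_power_def)
  show "0 \<in> x_power m k s" using subring_setD(2)[OF subring_PC] by (auto simp: x_power_def)
  show "x + y \<in> x_power m k s" if "x \<in> x_power m k s" "y \<in> x_power m k s" for x y :: "'k::field mpol mpol"
    using that keys_add[of x y] subring_setD(5)[OF subring_PC] by (auto simp: x_power_def)
  show "b * x \<in> x_power m k s" if "x \<in> x_power m k s" "b \<in> PC m k" for x b :: "'k::field mpol mpol"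
    using x_power_mult[of b m k 0 x s] that by (simp add: x_power_0)
qed

lemma x_x_power: assumes "j < k" shows "indet j \<in> x_power m k 1"
  using x_PC[OF assms] assms by (auto simp: x_power_def indet_def wt_single)

lemma x_power_1: "f \<in> x_power m k 1 \<longleftrightarrow> f \<in> PC m k \<and> lk f 0 = 0"
proof -
  have "1 \<le> xdeg k t" if "f \<in> PC m k" "lk f 0 = 0" "t \<in> ks f" for t
  proof -
    have "t \<noteq> 0" using that by (auto simp: in_keys_iff)
    moreover have "ks t \<subseteq> {..<k}" using that by (auto simp: mpol_over_def)
    ultimately show ?thesis using wt_eq_0_iff[of k "\<lambda>_. 1" t] by simp
  qed
  moreover have "lk f 0 = 0" if "f \<in> x_power m k 1"
  proof (rule ccontr)
    assume "lk f 0 \<noteq> 0"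
    then have "0 \<in> ks f" by (simp add: in_keys_iff)
    then have "1 \<le> xdeg k 0" using that unfolding x_power_def by blast
    then show False by simp
  qed
  ultimately show ?thesis by (auto simp: x_power_def)
qed

lemma ring_map_lk0: "ring_map (\<lambda>f. lk f (0 :: nat \<Rightarrow>\<^sub>0 nat))"
proof -
  have "lk f 0 = eval_hom (\<lambda>x. x) (\<lambda>_. 0) f" for f :: "'a::comm_ring_1 mpol"
  proof -
    have "(\<Prod>i\<in>ks t. (0::'a) ^ lk t i) = (if t = 0 then 1 else 0)" for t :: "nat \<Rightarrow>\<^sub>0 nat"
    proof (cases "t = 0")
      case False
      then obtain i where i: "i \<in> ks t" by fastforce
      then have "(0::'a) ^ lk t i = 0" by (intro zero_power) (simp add: in_keys_iff)
      then have "(\<Prod>i\<in>ks t. (0::'a) ^ lk t i) = 0" using i by (intro prod_zero) auto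
      then show ?thesis using False by simp
    qed simp
    then have "eval_hom (\<lambda>x. x) (\<lambda>_. 0) f = (\<Sum>t\<in>ks f. if t = 0 then lk f t else 0)"
      unfolding eval_hom_def by (intro sum.cong) auto
    then show ?thesis by (simp add: sum.delta' in_keys_iff)
  qed
  then have "(\<lambda>f::'a mpol. lk f 0) = eval_hom (\<lambda>x. x) (\<lambda>_. 0)" by auto
  then show ?thesis using eval_hom_ring_map[OF ring_map_id, of "\<lambda>_. 0"] by simp
qed

lemma lk_AC: "f \<in> PC m k \<Longrightarrow> lk f t \<in> AC m"
  using subring_setD(2)[OF subring_AC] by (cases "t \<in> ks f") (auto simp: mpol_over_def in_keys_iff)

text \<open>The constant term \<open>s\<^sub>0\<close> of \<open>s\<close> becomes invertible over the quotient field of \<open>A\<close>, and \<open>s\<^sub>0 - s \<in> \<langle>x\<rangle>\<close> is nilpotent modulo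
  \<open>\<langle>x\<rangle>\<^sup>e\<close>. So \<open>s\<^sub>0\<^sup>e\<close> lies in \<open>J + \<langle>x\<rangle>\<^sup>e\<close>, and the quotient is torsion over \<open>A\<close>.\<close>

lemma rank_le_0_of_unit:
  assumes J: "ideal_in (PC m k) J" and s: "s \<in> J" "lk s 0 \<noteq> 0"
  shows "rank_le m k (ideal_sum J (x_power m k e)) 0"
proof -
  let ?B = "PC m k"
  note B = subring_PC[of m k]
  have T: "ideal_in ?B (ideal_sum J (x_power m k e))" for e by (rule ideal_sum_ideal_in[OF J x_power_ideal_in B])
  have sB: "s \<in> ?B" using ideal_inD(1)[OF J] s by blast
  define n where "n = const (lk s 0) - s"
  have n: "n \<in> x_power m k 1" unfolding x_power_1 n_def
    using subring_setD(3)[OF B const_mpol_over[OF subring_AC lk_AC[OF sB]] sB] by (simp add: lookup_minus lookup_const)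
  have *: "const (lk s 0) ^ e \<in> ideal_sum J (x_power m k e)" for e
  proof (induct e)
    case 0
    show ?case using ideal_sum_right[OF J] subring_setD(1)[OF B] by (auto simp: x_power_0)
  next
    case (Suc e)
    then obtain a b where ab: "const (lk s 0) ^ e = a + b" "a \<in> J" "b \<in> x_power m k e" by (auto simp: ideal_sum_def)
    have "const (lk s 0) ^ Suc e = s * const (lk s 0) ^ e + n * (a + b)" by (simp add: n_def ab algebra_simps)
    also have "\<dots> = (const (lk s 0) ^ e * s + n * a) + n * b" by (simp add: algebra_simps)
    also have "\<dots> \<in> ideal_sum J (x_power m k (Suc e))"
    proof (rule ideal_sumI)
      have "const (lk s 0) ^ e \<in> ?B" by (intro subring_power[OF B] const_mpol_over[OF subring_AC] lk_AC[OF sB])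
      moreover have "n \<in> ?B" using n by (simp add: x_power_def)
      ultimately show "const (lk s 0) ^ e * s + n * a \<in> J"
        using ideal_inD(3,4)[OF J] s(1) ab(2) by blast
      show "n * b \<in> x_power m k (Suc e)" using x_power_mult[OF n ab(3)] by simp
    qed
    finally show ?case .
  qed
  interpret alg_mod ?B "AC m" const "ideal_sum J (x_power m k e)" by (rule alg_mod_A[OF T])
  have "const (lk s 0 ^ e) * f \<in> Sp {}" if "f \<in> ?B" for f
    using Sp_q[OF ideal_inD(5)[OF T *[of e] that]] by (simp add: const_power)
  moreover have "lk s 0 ^ e \<in> AC m" by (intro subring_power[OF subring_AC] lk_AC[OF sB])
  moreover have "lk s 0 ^ e \<noteq> 0" using s(2) by simp
  ultimately have "\<forall>f\<in>?B. \<exists>d\<in>AC m. d \<noteq> 0 \<and> const d * f \<in> Sp {}" by blast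
  then show ?thesis unfolding rank_le_def by (intro exI[of _ "{}"]) simp
qed

text \<open>The colon ideal \<open>V : z\<^sup>c\<close>.\<close>

definition colon :: "'a::comm_ring_1 set \<Rightarrow> nat \<Rightarrow> 'a set \<Rightarrow> 'a \<Rightarrow> 'a set" where
  "colon B c V z = {f \<in> B. z ^ c * f \<in> V}"

lemma colon_ideal_in:
  assumes B: "subring_set B" and V: "ideal_in B V" and z: "z \<in> B" shows "ideal_in B (colon B c V z)"
  unfolding ideal_in_def
proof (intro conjI ballI)
  show "colon B c V z \<subseteq> B" "0 \<in> colon B c V z" using subring_setD(2)[OF B] ideal_inD(2)[OF V] by (auto simp: colon_def)
  show "x + y \<in> colon B c V z" if "x \<in> colon B c V z" "y \<in> colon B c V z" for x y
    using that subring_setD(5)[OF B] ideal_inD(3)[OF V] by (simp add: colon_def distrib_left)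
  show "b * x \<in> colon B c V z" if "x \<in> colon B c V z" "b \<in> B" for x b
    using that subring_setD(4)[OF B] ideal_inD(4)[OF V, of "z ^ c * x" b] by (simp add: colon_def mult.left_commute)
qed

text \<open>Filter by the powers of \<open>z\<close>: modulo \<open>z\<close> the colon ideal becomes the boundary ideal, and multiplication by \<open>z\<close> shifts
  \<open>\<langle>x\<rangle>\<^sup>s\<close> to \<open>\<langle>x\<rangle>\<^bsup>s+1\<^esup>\<close>. So \<open>s\<close> steps, each of rank at most \<open>h\<close>, exhaust the quotient.\<close>

lemma rank_le_colon:
  assumes J: "ideal_in (PC m k) J" and j: "j < k"
    and h: "\<And>s'. s' \<le> s \<Longrightarrow> rank_le m k (ideal_sum (boundary (PC m k) c J (indet j)) (x_power m k s')) h"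
  shows "rank_le m k (ideal_sum (colon (PC m k) c J (indet j)) (x_power m k s)) (s * h)"
  using h
proof (induct s)
  case 0
  let ?U = "ideal_sum (colon (PC m k) c J (indet j)) (x_power m k 0)"
  note B = subring_PC[of m k]
  have T: "ideal_in (PC m k) ?U" by (rule ideal_sum_ideal_in[OF colon_ideal_in[OF B J x_PC[OF j]] x_power_ideal_in B])
  interpret alg_mod "PC m k" "AC m" const ?U by (rule alg_mod_A[OF T])
  have "const 1 * f \<in> Sp {}" if "f \<in> PC m k" for f
    using ideal_sum_right[OF colon_ideal_in[OF B J x_PC[OF j], of c], of "x_power m k 0"] that
    by (intro Sp_q) (auto simp: x_power_0 const_simps)
  moreover have "(1 :: 'a mpol) \<in> AC m" "(1 :: 'a mpol) \<noteq> 0" using subring_setD(1)[OF subring_AC] by auto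
  ultimately have "\<forall>f\<in>PC m k. \<exists>d\<in>AC m. d \<noteq> 0 \<and> const d * f \<in> Sp {}" by blast
  then show ?case unfolding rank_le_def by (intro exI[of _ "{}"]) simp
next
  case (Suc s)
  let ?z = "indet j :: 'a mpol mpol"
  let ?colon = "colon (PC m k) c J ?z" and ?boundary = "boundary (PC m k) c J ?z"
  note B = subring_PC[of m k] and z = x_PC[OF j, of m]
  have T: "ideal_in (PC m k) ?colon" "ideal_in (PC m k) ?boundary"
    by (rule colon_ideal_in[OF B J z], rule boundary_ideal_in[OF B J z])
  have "rank_le m k (ideal_sum ?colon (x_power m k (Suc s))) (h + s * h)"
  proof (rule rank_le_extension[of m k _ "ideal_sum ?boundary (x_power m k (Suc s))" "ideal_sum ?colon (x_power m k s)" h "s * h" ?z])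
    show "rank_le m k (ideal_sum ?boundary (x_power m k (Suc s))) h" by (rule Suc(2)) simp
    show "rank_le m k (ideal_sum ?colon (x_power m k s)) (s * h)" by (rule Suc(1)) (use Suc(2) in simp)
    fix u assume "u \<in> ideal_sum ?boundary (x_power m k (Suc s))"
    then obtain f g where u: "u = f + g" "f \<in> ?boundary" "g \<in> x_power m k (Suc s)" by (auto simp: ideal_sum_def)
    then obtain a where a: "f \<in> PC m k" "a \<in> PC m k" "?z ^ c * (f - a * ?z) \<in> J" by (auto simp: boundary_def)
    have "u - ?z * a = (f - a * ?z) + g" by (simp add: u algebra_simps)
    moreover have "f - a * ?z \<in> ?colon" using a subring_setD(3)[OF B a(1) subring_setD(4)[OF B a(2) z]] by (simp add: colon_def)
    ultimately show "\<exists>b\<in>PC m k. u - ?z * b \<in> ideal_sum ?colon (x_power m k (Suc s))" using ideal_sumI u(3) a(2) by metis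
  next
    fix u assume "u \<in> ideal_sum ?colon (x_power m k s)"
    then obtain f g where u: "u = f + g" "f \<in> ?colon" "g \<in> x_power m k s" by (auto simp: ideal_sum_def)
    have "?z * f \<in> ?colon" by (rule ideal_inD(4)[OF T(1) u(2) z])
    moreover have "?z * g \<in> x_power m k (Suc s)" using x_power_mult[OF x_x_power[OF j] u(3)] by simp
    ultimately show "?z * u \<in> ideal_sum ?colon (x_power m k (Suc s))" using ideal_sumI by (fastforce simp: u(1) distrib_left)
  qed (use ideal_sum_ideal_in[OF T(1) x_power_ideal_in B] ideal_sum_ideal_in[OF T(2) x_power_ideal_in B] z in auto)
  then show ?case by simp
qed

text \<open>Adding the powers \<open>z\<^sup>c\<close> to \<open>V\<close> one after the other costs at most the rank of \<open>P/(V : z\<^sup>c)\<close> each time.\<close>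

lemma rank_le_powers:
  assumes "ideal_in (PC m k) V" "set zs \<subseteq> PC m k" "\<And>z. z \<in> set zs \<Longrightarrow> rank_le m k (colon (PC m k) c V z) h"
    and "\<And>U. ideal_in (PC m k) U \<Longrightarrow> V \<subseteq> U \<Longrightarrow> \<forall>z\<in>set zs. z ^ c \<in> U \<Longrightarrow> rank_le m k U E"
  shows "rank_le m k V (length zs * h + E)"
  using assms
proof (induct zs arbitrary: V)
  case Nil
  then show ?case by auto
next
  case (Cons z zs)
  note B = subring_PC[of m k]
  have z: "z \<in> PC m k" "set zs \<subseteq> PC m k" using Cons(3) by auto
  have zc: "z ^ c \<in> PC m k" by (rule subring_power[OF B z(1)])
  define Z where "Z = (\<lambda>b. z ^ c * b) ` PC m k"
  have Z: "ideal_in (PC m k) Z" unfolding ideal_in_def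
  proof (intro conjI ballI)
    show "Z \<subseteq> PC m k" using subring_setD(4)[OF B zc] by (auto simp: Z_def)
    show "0 \<in> Z" using subring_setD(2)[OF B] by (force simp: Z_def)
    show "x + y \<in> Z" if xy: "x \<in> Z" "y \<in> Z" for x y
    proof -
      obtain a b where "x = z ^ c * a" "y = z ^ c * b" "a \<in> PC m k" "b \<in> PC m k" using xy by (auto simp: Z_def)
      then show ?thesis using subring_setD(5)[OF B, of a b] by (auto simp: Z_def distrib_left[symmetric])
    qed
    show "b * x \<in> Z" if bx: "x \<in> Z" "b \<in> PC m k" for x b
    proof -
      obtain a where "x = z ^ c * a" "a \<in> PC m k" using bx by (auto simp: Z_def)
      then have "b * x = z ^ c * (b * a)" "b * a \<in> PC m k" using subring_setD(4)[OF B bx(2)] by (auto simp: mult_ac)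
      then show ?thesis by (auto simp: Z_def)
    qed
  qed
  define V' where "V' = ideal_sum V Z"
  have V': "ideal_in (PC m k) V'" unfolding V'_def by (rule ideal_sum_ideal_in[OF Cons(2) Z B])
  have VV': "V \<subseteq> V'" unfolding V'_def by (rule ideal_sum_left[OF Z])
  have "z ^ c * 1 \<in> Z" unfolding Z_def using subring_setD(1)[OF B] by blast
  then have zV': "z ^ c \<in> V'" using ideal_sum_right[OF Cons(2), of Z] by (auto simp: V'_def)
  have "rank_le m k V' (length zs * h + E)"
  proof (rule Cons(1)[OF V' z(2)])
    fix y assume y: "y \<in> set zs"
    then have yB: "y \<in> PC m k" using z by auto
    show "rank_le m k (colon (PC m k) c V' y) h"
      by (rule rank_le_mono[OF Cons(4)[of y] colon_ideal_in[OF B Cons(2) yB] colon_ideal_in[OF B V' yB]])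
        (use y VV' in \<open>auto simp: colon_def\<close>)
  next
    fix U assume "ideal_in (PC m k) U" "V' \<subseteq> U" "\<forall>z\<in>set zs. z ^ c \<in> U"
    then show "rank_le m k U E" using Cons(5)[of U] VV' zV' by auto
  qed
  then have "rank_le m k V ((length zs * h + E) + h)"
  proof (rule rank_le_extension[OF Cons(2) V' colon_ideal_in[OF B Cons(2) z(1), of c] _ _ zc])
    show "rank_le m k (colon (PC m k) c V z) h" by (rule Cons(4)) simp
    show "\<exists>b\<in>PC m k. u - z ^ c * b \<in> V" if u: "u \<in> V'" for u
    proof -
      obtain f b where "u = f + z ^ c * b" "f \<in> V" "b \<in> PC m k" using u by (auto simp: V'_def ideal_sum_def Z_def)
      then show ?thesis by (intro bexI[of _ b]) simp
    qed
  qed (simp add: colon_def)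
  then show ?case by (simp add: algebra_simps)
qed

text \<open>Once all \<open>x\<^sub>j\<^sup>c\<close> lie in \<open>U\<close>, the \<open>c\<^sup>k\<close> monomials with exponents below \<open>c\<close> span the quotient.\<close>

lemma rank_le_base:
  assumes U: "ideal_in (PC m k) U" and x: "\<forall>z\<in>set (map indet [0..<k]). z ^ c \<in> U"
  shows "rank_le m k U (c ^ k)"
proof -
  let ?B = "PC m k"
  note B = subring_PC[of m k]
  interpret alg_mod ?B "AC m" const U by (rule alg_mod_A[OF U])
  let ?xs = "map indet [0..<k] :: 'a mpol mpol list"
  define X where "X = monom_of ?xs ` exponents k c"
  have xs: "set ?xs \<subseteq> ?B" using x_PC by auto
  have X: "finite X" "X \<subseteq> ?B" using monom_of_in[OF B xs] by (auto simp: X_def)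
  have cX: "card X \<le> c ^ k" unfolding X_def using card_image_le[OF finite_exponents] by (metis card_exponents)
  have mono: "Poly_Mapping.single t 1 \<in> Sp X" if t: "ks t \<subseteq> {..<k}" for t
  proof -
    have s: "Poly_Mapping.single t (1 :: 'a mpol) = (\<Prod>i<k. indet i ^ lk t i)"
      unfolding single_monom by (rule mev_superset) (use t in auto)
    show ?thesis
    proof (cases "\<forall>i<k. lk t i < c")
      case True
      have "monom_of (map indet ls) (map (lk t) ls) = (\<Prod>i\<in>set ls. (indet i :: 'a mpol mpol) ^ lk t i)" if "distinct ls" for ls
        using that by (induct ls) auto
      from this[of "[0..<k]"] have "Poly_Mapping.single t 1 = monom_of ?xs (map (lk t) [0..<k])"
        unfolding s by (simp add: lessThan_atLeast0)
      moreover have "map (lk t) [0..<k] \<in> exponents k c" using True by (auto simp: exponents_def)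
      ultimately show ?thesis by (intro Sp_self X) (auto simp: X_def)
    next
      case False
      then obtain i where i: "i < k" "c \<le> lk t i" by auto
      have "(\<Prod>i<k. indet i ^ lk t i) = (indet i :: 'a mpol mpol) ^ lk t i * (\<Prod>i\<in>{..<k} - {i}. indet i ^ lk t i)"
        by (rule prod.remove) (use i in auto)
      also have "(indet i :: 'a mpol mpol) ^ lk t i = indet i ^ (lk t i - c) * indet i ^ c"
        using i(2) by (simp add: power_add[symmetric])
      finally have e: "Poly_Mapping.single t (1 :: 'a mpol) =
          (indet i ^ (lk t i - c) * (\<Prod>i\<in>{..<k} - {i}. indet i ^ lk t i)) * indet i ^ c" unfolding s by (simp add: mult_ac)
      have "indet i ^ c \<in> U" using x i(1) by auto
      moreover have "(indet i :: 'a mpol mpol) ^ (lk t i - c) * (\<Prod>i\<in>{..<k} - {i}. indet i ^ lk t i) \<in> ?B"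
        by (intro subring_setD(4)[OF B] subring_prod[OF B] subring_power[OF B] x_PC) (use i in auto)
      ultimately show ?thesis unfolding e by (intro Sp_q ideal_inD(4)[OF U])
    qed
  qed
  have "const 1 * f \<in> Sp X" if f: "f \<in> ?B" for f
  proof -
    have "(\<Sum>t\<in>ks f. Poly_Mapping.single t (lk f t)) \<in> Sp X"
    proof (rule Sp_sum)
      fix t assume "t \<in> ks f"
      then have "ks t \<subseteq> {..<k}" using f by (auto simp: mpol_over_def)
      then show "Poly_Mapping.single t (lk f t) \<in> Sp X"
        unfolding single_const_monom[of t "lk f t"] by (intro Sp_scale mono lk_AC[OF f])
    qed
    then show ?thesis using pm_sum_single[of f] by (simp add: const_simps)
  qed
  then show ?thesis unfolding rank_le_def using X cX subring_setD(1)[OF subring_AC] by (meson one_neq_zero)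
qed

text \<open>The recursion of the growth estimate: the number \<open>E\<close> bounds the rank when all powers \<open>x\<^sub>j\<^sup>c\<close> have been added,
  and each of the \<open>k\<close> variables contributes \<open>s\<close> times the bound for its boundary ideal.\<close>

primrec rank_bound :: "nat \<Rightarrow> nat \<Rightarrow> nat \<Rightarrow> nat \<Rightarrow> nat" where
  "rank_bound k E 0 s = 0"
| "rank_bound k E (Suc t) s = k * (s * rank_bound k E t s) + E"

lemma rank_bound_mono: "s \<le> s' \<Longrightarrow> rank_bound k E t s \<le> rank_bound k E t s'"
  by (induct t) (auto intro!: mult_mono)

text \<open>The recursion gains one factor \<open>s\<close> per step, but its first step yields only the constant \<open>E\<close>; so \<open>t + 1\<close> steps give
  a polynomial in \<open>s\<close> of degree \<open>t\<close>.\<close>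

lemma rank_bound_bound: "\<exists>D. \<forall>s. rank_bound k E (Suc t) s \<le> D * (s + 1) ^ t"
proof (induct t)
  case 0
  show ?case by (intro exI[of _ E]) simp
next
  case (Suc t)
  then obtain D where D: "\<And>s. rank_bound k E (Suc t) s \<le> D * (s + 1) ^ t" by blast
  have "rank_bound k E (Suc (Suc t)) s \<le> (k * D + E) * (s + 1) ^ Suc t" for s
  proof -
    have "rank_bound k E (Suc (Suc t)) s \<le> k * (s * (D * (s + 1) ^ t)) + E" using D[of s] by (simp add: mult_le_mono)
    also have "\<dots> \<le> k * ((s + 1) * (D * (s + 1) ^ t)) + E * (s + 1) ^ Suc t" by (intro add_mono mult_le_mono) (auto simp: Suc_le_eq simp del: power_Suc)
    also have "\<dots> = (k * D + E) * (s + 1) ^ Suc t" by (simp add: algebra_simps)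
    finally show ?thesis .
  qed
  then show ?case by blast
qed

text \<open>Upper bound for the growth. An element outside \<open>\<langle>x\<rangle>\<close> in a boundary ideal makes its quotients torsion over \<open>A\<close>, which starts an
  induction: the boundary ideal of \<open>J\<close> along one variable satisfies the hypothesis for \<open>t - 1\<close>, and it bounds the rank for the
  colon ideal, hence the loss when \<open>x\<^sub>j\<^sup>c\<close> is added.\<close>

lemma growth_bound:
  assumes "ideal_in (PC m k) J"
    and "\<And>zs. length zs = t \<Longrightarrow> set zs \<subseteq> indet ` {..<k} \<Longrightarrow> \<exists>s\<in>boundaries (PC m k) c zs J. lk s 0 \<noteq> 0"
  shows "rank_le m k (ideal_sum J (x_power m k s)) (rank_bound k (c ^ k) t s)"
  using assms
proof (induct t arbitrary: J s)
  case 0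
  then obtain u where "u \<in> J" "lk u 0 \<noteq> 0" using 0(2)[of "[]"] by auto
  then show ?case using rank_le_0_of_unit[OF 0(1)] by simp
next
  case (Suc t)
  let ?B = "PC m k" and ?h = "rank_bound k (c ^ k) t s"
  note B = subring_PC[of m k] and J = Suc(2)
  let ?V = "ideal_sum J (x_power m k s)"
  have V: "ideal_in ?B ?V" by (rule ideal_sum_ideal_in[OF J x_power_ideal_in B])
  have "rank_le m k ?V (length (map indet [0..<k] :: 'a mpol mpol list) * (s * ?h) + c ^ k)"
  proof (rule rank_le_powers[OF V])
    show "set (map indet [0..<k]) \<subseteq> ?B" using x_PC by auto
    fix z :: "'a mpol mpol" assume "z \<in> set (map indet [0..<k])"
    then obtain j where j: "j < k" "z = indet j" by auto
    have zB: "z \<in> ?B" using j x_PC by simp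
    have bdB: "ideal_in ?B (boundary ?B c J z)" by (rule boundary_ideal_in[OF B J zB])
    have "rank_le m k (ideal_sum (boundary ?B c J z) (x_power m k s')) ?h" if "s' \<le> s" for s'
    proof (rule rank_le_mono[OF Suc(1)[OF bdB, of s']])
      fix zs :: "'a mpol mpol list" assume "length zs = t" "set zs \<subseteq> indet ` {..<k}"
      then show "\<exists>s\<in>boundaries ?B c zs (boundary ?B c J z). lk s 0 \<noteq> 0" using Suc(3)[of "z # zs"] j by auto
    qed (use rank_bound_mono[OF that] ideal_sum_ideal_in[OF bdB x_power_ideal_in B] in auto)
    then have "rank_le m k (ideal_sum (colon ?B c J z) (x_power m k s)) (s * ?h)" unfolding j(2) by (rule rank_le_colon[OF J j(1)])
    then show "rank_le m k (colon ?B c ?V z) (s * ?h)"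
    proof (rule rank_le_mono)
      show "ideal_sum (colon ?B c J z) (x_power m k s) \<subseteq> colon ?B c ?V z"
      proof
        fix u assume "u \<in> ideal_sum (colon ?B c J z) (x_power m k s)"
        then obtain f g where u: "u = f + g" "f \<in> ?B" "z ^ c * f \<in> J" "g \<in> x_power m k s" by (auto simp: ideal_sum_def colon_def)
        have "z ^ c * g \<in> x_power m k s" by (rule ideal_inD(4)[OF x_power_ideal_in u(4) subring_power[OF B zB]])
        then have "z ^ c * f + z ^ c * g \<in> ?V" by (rule ideal_sumI[OF u(3)])
        moreover have "g \<in> ?B" using u(4) by (simp add: x_power_def)
        ultimately show "u \<in> colon ?B c ?V z" using u(1,2) subring_setD(5)[OF B] by (simp add: colon_def distrib_left)
      qed
    qed (use ideal_sum_ideal_in[OF colon_ideal_in[OF B J zB] x_power_ideal_in B] colon_ideal_in[OF B V zB] in auto)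
  next
    fix U :: "'a mpol mpol set" assume "ideal_in ?B U" "\<forall>z\<in>set (map indet [0..<k]). z ^ c \<in> U"
    then show "rank_le m k U (c ^ k)" by (rule rank_le_base)
  qed
  then show ?case by simp
qed

lemma sum_gpart_bounded:
  assumes "\<And>t. t \<in> ks f \<Longrightarrow> wt w k t < s" shows "f = (\<Sum>e<s. gpart w k e f)"
  by (rule poly_mapping_eqI) (use assms in \<open>auto simp: lookup_sum lookup_gpart in_keys_iff\<close>)

text \<open>The bound on the exponents is used to bound the weight of the monomial.\<close>

lemma monom_of_indet_single:
  "length es = length L \<Longrightarrow> distinct L \<Longrightarrow> \<exists>t. monom_of (map indet L) es = Poly_Mapping.single t (1::'a::comm_ring_1) \<and>
     ks t \<subseteq> set L \<and> (\<forall>j. lk t j \<le> sum_list es)"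
proof (induct L arbitrary: es)
  case Nil
  then show ?case by (intro exI[of _ 0]) simp
next
  case (Cons j L)
  then obtain e fs where es: "es = e # fs" by (metis length_Suc_conv)
  obtain t where t: "monom_of (map indet L) fs = Poly_Mapping.single t (1::'a)" "ks t \<subseteq> set L" "\<forall>j. lk t j \<le> sum_list fs"
    using Cons(1)[of fs] Cons(2,3) es by auto
  let ?t = "Poly_Mapping.single j e + t"
  have "monom_of (map indet (j # L)) es = Poly_Mapping.single ?t (1::'a)"
    using t(1) by (simp add: es single_single_power[symmetric] mult_single)
  moreover have "ks ?t \<subseteq> set (j # L)" using t(2) by (auto simp: keys_plus_nat)
  moreover have "\<forall>i. lk ?t i \<le> sum_list es"
  proof
    fix i show "lk ?t i \<le> sum_list es"
      using t(3)[rule_format, of i] by (simp add: lookup_add lookup_single when_def es)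
  qed
  ultimately show ?case by blast
qed

text \<open>Lower bound for the growth. The monomials in independent variables have weight below \<open>s\<close>. A relation between them modulo
  \<open>q + \<langle>x\<rangle>\<^sup>s\<close> is a relation modulo \<open>q\<close>: elements of \<open>\<langle>x\<rangle>\<^sup>s\<close> have only parts of weight at least \<open>s\<close>, and the parts of
  small weight of an element of \<open>q\<close> lie in \<open>q\<close>. So the monomials are independent over \<open>A\<close> in the quotient.\<close>

lemma growth_lower:
  fixes q :: "'k::field mpol mpol set"
  assumes qh: "ideal_in (PC m k) q" "homog_ideal w k q" and w: "\<And>j. j < k \<Longrightarrow> 0 < w j"
    and L: "distinct L" "set L \<subseteq> {..<k}" "alg_indep const (AC m) (map indet L) q"
    and s: "sum w {..<k} * (length L * u) < s"
    and c: "rank_le m k (ideal_sum q (x_power m k s)) h"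
  shows "u ^ length L \<le> h"
proof (rule ccontr)
  assume "\<not> u ^ length L \<le> h"
  then have hu: "h < u ^ length L" by simp
  let ?B = "PC m k" and ?A = "AC m" and ?r = "length L" and ?V = "ideal_sum q (x_power m k s)"
  let ?ys = "map indet L :: 'k mpol mpol list"
  have B: "subring_set (PC m k :: 'k mpol mpol set)" and A: "subring_set (AC m :: 'k mpol set)"
    by (rule subring_PC subring_AC)+
  have V: "ideal_in ?B ?V" by (rule ideal_sum_ideal_in[OF qh(1) x_power_ideal_in B])
  interpret alg_mod ?B ?A const ?V by (rule alg_mod_A[OF V])
  obtain X where X: "finite X" "card X \<le> h" "X \<subseteq> ?B"
    "\<And>f. f \<in> ?B \<Longrightarrow> \<exists>d\<in>?A. d \<noteq> 0 \<and> const d * f \<in> Sp X" using c unfolding rank_le_def by blast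
  have ysB: "set ?ys \<subseteq> ?B" using L(2) x_PC by auto
  have "\<forall>es. \<exists>d. d \<in> ?A \<and> d \<noteq> 0 \<and> const d * monom_of ?ys es \<in> Sp X"
  proof
    fix es
    show "\<exists>d. d \<in> ?A \<and> d \<noteq> 0 \<and> const d * monom_of ?ys es \<in> Sp X"
      using X(4)[OF monom_of_in[OF B ysB, of es]] by blast
  qed
  from choice[OF this] obtain d where d: "\<And>es. d es \<in> ?A" "\<And>es. d es \<noteq> 0" "\<And>es. const (d es) * monom_of ?ys es \<in> Sp X" by blast
  have "\<forall>es. \<exists>l. (\<forall>b. l b \<in> ?A) \<and> const (d es) * monom_of ?ys es - (\<Sum>b\<in>X. const (l b) * b) \<in> ?V"
    using d(3) by (simp add: Sp_def)
  from choice[OF this] obtain l where l: "\<And>es b. l es b \<in> ?A"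
    "\<And>es. const (d es) * monom_of ?ys es - (\<Sum>b\<in>X. const (l es b) * b) \<in> ?V" by blast
  have card: "card X < card (exponents ?r u)" using X(2) hu by (simp add: card_exponents)
  obtain \<mu> where \<mu>: "\<And>e. \<mu> e \<in> ?A" "\<exists>e\<in>exponents ?r u. \<mu> e \<noteq> 0" "\<forall>b\<in>X. (\<Sum>e\<in>exponents ?r u. \<mu> e * l e b) = 0"
  proof -
    have "\<exists>la. (\<forall>e. la e \<in> ?A) \<and> (\<exists>e\<in>exponents ?r u. la e \<noteq> 0) \<and> (\<forall>b\<in>X. (\<Sum>e\<in>exponents ?r u. la e * l e b) = 0)"
      by (rule linear_dependence[OF A X(1) finite_exponents card]) (rule l(1))
    then show ?thesis using that by blast
  qed
  define v where "v = (\<Sum>es\<in>exponents ?r u. const (\<mu> es * d es) * monom_of ?ys es)"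
  have "(\<Sum>es\<in>exponents ?r u. const (\<mu> es) * (const (d es) * monom_of ?ys es - (\<Sum>b\<in>X. const (l es b) * b))) \<in> ?V"
    by (intro ideal_in_sum[OF V] ideal_inD(4)[OF V] l const_mpol_over[OF A] \<mu>)
  also have "(\<Sum>es\<in>exponents ?r u. const (\<mu> es) * (const (d es) * monom_of ?ys es - (\<Sum>b\<in>X. const (l es b) * b))) =
      v - (\<Sum>es\<in>exponents ?r u. \<Sum>b\<in>X. const (\<mu> es * l es b) * b)"
    by (simp add: v_def right_diff_distrib sum_subtractf sum_distrib_left const_simps mult_ac)
  also have "(\<Sum>es\<in>exponents ?r u. \<Sum>b\<in>X. const (\<mu> es * l es b) * b) = (\<Sum>b\<in>X. const (\<Sum>es\<in>exponents ?r u. \<mu> es * l es b) * b)"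
    by (subst sum.swap) (simp add: const_sum sum_distrib_right)
  also have "\<dots> = 0" using \<mu>(3) by (simp add: const_simps)
  finally have "v \<in> ?V" by simp
  then obtain g f where gf: "v = g + f" "g \<in> q" "f \<in> x_power m k s" by (auto simp: ideal_sum_def)
  \<comment> \<open>Exponents below \<open>u\<close> in \<open>length L\<close> variables keep the weight below the threshold for \<open>s\<close>.\<close>
  have small: "wt w k t < s" if "t \<in> ks v" for t
  proof -
    have "\<exists>es\<in>exponents ?r u. t \<in> ks (const (\<mu> es * d es) * monom_of ?ys es)"
    proof (rule ccontr)
      assume "\<not> ?thesis"
      then have "lk v t = 0" by (simp add: v_def lookup_sum in_keys_iff)
      then show False using that by (simp add: in_keys_iff)
    qed
    then obtain es where es: "es \<in> exponents ?r u" "t \<in> ks (const (\<mu> es * d es) * monom_of ?ys es)" by blast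
    obtain t' where t': "monom_of ?ys es = Poly_Mapping.single t' 1" "\<forall>j. lk t' j \<le> sum_list es"
      using monom_of_indet_single[of es L] es(1) L(1) by (auto simp: exponents_def)
    have "t = t'" using es(2) unfolding t'(1) by (auto simp: const_def mult_single split: if_splits)
    have "sum_list es \<le> ?r * u" using es(1) sum_list_mono[of es "\<lambda>x. x" "\<lambda>_. u"]
      by (force simp: exponents_def sum_list_triv)
    then have le: "lk t j \<le> ?r * u" for j using t'(2)[rule_format, of j] \<open>t = t'\<close> by simp
    have "wt w k t \<le> (\<Sum>j<k. w j * (?r * u))" unfolding wt_def using le by (intro sum_mono mult_le_mono) auto
    also have "\<dots> = sum w {..<k} * (?r * u)" by (simp add: sum_distrib_right)
    finally show ?thesis using s by simp
  qed
  have "v = (\<Sum>e<s. gpart w k e v)" by (rule sum_gpart_bounded[OF small])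
  also have "\<dots> \<in> q"
  proof (rule ideal_in_sum[OF qh(1)])
    fix e assume "e \<in> {..<s}"
    then have e: "e < s" by simp
    have "gpart w k e f = 0"
    proof (rule poly_mapping_eqI)
      fix t
      have "s \<le> wt w k t" if t: "t \<in> ks f"
      proof -
        have "s \<le> xdeg k t" using gf(3) t by (simp add: x_power_def)
        also have "\<dots> \<le> wt w k t" unfolding wt_def using w by (intro sum_mono) (simp add: Suc_le_eq)
        finally show ?thesis .
      qed
      then show "lk (gpart w k e f) t = lk 0 t" using e
        by (cases "t \<in> ks f") (auto simp: lookup_gpart in_keys_iff)
    qed
    then have "gpart w k e v = gpart w k e g" by (simp add: gf(1) gpart_add)
    then show "gpart w k e v \<in> q" using qh(2) gf(2) by (simp add: homog_ideal_def)
  qed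
  finally have "v \<in> q" .
  have "\<mu> es * d es = 0" if "es \<in> exponents ?r u" for es
  proof (rule alg_indepD[where c = "\<lambda>es. \<mu> es * d es", OF L(3)])
    show "\<mu> es * d es \<in> ?A" for es by (rule subring_setD(4)[OF A \<mu>(1) d(1)])
    show "(\<Sum>es\<in>exponents (length ?ys) u. const (\<mu> es * d es) * monom_of ?ys es) \<in> q"
      using \<open>v \<in> q\<close> by (simp only: v_def length_map)
    show "es \<in> exponents (length ?ys) u" using that by simp
  qed
  then show False using \<mu>(2) d(2) by auto
qed

text \<open>The irrelevant ideal \<open>\<langle>x\<^sub>1, \<dots>, x\<^sub>k\<rangle>\<close>, as the kernel of the constant coefficient; it is prime since \<open>P/\<langle>x\<rangle> = A\<close> is a domain.\<close>

definition x_ideal :: "nat \<Rightarrow> nat \<Rightarrow> 'k::field mpol mpol set" where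
  "x_ideal m k = {f \<in> PC m k. lk f 0 = 0}"

lemma hom_kernel_prime:
  fixes h :: "'a::comm_ring_1 \<Rightarrow> 'b::idom"
  assumes B: "subring_set B" and h: "ring_map h" shows "prime_in B {f \<in> B. h f = 0}"
  using B unfolding prime_in_def ideal_in_def by (auto simp: ring_mapD[OF h] subring_setD)

lemma x_ideal_prime: "prime_in (PC m k) (x_ideal m k)"
  unfolding x_ideal_def by (rule hom_kernel_prime[OF subring_PC ring_map_lk0])

section \<open>Long chains below the irrelevant ideal\<close>

text \<open>If there were no such chain, then, by the construction of chains from boundary ideals, all boundary ideals of \<open>q\<close> along
  \<open>t = length L\<close> variables would contain an element outside \<open>\<langle>x\<rangle>\<close>, for one exponent \<open>c\<close> that serves the finitely many lists of
  variables. Then the rank of \<open>P/(q + \<langle>x\<rangle>\<^sup>s)\<close> would grow at most like \<open>s\<^bsup>t-1\<^esup>\<close>, against the lower bound of order \<open>s\<^sup>t\<close>.\<close>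

lemma graded_chain:
  fixes q :: "'k::field mpol mpol set"
  assumes q: "ideal_in (PC m k) q" "homog_ideal w k q" and w: "\<And>j. j < k \<Longrightarrow> 0 < w j"
    and L: "distinct L" "set L \<subseteq> {..<k}" "alg_indep const (AC m) (map indet L) q"
  shows "\<exists>p. (\<forall>i\<le>length L. prime_in (PC m k) (p i)) \<and> (\<forall>i<length L. p i \<subset> p (Suc i)) \<and> q \<subseteq> p 0 \<and>
    p (length L) \<subseteq> x_ideal m k"
proof (rule ccontr)
  assume no: "\<not> ?thesis"
  let ?B = "PC m k" and ?t = "length L"
  have B: "subring_set (PC m k :: 'k mpol mpol set)" by (rule subring_PC)
  define Z where "Z = {zs :: 'k mpol mpol list. set zs \<subseteq> indet ` {..<k} \<and> length zs = ?t}"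
  have finZ: "finite Z" unfolding Z_def by (rule finite_lists_length_eq) simp
  have ZB: "set zs \<subseteq> ?B" if "zs \<in> Z" for zs using that by (auto simp: Z_def intro: x_PC)
  have "\<exists>c. \<exists>s\<in>boundaries ?B c zs q. lk s 0 \<noteq> 0" if zs: "zs \<in> Z" for zs
  proof (rule ccontr)
    assume n: "\<not> ?thesis"
    have "boundaries ?B c zs q \<subseteq> x_ideal m k" for c
    proof
      fix f assume f: "f \<in> boundaries ?B c zs q"
      have "ideal_in ?B (boundaries ?B c zs J)" if "ideal_in ?B J" "set zs \<subseteq> ?B" for zs and J :: "'k mpol mpol set"
        using that
      proof (induct zs arbitrary: J)
        case (Cons z zs)
        then show ?case using Cons(1)[OF boundary_ideal_in[OF B Cons(2)]] by simp
      qed simp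
      from ideal_inD(1)[OF this[OF q(1) ZB[OF zs]]] f have "f \<in> ?B" by blast
      then show "f \<in> x_ideal m k" using n f by (auto simp: x_ideal_def)
    qed
    then show False
    proof -
      have "length zs = ?t" using zs by (simp add: Z_def)
      with chain_from_boundaries[OF B x_ideal_prime q(1) ZB[OF zs] \<open>\<And>c. boundaries ?B c zs q \<subseteq> x_ideal m k\<close>] no
      show ?thesis by (simp only:)
    qed
  qed
  then obtain cc where cc: "\<And>zs. zs \<in> Z \<Longrightarrow> \<exists>s\<in>boundaries ?B (cc zs) zs q. lk s 0 \<noteq> 0" by metis
  define c where "c = Max (insert 0 (cc ` Z))"
  have cle: "cc zs \<le> c" if "zs \<in> Z" for zs unfolding c_def using finZ that by (intro Max_ge) auto
  have unit: "\<exists>s\<in>boundaries ?B c zs q. lk s 0 \<noteq> 0" if "length zs = ?t" "set zs \<subseteq> indet ` {..<k}" for zs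
  proof -
    have zs: "zs \<in> Z" using that by (simp add: Z_def)
    show ?thesis using cc[OF zs] boundaries_mono[OF B q(1) ZB[OF zs] subset_refl cle[OF zs]] by blast
  qed
  have up: "u ^ ?t \<le> rank_bound k (c ^ k) ?t (Suc (sum w {..<k} * (?t * u)))" for u
    by (rule growth_lower[OF q w L lessI growth_bound[OF q(1) unit]]) auto
  show False
  proof (cases ?t)
    case 0
    then show ?thesis using up[of 1] by simp
  next
    case (Suc t')
    obtain D where D: "\<And>s. rank_bound k (c ^ k) (Suc t') s \<le> D * (s + 1) ^ t'" using rank_bound_bound by blast
    \<comment> \<open>\<open>W * u\<close> dominates the argument \<open>s + 1\<close>, and \<open>u\<close> exceeds the constant \<open>D * W ^ t\<close>, so \<open>u ^ Suc t\<close> beats the bound.\<close>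
    define W where "W = sum w {..<k} * ?t + 2"
    define u where "u = D * W ^ t' + 1"
    have "u ^ Suc t' \<le> D * (Suc (sum w {..<k} * (?t * u)) + 1) ^ t'"       using order_trans[OF up[of u, unfolded Suc] D] by (simp only: Suc)
    also have "\<dots> \<le> D * (W * u) ^ t'"
    proof (intro mult_le_mono power_mono order_refl)
      show "Suc (sum w {..<k} * (?t * u)) + 1 \<le> W * u" by (simp add: W_def u_def algebra_simps)
    qed simp
    also have "\<dots> = D * W ^ t' * u ^ t'" by (simp add: power_mult_distrib)
    also have "\<dots> < u * u ^ t'" by (simp add: u_def)
    finally show False by simp
  qed
qed

text \<open>Choose as many variables as possible that are algebraically independent over \<open>A\<close> modulo \<open>q\<close>. Every other variable is then
  algebraic over them, and together with the \<open>a\<^sub>i\<close> they serve as \<open>ts\<close> in the counting argument.\<close>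

lemma alg_indep_maximal_bound:
  fixes q :: "'k::field mpol mpol set"
  assumes pq: "prime_in (PC m k) q" and qA: "\<And>c. c \<in> AC m \<Longrightarrow> const c \<in> q \<Longrightarrow> c = 0"
  shows "\<exists>L. distinct L \<and> set L \<subseteq> {..<k} \<and> alg_indep const (AC m) (map indet L) q \<and>
    (\<forall>p r. p 0 = q \<longrightarrow> (\<forall>i\<le>r. prime_in (PC m k) (p i)) \<longrightarrow> (\<forall>i<r. p i \<subset> p (Suc i)) \<longrightarrow> r \<le> m + length L)"
proof -
  let ?B = "PC m k" and ?A = "AC m"
  have B: "subring_set (PC m k :: 'k mpol mpol set)" and A: "subring_set (AC m :: 'k mpol set)"
    by (rule subring_PC subring_AC)+
  define \<L> where "\<L> = {L. distinct L \<and> set L \<subseteq> {..<k} \<and> alg_indep const ?A (map indet L) q}"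
  have "[] \<in> \<L>" using qA by (auto simp: \<L>_def alg_indep_def)
  moreover have "length L \<le> k" if "L \<in> \<L>" for L
  proof -
    have "card (set L) \<le> card {..<k}" using that by (intro card_mono) (auto simp: \<L>_def)
    then show ?thesis using that distinct_card[of L] by (simp add: \<L>_def)
  qed
  ultimately obtain L where L: "L \<in> \<L>" and max: "\<And>L'. L' \<in> \<L> \<Longrightarrow> length L' \<le> length L"
    using ex_has_greatest_nat[of "\<lambda>L. L \<in> \<L>" "[]" length "Suc k"] by (auto simp: less_Suc_eq_le)
  define ys where "ys = (map indet L :: 'k mpol mpol list)"
  define ts where "ts = (map (\<lambda>i. const (indet i)) [0..<m] @ ys :: 'k mpol mpol list)"
  have ysB: "set ys \<subseteq> ?B" using L x_PC by (auto simp: \<L>_def ys_def)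
  have tsB: "set ts \<subseteq> ?B" using ysB ca_PC by (auto simp: ts_def)
  have ind: "alg_indep const ?A ys q" using L by (simp add: \<L>_def ys_def)
  interpret poly_mod m k q ts
  proof unfold_locales
    show "subring_set (PC m k)" by (rule subring_PC)
    show "subring_set UNIV" by (rule subring_UNIV)
    show "ring_map (\<lambda>c. const (const c))" by (rule ring_map_cc)
    show "ideal_in (PC m k) q" by (rule prime_inD(1)[OF pq])
  qed (use tsB cc_PC in \<open>auto simp: ts_def\<close>)
  have monP: "monom_of ys es \<in> Pol" for es
  proof (rule monom_of_in[OF Pol_subring])
    show "set ys \<subseteq> Pol" using Pol_ts by (auto simp: ts_def)
  qed
  have step: "finite_over (insert (indet j) Z)" if j: "j < k" "j \<notin> set L" and Z: "finite_over Z" for j Z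
  proof -
    have "\<not> alg_indep const ?A (map indet (j # L)) q"
      using max[of "j # L"] L j by (auto simp: \<L>_def)
    then obtain s c es where c: "\<And>es. c es \<in> ?A"
      "(\<Sum>es\<in>exponents (length (map indet (j # L) :: 'k mpol mpol list)) s. const (c es) * monom_of (map indet (j # L)) es) \<in> q"
      "es \<in> exponents (length (map indet (j # L) :: 'k mpol mpol list)) s" "c es \<noteq> 0" unfolding alg_indep_def by blast
    define Q where "Q = (\<lambda>e. \<Sum>es\<in>exponents (length ys) s. const (c (e # es)) * monom_of ys es)"
    let ?x = "indet j :: 'k mpol mpol"
    have rel: "(\<Sum>e<s. Q e * ?x ^ e) \<in> q"
      using c(2) by (simp add: sum_exponents_Suc Q_def ys_def sum_distrib_left mult_ac)
    have QP: "Q e \<in> Pol" for e unfolding Q_def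
      by (intro subring_sum[OF Pol_subring] Pol_mult constA_Pol c monP)
    \<comment> \<open>The largest exponent \<open>N\<close> with a nonzero coefficient gives a leading coefficient outside \<open>q\<close>, by independence of \<open>L\<close>.\<close>
    define R where "R = (\<lambda>e. e < s \<and> (\<exists>fs\<in>exponents (length ys) s. c (e # fs) \<noteq> 0))"
    obtain e fs where "es = e # fs" "e < s" "fs \<in> exponents (length ys) s" using c(3) by (auto simp: exponents_def length_Suc_conv ys_def)
    then have "R e" using c(4) by (auto simp: R_def)
    define N where "N = (GREATEST e. R e)"
    have RN: "R N" unfolding N_def by (rule GreatestI_nat[of R e s, OF \<open>R e\<close>]) (simp add: R_def)
    have big: "Q e = 0" if "e < s" "N < e" for e
    proof -
      have "\<not> R e" using Greatest_le_nat[of R e s] that by (auto simp: N_def R_def)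
      then have "c (e # fs) = 0" if "fs \<in> exponents (length ys) s" for fs using that \<open>e < s\<close> by (auto simp: R_def)
      then show ?thesis unfolding Q_def by (intro sum.neutral) (simp add: const_simps)
    qed
    have QN: "Q N \<notin> q"
    proof
      assume "Q N \<in> q"
      then have "c (N # fs) = 0" if "fs \<in> exponents (length ys) s" for fs
        using alg_indepD[where c = "\<lambda>fs. c (N # fs)", OF ind, of s fs] c(1) that by (simp add: Q_def)
      then show False using RN by (auto simp: R_def)
    qed
    have "(\<Sum>e<s. Q e * ?x ^ e) = (\<Sum>e<Suc N. Q e * ?x ^ e)"
      using RN big by (intro sum.mono_neutral_right) (auto simp: R_def not_less_eq)
    then have "Q N * ?x ^ N + (\<Sum>e<N. Q e * ?x ^ e) \<in> q" using rel by (simp add: add.commute)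
    then show ?thesis by (rule finite_over_insert[OF pq Z x_PC[OF j(1)] QP QN QP])
  qed
  have "finite_over (indet ` U \<union> set ts)" if "finite U" "U \<subseteq> {..<k}" for U
    using that
  proof (induct U rule: finite_induct)
    case empty
    then show ?case using finite_over_ts[OF prime_inD(2)[OF pq]] by simp
  next
    case (insert j U)
    show ?case
    proof (cases "j \<in> set L")
      case True
      then have "indet ` insert j U \<union> set ts = indet ` U \<union> set ts" by (auto simp: ts_def ys_def)
      then show ?thesis using insert by simp
    next
      case False
      then show ?thesis using step[of j "indet ` U \<union> set ts"] insert by simp
    qed
  qed
  then have fin: "finite_over (indet ` {..<k} \<union> set ts)" by simp
  have "r \<le> m + length L" if "p 0 = q" "\<forall>i\<le>r. prime_in ?B (p i)" "\<forall>i<r. p i \<subset> p (Suc i)" for p r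
    using chain_bound[OF pq fin, of p r] that by (simp add: ts_def ys_def)
  then show ?thesis using L by (intro exI[of _ L]) (simp add: \<L>_def)
qed

section \<open>Minors and rank\<close>

text \<open>Submatrices are selected by lists of indices. Lists may contain repetitions and may be unsorted, which makes it possible to
  border a minor by appending an index; vanishing of the minor is not affected by the order.\<close>

definition minor_matrix :: "'a mat \<Rightarrow> nat list \<Rightarrow> nat list \<Rightarrow> 'a mat" where
  "minor_matrix M is js = mat (length is) (length js) (\<lambda>(a, b). M $$ (is ! a, js ! b))"

lemma minor_matrix_carrier [simp]: "minor_matrix M is js \<in> carrier_mat (length is) (length js)" by (simp add: minor_matrix_def)

definition has_minor :: "'a::comm_ring_1 mat \<Rightarrow> nat \<Rightarrow> bool" where
  "has_minor M r \<longleftrightarrow> (\<exists>is js. length is = r \<and> length js = r \<and> set is \<subseteq> {..<dim_row M} \<and> set js \<subseteq> {..<dim_col M} \<and>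
     det (minor_matrix M is js) \<noteq> 0)"

lemma has_minorI:
  "length is = r \<Longrightarrow> length js = r \<Longrightarrow> set is \<subseteq> {..<dim_row M} \<Longrightarrow> set js \<subseteq> {..<dim_col M} \<Longrightarrow>
   det (minor_matrix M is js) \<noteq> 0 \<Longrightarrow> has_minor M r"
  unfolding has_minor_def by blast

lemma det_minor_matrix_rows_distinct:
  assumes "length is = length js" "det (minor_matrix M is js) \<noteq> (0::'a::comm_ring_1)" shows "distinct is"
proof (rule ccontr)
  assume "\<not> distinct is"
  then obtain i j where ij: "i < length is" "j < length is" "i \<noteq> j" "is ! i = is ! j" by (auto simp: distinct_conv_nth)
  have "det (minor_matrix M is js) = 0"
    by (rule det_identical_rows[of _ "length is" i j]) (use ij assms in \<open>auto simp: minor_matrix_def intro!: eq_vecI\<close>)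
  then show False using assms by simp
qed

lemma transpose_minor_matrix:
  assumes "set is \<subseteq> {..<dim_row M}" "set js \<subseteq> {..<dim_col M}"
  shows "transpose_mat (minor_matrix M is js) = minor_matrix (transpose_mat M) js is"
  using assms nth_mem by (intro eq_matI) (auto simp: minor_matrix_def subset_iff)

lemma det_minor_matrix_transpose:
  assumes "length is = length js" "set is \<subseteq> {..<dim_row M}" "set js \<subseteq> {..<dim_col M}"
  shows "det (minor_matrix (transpose_mat M) js is) = det (minor_matrix M is js :: 'a::comm_ring_1 mat)"
  using det_transpose[of "minor_matrix M is js" "length is"] minor_matrix_carrier[of M "is" js]
  by (simp only: transpose_minor_matrix[OF assms(2,3)] assms(1))

text \<open>The increasing enumeration that underlies submatrices selected by index sets.\<close>

definition sorted_elems :: "nat set \<Rightarrow> nat list" where "sorted_elems S = map (pick S) [0..<card S]"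

lemma sorted_elems: assumes "finite S" shows "length (sorted_elems S) = card S" "set (sorted_elems S) = S" "distinct (sorted_elems S)"
proof -
  show len: "length (sorted_elems S) = card S" by (simp add: sorted_elems_def)
  have "card {x \<in> S. x < i} < card S" if "i \<in> S" for i
    using that assms by (intro psubset_card_mono) auto
  then have "S \<subseteq> set (sorted_elems S)" unfolding sorted_elems_def
    by (force simp: image_iff intro: pick_card_in_set[symmetric])
  moreover have "card (set (sorted_elems S)) \<le> card S" using card_length[of "sorted_elems S"] len by simp
  ultimately show eq: "set (sorted_elems S) = S" by (metis List.finite_set card_seteq)
  show "distinct (sorted_elems S)" by (rule card_distinct) (simp add: eq len)
qed

lemma submatrix_minor_matrix:
  assumes "S \<subseteq> {..<dim_row M}" "T \<subseteq> {..<dim_col M}"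
  shows "submatrix M S T = minor_matrix M (sorted_elems S) (sorted_elems T)"
proof -
  have "{i. i < dim_row M \<and> i \<in> S} = S" "{i. i < dim_col M \<and> i \<in> T} = T" using assms by auto
  then show ?thesis by (intro eq_matI) (auto simp: submatrix_def minor_matrix_def sorted_elems_def)
qed

text \<open>Sorting the rows permutes the rows of a square matrix and changes the determinant by a sign.\<close>

lemma det_minor_matrix_sort:
  assumes "distinct is" "length is = length js" "det (minor_matrix M is js) \<noteq> (0::'a::comm_ring_1)"
  shows "det (minor_matrix M (sorted_elems (set is)) js) \<noteq> 0"
proof -
  let ?n = "length is" and ?is = "sorted_elems (set is)"
  have s: "length ?is = ?n" "set ?is = set is" "distinct ?is"
    using sorted_elems[of "set is"] distinct_card[OF assms(1)] by auto
  have "\<forall>a<?n. \<exists>b<?n. ?is ! b = is ! a"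
    using s by (metis in_set_conv_nth nth_mem)
  then obtain p0 where p0: "\<And>a. a < ?n \<Longrightarrow> p0 a < ?n \<and> ?is ! p0 a = is ! a" by metis
  define p where "p = (\<lambda>a. if a < ?n then p0 a else a)"
  have inj: "inj_on p {0..<?n}"
  proof (rule inj_onI)
    fix x y assume *: "x \<in> {0..<?n}" "y \<in> {0..<?n}" "p x = p y"
    then have "is ! x = is ! y" using p0[of x] p0[of y] by (simp add: p_def)
    then show "x = y" using * assms(1) by (simp add: nth_eq_iff_index_eq)
  qed
  moreover have "p ` {0..<?n} \<subseteq> {0..<?n}" using p0 by (auto simp: p_def)
  ultimately have "bij_betw p {0..<?n} {0..<?n}"
    by (simp add: bij_betw_def endo_inj_surj)
  then have p: "p permutes {0..<?n}" by (rule bij_imp_permutes) (simp add: p_def)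
  have "minor_matrix M is js = mat ?n ?n (\<lambda>(i, j). minor_matrix M ?is js $$ (p i, j))"
    using p0 assms(2) s by (intro eq_matI) (auto simp: minor_matrix_def p_def)
  moreover have "minor_matrix M ?is js \<in> carrier_mat ?n ?n" using s assms(2) by (simp add: minor_matrix_def)
  ultimately have "det (minor_matrix M is js) = signof p * det (minor_matrix M ?is js)" using det_permute_rows[OF _ p] by metis
  then show ?thesis using assms(3) by auto
qed

lemma has_minor_iff_submatrix:
  "has_minor M r \<longleftrightarrow> (\<exists>S T. S \<subseteq> {..<dim_row M} \<and> T \<subseteq> {..<dim_col M} \<and> card S = r \<and> card T = r \<and>
     det (submatrix M S T) \<noteq> (0::'a::comm_ring_1))"
proof
  assume "has_minor M r"
  then obtain "is" js where *: "length is = r" "length js = r" "set is \<subseteq> {..<dim_row M}" "set js \<subseteq> {..<dim_col M}"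
     "det (minor_matrix M is js) \<noteq> 0" by (auto simp: has_minor_def)
  let ?is = "sorted_elems (set is)" and ?js = "sorted_elems (set js)"
  have di: "distinct is" using det_minor_matrix_rows_distinct[of "is" js M] * by simp
  have 1: "det (minor_matrix M ?is js) \<noteq> 0" by (rule det_minor_matrix_sort[OF di]) (use * in auto)
  have si: "length ?is = r" "set ?is = set is" using sorted_elems[of "set is"] distinct_card[OF di] * by auto
  have 2: "det (minor_matrix (transpose_mat M) js ?is) \<noteq> 0"
    using 1 det_minor_matrix_transpose[of ?is js M] si * by simp
  have dj: "distinct js" using det_minor_matrix_rows_distinct[OF _ 2] si * by simp
  have 3: "det (minor_matrix (transpose_mat M) ?js ?is) \<noteq> 0" by (rule det_minor_matrix_sort[OF dj _ 2]) (use si * in auto)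
  have sj: "length ?js = r" "set ?js = set js" using sorted_elems[of "set js"] distinct_card[OF dj] * by auto
  have "det (minor_matrix M ?is ?js) \<noteq> 0" using 3 det_minor_matrix_transpose[of ?is ?js M] si sj * by simp
  then show "\<exists>S T. S \<subseteq> {..<dim_row M} \<and> T \<subseteq> {..<dim_col M} \<and> card S = r \<and> card T = r \<and> det (submatrix M S T) \<noteq> 0"
    using * distinct_card[OF di] distinct_card[OF dj] by (intro exI[of _ "set is"] exI[of _ "set js"]) (auto simp: submatrix_minor_matrix)
next
  assume "\<exists>S T. S \<subseteq> {..<dim_row M} \<and> T \<subseteq> {..<dim_col M} \<and> card S = r \<and> card T = r \<and> det (submatrix M S T) \<noteq> 0"
  then obtain S T where *: "S \<subseteq> {..<dim_row M}" "T \<subseteq> {..<dim_col M}" "card S = r" "card T = r"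
    "det (submatrix M S T) \<noteq> 0" by blast
  then have "finite S" "finite T" using finite_subset by auto
  then show "has_minor M r" unfolding has_minor_def
    using * sorted_elems[of S] sorted_elems[of T] by (intro exI[of _ "sorted_elems S"] exI[of _ "sorted_elems T"]) (auto simp: submatrix_minor_matrix)
qed

lemma subring_det:
  assumes "subring_set C" "A \<in> carrier_mat n n" "\<And>i j. i < n \<Longrightarrow> j < n \<Longrightarrow> A $$ (i, j) \<in> C"
  shows "det A \<in> C"
proof -
  have "signof p \<in> C" for p :: "nat \<Rightarrow> nat"
    using subring_setD[OF assms(1)] by (simp add: sign_def)
  then show ?thesis unfolding det_def'[OF assms(2)]
    by (intro subring_sum[OF assms(1)] subring_setD(4)[OF assms(1)] subring_prod[OF assms(1)])
      (auto intro!: assms(3) dest: permutes_in_image[THEN iffD2])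
qed

text \<open>Expand the bordered minor along its last row: the cofactors do not depend on the row \<open>i\<close> that has been appended. If all bordered
  minors vanish, the coefficients that come out express \<open>\<delta>\<close> times the new column by the columns of the minor \<open>\<delta>\<close>.\<close>

lemma column_expansion:
  fixes M :: "'a::comm_ring_1 mat"
  assumes C: "subring_set C" "\<And>i j. i < dim_row M \<Longrightarrow> j < dim_col M \<Longrightarrow> M $$ (i, j) \<in> C"
    and len: "length is = r" "length js = r" and r: "set is \<subseteq> {..<dim_row M}" "set js \<subseteq> {..<dim_col M}" "j < dim_col M"
    and van: "\<And>i. i < dim_row M \<Longrightarrow> det (minor_matrix M (is @ [i]) (js @ [j])) = 0"
  shows "\<exists>c. (\<forall>b<r. c b \<in> C) \<and> (\<forall>i<dim_row M. det (minor_matrix M is js) * M $$ (i, j) = (\<Sum>b<r. c b * M $$ (i, js ! b)))"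
proof -
  define D where "D = (\<lambda>b. mat r r (\<lambda>(a, c). M $$ (is ! a, (js @ [j]) ! (if c < b then c else Suc c))))"
  define c where "c = (\<lambda>b. - ((-1) ^ (r + b) * (-1) ^ (r + r) * det (D b)))"
  have sgn: "(-1) ^ n \<in> C" for n by (intro subring_power[OF C(1)] subring_setD[OF C(1)])
  have isr: "is ! a < dim_row M" if "a < r" for a using that len r nth_mem by blast
  have jsr: "(js @ [j]) ! b < dim_col M" if "b \<le> r" for b
  proof (cases "b < r")
    case True
    have "js ! b \<in> {..<dim_col M}" by (rule subsetD[OF r(2) nth_mem]) (use True len in simp)
    then show ?thesis using True len by (simp add: nth_append)
  qed (use that len r(3) in \<open>simp add: nth_append\<close>)
  have "det (D b) \<in> C" for b
    by (rule subring_det[OF C(1), of _ r]) (auto simp: D_def intro!: C(2) isr jsr)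
  then have "c b \<in> C" for b unfolding c_def by (intro subring_setD[OF C(1)] sgn)
  moreover have "det (minor_matrix M is js) * M $$ (i, j) = (\<Sum>b<r. c b * M $$ (i, js ! b))" if i: "i < dim_row M" for i
  proof -
    let ?B = "minor_matrix M (is @ [i]) (js @ [j])"
    have B: "?B \<in> carrier_mat (Suc r) (Suc r)" using len by (simp add: minor_matrix_def)
    have cof: "cofactor ?B r b = (-1) ^ (r + b) * det (D b)" if "b \<le> r" for b
    proof -
      have "mat_delete ?B r b = D b"
        using len that by (intro eq_matI) (auto simp: mat_delete_def D_def minor_matrix_def nth_append)
      then show ?thesis by (simp add: cofactor_def)
    qed
    have Dr: "D r = minor_matrix M is js"
      using len by (intro eq_matI) (auto simp: D_def minor_matrix_def nth_append)
    have "0 = (\<Sum>b<Suc r. ?B $$ (r, b) * cofactor ?B r b)"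
      using laplace_expansion_row[OF B, of r] van[OF i] by simp
    also have "\<dots> = (\<Sum>b<r. ?B $$ (r, b) * cofactor ?B r b) + ?B $$ (r, r) * cofactor ?B r r"
      by (rule sum.lessThan_Suc)
    also have "(\<Sum>b<r. ?B $$ (r, b) * cofactor ?B r b) = (\<Sum>b<r. M $$ (i, js ! b) * ((-1) ^ (r + b) * det (D b)))"
    proof (rule sum.cong)
      fix b assume "b \<in> {..<r}"
      then have "?B $$ (r, b) = M $$ (i, js ! b)" using len by (simp add: minor_matrix_def nth_append)
      then show "?B $$ (r, b) * cofactor ?B r b = M $$ (i, js ! b) * ((-1) ^ (r + b) * det (D b))"
        using cof[of b] \<open>b \<in> {..<r}\<close> by simp
    qed simp
    also have "?B $$ (r, r) * cofactor ?B r r = M $$ (i, j) * ((-1) ^ (r + r) * det (minor_matrix M is js))"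
    proof -
      have "?B $$ (r, r) = M $$ (i, j)" using len by (simp add: minor_matrix_def nth_append)
      then show ?thesis using cof[of r] Dr by simp
    qed
    finally have *: "M $$ (i, j) * ((-1) ^ (r + r) * det (minor_matrix M is js)) = - (\<Sum>b<r. M $$ (i, js ! b) * ((-1) ^ (r + b) * det (D b)))"
      by (simp add: eq_neg_iff_add_eq_0 add.commute)
    have one: "(-1) ^ (r + r) * (-1) ^ (r + r) = (1::'a)" by (simp add: power_add[symmetric])
    have "det (minor_matrix M is js) * M $$ (i, j) = (-1) ^ (r + r) * (M $$ (i, j) * ((-1) ^ (r + r) * det (minor_matrix M is js)))"
      using one by (simp add: mult_ac)
    also have "\<dots> = (\<Sum>b<r. c b * M $$ (i, js ! b))"
      unfolding * c_def by (simp add: sum_distrib_left sum_negf[symmetric] mult_ac)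
    finally show ?thesis .
  qed
  ultimately show ?thesis by blast
qed

lemma ring_map_det: assumes "ring_map h" "A \<in> carrier_mat n n" shows "det (map_mat h A) = h (det A)"
proof -
  interpret comm_ring_hom h by unfold_locales (simp_all add: ring_mapD[OF assms(1)])
  show ?thesis by simp
qed

lemma minor_matrix_map:
  "set is \<subseteq> {..<dim_row M} \<Longrightarrow> set js \<subseteq> {..<dim_col M} \<Longrightarrow> minor_matrix (map_mat h M) is js = map_mat h (minor_matrix M is js)"
  using nth_mem by (intro eq_matI) (auto simp: minor_matrix_def subset_iff)

lemma det_minor_matrix_map:
  assumes "ring_map h" "length is = length js" "set is \<subseteq> {..<dim_row M}" "set js \<subseteq> {..<dim_col M}"
  shows "det (minor_matrix (map_mat h M) is js) = h (det (minor_matrix M is js))"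
  unfolding minor_matrix_map[OF assms(3,4)] by (rule ring_map_det[OF assms(1)]) (use minor_matrix_carrier[of M "is" js] assms(2) in simp)

lemma has_minor_map: assumes "ring_map h" "has_minor (map_mat h M) r" shows "has_minor M r"
proof -
  obtain "is" js where *: "length is = r" "length js = r" "set is \<subseteq> {..<dim_row M}" "set js \<subseteq> {..<dim_col M}"
     "det (minor_matrix (map_mat h M) is js) \<noteq> 0" using assms(2) by (auto simp: has_minor_def)
  then have "det (minor_matrix M is js) \<noteq> 0" using det_minor_matrix_map[OF assms(1), of "is" js M] ring_mapD(4)[OF assms(1)] by auto
  then show ?thesis using * by (intro has_minorI)
qed

lemma has_minor_map_inj: assumes "ring_map h" "inj h" shows "has_minor (map_mat h M) r \<longleftrightarrow> has_minor M r"
proof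
  assume "has_minor M r"
  then obtain "is" js where *: "length is = r" "length js = r" "set is \<subseteq> {..<dim_row M}" "set js \<subseteq> {..<dim_col M}"
     "det (minor_matrix M is js) \<noteq> 0" by (auto simp: has_minor_def)
  moreover have "h (det (minor_matrix M is js)) \<noteq> 0" using *(5) assms ring_mapD(4)[OF assms(1)] by (metis injD)
  ultimately show "has_minor (map_mat h M) r" by (intro has_minorI[of "is" _ js]) (simp_all add: det_minor_matrix_map[OF assms(1)])
qed (rule has_minor_map[OF assms(1)])

lemma has_minor_0: "has_minor M 0"
  unfolding has_minor_def by (intro exI[of _ "[]"]) (simp add: minor_matrix_def det_def')

lemma has_minor_le: "has_minor M r \<Longrightarrow> r \<le> dim_row M"
  unfolding has_minor_def using det_minor_matrix_rows_distinct by (metis card_lessThan card_mono distinct_card finite_lessThan)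

definition subfield_set :: "'a::field set \<Rightarrow> bool" where
  "subfield_set Q \<longleftrightarrow> subring_set Q \<and> (\<forall>x\<in>Q. inverse x \<in> Q)"

lemma set_ring_field: assumes "subfield_set Q" shows "field (set_ring Q)"
proof -
  have Q: "subring_set Q" using assms by (simp add: subfield_set_def)
  interpret cring "set_ring Q" by (rule set_ring_cring[OF Q])
  show ?thesis
  proof (rule cring_fieldI2)
    show "\<exists>b\<in>carrier (set_ring Q). a \<otimes>\<^bsub>set_ring Q\<^esub> b = \<one>\<^bsub>set_ring Q\<^esub>"
      if "a \<in> carrier (set_ring Q)" "a \<noteq> \<zero>\<^bsub>set_ring Q\<^esub>" for a
      using that assms by (intro bexI[of _ "inverse a"]) (auto simp: subfield_set_def)
  qed simp
qed

lemma vec_module_simps: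
  "carrier (vec_module F s) = {v \<in> carrier_vec s. \<forall>i<s. v $ i \<in> carrier F}"
  "\<zero>\<^bsub>vec_module F s\<^esub> = 0\<^sub>v s" "x \<oplus>\<^bsub>vec_module F s\<^esub> y = x + y" "c \<odot>\<^bsub>vec_module F s\<^esub> x = c \<cdot>\<^sub>v x"
  by (simp_all add: vec_module_def)

lemma vec_module_vectorspace: assumes Qf: "subfield_set Q" shows "vectorspace (set_ring Q) (vec_module (set_ring Q) s)"
proof -
  have Q: "subring_set Q" using Qf by (simp add: subfield_set_def)
  interpret field "set_ring Q" by (rule set_ring_field[OF Qf])
  have "abelian_group (vec_module (set_ring Q) s)"
  proof (rule abelian_groupI)
    fix x assume "x \<in> carrier (vec_module (set_ring Q) s)"
    then show "\<exists>y\<in>carrier (vec_module (set_ring Q) s). y \<oplus>\<^bsub>vec_module (set_ring Q) s\<^esub> x = \<zero>\<^bsub>vec_module (set_ring Q) s\<^esub>"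
      by (intro bexI[of _ "- x"]) (auto simp: vec_module_simps subring_setD[OF Q])
  qed (auto simp: vec_module_simps subring_setD[OF Q] intro: comm_add_vec assoc_add_vec)
  then have "Module.module (set_ring Q) (vec_module (set_ring Q) s)"
    by (intro moduleI is_cring)
      (auto simp: vec_module_simps subring_setD[OF Q] add_smult_distrib_vec smult_add_distrib_vec smult_smult_assoc)
  then show ?thesis unfolding vectorspace_def using set_ring_field[OF Qf] by simp
qed

text \<open>The columns of a nonzero minor of maximal size are linearly independent, and by the column expansion every other column
  depends on them. Coefficients stay in the subfield \<open>Q\<close> as they are minors.\<close>

lemma rank_over_eqI:
  fixes M :: "'a::field mat"
  assumes Qf: "subfield_set Q" and M: "\<And>i j. i < dim_row M \<Longrightarrow> j < dim_col M \<Longrightarrow> M $$ (i, j) \<in> Q"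
    and r: "has_minor M r" "\<not> has_minor M (Suc r)"
  shows "rank_over (set_ring Q) M = r"
proof -
  have Q: "subring_set Q" using Qf by (simp add: subfield_set_def)
  define s where "s = dim_row M"
  define V where "V = vec_module (set_ring Q) s"
  interpret V: vectorspace "set_ring Q" V unfolding V_def by (rule vec_module_vectorspace[OF Qf])
  obtain "is" js where *: "length is = r" "length js = r" "set is \<subseteq> {..<dim_row M}" "set js \<subseteq> {..<dim_col M}"
     "det (minor_matrix M is js) \<noteq> 0" using r(1) unfolding has_minor_def by blast
  have Vdim: "dim_vec x = s" if "x \<in> carrier V" for x
    using that unfolding V_def vec_module_simps by simp
  have Vops: "x \<oplus>\<^bsub>V\<^esub> y = x + y" "c \<odot>\<^bsub>V\<^esub> x = c \<cdot>\<^sub>v x" "\<zero>\<^bsub>V\<^esub> = 0\<^sub>v s" for x y c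
    unfolding V_def vec_module_simps by simp_all
  have finsum: "finsum V f A $ i = (\<Sum>x\<in>A. f x $ i)" if "finite A" "f \<in> A \<rightarrow> carrier V" "i < s" for f i and A :: "'a vec set"
    using that
  proof (induct A rule: finite_induct)
    case empty
    have "finsum V f {} = 0\<^sub>v s" unfolding V.finsum_empty Vops(3) ..
    then show ?case using empty by simp
  next
    case (insert x A)
    have fA: "f \<in> A \<rightarrow> carrier V" "f x \<in> carrier V" using insert(4) by auto
    have "finsum V f A \<in> carrier V" by (rule V.finsum_closed[OF fA(1)])
    from Vdim[OF this] have "(f x + finsum V f A) $ i = f x $ i + finsum V f A $ i" using insert(5) by simp
    then show ?case
      unfolding V.finsum_insert[OF insert(1,2) fA] Vops(1) using insert(1,2) insert(3)[OF fA(1) insert(5)] by simp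
  qed
  have lc: "V.lincomb a A $ i = (\<Sum>x\<in>A. a x * x $ i)"
    if "finite A" "A \<subseteq> carrier V" "a \<in> A \<rightarrow> Q" "i < s" for a i and A :: "'a vec set"
  proof -
    have "(\<lambda>x. a x \<odot>\<^bsub>V\<^esub> x) \<in> A \<rightarrow> carrier V"
    proof
      fix x assume "x \<in> A"
      then show "a x \<odot>\<^bsub>V\<^esub> x \<in> carrier V" using that(2,3) by (intro V.smult_closed) auto
    qed
    then have "V.lincomb a A $ i = (\<Sum>x\<in>A. (a x \<odot>\<^bsub>V\<^esub> x) $ i)"
      unfolding V.lincomb_def by (rule finsum[OF that(1) _ that(4)])
    also have "\<dots> = (\<Sum>x\<in>A. a x * x $ i)"
    proof (rule sum.cong)
      fix x assume "x \<in> A"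
      then have "dim_vec x = s" using Vdim that(2) by blast
      then show "(a x \<odot>\<^bsub>V\<^esub> x) $ i = a x * x $ i" using that(4) by (simp add: Vops)
    qed simp
    finally show ?thesis .
  qed
  have colsV: "set (cols M) \<subseteq> carrier V"
    using M by (auto simp: cols_def V_def vec_module_simps s_def)
  define u where "u = (\<lambda>b. col M (js ! b))"
  have jsr: "js ! b < dim_col M" if "b < r" for b using subsetD[OF *(4) nth_mem, of b] that *(2) by simp
  have isr: "is ! b < dim_row M" if "b < r" for b using subsetD[OF *(3) nth_mem, of b] that *(1) by simp
  have indep: "\<forall>b<r. al b = 0" if al: "\<forall>i<s. (\<Sum>b<r. al b * M $$ (i, js ! b)) = 0" for al
  proof -
    have "minor_matrix M is js *\<^sub>v vec r al = 0\<^sub>v r"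
    proof (rule eq_vecI)
      fix a assume "a < dim_vec (0\<^sub>v r :: 'a vec)"
      then have a: "a < r" by simp
      have "(minor_matrix M is js *\<^sub>v vec r al) $ a = (\<Sum>b\<in>{0..<r}. M $$ (is ! a, js ! b) * al b)"
        using a *(1,2) by (simp add: minor_matrix_def scalar_prod_def)
      also have "\<dots> = (\<Sum>b<r. al b * M $$ (is ! a, js ! b))"
        by (simp add: lessThan_atLeast0 mult.commute)
      also have "\<dots> = 0" using al isr[OF a] by (simp add: s_def)
      finally show "(minor_matrix M is js *\<^sub>v vec r al) $ a = 0\<^sub>v r $ a" using a by simp
    qed (simp add: *(1) minor_matrix_def)
    moreover have "minor_matrix M is js \<in> carrier_mat r r" using minor_matrix_carrier[of M "is" js] *(1,2) by simp
    note det_0_iff_vec_prod_zero_field[OF this]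
    moreover have "vec r al \<in> carrier_vec r" by simp
    ultimately have "vec r al = 0\<^sub>v r" using *(5) by blast
    then have e: "vec r al $ b = 0\<^sub>v r $ b" for b by simp
    have "al b = 0" if "b < r" for b using e[of b] that by simp
    then show ?thesis by simp
  qed
  have inj: "inj_on u {..<r}"
  proof (rule inj_onI)
    fix b b' assume b: "b \<in> {..<r}" "b' \<in> {..<r}" "u b = u b'"
    show "b = b'"
    proof (rule ccontr)
      assume n: "b \<noteq> b'"
      have "M $$ (i, js ! b) = M $$ (i, js ! b')" if "i < s" for i
      proof -
        have "u b $ i = u b' $ i" using b(3) by simp
        then show ?thesis using that jsr[of b] jsr[of b'] b(1,2) by (simp add: u_def s_def)
      qed
      then have "\<forall>i<s. (\<Sum>c<r. (if c = b then 1 else if c = b' then -1 else 0) * M $$ (i, js ! c)) = 0"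
      proof (intro allI impI)
        fix i assume i: "i < s"
        have "(\<Sum>c<r. (if c = b then 1 else if c = b' then -1 else 0) * M $$ (i, js ! c)) =
          (\<Sum>c\<in>{b, b'}. (if c = b then 1 else if c = b' then -1 else 0) * M $$ (i, js ! c))"
          using b by (intro sum.mono_neutral_right) auto
        also have "\<dots> = 0" using n \<open>\<And>i. i < s \<Longrightarrow> M $$ (i, js ! b) = M $$ (i, js ! b')\<close>[OF i] by simp
        finally show "(\<Sum>c<r. (if c = b then 1 else if c = b' then -1 else 0) * M $$ (i, js ! c)) = 0" .
      qed
      from indep[OF this] show False using b by auto
    qed
  qed
  define U where "U = u ` {..<r}"
  have U: "finite U" "card U = r" "U \<subseteq> set (cols M)"
    using card_image[OF inj] jsr by (auto simp: U_def u_def cols_def)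
  have UV: "U \<subseteq> carrier V" using U colsV by auto
  have uidx: "u b $ i = M $$ (i, js ! b)" if "b < r" "i < s" for b i
    using that jsr by (simp add: u_def s_def)
  have sumU: "(\<Sum>x\<in>U. f x) = (\<Sum>b<r. f (u b))" for f :: "'a vec \<Rightarrow> 'a"
    unfolding U_def by (rule sum.reindex_cong[OF inj]) auto
  have li: "V.lin_indpt U"
  proof
    assume "V.lin_dep U"
    then obtain a v where a: "a \<in> U \<rightarrow> Q" "V.lincomb a U = \<zero>\<^bsub>V\<^esub>" "v \<in> U" "a v \<noteq> 0"
      using V.finite_lin_dep[OF U(1) _ UV] by auto
    have "\<forall>i<s. (\<Sum>b<r. a (u b) * M $$ (i, js ! b)) = 0"
    proof (intro allI impI)
      fix i assume i: "i < s"
      have "(\<Sum>x\<in>U. a x * x $ i) = 0"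
        using lc[OF U(1) UV a(1) i] a(2) i by (simp add: Vops)
      then show "(\<Sum>b<r. a (u b) * M $$ (i, js ! b)) = 0" unfolding sumU using uidx i by simp
    qed
    from indep[OF this] show False using a(3,4) by (auto simp: U_def)
  qed
  have "maximal U (\<lambda>T. T \<subseteq> set (cols M) \<and> V.lin_indpt T)"
    unfolding maximal_def
  proof (intro conjI allI impI)
    fix T assume T: "U \<subseteq> T \<and> T \<subseteq> set (cols M) \<and> V.lin_indpt T"
    show "T = U"
    proof (rule ccontr)
      assume "T \<noteq> U"
      then obtain v where v: "v \<in> T" "v \<notin> U" using T by blast
      then obtain j where j: "j < dim_col M" "v = col M j" using T by (auto simp: cols_def subset_iff)
      have "\<exists>c. (\<forall>b<r. c b \<in> Q) \<and> (\<forall>i<dim_row M. det (minor_matrix M is js) * M $$ (i, j) = (\<Sum>b<r. c b * M $$ (i, js ! b)))"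
      proof (rule column_expansion[OF Q M *(1-4) j(1)])
        fix i assume "i < dim_row M"
        then show "det (minor_matrix M (is @ [i]) (js @ [j])) = 0"
          using has_minorI[of "is @ [i]" "Suc r" "js @ [j]" M] r(2) * j(1) by auto
      qed auto
      then obtain c where c: "\<And>b. b < r \<Longrightarrow> c b \<in> Q"
        "\<And>i. i < s \<Longrightarrow> det (minor_matrix M is js) * M $$ (i, j) = (\<Sum>b<r. c b * M $$ (i, js ! b))" by (auto simp: s_def)
      \<comment> \<open>The expansion read as a linear dependence, with coefficient \<open>\<delta> \<noteq> 0\<close> at the new column.\<close>
      define a where "a = (\<lambda>x. if x = v then det (minor_matrix M is js) else - c (the_inv_into {..<r} u x))"
      have au: "a (u b) = - c b" if "b < r" for b
        using that v by (auto simp: a_def the_inv_into_f_f[OF inj] U_def)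
      have dQ: "det (minor_matrix M is js) \<in> Q"
        by (rule subring_det[OF Q, of _ r]) (use * isr jsr M in \<open>auto simp: minor_matrix_def\<close>)
      have aQ: "a \<in> insert v U \<rightarrow> Q" using dQ c(1) au subring_setD(6)[OF Q] by (auto simp: U_def a_def)
      have ins: "insert v U \<subseteq> carrier V" using UV j(1) colsV v T by auto
      have "V.lincomb a (insert v U) = \<zero>\<^bsub>V\<^esub>"
      proof (rule eq_vecI)
        have "V.lincomb a (insert v U) \<in> carrier V"
          by (rule V.lincomb_closed[OF ins]) (use aQ in simp)
        then show "dim_vec (V.lincomb a (insert v U)) = dim_vec \<zero>\<^bsub>V\<^esub>" by (simp add: Vops Vdim)
        fix i assume "i < dim_vec \<zero>\<^bsub>V\<^esub>"
        then have i: "i < s" by (simp add: Vops)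
        have "V.lincomb a (insert v U) $ i = (\<Sum>x\<in>insert v U. a x * x $ i)"
          using lc[OF _ ins aQ i] U(1) by simp
        also have "\<dots> = a v * v $ i + (\<Sum>x\<in>U. a x * x $ i)" using U(1) v by simp
        also have "(\<Sum>x\<in>U. a x * x $ i) = (\<Sum>b<r. - c b * M $$ (i, js ! b))"
          unfolding sumU by (rule sum.cong) (use au uidx i in auto)
        also have "a v * v $ i = det (minor_matrix M is js) * M $$ (i, j)" using j i by (simp add: a_def s_def)
        finally show "V.lincomb a (insert v U) $ i = \<zero>\<^bsub>V\<^esub> $ i"
          using c(2)[OF i] i by (simp add: sum_negf Vops)
      qed
      then have "V.lin_dep T" unfolding V.lin_dep_def
        using U(1) v(1) T aQ *(5)
        by (intro exI[of _ "insert v U"] exI[of _ a] exI[of _ v]) (simp add: a_def)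
      then show False using T by simp
    qed
  next
    show "U \<subseteq> set (cols M)" by (rule U(3))
    show "V.lin_indpt U" by (rule li)
  qed
  from V.dim_span[OF colsV _ this] have "vectorspace.dim (set_ring Q) (V\<lparr>carrier := V.span (set (cols M))\<rparr>) = card U"
    by simp
  then show ?thesis using U(2) by (simp add: rank_over_def V_def s_def Let_def)
qed

text \<open>Sizes of nonzero minors form an initial segment: at a gap the criterion above would give the rank two different values.\<close>

lemma has_minor_iff_rank_over:
  fixes M :: "'a::field mat"
  assumes Qf: "subfield_set Q" and M: "\<And>i j. i < dim_row M \<Longrightarrow> j < dim_col M \<Longrightarrow> M $$ (i, j) \<in> Q"
  shows "has_minor M r \<longleftrightarrow> r \<le> rank_over (set_ring Q) M"
    "has_minor M (rank_over (set_ring Q) M)"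
proof -
  define m where "m = Max {r. has_minor M r}"
  have fin: "finite {r. has_minor M r}" by (rule finite_subset[of _ "{..dim_row M}"]) (auto dest: has_minor_le)
  have mm: "has_minor M m" using Max_in[OF fin] has_minor_0[of M] by (auto simp: m_def)
  have mx: "r \<le> m" if "has_minor M r" for r using Max_ge[OF fin, of r] that by (simp add: m_def)
  have rk: "rank_over (set_ring Q) M = m" by (rule rank_over_eqI[OF Qf M mm]) (use mx[of "Suc m"] in auto)
  show "has_minor M (rank_over (set_ring Q) M)" using mm rk by simp
  show "has_minor M r \<longleftrightarrow> r \<le> rank_over (set_ring Q) M" for r
  proof
    assume "r \<le> rank_over (set_ring Q) M"
    show "has_minor M r"
    proof (rule ccontr)
      assume nr: "\<not> has_minor M r"
      define l where "l = Max {r'. r' < r \<and> has_minor M r'}"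
      have ne: "{r'. r' < r \<and> has_minor M r'} \<noteq> {}" using nr has_minor_0[of M] by (cases "r = 0") auto
      have l: "l < r" "has_minor M l" using Max_in[OF _ ne] by (auto simp: l_def)
      have "\<not> has_minor M (Suc l)"
      proof
        assume a: "has_minor M (Suc l)"
        then have "Suc l < r" using nr l(1) by (cases "Suc l = r") auto
        then have "Suc l \<le> l" using a unfolding l_def by (intro Max_ge) auto
        then show False by simp
      qed
      then have "rank_over (set_ring Q) M = l" by (intro rank_over_eqI[OF Qf M l(2)])
      then show False using l \<open>r \<le> rank_over (set_ring Q) M\<close> by simp
    qed
  next
    assume "has_minor M r"
    from mx[OF this] show "r \<le> rank_over (set_ring Q) M" by (simp only: rk)
  qed
qed

lemma subfield_UNIV: "subfield_set UNIV" by (simp add: subfield_set_def subring_set_def)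

lemma rank_K_eq: "rank_K M = rank_over (set_ring UNIV) M"
proof -
  have 1: "set_ring UNIV = (class_ring :: 'a::field ring)" by (simp add: set_ring_def)
  have 2: "vec_module class_ring s = module_vec TYPE('a) s" for s by (simp add: vec_module_def module_vec_def)
  show ?thesis unfolding rank_K_def rank_over_def Let_def 1 2 vec_space.rank_def ..
qed

lemma has_minor_iff_rank_K: "has_minor M r \<longleftrightarrow> r \<le> rank_K M" "has_minor M (rank_K M)"
  unfolding rank_K_eq using has_minor_iff_rank_over[OF subfield_UNIV, of M] by auto

lemma Fract_1: "ring_map (\<lambda>p::'a::idom. Fract p 1)" "inj (\<lambda>p::'a::idom. Fract p 1)"
  by (auto simp: ring_map_def inj_def eq_fract One_fract_def)

lemma quotient_field_subfield:
  assumes "subring_set (B::'a::idom set)"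
  shows "subfield_set {Fract a b | a b. a \<in> B \<and> b \<in> B \<and> b \<noteq> 0}"
  unfolding subfield_set_def subring_set_def
proof (intro conjI ballI)
  let ?Q = "{Fract a b | a b. a \<in> B \<and> b \<in> B \<and> b \<noteq> 0}"
  note S = subring_setD[OF assms]
  show "1 \<in> ?Q" using S(1) by (intro CollectI exI[of _ 1]) (simp add: One_fract_def)
  fix x y assume "x \<in> ?Q" "y \<in> ?Q"
  then obtain a b c d where *: "x = Fract a b" "y = Fract c d" "a \<in> B" "b \<in> B" "b \<noteq> 0" "c \<in> B" "d \<in> B" "d \<noteq> 0" by blast
  have "x - y = Fract (a * d - c * b) (b * d)" "x * y = Fract (a * c) (b * d)" using * by auto
  moreover have "a * d - c * b \<in> B" "a * c \<in> B" "b * d \<in> B" "b * d \<noteq> 0" using * S(3,4) by auto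
  ultimately show "x - y \<in> ?Q" "x * y \<in> ?Q" by blast+
next
  let ?Q = "{Fract a b | a b. a \<in> B \<and> b \<in> B \<and> b \<noteq> 0}"
  fix x assume "x \<in> ?Q"
  then obtain a b where *: "x = Fract a b" "a \<in> B" "b \<in> B" "b \<noteq> 0" by blast
  show "inverse x \<in> ?Q"
  proof (cases "a = 0")
    case True
    then have "inverse x = Fract 0 1" using * by (simp add: fract_collapse)
    moreover have "0 \<in> B" "1 \<in> B" "(1::'a) \<noteq> 0" using subring_setD(1,2)[OF assms] by simp_all
    ultimately show ?thesis by blast
  next
    case False
    then show ?thesis using * by auto
  qed
qed

text \<open>The minors of a matrix over \<open>A\<close> vanish over the quotient field if and only if they vanish in \<open>A\<close>.\<close>

lemma has_minor_iff_rank_A: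
  fixes M :: "'k::field mpol mat"
  assumes M: "\<And>i j. i < dim_row M \<Longrightarrow> j < dim_col M \<Longrightarrow> M $$ (i, j) \<in> AC m"
  shows "has_minor M r \<longleftrightarrow> r \<le> rank_A m M" "has_minor M (rank_A m M)"
proof -
  let ?Q = "{Fract a b | a b. a \<in> (AC m :: 'k mpol set) \<and> b \<in> AC m \<and> b \<noteq> 0}"
  have "quotient_field (carrier (A_ring m)) = set_ring ?Q"
    unfolding quotient_field_def A_ring_eq by (simp add: set_ring_def)
  then have rk: "rank_A m M = rank_over (set_ring ?Q) (map_mat (\<lambda>p. Fract p 1) M)"
    by (simp only: rank_A_def)
  have "map_mat (\<lambda>p. Fract p 1) M $$ (i, j) \<in> ?Q"
    if "i < dim_row (map_mat (\<lambda>p. Fract p 1) M)" "j < dim_col (map_mat (\<lambda>p. Fract p 1) M)" for i j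
  proof -
    have "M $$ (i, j) \<in> AC m" "(1 :: 'k mpol) \<in> AC m" using that M[of i j] subring_setD(1)[OF subring_AC] by auto
    moreover have "(1::'k mpol) \<noteq> 0" by simp
    ultimately have "Fract (M $$ (i, j)) 1 \<in> ?Q" by blast
    moreover have "map_mat (\<lambda>p. Fract p 1) M $$ (i, j) = Fract (M $$ (i, j)) 1" using that by simp
    ultimately show ?thesis by (simp only:)
  qed
  from has_minor_iff_rank_over[OF quotient_field_subfield[OF subring_AC] this]
  show "has_minor M r \<longleftrightarrow> r \<le> rank_A m M" "has_minor M (rank_A m M)"
    unfolding rk has_minor_map_inj[OF Fract_1] by auto
qed

section \<open>Localization at a prime\<close>

text \<open>The localization of \<open>R\<close> at \<open>p\<close>: \<open>fr a s\<close> is the fraction \<open>a/s\<close>, \<open>emb\<close> the canonical map, \<open>ctr\<close> and \<open>ext\<close> are contraction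
  and extension of ideals.\<close>

locale localize = primeideal p R for p and R (structure)
begin

abbreviation "S \<equiv> carrier R - p"
abbreviation "fr \<equiv> loc_frac R p"
abbreviation "L \<equiv> localization R p"

lemma one_S [simp]: "\<one> \<in> S" using one_imp_carrier I_notcarr by auto
lemma mult_S: "s \<in> S \<Longrightarrow> t \<in> S \<Longrightarrow> s \<otimes> t \<in> S" using I_prime by auto
lemma SR: "s \<in> S \<Longrightarrow> s \<in> carrier R" by simp
lemma rel_iff: "((a, s), (b, t)) \<in> loc_rel R p \<longleftrightarrow> a \<in> carrier R \<and> b \<in> carrier R \<and> s \<in> S \<and> t \<in> S \<and>
   (\<exists>u\<in>S. u \<otimes> (t \<otimes> a \<ominus> s \<otimes> b) = \<zero>)"
  by (simp add: loc_rel_def)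

lemma relI: "a \<in> carrier R \<Longrightarrow> b \<in> carrier R \<Longrightarrow> s \<in> S \<Longrightarrow> t \<in> S \<Longrightarrow> u \<in> S \<Longrightarrow>
  u \<otimes> (t \<otimes> a \<ominus> s \<otimes> b) = \<zero> \<Longrightarrow> ((a, s), (b, t)) \<in> loc_rel R p"
  unfolding rel_iff by blast

lemma rel_sym: assumes "((a, s), (b, t)) \<in> loc_rel R p" shows "((b, t), (a, s)) \<in> loc_rel R p"
proof -
  obtain u where u: "a \<in> carrier R" "b \<in> carrier R" "s \<in> S" "t \<in> S" "u \<in> S" "u \<otimes> (t \<otimes> a \<ominus> s \<otimes> b) = \<zero>"
    using assms unfolding rel_iff by blast
  note c = u(1,2) u(3-5)[THEN SR]
  have "u \<otimes> (s \<otimes> b \<ominus> t \<otimes> a) = \<ominus> (u \<otimes> (t \<otimes> a \<ominus> s \<otimes> b))" using c by algebra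
  then show ?thesis using relI[OF u(2,1,4,3,5)] u(6) by simp
qed

lemma rel_trans:
  assumes "((a, s), (b, t)) \<in> loc_rel R p" "((b, t), (c, r)) \<in> loc_rel R p"
  shows "((a, s), (c, r)) \<in> loc_rel R p"
proof -
  obtain u where u: "a \<in> carrier R" "b \<in> carrier R" "s \<in> S" "t \<in> S" "u \<in> S" "u \<otimes> (t \<otimes> a \<ominus> s \<otimes> b) = \<zero>"
    using assms unfolding rel_iff by blast
  obtain v where v: "c \<in> carrier R" "r \<in> S" "v \<in> S" "v \<otimes> (r \<otimes> b \<ominus> t \<otimes> c) = \<zero>"
    using assms unfolding rel_iff by blast
  note C = u(1,2) u(3-5)[THEN SR] v(1) v(2,3)[THEN SR]
  have "(u \<otimes> v \<otimes> t) \<otimes> (r \<otimes> a \<ominus> s \<otimes> c) = (v \<otimes> r) \<otimes> (u \<otimes> (t \<otimes> a \<ominus> s \<otimes> b)) \<oplus> (u \<otimes> s) \<otimes> (v \<otimes> (r \<otimes> b \<ominus> t \<otimes> c))"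
    using C by algebra
  also have "\<dots> = \<zero>" using C unfolding u(6) v(4) by simp
  finally show ?thesis by (intro relI[OF u(1) v(1) u(3) v(2), of "u \<otimes> v \<otimes> t"] mult_S u(5) v(3) u(4))
qed

lemma rel_refl: "a \<in> carrier R \<Longrightarrow> s \<in> S \<Longrightarrow> ((a, s), (a, s)) \<in> loc_rel R p"
  by (rule relI[OF _ _ _ _ one_S]) (simp_all add: minus_eq r_neg)

lemma fr_iff_rel:
  assumes "a \<in> carrier R" "s \<in> S"
  shows "fr a s = fr b t \<longleftrightarrow> ((a, s), (b, t)) \<in> loc_rel R p"
proof
  assume "fr a s = fr b t"
  moreover have "(a, s) \<in> fr a s" using rel_refl[OF assms] by (simp add: loc_frac_def)
  ultimately have "((b, t), (a, s)) \<in> loc_rel R p" by (simp add: loc_frac_def)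
  then show "((a, s), (b, t)) \<in> loc_rel R p" by (rule rel_sym)
next
  assume r: "((a, s), (b, t)) \<in> loc_rel R p"
  show "fr a s = fr b t"
  proof (rule Set.set_eqI)
    fix x :: "'a \<times> 'a" obtain c u where x: "x = (c, u)" by (cases x)
    show "x \<in> fr a s \<longleftrightarrow> x \<in> fr b t"
      unfolding x loc_frac_def using rel_trans[OF r] rel_trans[OF rel_sym[OF r]] by blast
  qed
qed

lemma fr_eq_iff:
  assumes "a \<in> carrier R" "s \<in> S" "b \<in> carrier R" "t \<in> S"
  shows "fr a s = fr b t \<longleftrightarrow> (\<exists>u\<in>S. u \<otimes> (t \<otimes> a \<ominus> s \<otimes> b) = \<zero>)"
  unfolding fr_iff_rel[OF assms(1,2)] rel_iff using assms by simp

lemma fr_eqI: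
  assumes "a \<in> carrier R" "s \<in> S" "b \<in> carrier R" "t \<in> S" "t \<otimes> a = s \<otimes> b"
  shows "fr a s = fr b t"
proof -
  have "\<one> \<otimes> (t \<otimes> a \<ominus> s \<otimes> b) = \<zero>" using assms SR[OF assms(2)] by (simp add: minus_eq r_neg)
  then show ?thesis unfolding fr_eq_iff[OF assms(1-4)] by (intro bexI[OF _ one_S])
qed

lemma carrier_L: "carrier L = {fr a s | a s. a \<in> carrier R \<and> s \<in> S}"
  by (auto simp: localization_def quotient_def loc_frac_def)

lemma L_cases: assumes "x \<in> carrier L" obtains a s where "a \<in> carrier R" "s \<in> S" "x = fr a s"
  using assms unfolding carrier_L by blast

lemma fr_closed: "a \<in> carrier R \<Longrightarrow> s \<in> S \<Longrightarrow> fr a s \<in> carrier L"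
  unfolding carrier_L by blast

lemma mem_frD: assumes "(a', s') \<in> fr a s"
  shows "((a, s), (a', s')) \<in> loc_rel R p"
  using assms by (simp add: loc_frac_def)

lemma UN_frac2:
  assumes "a \<in> carrier R" "s \<in> S" "b \<in> carrier R" "t \<in> S"
    and "\<And>a' s' b' t'. ((a, s), (a', s')) \<in> loc_rel R p \<Longrightarrow> ((b, t), (b', t')) \<in> loc_rel R p \<Longrightarrow> F a' s' b' t' = F a s b t"
  shows "(\<Union>(a', s')\<in>fr a s. \<Union>(b', t')\<in>fr b t. F a' s' b' t') = F a s b t"
proof -
  have m: "(a, s) \<in> fr a s" "(b, t) \<in> fr b t"
    using rel_refl[OF assms(1,2)] rel_refl[OF assms(3,4)] by (simp_all add: loc_frac_def)
  have eq: "F a' s' b' t' = F a s b t" if "(a', s') \<in> fr a s" "(b', t') \<in> fr b t" for a' s' b' t'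
    using assms(5)[OF mem_frD[OF that(1)] mem_frD[OF that(2)]] .
  have "(\<Union>(b', t')\<in>fr b t. F a' s' b' t') = F a s b t" if "(a', s') \<in> fr a s" for a' s'
    by (rule UN_constant_eq[OF m(2)]) (use eq[OF that] in auto)
  then show ?thesis by (intro UN_constant_eq[OF m(1)]) auto
qed

lemma fr_mult:
  assumes "a \<in> carrier R" "s \<in> S" "b \<in> carrier R" "t \<in> S"
  shows "fr a s \<otimes>\<^bsub>L\<^esub> fr b t = fr (a \<otimes> b) (s \<otimes> t)"
proof -
  have "fr a s \<otimes>\<^bsub>L\<^esub> fr b t = (\<Union>(a', s')\<in>fr a s. \<Union>(b', t')\<in>fr b t. fr (a' \<otimes> b') (s' \<otimes> t'))"
    by (simp add: localization_def)
  also have "\<dots> = fr (a \<otimes> b) (s \<otimes> t)"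
  proof (rule UN_frac2[OF assms])
    fix a' s' b' t' assume r: "((a, s), (a', s')) \<in> loc_rel R p" "((b, t), (b', t')) \<in> loc_rel R p"
    obtain u where u: "a' \<in> carrier R" "s' \<in> S" "u \<in> S" "u \<otimes> (s' \<otimes> a \<ominus> s \<otimes> a') = \<zero>" using r(1) unfolding rel_iff by blast
    obtain v where v: "b' \<in> carrier R" "t' \<in> S" "v \<in> S" "v \<otimes> (t' \<otimes> b \<ominus> t \<otimes> b') = \<zero>" using r(2) unfolding rel_iff by blast
    note C = assms(1,3) assms(2,4)[THEN SR] u(1) v(1) u(2,3)[THEN SR] v(2,3)[THEN SR]
    have "(u \<otimes> v) \<otimes> ((s' \<otimes> t') \<otimes> (a \<otimes> b) \<ominus> (s \<otimes> t) \<otimes> (a' \<otimes> b')) =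
       (v \<otimes> t' \<otimes> b) \<otimes> (u \<otimes> (s' \<otimes> a \<ominus> s \<otimes> a')) \<oplus> (u \<otimes> s \<otimes> a') \<otimes> (v \<otimes> (t' \<otimes> b \<ominus> t \<otimes> b'))"
      using C by algebra
    also have "\<dots> = \<zero>" using C unfolding u(4) v(4) by simp
    finally have "((a \<otimes> b, s \<otimes> t), (a' \<otimes> b', s' \<otimes> t')) \<in> loc_rel R p"
      by (intro relI[where u = "u \<otimes> v"] mult_S m_closed assms u v)
    from fr_iff_rel[OF m_closed[OF assms(1,3)] mult_S[OF assms(2,4)], THEN iffD2, OF this]
    show "fr (a' \<otimes> b') (s' \<otimes> t') = fr (a \<otimes> b) (s \<otimes> t)" by (rule sym)
  qed
  finally show ?thesis .
qed

lemma fr_add: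
  assumes "a \<in> carrier R" "s \<in> S" "b \<in> carrier R" "t \<in> S"
  shows "fr a s \<oplus>\<^bsub>L\<^esub> fr b t = fr (t \<otimes> a \<oplus> s \<otimes> b) (s \<otimes> t)"
proof -
  have "fr a s \<oplus>\<^bsub>L\<^esub> fr b t = (\<Union>(a', s')\<in>fr a s. \<Union>(b', t')\<in>fr b t. fr (t' \<otimes> a' \<oplus> s' \<otimes> b') (s' \<otimes> t'))"
    by (simp add: localization_def)
  also have "\<dots> = fr (t \<otimes> a \<oplus> s \<otimes> b) (s \<otimes> t)"
  proof (rule UN_frac2[OF assms])
    fix a' s' b' t' assume r: "((a, s), (a', s')) \<in> loc_rel R p" "((b, t), (b', t')) \<in> loc_rel R p"
    obtain u where u: "a' \<in> carrier R" "s' \<in> S" "u \<in> S" "u \<otimes> (s' \<otimes> a \<ominus> s \<otimes> a') = \<zero>" using r(1) unfolding rel_iff by blast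
    obtain v where v: "b' \<in> carrier R" "t' \<in> S" "v \<in> S" "v \<otimes> (t' \<otimes> b \<ominus> t \<otimes> b') = \<zero>" using r(2) unfolding rel_iff by blast
    note C = assms(1,3) assms(2,4)[THEN SR] u(1) v(1) u(2,3)[THEN SR] v(2,3)[THEN SR]
    have "(u \<otimes> v) \<otimes> ((s' \<otimes> t') \<otimes> (t \<otimes> a \<oplus> s \<otimes> b) \<ominus> (s \<otimes> t) \<otimes> (t' \<otimes> a' \<oplus> s' \<otimes> b')) =
       (v \<otimes> t \<otimes> t') \<otimes> (u \<otimes> (s' \<otimes> a \<ominus> s \<otimes> a')) \<oplus> (u \<otimes> s \<otimes> s') \<otimes> (v \<otimes> (t' \<otimes> b \<ominus> t \<otimes> b'))"
      using C by algebra
    also have "\<dots> = \<zero>" using C unfolding u(4) v(4) by simp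
    finally have r: "((t \<otimes> a \<oplus> s \<otimes> b, s \<otimes> t), (t' \<otimes> a' \<oplus> s' \<otimes> b', s' \<otimes> t')) \<in> loc_rel R p"
      by (intro relI[where u = "u \<otimes> v"] mult_S a_closed m_closed C u(2,3) v(2,3) assms(2,4))
    have "t \<otimes> a \<oplus> s \<otimes> b \<in> carrier R" using C by simp
    from fr_iff_rel[OF this mult_S[OF assms(2,4)], THEN iffD2, OF r]
    show "fr (t' \<otimes> a' \<oplus> s' \<otimes> b') (s' \<otimes> t') = fr (t \<otimes> a \<oplus> s \<otimes> b) (s \<otimes> t)" by (rule sym)
  qed
  finally show ?thesis .
qed

lemma L_one: "\<one>\<^bsub>L\<^esub> = fr \<one> \<one>" and L_zero: "\<zero>\<^bsub>L\<^esub> = fr \<zero> \<one>"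
  by (simp_all add: localization_def)

lemma L_cring: "cring L"
proof (rule cringI)
  show "abelian_group L"
  proof (rule abelian_groupI)
    fix x y assume "x \<in> carrier L" "y \<in> carrier L"
    then obtain a s b t where x: "a \<in> carrier R" "s \<in> S" "x = fr a s" and y: "b \<in> carrier R" "t \<in> S" "y = fr b t"
      by (metis L_cases)
    note C = x(1) y(1) x(2)[THEN SR] y(2)[THEN SR]
    show "x \<oplus>\<^bsub>L\<^esub> y \<in> carrier L" unfolding x(3) y(3) fr_add[OF x(1,2) y(1,2)] using C
      by (intro fr_closed mult_S x y) simp
    have 1: "t \<otimes> a \<oplus> s \<otimes> b = s \<otimes> b \<oplus> t \<otimes> a" "s \<otimes> t = t \<otimes> s" using C by algebra+
    show "x \<oplus>\<^bsub>L\<^esub> y = y \<oplus>\<^bsub>L\<^esub> x" unfolding x(3) y(3) fr_add[OF x(1,2) y(1,2)] fr_add[OF y(1,2) x(1,2)] 1 ..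
    fix z assume "z \<in> carrier L"
    then obtain c r where z: "c \<in> carrier R" "r \<in> S" "z = fr c r" by (metis L_cases)
    note C' = C z(1) z(2)[THEN SR]
    have 2: "t \<otimes> a \<oplus> s \<otimes> b \<in> carrier R" "r \<otimes> b \<oplus> t \<otimes> c \<in> carrier R" using C' by simp_all
    have 3: "r \<otimes> (t \<otimes> a \<oplus> s \<otimes> b) \<oplus> (s \<otimes> t) \<otimes> c = (t \<otimes> r) \<otimes> a \<oplus> s \<otimes> (r \<otimes> b \<oplus> t \<otimes> c)"
      "(s \<otimes> t) \<otimes> r = s \<otimes> (t \<otimes> r)" using C' by algebra+
    show "(x \<oplus>\<^bsub>L\<^esub> y) \<oplus>\<^bsub>L\<^esub> z = x \<oplus>\<^bsub>L\<^esub> (y \<oplus>\<^bsub>L\<^esub> z)"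
      unfolding x(3) y(3) z(3) fr_add[OF x(1,2) y(1,2)] fr_add[OF y(1,2) z(1,2)]
        fr_add[OF 2(1) mult_S[OF x(2) y(2)] z(1,2)] fr_add[OF x(1,2) 2(2) mult_S[OF y(2) z(2)]] 3 ..
  next
    show "\<zero>\<^bsub>L\<^esub> \<in> carrier L" unfolding L_zero by (intro fr_closed one_S) simp
    fix x assume "x \<in> carrier L"
    then obtain a s where x: "a \<in> carrier R" "s \<in> S" "x = fr a s" by (metis L_cases)
    note C = x(1) x(2)[THEN SR]
    have 1: "s \<otimes> \<zero> \<oplus> \<one> \<otimes> a = a" "\<one> \<otimes> s = s" using C by simp_all
    show "\<zero>\<^bsub>L\<^esub> \<oplus>\<^bsub>L\<^esub> x = x" unfolding L_zero x(3) fr_add[OF zero_closed one_S x(1,2)] 1 ..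
    have n: "\<ominus> a \<in> carrier R" using C by simp
    have "fr (\<ominus> a) s \<oplus>\<^bsub>L\<^esub> x = \<zero>\<^bsub>L\<^esub>"
      unfolding L_zero x(3) fr_add[OF n x(2) x(1,2)]
    proof (rule fr_eqI)
      have "s \<otimes> \<ominus> a \<oplus> s \<otimes> a = \<zero>" using C by algebra
      then show "\<one> \<otimes> (s \<otimes> \<ominus> a \<oplus> s \<otimes> a) = s \<otimes> s \<otimes> \<zero>" using C by simp
    qed (use C mult_S[OF x(2) x(2)] one_S in simp_all)
    then show "\<exists>y\<in>carrier L. y \<oplus>\<^bsub>L\<^esub> x = \<zero>\<^bsub>L\<^esub>" using fr_closed[OF n x(2)] by blast
  qed
  show "Group.comm_monoid L"
  proof (rule comm_monoidI)
    show "\<one>\<^bsub>L\<^esub> \<in> carrier L" unfolding L_one by (intro fr_closed one_S one_closed)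
    fix x assume "x \<in> carrier L"
    then obtain a s where x: "a \<in> carrier R" "s \<in> S" "x = fr a s" by (metis L_cases)
    show "\<one>\<^bsub>L\<^esub> \<otimes>\<^bsub>L\<^esub> x = x"
      unfolding L_one x(3) fr_mult[OF one_closed one_S x(1,2)] using x(1) SR[OF x(2)] by simp
    fix y assume "y \<in> carrier L"
    then obtain b t where y: "b \<in> carrier R" "t \<in> S" "y = fr b t" by (metis L_cases)
    show "x \<otimes>\<^bsub>L\<^esub> y \<in> carrier L" unfolding x(3) y(3) fr_mult[OF x(1,2) y(1,2)]
      by (intro fr_closed mult_S m_closed x y)
    show "x \<otimes>\<^bsub>L\<^esub> y = y \<otimes>\<^bsub>L\<^esub> x" unfolding x(3) y(3) fr_mult[OF x(1,2) y(1,2)] fr_mult[OF y(1,2) x(1,2)]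
      using m_comm[OF x(1) y(1)] m_comm[OF SR[OF x(2)] SR[OF y(2)]] by simp
    fix z assume "z \<in> carrier L"
    then obtain c r where z: "c \<in> carrier R" "r \<in> S" "z = fr c r" by (metis L_cases)
    show "(x \<otimes>\<^bsub>L\<^esub> y) \<otimes>\<^bsub>L\<^esub> z = x \<otimes>\<^bsub>L\<^esub> (y \<otimes>\<^bsub>L\<^esub> z)"
      unfolding x(3) y(3) z(3) fr_mult[OF x(1,2) y(1,2)] fr_mult[OF y(1,2) z(1,2)]
        fr_mult[OF m_closed[OF x(1) y(1)] mult_S[OF x(2) y(2)] z(1,2)]
        fr_mult[OF x(1,2) m_closed[OF y(1) z(1)] mult_S[OF y(2) z(2)]]
      using m_assoc[OF x(1) y(1) z(1)] m_assoc[OF SR[OF x(2)] SR[OF y(2)] SR[OF z(2)]] by simp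
  qed
  fix x y z assume "x \<in> carrier L" "y \<in> carrier L" "z \<in> carrier L"
  then obtain a s b t c r where x: "a \<in> carrier R" "s \<in> S" "x = fr a s" and y: "b \<in> carrier R" "t \<in> S" "y = fr b t"
    and z: "c \<in> carrier R" "r \<in> S" "z = fr c r" by (metis L_cases)
  note C = x(1) y(1) z(1) x(2)[THEN SR] y(2)[THEN SR] z(2)[THEN SR]
  have 1: "t \<otimes> a \<oplus> s \<otimes> b \<in> carrier R" using C by simp
  show "(x \<oplus>\<^bsub>L\<^esub> y) \<otimes>\<^bsub>L\<^esub> z = x \<otimes>\<^bsub>L\<^esub> z \<oplus>\<^bsub>L\<^esub> y \<otimes>\<^bsub>L\<^esub> z"
    unfolding x(3) y(3) z(3) fr_add[OF x(1,2) y(1,2)] fr_mult[OF x(1,2) z(1,2)] fr_mult[OF y(1,2) z(1,2)]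
      fr_mult[OF 1 mult_S[OF x(2) y(2)] z(1,2)]
      fr_add[OF m_closed[OF x(1) z(1)] mult_S[OF x(2) z(2)] m_closed[OF y(1) z(1)] mult_S[OF y(2) z(2)]]
  proof (rule fr_eqI)
    show "s \<otimes> r \<otimes> (t \<otimes> r) \<otimes> ((t \<otimes> a \<oplus> s \<otimes> b) \<otimes> c) = s \<otimes> t \<otimes> r \<otimes> (t \<otimes> r \<otimes> (a \<otimes> c) \<oplus> s \<otimes> r \<otimes> (b \<otimes> c))"
      using C by algebra
    show "(t \<otimes> a \<oplus> s \<otimes> b) \<otimes> c \<in> carrier R" "t \<otimes> r \<otimes> (a \<otimes> c) \<oplus> s \<otimes> r \<otimes> (b \<otimes> c) \<in> carrier R" using C by simp_all
  qed (intro mult_S x y z)+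
qed

sublocale L: cring L by (rule L_cring)

abbreviation "emb a \<equiv> fr a \<one>"

lemma emb_hom: "emb \<in> Ring.ring_hom R L"
proof (rule ring_hom_memI)
  fix a b assume ab: "a \<in> carrier R" "b \<in> carrier R"
  show "emb a \<in> carrier L" by (intro fr_closed ab one_S)
  show "emb (a \<otimes> b) = emb a \<otimes>\<^bsub>L\<^esub> emb b" unfolding fr_mult[OF ab(1) one_S ab(2) one_S] by simp
  show "emb (a \<oplus> b) = emb a \<oplus>\<^bsub>L\<^esub> emb b" unfolding fr_add[OF ab(1) one_S ab(2) one_S] using ab by simp
qed (simp add: L_one)

lemma emb_ring_hom: "ring_hom_ring R L emb"
  by (rule ring_hom_ringI2[OF ring_axioms L.ring_axioms emb_hom])

lemma fr_split: assumes "a \<in> carrier R" "s \<in> S" shows "fr a s = fr \<one> s \<otimes>\<^bsub>L\<^esub> emb a" "emb a = emb s \<otimes>\<^bsub>L\<^esub> fr a s"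
proof -
  show "fr a s = fr \<one> s \<otimes>\<^bsub>L\<^esub> emb a"
    unfolding fr_mult[OF one_closed assms(2) assms(1) one_S] using assms(1) SR[OF assms(2)] by simp
  show "emb a = emb s \<otimes>\<^bsub>L\<^esub> fr a s"
    unfolding fr_mult[OF SR[OF assms(2)] one_S assms]
    by (rule fr_eqI) (use assms SR[OF assms(2)] mult_S[OF one_S assms(2)] one_S in simp_all)
qed

definition ctr :: "('a \<times> 'a) set set \<Rightarrow> 'a set" where "ctr Q = {a \<in> carrier R. emb a \<in> Q}"
definition ext :: "'a set \<Rightarrow> ('a \<times> 'a) set set" where "ext J = {fr a s | a s. a \<in> J \<and> s \<in> S}"

lemma ctr_prime: "primeideal Q L \<Longrightarrow> primeideal (ctr Q) R"
  unfolding ctr_def using ring_hom_ring.primeideal_vimage[OF emb_ring_hom is_cring] by blast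

lemma emb_unit_notin: assumes "ideal Q L" "Q \<noteq> carrier L" "s \<in> S" shows "emb s \<notin> Q"
proof
  interpret Q: ideal Q L by (rule assms(1))
  assume "emb s \<in> Q"
  then have "emb s \<otimes>\<^bsub>L\<^esub> fr \<one> s \<in> Q" by (intro Q.I_r_closed fr_closed one_closed assms(3))
  moreover have "emb s \<otimes>\<^bsub>L\<^esub> fr \<one> s = \<one>\<^bsub>L\<^esub>" using fr_split(2)[OF one_closed assms(3)] by (simp add: L_one)
  ultimately show False using Q.one_imp_carrier assms(2) by simp
qed

lemma ctr_subset: assumes "primeideal Q L" shows "ctr Q \<subseteq> p"
proof -
  interpret Q: primeideal Q L by (rule assms)
  have "emb s \<notin> Q" if "s \<in> S" for s using emb_unit_notin[OF Q.is_ideal _ that] Q.I_notcarr by auto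
  then show ?thesis by (auto simp: ctr_def)
qed

lemma ctr_strict: assumes "primeideal Q L" "primeideal Q' L" "Q \<subset> Q'" shows "ctr Q \<subset> ctr Q'"
proof -
  interpret Q: primeideal Q L by (rule assms)
  interpret Q': primeideal Q' L by (rule assms)
  obtain x where x: "x \<in> Q'" "x \<notin> Q" using assms(3) by blast
  then obtain a s where a: "a \<in> carrier R" "s \<in> S" "x = fr a s" by (metis L_cases Q'.Icarr)
  have "emb a \<in> Q'" unfolding fr_split(2)[OF a(1,2)] using x(1) a by (intro Q'.I_l_closed fr_closed one_S SR) auto
  moreover have "emb a \<notin> Q"
  proof
    assume "emb a \<in> Q"
    then have "fr a s \<in> Q" unfolding fr_split(1)[OF a(1,2)] using a by (intro Q.I_l_closed fr_closed one_closed)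
    then show False using x a by simp
  qed
  ultimately show ?thesis using assms(3) a(1) by (auto simp: ctr_def)
qed

lemma ext_ideal: assumes "ideal J R" shows "ideal (ext J) L"
proof (rule idealI)
  interpret J: ideal J R by (rule assms)
  show "ring L" by (rule L.ring_axioms)
  show "subgroup (ext J) (add_monoid L)"
  proof (rule group.subgroupI)
    show "group (add_monoid L)" by (rule L.a_group)
    show "ext J \<subseteq> carrier (add_monoid L)" using J.Icarr by (auto simp: ext_def intro: fr_closed)
    have "fr \<zero> \<one> \<in> ext J"
      unfolding ext_def using additive_subgroup.zero_closed[OF J.additive_subgroup_axioms] one_S by blast
    then show "ext J \<noteq> {}" by blast
    fix x assume "x \<in> ext J"
    then obtain a s where x: "a \<in> J" "s \<in> S" "x = fr a s" by (auto simp: ext_def simp del: Diff_iff)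
    note aR = J.Icarr[OF x(1)]
    have "fr (\<ominus> a) s \<oplus>\<^bsub>L\<^esub> x = \<zero>\<^bsub>L\<^esub>"
      unfolding L_zero x(3) fr_add[OF a_inv_closed[OF aR] x(2) aR x(2)]
    proof (rule fr_eqI)
      note C = aR SR[OF x(2)]
      have "s \<otimes> \<ominus> a \<oplus> s \<otimes> a = \<zero>" using C by algebra
      then show "\<one> \<otimes> (s \<otimes> \<ominus> a \<oplus> s \<otimes> a) = s \<otimes> s \<otimes> \<zero>" using C by simp
    qed (use aR SR[OF x(2)] mult_S[OF x(2) x(2)] one_S in simp_all)
    then have "\<ominus>\<^bsub>L\<^esub> x = fr (\<ominus> a) s"
      using L.minus_equality[of "fr (\<ominus> a) s" x] fr_closed[OF aR x(2)] fr_closed[OF a_inv_closed[OF aR] x(2)] x(3) by simp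
    then show "inv\<^bsub>add_monoid L\<^esub> x \<in> ext J"
      using x J.a_inv_closed[OF x(1)] unfolding a_inv_def by (auto simp: ext_def simp del: Diff_iff)
    fix y assume "y \<in> ext J"
    then obtain b t where y: "b \<in> J" "t \<in> S" "y = fr b t" by (auto simp: ext_def simp del: Diff_iff)
    have "t \<otimes> a \<oplus> s \<otimes> b \<in> J" using x y by (intro J.a_closed J.I_l_closed SR)
    then show "x \<otimes>\<^bsub>add_monoid L\<^esub> y \<in> ext J"
      using fr_add[OF aR x(2) J.Icarr[OF y(1)] y(2)] mult_S[OF x(2) y(2)] x(3) y(3)
      by (auto simp: ext_def simp del: Diff_iff)
  qed
  fix x y assume "x \<in> ext J" "y \<in> carrier L"
  then obtain a s b t where x: "a \<in> J" "s \<in> S" "x = fr a s" and y: "b \<in> carrier R" "t \<in> S" "y = fr b t"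
    by (auto simp: ext_def carrier_L simp del: Diff_iff)
  have "y \<otimes>\<^bsub>L\<^esub> x = fr (b \<otimes> a) (t \<otimes> s)" "x \<otimes>\<^bsub>L\<^esub> y = fr (a \<otimes> b) (s \<otimes> t)"
    unfolding x(3) y(3) by (rule fr_mult[OF y(1,2) J.Icarr[OF x(1)] x(2)], rule fr_mult[OF J.Icarr[OF x(1)] x(2) y(1,2)])
  then show "y \<otimes>\<^bsub>L\<^esub> x \<in> ext J" "x \<otimes>\<^bsub>L\<^esub> y \<in> ext J"
    using J.I_l_closed[OF x(1) y(1)] J.I_r_closed[OF x(1) y(1)] mult_S[OF x(2) y(2)] mult_S[OF y(2) x(2)]
    by (auto simp: ext_def simp del: Diff_iff)
qed

text \<open>Denominators can be cancelled in a prime inside \<open>p\<close>.\<close>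

lemma fr_ext_iff:
  assumes J: "primeideal J R" "J \<subseteq> p" and a: "a \<in> carrier R" "s \<in> S"
  shows "fr a s \<in> ext J \<longleftrightarrow> a \<in> J"
proof
  interpret J: primeideal J R by (rule J)
  assume "fr a s \<in> ext J"
  then obtain b t where b: "b \<in> J" "t \<in> S" "fr a s = fr b t" by (auto simp: ext_def simp del: Diff_iff)
  note bR = J.Icarr[OF b(1)]
  obtain u where u: "u \<in> S" "u \<otimes> (t \<otimes> a \<ominus> s \<otimes> b) = \<zero>" using b(3) fr_eq_iff[OF a bR b(2)] by blast
  note C = a(1) bR SR[OF a(2)] SR[OF b(2)] SR[OF u(1)]
  have "(u \<otimes> t) \<otimes> a = u \<otimes> (t \<otimes> a \<ominus> s \<otimes> b) \<oplus> u \<otimes> s \<otimes> b" using C by algebra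
  also have "\<dots> = u \<otimes> s \<otimes> b" using C by (simp add: u(2))
  also have "\<dots> \<in> J" using b(1) C by (intro J.I_l_closed m_closed)
  finally have "u \<otimes> t \<in> J \<or> a \<in> J" using C by (intro J.I_prime) simp_all
  then show "a \<in> J" using J(2) mult_S[OF u(1) b(2)] by auto
next
  assume "a \<in> J" then show "fr a s \<in> ext J" using a unfolding ext_def by blast
qed

lemma ext_prime: assumes J: "primeideal J R" "J \<subseteq> p" shows "primeideal (ext J) L"
proof (rule primeidealI)
  interpret J: primeideal J R by (rule J)
  show "ideal (ext J) L" by (rule ext_ideal[OF J.is_ideal])
  show "cring L" by (rule L_cring)
  have "fr \<one> \<one> \<notin> ext J" using fr_ext_iff[OF J one_closed one_S] J(2) one_S by auto
  then show "carrier L \<noteq> ext J" using fr_closed[OF one_closed one_S] by blast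
  fix x y assume "x \<in> carrier L" "y \<in> carrier L" "x \<otimes>\<^bsub>L\<^esub> y \<in> ext J"
  moreover from this obtain a s b t where x: "a \<in> carrier R" "s \<in> S" "x = fr a s" and y: "b \<in> carrier R" "t \<in> S" "y = fr b t"
    by (metis L_cases)
  ultimately have "fr (a \<otimes> b) (s \<otimes> t) \<in> ext J" using fr_mult[OF x(1,2) y(1,2)] by simp
  then have "a \<otimes> b \<in> J" using fr_ext_iff[OF J m_closed[OF x(1) y(1)] mult_S[OF x(2) y(2)]] by simp
  then show "x \<in> ext J \<or> y \<in> ext J"
    unfolding x(3) y(3) fr_ext_iff[OF J x(1,2)] fr_ext_iff[OF J y(1,2)] by (rule J.I_prime[OF x(1) y(1)])
qed

lemma ext_strict:
  assumes "primeideal J R" "primeideal J' R" "J' \<subseteq> p" "J \<subset> J'" shows "ext J \<subset> ext J'"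
proof -
  obtain a where a: "a \<in> J'" "a \<notin> J" using assms(4) by blast
  have aR: "a \<in> carrier R" using a(1) assms(2) by (meson ideal.Icarr primeideal.axioms(1))
  have Jp: "J \<subseteq> p" using assms by blast
  have "emb a \<in> ext J'" "emb a \<notin> ext J"
    using fr_ext_iff[OF assms(2,3) aR one_S] fr_ext_iff[OF assms(1) Jp aR one_S] a by auto
  moreover have "ext J \<subseteq> ext J'" using assms(4) by (auto simp: ext_def simp del: Diff_iff)
  ultimately show ?thesis by blast
qed

text \<open>Every proper ideal of the localization contracts into \<open>p\<close>, because elements outside \<open>p\<close> become units.\<close>

lemma L_maximal: "maximalideal (ext p) L" "(THE M. maximalideal M L) = ext p"
proof -
  have pp: "primeideal p R" by (rule primeideal)
  interpret E: primeideal "ext p" L by (rule ext_prime[OF pp subset_refl])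
  have sub: "Q \<subseteq> ext p" if Q: "ideal Q L" "Q \<noteq> carrier L" for Q
  proof
    interpret Q: ideal Q L by (rule Q)
    fix x assume x: "x \<in> Q"
    then obtain a s where a: "a \<in> carrier R" "s \<in> S" "x = fr a s" by (metis L_cases Q.Icarr)
    have "emb a \<in> Q" unfolding fr_split(2)[OF a(1,2)] using x a by (intro Q.I_l_closed fr_closed one_S SR) auto
    then have "a \<in> p" using emb_unit_notin[OF Q] a(1) by blast
    then show "x \<in> ext p" using a unfolding ext_def by blast
  qed
  show m: "maximalideal (ext p) L"
  proof (rule maximalidealI)
    show "ideal (ext p) L" by (rule E.is_ideal)
    show "carrier L \<noteq> ext p" using E.I_notcarr .
    fix J assume "ideal J L" "ext p \<subseteq> J" "J \<subseteq> carrier L"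
    then show "J = ext p \<or> J = carrier L" using sub[of J] by blast
  qed
  show "(THE M. maximalideal M L) = ext p"
  proof (rule the_equality[where P = "\<lambda>M. maximalideal M L", OF m])
    fix M assume M: "maximalideal M L"
    then interpret M: maximalideal M L .
    have "M \<subseteq> ext p" using sub[OF M.is_ideal] M.I_notcarr by auto
    then show "M = ext p" using M.I_maximal[OF E.is_ideal] E.a_subset E.I_notcarr by blast
  qed
qed

end

definition spec_chain :: "('a, 'b) ring_scheme \<Rightarrow> nat \<Rightarrow> (nat \<Rightarrow> 'a set) \<Rightarrow> bool" where
  "spec_chain R r f \<longleftrightarrow> (\<forall>i\<le>r. primeideal (f i) R) \<and> (\<forall>i<r. f i \<subset> f (Suc i))"

lemma spec_chain_subset: assumes "spec_chain R r f" "i \<le> j" "j \<le> r" shows "f i \<subseteq> f j"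
  using assms(2,3)
proof (induct rule: dec_induct)
  case (step n)
  then have "f n \<subset> f (Suc n)" using assms(1) by (simp add: spec_chain_def)
  then show ?case using step by auto
qed simp

text \<open>Extension and contraction identify the primes of the localization with the primes of \<open>R\<close> inside \<open>p\<close> and preserve strict
  inclusions.\<close>

lemma (in localize) krull_dim_L: "krull_dim L = Sup {enat r | r. \<exists>f. spec_chain R r f \<and> f r \<subseteq> p}"
proof -
  have "(\<exists>g. spec_chain L r g) \<longleftrightarrow> (\<exists>f. spec_chain R r f \<and> f r \<subseteq> p)" for r
  proof
    assume "\<exists>g. spec_chain L r g"
    then obtain g where g: "spec_chain L r g" by blast
    show "\<exists>f. spec_chain R r f \<and> f r \<subseteq> p"
      using g ctr_prime ctr_strict ctr_subset unfolding spec_chain_def by (intro exI[of _ "\<lambda>i. ctr (g i)"]) auto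
  next
    assume "\<exists>f. spec_chain R r f \<and> f r \<subseteq> p"
    then obtain f where f: "spec_chain R r f" "f r \<subseteq> p" by blast
    have sub: "f i \<subseteq> p" if "i \<le> r" for i using spec_chain_subset[OF f(1) that] f(2) by auto
    show "\<exists>g. spec_chain L r g"
    proof (intro exI[of _ "\<lambda>i. ext (f i)"], unfold spec_chain_def, intro conjI allI impI)
      fix i assume "i \<le> r"
      then show "primeideal (ext (f i)) L" using f(1) sub by (intro ext_prime) (auto simp: spec_chain_def)
    next
      fix i assume "i < r"
      then show "ext (f i) \<subset> ext (f (Suc i))" using f(1) sub by (intro ext_strict) (auto simp: spec_chain_def)
    qed
  qed
  then show ?thesis unfolding krull_dim_def spec_chain_def by simp
qed

lemma krull_dim_spec_chain: "krull_dim R = Sup {enat r | r. \<exists>f. spec_chain R r f}"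
  unfolding krull_dim_def spec_chain_def ..

section \<open>Dimension of cotangent spaces\<close>

text \<open>A bijection with coordinate vectors that respects the operations turns a record into a vector space of that dimension. This spares
  checking the module axioms of the cotangent space by hand.\<close>

lemma transported_dim:
  fixes V :: "('k::field, 'x) module" and \<phi> :: "'k vec \<Rightarrow> 'x"
  assumes bij: "bij_betw \<phi> (carrier_vec n) (carrier V)"
    and add: "\<And>v w. v \<in> carrier_vec n \<Longrightarrow> w \<in> carrier_vec n \<Longrightarrow> \<phi> v \<oplus>\<^bsub>V\<^esub> \<phi> w = \<phi> (v + w)"
    and smult: "\<And>c v. v \<in> carrier_vec n \<Longrightarrow> c \<odot>\<^bsub>V\<^esub> \<phi> v = \<phi> (c \<cdot>\<^sub>v v)"
    and zero: "\<zero>\<^bsub>V\<^esub> = \<phi> (0\<^sub>v n)"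
  shows "vectorspace.dim (class_ring :: 'k ring) V = n"
proof -
  have inj: "inj_on \<phi> (carrier_vec n)" and sur: "\<phi> ` carrier_vec n = carrier V"
    using bij by (auto simp: bij_betw_def)
  have cl: "\<phi> v \<in> carrier V" if "v \<in> carrier_vec n" for v using sur that by blast
  have ex: "\<exists>v\<in>carrier_vec n. x = \<phi> v" if "x \<in> carrier V" for x using sur that by blast
  have ag: "abelian_group V"
  proof (rule abelian_groupI)
    fix x y z assume "x \<in> carrier V" "y \<in> carrier V" "z \<in> carrier V"
    then obtain u v w where u: "u \<in> carrier_vec n" "v \<in> carrier_vec n" "w \<in> carrier_vec n" "x = \<phi> u" "y = \<phi> v" "z = \<phi> w"
      using ex by metis
    show "x \<oplus>\<^bsub>V\<^esub> y \<oplus>\<^bsub>V\<^esub> z = x \<oplus>\<^bsub>V\<^esub> (y \<oplus>\<^bsub>V\<^esub> z)"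
      using u by (simp add: add assoc_add_vec[of u n])
  next
    fix x y assume "x \<in> carrier V" "y \<in> carrier V"
    then obtain u v where u: "u \<in> carrier_vec n" "v \<in> carrier_vec n" "x = \<phi> u" "y = \<phi> v"
      using ex by metis
    show "x \<oplus>\<^bsub>V\<^esub> y \<in> carrier V" using u by (simp add: add cl)
    show "x \<oplus>\<^bsub>V\<^esub> y = y \<oplus>\<^bsub>V\<^esub> x" using u by (simp add: add comm_add_vec[of u n])
  next
    fix x assume "x \<in> carrier V"
    then obtain u where u: "u \<in> carrier_vec n" "x = \<phi> u" using ex by metis
    show "\<zero>\<^bsub>V\<^esub> \<oplus>\<^bsub>V\<^esub> x = x" using u by (simp add: add zero)
    show "\<exists>y\<in>carrier V. y \<oplus>\<^bsub>V\<^esub> x = \<zero>\<^bsub>V\<^esub>"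
    proof (intro bexI[of _ "\<phi> ((-1) \<cdot>\<^sub>v u)"])
      have "(-1) \<cdot>\<^sub>v u + u = 0\<^sub>v n" using u(1) by (intro eq_vecI) auto
      then show "\<phi> ((-1) \<cdot>\<^sub>v u) \<oplus>\<^bsub>V\<^esub> x = \<zero>\<^bsub>V\<^esub>" using u by (simp add: add zero)
    qed (use u in \<open>simp add: cl\<close>)
  qed (simp add: zero cl)
  have mod: "Module.module (class_ring :: 'k ring) V"
  proof (rule moduleI[OF class_cring.cring_axioms ag])
    fix a b :: 'k and x assume "x \<in> carrier V"
    then obtain u where u: "u \<in> carrier_vec n" "x = \<phi> u" using ex by metis
    show "a \<odot>\<^bsub>V\<^esub> x \<in> carrier V" using u by (simp add: smult cl)
    show "(a \<oplus>\<^bsub>class_ring\<^esub> b) \<odot>\<^bsub>V\<^esub> x = a \<odot>\<^bsub>V\<^esub> x \<oplus>\<^bsub>V\<^esub> b \<odot>\<^bsub>V\<^esub> x"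
      using u by (simp add: smult add add_smult_distrib_vec)
    show "a \<otimes>\<^bsub>class_ring\<^esub> b \<odot>\<^bsub>V\<^esub> x = a \<odot>\<^bsub>V\<^esub> (b \<odot>\<^bsub>V\<^esub> x)"
      using u by (simp add: smult smult_smult_assoc)
    show "\<one>\<^bsub>class_ring\<^esub> \<odot>\<^bsub>V\<^esub> x = x" using u by (simp add: smult)
    fix y assume "y \<in> carrier V"
    then obtain v where v: "v \<in> carrier_vec n" "y = \<phi> v" using ex by metis
    show "a \<odot>\<^bsub>V\<^esub> (x \<oplus>\<^bsub>V\<^esub> y) = a \<odot>\<^bsub>V\<^esub> x \<oplus>\<^bsub>V\<^esub> a \<odot>\<^bsub>V\<^esub> y"
      using u v by (simp add: smult add smult_add_distrib_vec[of u n])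
  qed
  interpret V: vectorspace "class_ring :: 'k ring" V
    unfolding vectorspace_def using mod class_field by blast
  interpret K: vec_space "TYPE('k)" n .
  interpret T: linear_map "class_ring :: 'k ring" "module_vec TYPE('k) n" V \<phi>
  proof unfold_locales
    show "\<phi> \<in> module_hom class_ring (module_vec TYPE('k) n) V"
      unfolding module_hom_def by (auto simp: module_vec_simps cl add smult)
  qed
  have "vectorspace.dim class_ring (module_vec TYPE('k) n) = V.dim"
    by (rule T.dim_eq) (use inj sur K.fin_dim in \<open>simp_all add: module_vec_simps\<close>)
  then show ?thesis using K.dim_is_n by simp
qed

text \<open>The \<open>z\<^sub>i\<close> induce a \<open>K\<close>-basis of \<open>N/N\<^sup>2\<close>, stated by elements of \<open>S\<close> so that it can be verified before cosets are formed.\<close>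

definition cot_basis :: "('k::field \<Rightarrow> 'a) \<Rightarrow> ('a, 'b) ring_scheme \<Rightarrow> 'a set \<Rightarrow> (nat \<Rightarrow> 'a) \<Rightarrow> nat \<Rightarrow> bool" where
  "cot_basis \<iota> S N z l \<longleftrightarrow> (\<forall>i<l. z i \<in> N) \<and>
     (\<forall>x\<in>N. \<exists>v. x \<ominus>\<^bsub>S\<^esub> (\<Oplus>\<^bsub>S\<^esub>i\<in>{..<l}. \<iota> (v i) \<otimes>\<^bsub>S\<^esub> z i) \<in> N \<cdot>\<^bsub>S\<^esub> N) \<and>
     (\<forall>v. (\<Oplus>\<^bsub>S\<^esub>i\<in>{..<l}. \<iota> (v i) \<otimes>\<^bsub>S\<^esub> z i) \<in> N \<cdot>\<^bsub>S\<^esub> N \<longrightarrow> (\<forall>i<l. v i = 0))"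

lemma cotangent_dim_eqI:
  fixes \<iota> :: "'k::field \<Rightarrow> 'a"
  assumes S: "cring S" and N: "ideal N S" and \<iota>: "\<iota> \<in> Ring.ring_hom class_ring S"
    and b: "cot_basis \<iota> S N z l"
  shows "cotangent_dim \<iota> S N = l"
proof -
  interpret S: cring S by (rule S)
  interpret N: ideal N S by (rule N)
  interpret N2: ideal "N \<cdot>\<^bsub>S\<^esub> N" S by (rule S.ideal_prod_is_ideal[OF N N])
  let ?N2 = "N \<cdot>\<^bsub>S\<^esub> N"
  have \<iota>c: "\<iota> c \<in> carrier S" for c using ring_hom_closed[OF \<iota>] by simp
  have \<iota>h: "\<iota> (c * d) = \<iota> c \<otimes>\<^bsub>S\<^esub> \<iota> d" "\<iota> (c + d) = \<iota> c \<oplus>\<^bsub>S\<^esub> \<iota> d" for c d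
    using ring_hom_mult[OF \<iota>, of c d] ring_hom_add[OF \<iota>, of c d] by simp_all
  have \<iota>0: "\<iota> 0 = \<zero>\<^bsub>S\<^esub>" using ring_hom_zero[OF \<iota>] class_ring.ring_axioms S.ring_axioms by simp
  have zN: "z i \<in> N" if "i < l" for i using b that by (simp add: cot_basis_def)
  have zc: "z i \<in> carrier S" if "i < l" for i using N.Icarr[OF zN[OF that]] .
  define \<sigma> where "\<sigma> = (\<lambda>v. \<Oplus>\<^bsub>S\<^esub>i\<in>{..<l}. \<iota> (v i) \<otimes>\<^bsub>S\<^esub> z i)"
  have tc: "(\<lambda>i. \<iota> (v i) \<otimes>\<^bsub>S\<^esub> z i) \<in> {..<l} \<rightarrow> carrier S" for v using zc \<iota>c by auto
  have \<sigma>c: "\<sigma> v \<in> carrier S" for v unfolding \<sigma>_def by (rule S.finsum_closed[OF tc])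
  have \<sigma>_add: "\<sigma> (\<lambda>i. v i + w i) = \<sigma> v \<oplus>\<^bsub>S\<^esub> \<sigma> w" for v w
  proof -
    have "\<sigma> (\<lambda>i. v i + w i) = (\<Oplus>\<^bsub>S\<^esub>i\<in>{..<l}. (\<iota> (v i) \<otimes>\<^bsub>S\<^esub> z i) \<oplus>\<^bsub>S\<^esub> (\<iota> (w i) \<otimes>\<^bsub>S\<^esub> z i))"
      unfolding \<sigma>_def by (rule S.finsum_cong') (use zc \<iota>c \<iota>h in \<open>auto simp: S.l_distr\<close>)
    also have "\<dots> = \<sigma> v \<oplus>\<^bsub>S\<^esub> \<sigma> w" unfolding \<sigma>_def by (rule S.finsum_addf[OF tc tc])
    finally show ?thesis .
  qed
  have \<sigma>_smult: "\<sigma> (\<lambda>i. c * v i) = \<iota> c \<otimes>\<^bsub>S\<^esub> \<sigma> v" for c v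
  proof -
    have "\<sigma> (\<lambda>i. c * v i) = (\<Oplus>\<^bsub>S\<^esub>i\<in>{..<l}. \<iota> c \<otimes>\<^bsub>S\<^esub> (\<iota> (v i) \<otimes>\<^bsub>S\<^esub> z i))"
      unfolding \<sigma>_def by (rule S.finsum_cong') (use zc \<iota>c \<iota>h in \<open>auto simp: S.m_assoc\<close>)
    also have "\<dots> = \<iota> c \<otimes>\<^bsub>S\<^esub> \<sigma> v" unfolding \<sigma>_def by (rule S.finsum_rdistr[symmetric, OF _ \<iota>c tc]) simp
    finally show ?thesis .
  qed
  have \<sigma>_cong: "\<sigma> v = \<sigma> w" if "\<And>i. i < l \<Longrightarrow> v i = w i" for v w
    unfolding \<sigma>_def by (rule S.finsum_cong') (use that zc \<iota>c in auto)
  have \<sigma>_zero: "\<sigma> (\<lambda>_. 0) = \<zero>\<^bsub>S\<^esub>"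
    unfolding \<sigma>_def by (rule S.add.finprod_one_eqI) (simp add: \<iota>0 zc)
  have \<sigma>N: "\<sigma> v \<in> N" for v
  proof -
    have "(\<Oplus>\<^bsub>S\<^esub>i\<in>F. \<iota> (v i) \<otimes>\<^bsub>S\<^esub> z i) \<in> N" if "finite F" "F \<subseteq> {..<l}" for F v
      using that
    proof (induct F rule: finite_induct)
      case empty then show ?case using additive_subgroup.zero_closed[OF N.additive_subgroup_axioms] by simp
    next
      case (insert i F)
      then show ?case
        using zc zN \<iota>c by (subst S.finsum_insert) (auto intro!: additive_subgroup.a_closed[OF N.additive_subgroup_axioms] N.I_l_closed)
    qed
    then show ?thesis unfolding \<sigma>_def by simp
  qed
  define \<phi> where "\<phi> = (\<lambda>v :: 'k vec. ?N2 +>\<^bsub>S\<^esub> \<sigma> (\<lambda>i. v $ i))"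
  let ?V = "cotangent_space \<iota> S N"
  have eq_iff: "?N2 +>\<^bsub>S\<^esub> x = ?N2 +>\<^bsub>S\<^esub> y \<longleftrightarrow> x \<ominus>\<^bsub>S\<^esub> y \<in> ?N2" if "x \<in> carrier S" "y \<in> carrier S" for x y
    using S.quotient_eq_iff_same_a_r_cos[OF N2.is_ideal that] by blast
  show ?thesis unfolding cotangent_dim_def
  proof (rule transported_dim[of \<phi>])
    show "bij_betw \<phi> (carrier_vec l) (carrier ?V)"
    proof (rule bij_betwI')
      fix v w :: "'k vec" assume v: "v \<in> carrier_vec l" "w \<in> carrier_vec l"
      show "(\<phi> v = \<phi> w) = (v = w)"
      proof
        assume "\<phi> v = \<phi> w"
        then have "\<sigma> (\<lambda>i. v $ i) \<ominus>\<^bsub>S\<^esub> \<sigma> (\<lambda>i. w $ i) \<in> ?N2" unfolding \<phi>_def eq_iff[OF \<sigma>c \<sigma>c] .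
        moreover have "\<sigma> (\<lambda>i. v $ i) \<ominus>\<^bsub>S\<^esub> \<sigma> (\<lambda>i. w $ i) = \<sigma> (\<lambda>i. v $ i - w $ i)"
        proof -
          have "\<sigma> (\<lambda>i. v $ i) = \<sigma> (\<lambda>i. v $ i - w $ i) \<oplus>\<^bsub>S\<^esub> \<sigma> (\<lambda>i. w $ i)"
            unfolding \<sigma>_add[symmetric] by (rule \<sigma>_cong) simp
          then show ?thesis using \<sigma>c by (simp add: S.minus_eq S.a_assoc S.r_neg)
        qed
        ultimately have "\<forall>i<l. v $ i - w $ i = 0" using b unfolding cot_basis_def \<sigma>_def by auto
        then show "v = w" using v by (intro eq_vecI) auto
      qed simp
    next
      fix v :: "'k vec" assume "v \<in> carrier_vec l"
      show "\<phi> v \<in> carrier ?V" using \<sigma>N[of "\<lambda>i. v $ i"] unfolding \<phi>_def cotangent_space_def by simp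
    next
      fix y assume "y \<in> carrier ?V"
      then obtain x where x: "x \<in> N" "y = ?N2 +>\<^bsub>S\<^esub> x" by (auto simp: cotangent_space_def)
      obtain v where v: "x \<ominus>\<^bsub>S\<^esub> \<sigma> v \<in> ?N2" using b x(1) unfolding cot_basis_def \<sigma>_def by blast
      have "\<sigma> v = \<sigma> (\<lambda>i. vec l v $ i)" by (rule \<sigma>_cong) simp
      then have "y = \<phi> (vec l v)"
        using v eq_iff[OF N.Icarr[OF x(1)] \<sigma>c] x(2) by (simp add: \<phi>_def)
      then show "\<exists>v\<in>carrier_vec l. y = \<phi> v" by (intro bexI[of _ "vec l v"]) auto
    qed
  next
    fix v w :: "'k vec" assume v: "v \<in> carrier_vec l" "w \<in> carrier_vec l"
    have "\<phi> v \<oplus>\<^bsub>?V\<^esub> \<phi> w = ?N2 +>\<^bsub>S\<^esub> (\<sigma> (\<lambda>i. v $ i) \<oplus>\<^bsub>S\<^esub> \<sigma> (\<lambda>i. w $ i))"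
      using N2.a_rcos_sum[OF \<sigma>c \<sigma>c] by (simp add: \<phi>_def cotangent_space_def)
    also have "\<sigma> (\<lambda>i. v $ i) \<oplus>\<^bsub>S\<^esub> \<sigma> (\<lambda>i. w $ i) = \<sigma> (\<lambda>i. (v + w) $ i)"
      unfolding \<sigma>_add[symmetric] by (rule \<sigma>_cong) (use v in auto)
    finally show "\<phi> v \<oplus>\<^bsub>?V\<^esub> \<phi> w = \<phi> (v + w)" by (simp add: \<phi>_def)
  next
    fix c and v :: "'k vec" assume v: "v \<in> carrier_vec l"
    have "c \<odot>\<^bsub>?V\<^esub> \<phi> v = ?N2 +>\<^bsub>S\<^esub> (\<iota> c \<otimes>\<^bsub>S\<^esub> \<sigma> (\<lambda>i. v $ i))"
      using N2.rcoset_mult_add[OF \<iota>c \<sigma>c] by (simp add: \<phi>_def cotangent_space_def)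
    also have "\<iota> c \<otimes>\<^bsub>S\<^esub> \<sigma> (\<lambda>i. v $ i) = \<sigma> (\<lambda>i. (c \<cdot>\<^sub>v v) $ i)"
      unfolding \<sigma>_smult[symmetric] by (rule \<sigma>_cong) (use v in auto)
    finally show "c \<odot>\<^bsub>?V\<^esub> \<phi> v = \<phi> (c \<cdot>\<^sub>v v)" by (simp add: \<phi>_def)
  next
    have "\<sigma> (\<lambda>i. 0\<^sub>v l $ i) = \<zero>\<^bsub>S\<^esub>" unfolding \<sigma>_zero[symmetric] by (rule \<sigma>_cong) simp
    then have "\<phi> (0\<^sub>v l) = ?N2" using S.a_coset_add_zero[of ?N2] N2.a_subset by (simp add: \<phi>_def)
    then show "\<zero>\<^bsub>?V\<^esub> = \<phi> (0\<^sub>v l)" by (simp add: cotangent_space_def)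
  qed
qed

lemma ideal_prodD: "x \<in> I \<cdot>\<^bsub>R\<^esub> J \<Longrightarrow> (\<And>i j. i \<in> I \<Longrightarrow> j \<in> J \<Longrightarrow> i \<otimes>\<^bsub>R\<^esub> j \<in> Q) \<Longrightarrow>
   (\<And>s t. s \<in> Q \<Longrightarrow> t \<in> Q \<Longrightarrow> s \<oplus>\<^bsub>R\<^esub> t \<in> Q) \<Longrightarrow> x \<in> Q"
  by (induct rule: ideal_prod.induct) auto

context localize
begin

lemma ext_prod: "ext p \<cdot>\<^bsub>L\<^esub> ext p = ext (p \<cdot> p)"
proof
  have p2: "ideal (p \<cdot> p) R" by (rule ideal_prod_is_ideal[OF is_ideal is_ideal])
  interpret E: ideal "ext (p \<cdot> p)" L by (rule ext_ideal[OF p2])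
  show "ext p \<cdot>\<^bsub>L\<^esub> ext p \<subseteq> ext (p \<cdot> p)"
  proof
    fix x assume "x \<in> ext p \<cdot>\<^bsub>L\<^esub> ext p"
    then show "x \<in> ext (p \<cdot> p)"
    proof (rule ideal_prodD)
      fix i j assume "i \<in> ext p" "j \<in> ext p"
      then obtain a s b t where *: "a \<in> p" "s \<in> S" "i = fr a s" "b \<in> p" "t \<in> S" "j = fr b t" unfolding ext_def by blast
      have "a \<otimes> b \<in> p \<cdot> p" using *(1,4) by (rule ideal_prod.prod)
      then show "i \<otimes>\<^bsub>L\<^esub> j \<in> ext (p \<cdot> p)"
        unfolding *(3,6) fr_mult[OF Icarr[OF *(1)] *(2) Icarr[OF *(4)] *(5)] ext_def using mult_S[OF *(2,5)] by blast
    qed (rule additive_subgroup.a_closed[OF E.additive_subgroup_axioms])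
  qed
  interpret EE: ideal "ext p \<cdot>\<^bsub>L\<^esub> ext p" L
    by (rule L.ideal_prod_is_ideal[OF ext_ideal[OF is_ideal] ext_ideal[OF is_ideal]])
  have emb: "a \<in> carrier R \<and> emb a \<in> ext p \<cdot>\<^bsub>L\<^esub> ext p" if "a \<in> p \<cdot> p" for a
    using that
  proof (induct rule: ideal_prod.induct)
    case (prod i j)
    have "emb i \<in> ext p" "emb j \<in> ext p" unfolding ext_def using prod one_S by blast+
    then have "emb i \<otimes>\<^bsub>L\<^esub> emb j \<in> ext p \<cdot>\<^bsub>L\<^esub> ext p" by (rule ideal_prod.prod)
    then show ?case using ring_hom_mult[OF emb_hom Icarr[OF prod(1)] Icarr[OF prod(2)]] Icarr prod by simp
  next
    case (sum a b)
    then show ?case using ring_hom_add[OF emb_hom, of a b] additive_subgroup.a_closed[OF EE.additive_subgroup_axioms] by simp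
  qed
  show "ext (p \<cdot> p) \<subseteq> ext p \<cdot>\<^bsub>L\<^esub> ext p"
  proof
    fix x assume "x \<in> ext (p \<cdot> p)"
    then obtain a s where a: "a \<in> p \<cdot> p" "s \<in> S" "x = fr a s" unfolding ext_def by blast
    show "x \<in> ext p \<cdot>\<^bsub>L\<^esub> ext p" unfolding a(3) fr_split(1)[OF conjunct1[OF emb[OF a(1)]] a(2)]
      by (rule EE.I_l_closed[OF conjunct2[OF emb[OF a(1)]] fr_closed[OF one_closed a(2)]])
  qed
qed

lemma emb_finsum: assumes "finite F" "g \<in> F \<rightarrow> carrier R"
  shows "emb (finsum R g F) = (\<Oplus>\<^bsub>L\<^esub>i\<in>F. emb (g i))"
  using assms
proof (induct F rule: finite_induct)
  case empty then show ?case by (simp add: L_zero)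
next
  case (insert x F)
  have g: "g \<in> F \<rightarrow> carrier R" "g x \<in> carrier R" "finsum R g F \<in> carrier R" using insert(4) by (auto intro: finsum_closed)
  have h: "(\<lambda>i. emb (g i)) \<in> F \<rightarrow> carrier L" "emb (g x) \<in> carrier L"
    using insert(4) ring_hom_closed[OF emb_hom] by auto
  show ?case
    unfolding finsum_insert[OF insert(1,2) g(1,2)] L.finsum_insert[OF insert(1,2) h]
    using ring_hom_add[OF emb_hom g(2,3)] insert(3)[OF g(1)] by simp
qed

text \<open>Since the residue field is \<open>K\<close>, every \<open>s \<notin> p\<close> has a scalar \<open>c\<close> with \<open>c s - 1 \<in> p\<close>. So multiplication by \<open>s\<close> is invertible on
  \<open>p/p\<^sup>2\<close>, and localization at \<open>p\<close> does not change the cotangent space.\<close>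

lemma cot_basis_L:
  fixes \<iota> :: "'k::field \<Rightarrow> 'a"
  assumes \<iota>: "\<iota> \<in> Ring.ring_hom class_ring R" and rat: "\<And>r. r \<in> carrier R \<Longrightarrow> \<exists>c. r \<ominus> \<iota> c \<in> p"
    and b: "cot_basis \<iota> R p z l"
  shows "cot_basis (\<lambda>c. emb (\<iota> c)) L (ext p) (\<lambda>i. emb (z i)) l"
proof -
  have p2: "ideal (p \<cdot> p) R" by (rule ideal_prod_is_ideal[OF is_ideal is_ideal])
  interpret p2: ideal "p \<cdot> p" R by (rule p2)
  interpret E: ideal "ext (p \<cdot> p)" L by (rule ext_ideal[OF p2])
  have \<iota>c: "\<iota> c \<in> carrier R" for c using ring_hom_closed[OF \<iota>] by simp
  have zp: "z i \<in> p" if "i < l" for i using b that by (simp add: cot_basis_def)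
  have zc: "z i \<in> carrier R" if "i < l" for i using Icarr[OF zp[OF that]] .
  define \<sigma> where "\<sigma> = (\<lambda>v. \<Oplus>i\<in>{..<l}. \<iota> (v i) \<otimes> z i)"
  have tc: "(\<lambda>i. \<iota> (v i) \<otimes> z i) \<in> {..<l} \<rightarrow> carrier R" for v using zc \<iota>c by auto
  have \<sigma>c: "\<sigma> v \<in> carrier R" for v unfolding \<sigma>_def by (rule finsum_closed[OF tc])
  have \<sigma>L: "(\<Oplus>\<^bsub>L\<^esub>i\<in>{..<l}. emb (\<iota> (v i)) \<otimes>\<^bsub>L\<^esub> emb (z i)) = emb (\<sigma> v)" for v
  proof -
    have "emb (\<sigma> v) = (\<Oplus>\<^bsub>L\<^esub>i\<in>{..<l}. emb (\<iota> (v i) \<otimes> z i))" unfolding \<sigma>_def by (rule emb_finsum[OF _ tc]) simp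
    also have "\<dots> = (\<Oplus>\<^bsub>L\<^esub>i\<in>{..<l}. emb (\<iota> (v i)) \<otimes>\<^bsub>L\<^esub> emb (z i))"
      by (rule L.finsum_cong') (use zc \<iota>c ring_hom_mult[OF emb_hom] ring_hom_closed[OF emb_hom] in auto)
    finally show ?thesis by simp
  qed
  have unit: "\<exists>c'. s \<otimes> \<iota> c' \<ominus> \<one> \<in> p" if s: "s \<in> S" for s
  proof -
    obtain c where c: "s \<ominus> \<iota> c \<in> p" using rat[OF SR[OF s]] by blast
    have "c \<noteq> 0"
    proof
      assume "c = 0"
      then have "\<iota> c = \<zero>" using ring_hom_zero[OF \<iota> class_ring.ring_axioms ring_axioms] by simp
      then show False using c s by (simp add: minus_eq)
    qed
    then have cc: "\<iota> c \<otimes> \<iota> (inverse c) = \<one>"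
      using ring_hom_mult[OF \<iota>, of c "inverse c"] ring_hom_one[OF \<iota>] by simp
    note C = SR[OF s] \<iota>c
    have "(s \<ominus> \<iota> c) \<otimes> \<iota> (inverse c) = s \<otimes> \<iota> (inverse c) \<ominus> \<iota> c \<otimes> \<iota> (inverse c)" using C by algebra
    then have "s \<otimes> \<iota> (inverse c) \<ominus> \<one> = (s \<ominus> \<iota> c) \<otimes> \<iota> (inverse c)" using cc by simp
    then show ?thesis using I_r_closed[OF c \<iota>c] by metis
  qed
  show ?thesis unfolding cot_basis_def \<sigma>L ext_prod
  proof (intro conjI allI impI ballI)
    fix i assume "i < l"
    then show "emb (z i) \<in> ext p" unfolding ext_def using zp one_S by blast
  next
    fix x assume "x \<in> ext p"
    then obtain a s where a: "a \<in> p" "s \<in> S" "x = fr a s" unfolding ext_def by blast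
    obtain c where c: "s \<otimes> \<iota> c \<ominus> \<one> \<in> p" using unit[OF a(2)] by blast
    note aR = Icarr[OF a(1)] and sR = SR[OF a(2)]
    have "\<iota> c \<otimes> a \<in> p" by (rule I_l_closed[OF a(1) \<iota>c])
    then obtain v where v: "\<iota> c \<otimes> a \<ominus> \<sigma> v \<in> p \<cdot> p" using b unfolding cot_basis_def \<sigma>_def by blast
    have "a \<otimes> (s \<otimes> \<iota> c \<ominus> \<one>) \<in> p \<cdot> p" using a(1) c by (rule ideal_prod.prod)
    moreover have "s \<otimes> (\<iota> c \<otimes> a \<ominus> \<sigma> v) \<in> p \<cdot> p" by (rule p2.I_l_closed[OF v sR])
    ultimately have "s \<otimes> (\<iota> c \<otimes> a \<ominus> \<sigma> v) \<ominus> a \<otimes> (s \<otimes> \<iota> c \<ominus> \<one>) \<in> p \<cdot> p"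
      unfolding minus_eq by (intro additive_subgroup.a_closed[OF p2.additive_subgroup_axioms]
        additive_subgroup.a_inv_closed[OF p2.additive_subgroup_axioms])
    moreover have "s \<otimes> (\<iota> c \<otimes> a \<ominus> \<sigma> v) \<ominus> a \<otimes> (s \<otimes> \<iota> c \<ominus> \<one>) = a \<ominus> s \<otimes> \<sigma> v"
      using aR sR \<iota>c \<sigma>c by algebra
    ultimately have d: "a \<ominus> s \<otimes> \<sigma> v \<in> p \<cdot> p" by simp
    have "x \<ominus>\<^bsub>L\<^esub> emb (\<sigma> v) = fr (a \<ominus> s \<otimes> \<sigma> v) s"
    proof -
      have "fr (a \<ominus> s \<otimes> \<sigma> v) s \<oplus>\<^bsub>L\<^esub> emb (\<sigma> v) = x"
        unfolding a(3) fr_add[OF p2.Icarr[OF d] a(2) \<sigma>c one_S]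
      proof (rule fr_eqI)
        show "s \<otimes> (\<one> \<otimes> (a \<ominus> s \<otimes> \<sigma> v) \<oplus> s \<otimes> \<sigma> v) = s \<otimes> \<one> \<otimes> a" using aR sR \<sigma>c by algebra
      qed (use aR sR \<sigma>c a(2) mult_S[OF a(2) one_S] in simp_all)
      moreover have "fr (a \<ominus> s \<otimes> \<sigma> v) s \<in> carrier L" "emb (\<sigma> v) \<in> carrier L"
        using fr_closed[OF p2.Icarr[OF d] a(2)] fr_closed[OF \<sigma>c one_S] by auto
      ultimately show ?thesis by (auto simp: L.minus_eq L.a_assoc L.r_neg)
    qed
    then show "\<exists>v. x \<ominus>\<^bsub>L\<^esub> emb (\<sigma> v) \<in> ext (p \<cdot> p)" using d a(2) unfolding ext_def by (intro exI[of _ v]) auto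
  next
    fix v i assume v: "emb (\<sigma> v) \<in> ext (p \<cdot> p)" and i: "i < l"
    then obtain a s where a: "a \<in> p \<cdot> p" "s \<in> S" "emb (\<sigma> v) = fr a s" unfolding ext_def by blast
    note aR = p2.Icarr[OF a(1)]
    obtain u where u: "u \<in> S" "u \<otimes> (s \<otimes> \<sigma> v \<ominus> \<one> \<otimes> a) = \<zero>"
      using a(3) fr_eq_iff[OF \<sigma>c one_S aR a(2)] by blast
    note C = aR SR[OF a(2)] SR[OF u(1)] \<sigma>c \<iota>c
    obtain c where c: "(u \<otimes> s) \<otimes> \<iota> c \<ominus> \<one> \<in> p" using unit[OF mult_S[OF u(1) a(2)]] by blast
    have \<sigma>p: "\<sigma> v \<in> p"
    proof -
      have "ext (p \<cdot> p) \<subseteq> ext p"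
        using ideal_prod_inter[OF is_ideal is_ideal] unfolding ext_def by blast
      then have "emb (\<sigma> v) \<in> ext p" using v by blast
      then show ?thesis using fr_ext_iff[OF primeideal subset_refl \<sigma>c one_S] by simp
    qed
    have "((u \<otimes> s) \<otimes> \<iota> c \<ominus> \<one>) \<otimes> \<sigma> v \<in> p \<cdot> p" using c \<sigma>p by (rule ideal_prod.prod)
    moreover have "(u \<otimes> \<iota> c) \<otimes> a \<in> p \<cdot> p" using a(1) C by (intro p2.I_l_closed) simp_all
    ultimately have "(u \<otimes> \<iota> c) \<otimes> a \<ominus> ((u \<otimes> s) \<otimes> \<iota> c \<ominus> \<one>) \<otimes> \<sigma> v \<in> p \<cdot> p"
      unfolding minus_eq by (intro additive_subgroup.a_closed[OF p2.additive_subgroup_axioms]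
        additive_subgroup.a_inv_closed[OF p2.additive_subgroup_axioms])
    moreover have "(u \<otimes> \<iota> c) \<otimes> a \<ominus> ((u \<otimes> s) \<otimes> \<iota> c \<ominus> \<one>) \<otimes> \<sigma> v = \<sigma> v \<ominus> \<iota> c \<otimes> (u \<otimes> (s \<otimes> \<sigma> v \<ominus> \<one> \<otimes> a))"
      using C by algebra
    ultimately have "\<sigma> v \<in> p \<cdot> p" using C unfolding u(2) by (simp add: minus_eq)
    then show "v i = 0" using b i unfolding cot_basis_def \<sigma>_def by blast
  qed
qed

lemma cotangent_dim_L:
  fixes \<iota> :: "'k::field \<Rightarrow> 'a"
  assumes "\<iota> \<in> Ring.ring_hom class_ring R" "\<And>r. r \<in> carrier R \<Longrightarrow> \<exists>c. r \<ominus> \<iota> c \<in> p" "cot_basis \<iota> R p z l"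
  shows "cotangent_dim (\<lambda>c. emb (\<iota> c)) L (THE M. maximalideal M L) = l"
proof -
  have "emb \<circ> \<iota> \<in> Ring.ring_hom class_ring L" by (rule ring_hom_trans[OF assms(1) emb_hom])
  then have "(\<lambda>c. emb (\<iota> c)) \<in> Ring.ring_hom class_ring L" by (simp add: comp_def)
  then show ?thesis unfolding L_maximal(2)
    by (rule cotangent_dim_eqI[OF L_cring ext_ideal[OF is_ideal] _ cot_basis_L[OF assms]])
qed

end

section \<open>The zero point and the primes of a quotient ring\<close>

lemma lookup_const_mult: "lk (const c * f) t = c * lk f t"
proof -
  have k: "ks (const c) \<subseteq> {0}" by (auto simp: const_def)
  have "const c * f = (\<Sum>u\<in>{0}. \<Sum>t\<in>ks f. Poly_Mapping.single (u + t) (lk (const c) u * lk f t))"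
    unfolding pm_times by (rule sum.mono_neutral_left) (use k in \<open>auto simp: in_keys_iff\<close>)
  then have "const c * f = (\<Sum>t\<in>ks f. Poly_Mapping.single t (c * lk f t))"
    by (simp add: lookup_const)
  then show ?thesis by (auto simp: lookup_sum lookup_single when_def in_keys_iff)
qed

text \<open>The maximal ideal of the zero point over \<open>\<Gamma>\<close>, as the kernel of the evaluation at \<open>(\<gamma>\<^sub>1, \<dots>, \<gamma>\<^sub>m, 0, \<dots>, 0)\<close>.\<close>

definition zero_pt :: "nat \<Rightarrow> nat \<Rightarrow> 'k::field vec \<Rightarrow> 'k mpol mpol set" where
  "zero_pt m k \<Gamma> = {f \<in> PC m k. eval_at \<Gamma> (lk f 0) = 0}"

lemma ring_map_zero_pt: "ring_map (\<lambda>f :: 'k::field mpol mpol. eval_at \<Gamma> (lk f 0))"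
  using ring_map_comp[where f = "eval_at \<Gamma>" and g = "\<lambda>f. lk f 0", OF ring_map_eval_at ring_map_lk0] .

lemma zero_pt_prime: "prime_in (PC m k) (zero_pt m k \<Gamma>)"
  unfolding zero_pt_def by (rule hom_kernel_prime[OF subring_PC ring_map_zero_pt])

lemma zero_pt_generators_PC:
  "{const (indet i - const (\<Gamma> $ i)) | i. i < m} \<union> {indet j | j. j < k} \<subseteq> PC m k"
proof -
  have "const (indet i - const (\<Gamma> $ i)) \<in> PC m k" if "i < m" for i
    by (intro const_mpol_over[OF subring_AC] subring_setD(3)[OF subring_AC] indet_mpol_over[OF subring_UNIV] const_mpol_over[OF subring_UNIV] that UNIV_I)
  then show ?thesis using x_PC by auto
qed

lemma lk0_simps [simp]: "lk (const c) 0 = c" "lk (indet j) 0 = 0"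
proof -
  show "lk (const c) 0 = c" by (simp add: lookup_const)
  have "Poly_Mapping.single j (1::nat) \<noteq> 0" by (metis lookup_single_eq lookup_zero one_neq_zero)
  then show "lk (indet j) 0 = 0" by (simp add: indet_def lookup_single when_def)
qed

text \<open>Modulo the generators \<open>a\<^sub>i - \<gamma>\<^sub>i\<close> and \<open>x\<^sub>j\<close> every polynomial is congruent to its value at the zero point.\<close>

lemma P_zero_point_eq:
  fixes \<Gamma> :: "'k::field vec"
  shows "P_zero_point m k \<Gamma> = span_in (PC m k) ({const (indet i - const (\<Gamma> $ i)) | i. i < m} \<union> {indet j | j. j < k})"
    and "P_zero_point m k \<Gamma> = zero_pt m k \<Gamma>"
proof -
  let ?H = "{const (indet i - const (\<Gamma> $ i)) | i. i < m} \<union> {indet j | j. j < k}"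
  let ?J = "span_in (PC m k) ?H"
  note B = subring_PC[of m k, where 'a = 'k]
  show 1: "P_zero_point m k \<Gamma> = ?J"
    unfolding P_zero_point_def P_ring_eq by (rule genideal_eq_span_in[OF B zero_pt_generators_PC])
  have J: "ideal_in (PC m k) ?J" by (rule span_in_ideal_in[OF B zero_pt_generators_PC])
  let ?h = "\<lambda>f :: 'k mpol mpol. eval_at \<Gamma> (lk f 0)"
  note h = ring_mapD[OF ring_map_zero_pt, of \<Gamma>]
  have "?J \<subseteq> zero_pt m k \<Gamma>"
  proof (rule span_in_minimal[OF prime_inD(1)[OF zero_pt_prime]])
    show "?H \<subseteq> zero_pt m k \<Gamma>" using zero_pt_generators_PC[of \<Gamma> m k]
      by (auto simp: zero_pt_def ring_mapD[OF ring_map_eval_at])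
  qed
  have res: "f - const (const (?h f)) \<in> ?J" if "f \<in> PC m k" for f
    using that
  proof (induct rule: PC_induct)
    case (const c) then show ?case using ideal_inD(2)[OF J] by simp
  next
    case (a i)
    then have "const (indet i - const (\<Gamma> $ i)) \<in> ?J" by (intro subsetD[OF span_in_superset[OF B]]) blast
    then show ?case by (simp add: const_simps)
  next
    case (x j)
    then have "indet j \<in> ?J" by (intro subsetD[OF span_in_superset[OF B]]) blast
    then show ?case by (simp add: ring_mapD[OF ring_map_eval_at] const_simps)
  next
    case (add f g)
    have "(f + g) - const (const (?h (f + g))) = (f - const (const (?h f))) + (g - const (const (?h g)))"
      by (simp only: h const_simps) simp
    then show ?case using ideal_inD(3)[OF J add(3,4)] by (simp only:)
  next
    case (mult f g)
    have "f * g - const (const (?h (f * g))) = f * (g - const (const (?h g))) + const (const (?h g)) * (f - const (const (?h f)))"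
      by (simp only: h const_simps) (simp add: algebra_simps)
    then show ?case using ideal_inD(3)[OF J ideal_inD(4)[OF J mult(4,1)] ideal_inD(4)[OF J mult(3) cc_PC]] by (simp only:)
  qed
  have "zero_pt m k \<Gamma> \<subseteq> ?J"
  proof
    fix f assume "f \<in> zero_pt m k \<Gamma>"
    then show "f \<in> ?J" using res[of f] by (simp add: zero_pt_def const_simps)
  qed
  with \<open>?J \<subseteq> zero_pt m k \<Gamma>\<close> show "P_zero_point m k \<Gamma> = zero_pt m k \<Gamma>" unfolding 1 by (rule subset_antisym)
qed

lemma PC_residue:
  assumes "f \<in> PC m k" shows "f - const (const (eval_at \<Gamma> (lk f 0))) \<in> zero_pt m k \<Gamma>"
  unfolding zero_pt_def using subring_setD(3)[OF subring_PC assms cc_PC] by (simp add: ring_mapD[OF ring_map_zero_pt])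

text \<open>The quotient of a concrete ring by an ideal, with \<open>\<pi>\<close> the residue map. The primes of the quotient correspond to the primes of \<open>B\<close>
  over \<open>I\<close>, so that chains can be studied inside \<open>B\<close>.\<close>

locale quotient_in =
  fixes B :: "'p::comm_ring_1 set" and I :: "'p set"
  assumes B: "subring_set B" and I: "ideal_in B I"
begin

abbreviation "\<pi> f \<equiv> I +>\<^bsub>set_ring B\<^esub> f"
abbreviation "Q \<equiv> set_ring B Quot I"

sublocale P: cring "set_ring B" by (rule set_ring_cring[OF B])
sublocale I: ideal I "set_ring B" using ideal_iff_ideal_in[OF B] I by simp
sublocale Q: cring Q by (rule I.quotient_is_cring[OF P.is_cring])

lemma \<pi>_hom: "ring_hom_ring (set_ring B) Q (\<lambda>f. \<pi> f)" by (rule I.rcos_ring_hom_ring)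

lemma \<pi>_ring_hom: "(\<lambda>f. \<pi> f) \<in> Ring.ring_hom (set_ring B) Q" by (rule I.rcos_ring_hom)

lemma carrier_Q: "carrier Q = (\<lambda>f. \<pi> f) ` B"
  unfolding FactRing_def A_RCOSETS_def' by auto

lemma \<pi>_closed: "f \<in> B \<Longrightarrow> \<pi> f \<in> carrier Q" unfolding carrier_Q by blast

lemma \<pi>_eq_iff: "f \<in> B \<Longrightarrow> g \<in> B \<Longrightarrow> \<pi> f = \<pi> g \<longleftrightarrow> f - g \<in> I"
  using P.quotient_eq_iff_same_a_r_cos[OF I.is_ideal, of f g] set_ring_minus[OF B, of f g] by simp

lemma \<pi>_simps:
  assumes "f \<in> B" "g \<in> B"
  shows "\<pi> f \<otimes>\<^bsub>Q\<^esub> \<pi> g = \<pi> (f * g)" "\<pi> f \<oplus>\<^bsub>Q\<^esub> \<pi> g = \<pi> (f + g)" "\<pi> f \<ominus>\<^bsub>Q\<^esub> \<pi> g = \<pi> (f - g)"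
proof -
  interpret h: ring_hom_ring "set_ring B" Q "\<lambda>f. \<pi> f" by (rule \<pi>_hom)
  show "\<pi> f \<otimes>\<^bsub>Q\<^esub> \<pi> g = \<pi> (f * g)" "\<pi> f \<oplus>\<^bsub>Q\<^esub> \<pi> g = \<pi> (f + g)"
    using h.hom_mult[of f g] h.hom_add[of f g] assms by simp_all
  have "\<pi> (f \<ominus>\<^bsub>set_ring B\<^esub> g) = \<pi> f \<ominus>\<^bsub>Q\<^esub> \<pi> g"
    unfolding a_minus_def using h.hom_add[of f "\<ominus>\<^bsub>set_ring B\<^esub> g"] h.hom_a_inv[of g] assms
    by (simp add: set_ring_uminus[OF B] subring_setD[OF B])
  then show "\<pi> f \<ominus>\<^bsub>Q\<^esub> \<pi> g = \<pi> (f - g)" using set_ring_minus[OF B assms] by simp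
qed

lemma \<pi>_one: "\<one>\<^bsub>Q\<^esub> = \<pi> 1"
  using ring_hom_one[OF \<pi>_ring_hom] by simp

lemma \<pi>_zero: "\<zero>\<^bsub>Q\<^esub> = \<pi> 0"
  using ring_hom_zero[OF \<pi>_ring_hom P.ring_axioms Q.ring_axioms] by simp

lemma \<pi>_sum: "(\<And>i. i \<in> F \<Longrightarrow> g i \<in> B) \<Longrightarrow> finite F \<Longrightarrow> (\<Oplus>\<^bsub>Q\<^esub>i\<in>F. \<pi> (g i)) = \<pi> (sum g F)"
proof (induct F rule: infinite_finite_induct)
  case empty then show ?case by (simp only: Q.finsum_empty sum.empty \<pi>_zero)
next
  case (insert x F)
  have gx: "g x \<in> B" and gF: "sum g F \<in> B" using insert by (auto intro: subring_sum[OF B])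
  have 1: "(\<lambda>i. \<pi> (g i)) \<in> F \<rightarrow> carrier Q" using insert \<pi>_closed by auto
  show ?case unfolding Q.finsum_insert[OF insert(1,2) 1 \<pi>_closed[OF gx]] sum.insert[OF insert(1,2)]
    using insert \<pi>_simps(2)[OF gx gF] by simp
qed simp

definition pre :: "'p set set \<Rightarrow> 'p set" where "pre X = {f \<in> B. \<pi> f \<in> X}"

lemma pre_prime: "primeideal X Q \<Longrightarrow> prime_in B (pre X)"
  using ring_hom_ring.primeideal_vimage[OF \<pi>_hom P.is_cring, of X] primeideal_iff_prime_in[OF B]
  by (simp add: pre_def)

lemma pre_I: "primeideal X Q \<Longrightarrow> I \<subseteq> pre X"
proof
  fix f assume X: "primeideal X Q" and f: "f \<in> I"
  interpret X: primeideal X Q by (rule X)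
  have fB: "f \<in> B" using f ideal_inD(1)[OF I] by blast
  have "\<pi> f = \<zero>\<^bsub>Q\<^esub>" unfolding \<pi>_zero using \<pi>_eq_iff[OF fB subring_setD(2)[OF B]] f by simp
  then show "f \<in> pre X" using additive_subgroup.zero_closed[OF X.additive_subgroup_axioms] fB by (simp add: pre_def)
qed

lemma prime_carrier: assumes "primeideal X Q" shows "X \<subseteq> carrier Q"
proof -
  interpret X: primeideal X Q by (rule assms)
  show ?thesis by (rule X.a_subset)
qed

lemma img_pre: "X \<subseteq> carrier Q \<Longrightarrow> (\<lambda>f. \<pi> f) ` pre X = X"
  unfolding pre_def carrier_Q by auto

lemma mem_img_iff: "ideal_in B J \<Longrightarrow> I \<subseteq> J \<Longrightarrow> f \<in> B \<Longrightarrow> \<pi> f \<in> (\<lambda>f. \<pi> f) ` J \<longleftrightarrow> f \<in> J"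
proof
  assume J: "ideal_in B J" "I \<subseteq> J" "f \<in> B" and "\<pi> f \<in> (\<lambda>f. \<pi> f) ` J"
  then obtain g where g: "g \<in> J" "\<pi> f = \<pi> g" by blast
  have "f - g \<in> J" using \<pi>_eq_iff[OF J(3), of g] g ideal_inD(1)[OF J(1)] J(2) by blast
  then have "(f - g) + g \<in> J" using ideal_inD(3)[OF J(1) _ g(1)] by blast
  then show "f \<in> J" by simp
qed simp

lemma img_prime: assumes J: "prime_in B J" "I \<subseteq> J" shows "primeideal ((\<lambda>f. \<pi> f) ` J) Q"
proof (rule primeidealI)
  note J1 = prime_inD(1)[OF J(1)]
  show "ideal ((\<lambda>f. \<pi> f) ` J) Q"
    by (rule P.ring_ideal_imp_quot_ideal[OF I.is_ideal]) (use ideal_iff_ideal_in[OF B] J1 in simp)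
  show "cring Q" by (rule Q.is_cring)
  have "\<pi> 1 \<notin> (\<lambda>f. \<pi> f) ` J"
    using mem_img_iff[OF J1 J(2) subring_setD(1)[OF B]] prime_inD(2)[OF J(1)] by blast
  then show "carrier Q \<noteq> (\<lambda>f. \<pi> f) ` J" using \<pi>_closed[OF subring_setD(1)[OF B]] by blast
  fix x y assume "x \<in> carrier Q" "y \<in> carrier Q" and xy: "x \<otimes>\<^bsub>Q\<^esub> y \<in> (\<lambda>f. \<pi> f) ` J"
  then obtain f g where f: "f \<in> B" "x = \<pi> f" and g: "g \<in> B" "y = \<pi> g" unfolding carrier_Q by blast
  have "\<pi> (f * g) \<in> (\<lambda>f. \<pi> f) ` J" using xy \<pi>_simps(1)[OF f(1) g(1)] unfolding f(2) g(2) by simp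
  then have "f * g \<in> J" using mem_img_iff[OF J1 J(2) subring_setD(4)[OF B f(1) g(1)]] by blast
  then show "x \<in> (\<lambda>f. \<pi> f) ` J \<or> y \<in> (\<lambda>f. \<pi> f) ` J"
    unfolding f(2) g(2) mem_img_iff[OF J1 J(2) f(1)] mem_img_iff[OF J1 J(2) g(1)]
    by (rule prime_inD(3)[OF J(1) f(1) g(1)])
qed

definition prime_chain :: "nat \<Rightarrow> (nat \<Rightarrow> 'p set) \<Rightarrow> bool" where
  "prime_chain r p \<longleftrightarrow> (\<forall>i\<le>r. prime_in B (p i)) \<and> (\<forall>i<r. p i \<subset> p (Suc i)) \<and> I \<subseteq> p 0"

lemma prime_chain_mono: assumes "prime_chain r p" "i \<le> j" "j \<le> r" shows "p i \<subseteq> p j"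
  using assms(2,3)
proof (induct rule: dec_induct)
  case (step n)
  then have "p n \<subset> p (Suc n)" using assms(1) by (simp add: prime_chain_def)
  then show ?case using step by auto
qed simp

text \<open>The bound \<open>J\<close> at the end of the chain covers both the dimension of the quotient (\<open>J = B\<close>) and the dimension at a point.\<close>

lemma spec_chain_iff_prime_chain:
  assumes J: "ideal_in B J" "I \<subseteq> J"
  shows "(\<exists>f. spec_chain Q r f \<and> f r \<subseteq> (\<lambda>f. \<pi> f) ` J) \<longleftrightarrow> (\<exists>p. prime_chain r p \<and> p r \<subseteq> J)"
proof
  assume "\<exists>f. spec_chain Q r f \<and> f r \<subseteq> (\<lambda>f. \<pi> f) ` J"
  then obtain f where f: "spec_chain Q r f" "f r \<subseteq> (\<lambda>f. \<pi> f) ` J" by blast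
  have pr: "primeideal (f i) Q" if "i \<le> r" for i using f(1) that by (simp add: spec_chain_def)
  have "prime_chain r (\<lambda>i. pre (f i))" unfolding prime_chain_def
  proof (intro conjI allI impI)
    fix i assume "i \<le> r" then show "prime_in B (pre (f i))" by (intro pre_prime pr)
  next
    fix i assume i: "i < r"
    then have s: "f i \<subset> f (Suc i)" using f(1) by (simp add: spec_chain_def)
    have sub: "f i \<subseteq> carrier Q" "f (Suc i) \<subseteq> carrier Q"
      using prime_carrier[OF pr[of i]] prime_carrier[OF pr[of "Suc i"]] i by auto
    obtain x where x: "x \<in> f (Suc i)" "x \<notin> f i" using s by blast
    then obtain y where y: "y \<in> B" "x = \<pi> y" using sub(2) unfolding carrier_Q by blast
    have "y \<in> pre (f (Suc i))" "y \<notin> pre (f i)" using x y by (simp_all add: pre_def)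
    moreover have "pre (f i) \<subseteq> pre (f (Suc i))" using s unfolding pre_def by blast
    ultimately show "pre (f i) \<subset> pre (f (Suc i))" by blast
  next
    show "I \<subseteq> pre (f 0)" by (rule pre_I[OF pr]) simp
  qed
  moreover have "pre (f r) \<subseteq> J"
  proof
    fix x assume "x \<in> pre (f r)"
    then have x: "x \<in> B" "\<pi> x \<in> (\<lambda>f. \<pi> f) ` J" using f(2) unfolding pre_def by blast+
    from mem_img_iff[OF J x(1)] x(2) show "x \<in> J" by (rule iffD1)
  qed
  ultimately show "\<exists>p. prime_chain r p \<and> p r \<subseteq> J" by blast
next
  assume "\<exists>p. prime_chain r p \<and> p r \<subseteq> J"
  then obtain p where p: "prime_chain r p" "p r \<subseteq> J" by blast
  have sub: "I \<subseteq> p i" if "i \<le> r" for i using prime_chain_mono[OF p(1), of 0 i] p(1) that by (auto simp: prime_chain_def)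
  have pr: "prime_in B (p i)" if "i \<le> r" for i using p(1) that by (simp add: prime_chain_def)
  have "spec_chain Q r (\<lambda>i. (\<lambda>f. \<pi> f) ` p i)" unfolding spec_chain_def
  proof (intro conjI allI impI)
    fix i assume "i \<le> r" then show "primeideal ((\<lambda>f. \<pi> f) ` p i) Q" by (intro img_prime pr sub)
  next
    fix i assume i: "i < r"
    then have s: "p i \<subset> p (Suc i)" using p(1) by (simp add: prime_chain_def)
    then obtain x where x: "x \<in> p (Suc i)" "x \<notin> p i" by blast
    have xB: "x \<in> B" using x(1) ideal_inD(1)[OF prime_inD(1)[OF pr[of "Suc i"]]] i by auto
    have "\<pi> x \<notin> (\<lambda>f. \<pi> f) ` p i"
      using mem_img_iff[OF prime_inD(1)[OF pr[of i]] sub[of i] xB] x(2) i by simp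
    then show "(\<lambda>f. \<pi> f) ` p i \<subset> (\<lambda>f. \<pi> f) ` p (Suc i)" using s x(1) by blast
  qed
  then show "\<exists>f. spec_chain Q r f \<and> f r \<subseteq> (\<lambda>f. \<pi> f) ` J" using p(2) by blast
qed

lemma krull_dim_Q: "krull_dim Q = Sup {enat r | r. \<exists>p. prime_chain r p}"
proof -
  have BB: "ideal_in B B" unfolding ideal_in_def by (simp add: subring_setD[OF B])
  have a: "(\<exists>f. spec_chain Q r f \<and> f r \<subseteq> (\<lambda>f. \<pi> f) ` B) \<longleftrightarrow> (\<exists>f. spec_chain Q r f)" for r
  proof -
    have "f r \<subseteq> carrier Q" if "spec_chain Q r f" for f
      by (rule prime_carrier) (use that in \<open>simp add: spec_chain_def\<close>)
    then show ?thesis unfolding carrier_Q by blast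
  qed
  have "p r \<subseteq> B" if "prime_chain r p" for r p
    by (rule ideal_inD(1)[OF prime_inD(1)]) (use that in \<open>simp add: prime_chain_def\<close>)
  then have b: "(\<exists>p. prime_chain r p \<and> p r \<subseteq> B) \<longleftrightarrow> (\<exists>p. prime_chain r p)" for r by blast
  have "(\<exists>f. spec_chain Q r f) \<longleftrightarrow> (\<exists>p. prime_chain r p)" for r
    using spec_chain_iff_prime_chain[OF BB ideal_inD(1)[OF I], of r] by (simp only: a b)
  then show ?thesis unfolding krull_dim_spec_chain by (simp only:)
qed

end

section \<open>Positive algebras\<close>

text \<open>The data of the theorem. From here on \<open>B\<close> stands for \<open>P\<close>, \<open>Q\<close> for \<open>R = P/I\<close>, \<open>\<pi>\<close> for the residue map \<open>P \<rightarrow> R\<close>, \<open>\<iota>\<close> for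
  the structure map \<open>K \<rightarrow> R\<close> and \<open>LA\<close> for the linear coefficient matrix over \<open>A\<close>.\<close>

locale positive_alg =
  fixes m k :: nat and W :: "nat list" and I :: "'k::field mpol mpol set" and G :: "'k mpol mpol list"
  assumes pa: "positive_algebra m k W I"
    and GP: "set G \<subseteq> carrier (P_ring m k)" and Gh: "\<forall>g\<in>set G. W_homogeneous W g"
    and IG: "I = genideal (P_ring m k) (set G)"
begin

abbreviation "B \<equiv> PC m k :: 'k mpol mpol set"
abbreviation "A \<equiv> AC m :: 'k mpol set"
abbreviation "w j \<equiv> W ! j"

lemma subB: "subring_set B" and subA: "subring_set A" by (rule subring_PC, rule subring_AC)

lemma GB: "set G \<subseteq> B" using GP by (simp add: P_ring_eq)

lemma w_pos: "j < k \<Longrightarrow> 0 < w j"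
  using pa by (auto simp: positive_algebra_def)

lemma I_span_in: "I = span_in B (set G)"
  unfolding IG P_ring_eq by (rule genideal_eq_span_in[OF subB GB])

lemma I_ideal_in: "ideal_in B I" unfolding I_span_in by (rule span_in_ideal_in[OF subB GB])

lemma I_homog_ideal: "homog_ideal w k I" unfolding I_span_in
proof (rule homog_ideal_span_in[OF subA GB])
  fix h assume "h \<in> set G"
  then have "W_homogeneous W h" using Gh by blast
  moreover have "length W = k" using pa by (simp add: positive_algebra_def)
  ultimately show "\<exists>e. homog w k e h" by (simp add: W_homogeneous_def homog_def wt_def)
qed

text \<open>The constant coefficient is the part of weight \<open>0\<close>. As \<open>I\<close> is homogeneous, it lies in \<open>I \<inter> A = 0\<close>.\<close>

lemma I_lk0: assumes "f \<in> I" shows "lk f 0 = 0"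
proof -
  have fB: "f \<in> B" using ideal_inD(1)[OF I_ideal_in] assms by blast
  have "gpart w k 0 f \<in> I" using I_homog_ideal assms by (simp add: homog_ideal_def)
  moreover have "gpart w k 0 f = const (lk f 0)" by (rule gpart_0_const[OF w_pos fB])
  moreover have "lk f 0 \<in> A" by (rule lk_AC[OF fB])
  ultimately have "const (lk f 0) \<in> I \<inter> const ` carrier (A_ring m)" by (simp add: A_ring_eq)
  
  moreover have "I \<inter> const ` carrier (A_ring m) = {0}" using pa unfolding positive_algebra_def by blast
  ultimately have "const (lk f 0) = 0" by blast
  then show ?thesis by simp
qed

lemma I_x_ideal: "I \<subseteq> x_ideal m k"
  using I_lk0 ideal_inD(1)[OF I_ideal_in] by (auto simp: x_ideal_def)

lemma x_ideal_zero_pt: "x_ideal m k \<subseteq> zero_pt m k \<Gamma>"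
  by (auto simp: x_ideal_def zero_pt_def ring_mapD[OF ring_map_eval_at])

lemma I_zero_pt: "I \<subseteq> zero_pt m k \<Gamma>" using I_x_ideal x_ideal_zero_pt by blast

sublocale quotient_in B I by unfold_locales (rule subB, rule I_ideal_in)

lemma R_ring_Q: "R_ring m k I = Q" by (simp add: R_ring_def P_ring_eq)

text \<open>The maximal ideal of \<open>R\<close> belonging to the zero point over \<open>\<Gamma>\<close>.\<close>

definition MM :: "'k vec \<Rightarrow> 'k mpol mpol set set" where "MM \<Gamma> = (\<lambda>f. \<pi> f) ` zero_pt m k \<Gamma>"

lemma R_zero_point_MM: "R_zero_point m k I \<Gamma> = MM \<Gamma>"
  by (simp add: R_zero_point_def MM_def P_zero_point_eq(2) P_ring_eq)

lemma MM_prime: "primeideal (MM \<Gamma>) Q"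
  unfolding MM_def by (rule img_prime[OF zero_pt_prime I_zero_pt])

lemma localize_MM: "localize (MM \<Gamma>) Q"
  unfolding localize_def by (rule MM_prime)

definition \<iota> :: "'k \<Rightarrow> 'k mpol mpol set" where "\<iota> c = \<pi> (const (const c))"

lemma R_of_K_\<iota>: "R_of_K m k I = \<iota>"
  by (simp add: fun_eq_iff R_of_K_def \<iota>_def P_ring_eq)

lemma \<iota>_hom: "\<iota> \<in> Ring.ring_hom class_ring Q"
  by (rule ring_hom_memI)
    (simp_all add: \<iota>_def const_simps \<pi>_simps[OF cc_PC cc_PC] \<pi>_closed[OF cc_PC] \<pi>_one)

lemma MM_residue: assumes "r \<in> carrier Q" shows "\<exists>c. r \<ominus>\<^bsub>Q\<^esub> \<iota> c \<in> MM \<Gamma>"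
proof -
  obtain f where f: "f \<in> B" "r = \<pi> f" using assms unfolding carrier_Q by blast
  have "r \<ominus>\<^bsub>Q\<^esub> \<iota> (eval_at \<Gamma> (lk f 0)) = \<pi> (f - const (const (eval_at \<Gamma> (lk f 0))))"
    unfolding f(2) \<iota>_def by (rule \<pi>_simps(3)[OF f(1) cc_PC])
  then show ?thesis unfolding MM_def using PC_residue[OF f(1)] by blast
qed

text \<open>The residue field is \<open>K\<close>: a strictly larger ideal contains a nonzero scalar.\<close>

lemma MM_maximal: "maximalideal (MM \<Gamma>) Q"
proof (rule maximalidealI)
  interpret M: primeideal "MM \<Gamma>" Q by (rule MM_prime)
  show "ideal (MM \<Gamma>) Q" by (rule M.is_ideal)
  show "carrier Q \<noteq> MM \<Gamma>" by (rule M.I_notcarr)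
  fix J assume J: "ideal J Q" "MM \<Gamma> \<subseteq> J" "J \<subseteq> carrier Q"
  interpret J: ideal J Q by (rule J(1))
  show "J = MM \<Gamma> \<or> J = carrier Q"
  proof (rule disjCI)
    assume "J \<noteq> carrier Q"
    show "J = MM \<Gamma>"
    proof (rule ccontr)
      assume "J \<noteq> MM \<Gamma>"
      then obtain x where x: "x \<in> J" "x \<notin> MM \<Gamma>" using J(2) by blast
      have xc: "x \<in> carrier Q" using J(3) x(1) by blast
      obtain c where c: "x \<ominus>\<^bsub>Q\<^esub> \<iota> c \<in> MM \<Gamma>" using MM_residue[OF xc] by blast
      have \<iota>c: "\<iota> c \<in> carrier Q" for c using ring_hom_closed[OF \<iota>_hom] by simp
      have "c \<noteq> 0"
      proof
        assume "c = 0"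
        then have "\<iota> c = \<zero>\<^bsub>Q\<^esub>" by (simp add: \<iota>_def const_simps \<pi>_zero)
        then show False using c x(2) xc by (simp add: Q.minus_eq)
      qed
      have "x \<ominus>\<^bsub>Q\<^esub> (x \<ominus>\<^bsub>Q\<^esub> \<iota> c) \<in> J"
        unfolding Q.minus_eq[of x "x \<ominus>\<^bsub>Q\<^esub> \<iota> c"]
        by (intro additive_subgroup.a_closed[OF J.additive_subgroup_axioms] x(1)
            additive_subgroup.a_inv_closed[OF J.additive_subgroup_axioms] subsetD[OF J(2) c])
      moreover have "x \<ominus>\<^bsub>Q\<^esub> (x \<ominus>\<^bsub>Q\<^esub> \<iota> c) = \<iota> c" using xc \<iota>c[of c] by algebra
      ultimately have "\<iota> c \<in> J" by simp
      then have "\<iota> (inverse c) \<otimes>\<^bsub>Q\<^esub> \<iota> c \<in> J" by (rule J.I_l_closed[OF _ \<iota>c])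
      moreover have "\<iota> (inverse c) \<otimes>\<^bsub>Q\<^esub> \<iota> c = \<one>\<^bsub>Q\<^esub>"
        using ring_hom_mult[OF \<iota>_hom, of "inverse c" c] ring_hom_one[OF \<iota>_hom] \<open>c \<noteq> 0\<close> by simp
      ultimately have "\<one>\<^bsub>Q\<^esub> \<in> J" by simp
      then show False using J.one_imp_carrier \<open>J \<noteq> carrier Q\<close> by blast
    qed
  qed
qed

text \<open>The square \<open>\<MM>\<^sup>2\<close> of the ideal of the zero point.\<close>

definition zero_pt_sq :: "'k vec \<Rightarrow> 'k mpol mpol set" where
  "zero_pt_sq \<Gamma> = zero_pt m k \<Gamma> \<cdot>\<^bsub>set_ring B\<^esub> zero_pt m k \<Gamma>"

lemma zero_pt_ideal: "ideal (zero_pt m k \<Gamma>) (set_ring B)"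
  using ideal_iff_ideal_in[OF subB] prime_inD(1)[OF zero_pt_prime] by blast

lemma zero_pt_sq_ideal_in: "ideal_in B (zero_pt_sq \<Gamma>)"
  using ideal_iff_ideal_in[OF subB] P.ideal_prod_is_ideal[OF zero_pt_ideal zero_pt_ideal] by (auto simp: zero_pt_sq_def)

lemma zero_pt_sqI: "f \<in> zero_pt m k \<Gamma> \<Longrightarrow> g \<in> zero_pt m k \<Gamma> \<Longrightarrow> f * g \<in> zero_pt_sq \<Gamma>"
  using ideal_prod.prod[of f "zero_pt m k \<Gamma>" g "zero_pt m k \<Gamma>" "set_ring B"] by (simp add: zero_pt_sq_def)

lemma zero_pt_sq_induct:
  assumes "x \<in> zero_pt_sq \<Gamma>" "\<And>f g. f \<in> zero_pt m k \<Gamma> \<Longrightarrow> g \<in> zero_pt m k \<Gamma> \<Longrightarrow> f * g \<in> S"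
    "\<And>f g. f \<in> S \<Longrightarrow> g \<in> S \<Longrightarrow> f + g \<in> S"
  shows "x \<in> S"
  using assms(1) unfolding zero_pt_sq_def by (rule ideal_prodD) (use assms(2,3) in simp_all)

lemma zero_pt_B: "f \<in> zero_pt m k \<Gamma> \<Longrightarrow> f \<in> B" by (simp add: zero_pt_def)

lemma MM_prod: "MM \<Gamma> \<cdot>\<^bsub>Q\<^esub> MM \<Gamma> = (\<lambda>f. \<pi> f) ` zero_pt_sq \<Gamma>"
proof
  have M2B: "f \<in> B" if "f \<in> zero_pt_sq \<Gamma>" for f using that ideal_inD(1)[OF zero_pt_sq_ideal_in] by blast
  show "MM \<Gamma> \<cdot>\<^bsub>Q\<^esub> MM \<Gamma> \<subseteq> (\<lambda>f. \<pi> f) ` zero_pt_sq \<Gamma>"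
  proof
    fix x assume "x \<in> MM \<Gamma> \<cdot>\<^bsub>Q\<^esub> MM \<Gamma>"
    then show "x \<in> (\<lambda>f. \<pi> f) ` zero_pt_sq \<Gamma>"
    proof (rule ideal_prodD)
      fix i j assume "i \<in> MM \<Gamma>" "j \<in> MM \<Gamma>"
      then obtain f g where "f \<in> zero_pt m k \<Gamma>" "g \<in> zero_pt m k \<Gamma>" "i = \<pi> f" "j = \<pi> g" by (auto simp: MM_def)
      then show "i \<otimes>\<^bsub>Q\<^esub> j \<in> (\<lambda>f. \<pi> f) ` zero_pt_sq \<Gamma>" using zero_pt_sqI \<pi>_simps(1)[OF zero_pt_B zero_pt_B] by auto
    next
      fix s t assume "s \<in> (\<lambda>f. \<pi> f) ` zero_pt_sq \<Gamma>" "t \<in> (\<lambda>f. \<pi> f) ` zero_pt_sq \<Gamma>"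
      then obtain f g where "f \<in> zero_pt_sq \<Gamma>" "g \<in> zero_pt_sq \<Gamma>" "s = \<pi> f" "t = \<pi> g" by blast
      then show "s \<oplus>\<^bsub>Q\<^esub> t \<in> (\<lambda>f. \<pi> f) ` zero_pt_sq \<Gamma>"
        using ideal_inD(3)[OF zero_pt_sq_ideal_in] \<pi>_simps(2)[OF M2B M2B] by auto
    qed
  qed
  show "(\<lambda>f. \<pi> f) ` zero_pt_sq \<Gamma> \<subseteq> MM \<Gamma> \<cdot>\<^bsub>Q\<^esub> MM \<Gamma>"
  proof
    fix x assume "x \<in> (\<lambda>f. \<pi> f) ` zero_pt_sq \<Gamma>"
    then obtain f where f: "f \<in> zero_pt_sq \<Gamma>" "x = \<pi> f" by blast
    have "f \<in> {f \<in> B. \<pi> f \<in> MM \<Gamma> \<cdot>\<^bsub>Q\<^esub> MM \<Gamma>}" using f(1)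
    proof (rule zero_pt_sq_induct)
      fix f g assume fg: "f \<in> zero_pt m k \<Gamma>" "g \<in> zero_pt m k \<Gamma>"
      have "\<pi> f \<otimes>\<^bsub>Q\<^esub> \<pi> g \<in> MM \<Gamma> \<cdot>\<^bsub>Q\<^esub> MM \<Gamma>" using fg by (intro ideal_prod.prod) (auto simp: MM_def)
      then show "f * g \<in> {f \<in> B. \<pi> f \<in> MM \<Gamma> \<cdot>\<^bsub>Q\<^esub> MM \<Gamma>}"
        using \<pi>_simps(1)[OF zero_pt_B[OF fg(1)] zero_pt_B[OF fg(2)]] subring_setD(4)[OF subB zero_pt_B[OF fg(1)] zero_pt_B[OF fg(2)]] by simp
    next
      fix f g assume "f \<in> {f \<in> B. \<pi> f \<in> MM \<Gamma> \<cdot>\<^bsub>Q\<^esub> MM \<Gamma>}" "g \<in> {f \<in> B. \<pi> f \<in> MM \<Gamma> \<cdot>\<^bsub>Q\<^esub> MM \<Gamma>}"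
      then have fg: "f \<in> B" "g \<in> B" "\<pi> f \<in> MM \<Gamma> \<cdot>\<^bsub>Q\<^esub> MM \<Gamma>" "\<pi> g \<in> MM \<Gamma> \<cdot>\<^bsub>Q\<^esub> MM \<Gamma>" by auto
      then show "f + g \<in> {f \<in> B. \<pi> f \<in> MM \<Gamma> \<cdot>\<^bsub>Q\<^esub> MM \<Gamma>}"
        using ideal_prod.sum[OF fg(3,4)] \<pi>_simps(2)[OF fg(1,2)] subring_setD(5)[OF subB fg(1,2)] by simp
    qed
    then show "x \<in> MM \<Gamma> \<cdot>\<^bsub>Q\<^esub> MM \<Gamma>" using f(2) by simp
  qed
qed

text \<open>The square of the maximal ideal of \<open>R\<close> corresponds to \<open>I + \<MM>\<^sup>2\<close> in \<open>P\<close>.\<close>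

lemma \<pi>_MM_prod_iff: assumes "f \<in> B" shows "\<pi> f \<in> MM \<Gamma> \<cdot>\<^bsub>Q\<^esub> MM \<Gamma> \<longleftrightarrow> f \<in> ideal_sum I (zero_pt_sq \<Gamma>)"
proof
  assume "\<pi> f \<in> MM \<Gamma> \<cdot>\<^bsub>Q\<^esub> MM \<Gamma>"
  then obtain g where g: "g \<in> zero_pt_sq \<Gamma>" "\<pi> f = \<pi> g" unfolding MM_prod by blast
  then have "f - g \<in> I" using \<pi>_eq_iff[OF assms] ideal_inD(1)[OF zero_pt_sq_ideal_in] by blast
  from ideal_sumI[OF this g(1)] show "f \<in> ideal_sum I (zero_pt_sq \<Gamma>)" by simp
next
  assume "f \<in> ideal_sum I (zero_pt_sq \<Gamma>)"
  then obtain a g where g: "f = a + g" "a \<in> I" "g \<in> zero_pt_sq \<Gamma>" by (auto simp: ideal_sum_def)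
  have "\<pi> f = \<pi> g" using \<pi>_eq_iff[OF assms, of g] g ideal_inD(1)[OF zero_pt_sq_ideal_in] by auto
  then show "\<pi> f \<in> MM \<Gamma> \<cdot>\<^bsub>Q\<^esub> MM \<Gamma>" unfolding MM_prod using g(3) by blast
qed

lemma indet_zero_pt: "j < k \<Longrightarrow> indet j \<in> zero_pt m k \<Gamma>"
  using x_PC by (simp add: zero_pt_def ring_mapD[OF ring_map_eval_at])

text \<open>Split one variable off every monomial of degree at least two.\<close>

lemma x_power2_zero_pt_sq: "x_power m k 2 \<subseteq> zero_pt_sq \<Gamma>"
proof
  fix f :: "'k mpol mpol" assume f: "f \<in> x_power m k 2"
  have fB: "f \<in> B" using f by (simp add: x_power_def)
  have "(\<Sum>t\<in>ks f. Poly_Mapping.single t (lk f t)) \<in> zero_pt_sq \<Gamma>"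
  proof (rule ideal_in_sum[OF zero_pt_sq_ideal_in])
    fix t assume t: "t \<in> ks f"
    then have tk: "ks t \<subseteq> {..<k}" "2 \<le> xdeg k t" using f by (auto simp: x_power_def mpol_over_def)
    then have "t \<noteq> 0" by auto
    then obtain j where j: "j \<in> ks t" by fastforce
    then have jk: "j < k" using tk by auto
    define u where "u = t - Poly_Mapping.single j 1"
    have tu: "t = Poly_Mapping.single j 1 + u"
      using j by (intro poly_mapping_eqI) (auto simp: u_def lookup_add lookup_minus lookup_single when_def in_keys_iff)
    have "u \<noteq> 0" using tk(2) jk unfolding tu by (auto simp: wt_add wt_single)
    have uk: "ks u \<subseteq> {..<k}" using tk(1) unfolding tu keys_plus_nat by auto
    have "Poly_Mapping.single u (lk f t) \<in> zero_pt m k \<Gamma>"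
      using mpol_over_single[OF subA lk_AC[OF fB] uk] \<open>u \<noteq> 0\<close>
      by (simp add: zero_pt_def lookup_single when_def ring_mapD[OF ring_map_eval_at])
    from zero_pt_sqI[OF indet_zero_pt[OF jk] this] show "Poly_Mapping.single t (lk f t) \<in> zero_pt_sq \<Gamma>"
      unfolding indet_def mult_single One_nat_def[symmetric] tu[symmetric] mult_1_left .
  qed
  then show "f \<in> zero_pt_sq \<Gamma>" using pm_sum_single[of f] by simp
qed

lemma order2_part_x_power2: "f \<in> B \<Longrightarrow> order2_part k f \<in> x_power m k 2"
  unfolding x_power_def
proof (intro CollectI conjI ballI)
  assume f: "f \<in> B"
  show "order2_part k f \<in> B" by (rule mpol_over_keys_subset[OF f]) (auto simp: in_keys_iff lookup_order2_part split: if_splits)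
  show "2 \<le> xdeg k t" if "t \<in> ks (order2_part k f)" for t using that by (auto simp: in_keys_iff lookup_order2_part split: if_splits)
qed

abbreviation "LA \<equiv> lin_mat_A k G"

lemma LA_dims [simp]: "dim_row LA = length G" "dim_col LA = k" by (simp_all add: lin_mat_A_def)

lemma LA_index: "i < length G \<Longrightarrow> j < k \<Longrightarrow> LA $$ (i, j) = lin_coeff (G ! i) j"
  by (simp add: lin_mat_A_def)

lemma LA_in: "i < length G \<Longrightarrow> j < k \<Longrightarrow> LA $$ (i, j) \<in> A"
  using lk_AC[OF subsetD[OF GB nth_mem]] by (simp add: LA_index lin_coeff_def)

lemma lin_coeff_sum_mult: "lin_coeff (\<Sum>s\<in>F. const (c s) * g s) j = (\<Sum>s\<in>F. c s * lin_coeff (g s) j)"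
  unfolding lin_coeff_def lookup_sum lookup_const_mult ..

text \<open>Cramer's rule: multiplying the rows of \<open>LA\<close> that belong to the minor by its adjugate combines the generators into elements of \<open>I\<close>
  whose linear coefficients in the chosen columns form the diagonal matrix with entries \<open>\<delta>\<close>.\<close>

lemma cramer_relations:
  assumes len: "length is = r" "length js = r" and r: "set is \<subseteq> {..<length G}" "set js \<subseteq> {..<k}"
    and \<delta>: "\<delta> = det (minor_matrix LA is js)" "\<delta> \<noteq> 0"
  shows "\<delta> \<in> A" "distinct js"
    "\<exists>g. \<forall>t\<in>set js. g t \<in> I \<and> (\<forall>t'\<in>set js. lin_coeff (g t) t' = (if t = t' then \<delta> else 0))"
proof -
  let ?M = "minor_matrix LA is js"
  have M: "?M \<in> carrier_mat r r" using len by (simp add: minor_matrix_def)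
  have isr: "is ! a < length G" if "a < r" for a using subsetD[OF r(1) nth_mem, of a] that len by simp
  have jsr: "js ! a < k" if "a < r" for a using subsetD[OF r(2) nth_mem, of a] that len by simp
  have MA: "?M $$ (a, b) \<in> A" if "a < r" "b < r" for a b
    using that len LA_in[OF isr[OF that(1)] jsr[OF that(2)]] by (simp add: minor_matrix_def)
  show "\<delta> \<in> A" unfolding \<delta>(1) by (rule subring_det[OF subA M MA])
  show dj: "distinct js"
  proof (rule det_minor_matrix_rows_distinct[of js "is" "transpose_mat LA"])
    show "det (minor_matrix (transpose_mat LA) js is) \<noteq> 0"
      using det_minor_matrix_transpose[of "is" js LA] len r \<delta> by simp
  qed (use len in simp)
  have adjA: "adj_mat ?M $$ (a, b) \<in> A" if "a < r" "b < r" for a b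
  proof -
    have "det (mat_delete ?M b a) \<in> A"
    proof (rule subring_det[OF subA, of _ "r - 1"])
      show "mat_delete ?M b a \<in> carrier_mat (r - 1) (r - 1)" using M by (simp add: mat_delete_def)
      fix i j assume ij: "i < r - 1" "j < r - 1"
      have "mat_delete ?M b a $$ (i, j) = ?M $$ (if i < b then i else Suc i, if j < a then j else Suc j)"
        using ij M by (simp add: mat_delete_def)
      then show "mat_delete ?M b a $$ (i, j) \<in> A" using ij by (auto intro!: MA)
    qed
    moreover have "(-1) ^ n \<in> A" for n by (intro subring_power[OF subA] subring_setD[OF subA])
    ultimately have "cofactor ?M b a \<in> A" unfolding cofactor_def by (intro subring_setD(4)[OF subA])
    then show ?thesis using that M by (simp add: adj_mat_def)
  qed
  have adj: "(\<Sum>s<r. adj_mat ?M $$ (a, s) * LA $$ (is ! s, js ! b)) = (if a = b then \<delta> else 0)" if "a < r" "b < r" for a b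
  proof -
    have "(adj_mat ?M * ?M) $$ (a, b) = (\<delta> \<cdot>\<^sub>m 1\<^sub>m r) $$ (a, b)" using adj_mat(3)[OF M] \<delta>(1) by simp
    moreover have "(adj_mat ?M * ?M) $$ (a, b) = (\<Sum>s<r. adj_mat ?M $$ (a, s) * ?M $$ (s, b))"
      using that M adj_mat(1)[OF M] by (simp add: scalar_prod_def lessThan_atLeast0)
    moreover have "(\<Sum>s<r. adj_mat ?M $$ (a, s) * ?M $$ (s, b)) = (\<Sum>s<r. adj_mat ?M $$ (a, s) * LA $$ (is ! s, js ! b))"
      by (rule sum.cong) (use that len in \<open>simp_all add: minor_matrix_def\<close>)
    ultimately show ?thesis using that by simp
  qed
  define h where "h = (\<lambda>a. \<Sum>s<r. const (adj_mat ?M $$ (a, s)) * G ! (is ! s))"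
  have hI: "h a \<in> I" if "a < r" for a unfolding h_def
  proof (rule ideal_in_sum[OF I_ideal_in])
    fix s assume "s \<in> {..<r}"
    then have s: "s < r" by simp
    have "G ! (is ! s) \<in> I" using span_in_superset[OF subB, of "set G"] isr[OF s] unfolding I_span_in by auto
    then show "const (adj_mat ?M $$ (a, s)) * G ! (is ! s) \<in> I"
      by (rule ideal_inD(4)[OF I_ideal_in]) (rule const_mpol_over[OF subA adjA[OF that s]])
  qed
  have hl: "lin_coeff (h a) (js ! b) = (if a = b then \<delta> else 0)" if "a < r" "b < r" for a b
  proof -
    have "lin_coeff (h a) (js ! b) = (\<Sum>s<r. adj_mat ?M $$ (a, s) * LA $$ (is ! s, js ! b))"
      unfolding h_def lin_coeff_sum_mult by (rule sum.cong) (use isr jsr[OF that(2)] in \<open>simp_all add: LA_index\<close>)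
    then show ?thesis using adj[OF that] by simp
  qed
  define ix where "ix = (\<lambda>t. SOME a. a < r \<and> js ! a = t)"
  have ix: "ix t < r \<and> js ! ix t = t" if "t \<in> set js" for t
    unfolding ix_def by (rule someI_ex) (use that len in \<open>auto simp: in_set_conv_nth\<close>)
  show "\<exists>g. \<forall>t\<in>set js. g t \<in> I \<and> (\<forall>t'\<in>set js. lin_coeff (g t) t' = (if t = t' then \<delta> else 0))"
  proof (intro exI[of _ "\<lambda>t. h (ix t)"] ballI conjI)
    fix t assume t: "t \<in> set js"
    show "h (ix t) \<in> I" using hI ix[OF t] by blast
    fix t' assume t': "t' \<in> set js"
    have "lin_coeff (h (ix t)) (js ! ix t') = (if ix t = ix t' then \<delta> else 0)" using hl ix[OF t] ix[OF t'] by blast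
    moreover have "js ! ix t' = t'" using ix[OF t'] by simp
    moreover have "ix t = ix t' \<longleftrightarrow> t = t'" using ix[OF t] ix[OF t'] by metis
    ultimately show "lin_coeff (h (ix t)) t' = (if t = t' then \<delta> else 0)" by simp
  qed
qed

text \<open>The relations from Cramer's rule allow the columns of the minor to be eliminated.\<close>

lemma minor_chain_bound:
  assumes len: "length is = r" "length js = r" and r: "set is \<subseteq> {..<length G}" "set js \<subseteq> {..<k}"
    and \<delta>: "const (det (minor_matrix LA is js)) \<notin> p 0" and p: "prime_chain l p"
  shows "l + r \<le> m + k"
proof -
  let ?\<delta> = "det (minor_matrix LA is js)"
  have p0: "prime_in B (p 0)" using p by (simp add: prime_chain_def)
  have nz: "?\<delta> \<noteq> 0" using \<delta> ideal_inD(2)[OF prime_inD(1)[OF p0]] by (auto simp: const_simps)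
  note c = cramer_relations[OF len r refl nz]
  obtain g where g: "\<And>t. t \<in> set js \<Longrightarrow> g t \<in> I"
    "\<And>t t'. t \<in> set js \<Longrightarrow> t' \<in> set js \<Longrightarrow> lin_coeff (g t) t' = (if t = t' then ?\<delta> else 0)"
    using c(3) by blast
  have "l \<le> m + k - card (set js)"
  proof (rule elimination_chain_bound[where q = "p 0" and J = I and w = w and T = "set js" and \<delta> = ?\<delta> and g = g and p = p and r = l])
    show "prime_in B (p 0)" by (rule p0)
    show "homog_ideal w k I" by (rule I_homog_ideal)
    show "lk f 0 = 0" if "f \<in> I" for f by (rule I_lk0[OF that])
    show "0 < w j" if "j < k" for j by (rule w_pos[OF that])
    show "set js \<subseteq> {..<k}" by (rule r(2))
    show "?\<delta> \<in> A" by (rule c(1))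
    show "const ?\<delta> \<notin> p 0" by (rule \<delta>)
    show "g t \<in> I" if "t \<in> set js" for t by (rule g(1)[OF that])
    show "lin_coeff (g t) t' = (if t = t' then ?\<delta> else 0)" if "t \<in> set js" "t' \<in> set js" for t t'
      by (rule g(2)[OF that])
    show "p 0 = p 0" by (rule refl)
    show "I \<subseteq> p 0" using p by (simp add: prime_chain_def)
    show "prime_in B (p i)" if "i \<le> l" for i using p that by (simp add: prime_chain_def)
    show "p i \<subset> p (Suc i)" if "i < l" for i using p that by (simp add: prime_chain_def)
  qed
  moreover have "card (set js) = r" using distinct_card[OF c(2)] len by simp
  moreover have "card (set js) \<le> k" using card_mono[OF _ r(2)] by simp
  ultimately show ?thesis by simp
qed

end

section \<open>The cotangent space at the zero point\<close>

text \<open>A first order deformation of the zero point: \<open>a\<^sub>i\<close> is sent to \<open>\<gamma>\<^sub>i + \<alpha>\<^sub>i \<epsilon>\<close> and \<open>x\<^sub>j\<close> to \<open>\<beta>\<^sub>j \<epsilon>\<close>, where \<open>\<epsilon>\<close> is the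
  indeterminate of univariate polynomials. Its coefficient of \<open>\<epsilon>\<close> is the derivative at \<open>\<Gamma>\<^sub>0\<close> in the direction \<open>(\<alpha>, \<beta>)\<close>.\<close>

definition dual_eval :: "'k::field vec \<Rightarrow> (nat \<Rightarrow> 'k) \<Rightarrow> (nat \<Rightarrow> 'k) \<Rightarrow> 'k mpol mpol \<Rightarrow> 'k poly" where
  "dual_eval \<Gamma> \<alpha> \<beta> = eval_hom (eval_hom (\<lambda>c. [:c:]) (\<lambda>i. [:\<Gamma> $ i, \<alpha> i:])) (\<lambda>j. [:0, \<beta> j:])"

lemma ring_map_poly: "ring_map (\<lambda>c :: 'k::field. [:c:])" "ring_map (\<lambda>p :: 'k::field poly. coeff p 0)"
  by (simp_all add: ring_map_def one_pCons mult_pCons_left coeff_mult_0)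

lemma ring_map_dual_eval: "ring_map (dual_eval \<Gamma> \<alpha> \<beta>)"
  unfolding dual_eval_def by (intro eval_hom_ring_map ring_map_poly)

lemma dual_eval_simps:
  "dual_eval \<Gamma> \<alpha> \<beta> (const (const c)) = [:c:]" "dual_eval \<Gamma> \<alpha> \<beta> (const (indet i)) = [:\<Gamma> $ i, \<alpha> i:]"
  "dual_eval \<Gamma> \<alpha> \<beta> (indet j) = [:0, \<beta> j:]"
  unfolding dual_eval_def
  by (simp_all add: eval_hom_const eval_hom_indet eval_hom_ring_map ring_map_poly)

lemma coeff_0_dual_eval: assumes "f \<in> PC m k" shows "coeff (dual_eval \<Gamma> \<alpha> \<beta> f) 0 = eval_at \<Gamma> (lk f 0)"
  using assms
proof (induct rule: PC_induct)
  case (add f g)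
  then show ?case by (simp add: ring_mapD(2)[OF ring_map_dual_eval] ring_mapD(2)[OF ring_map_zero_pt])
next
  case (mult f g)
  then show ?case by (simp add: ring_mapD(3)[OF ring_map_dual_eval] ring_mapD(3)[OF ring_map_zero_pt] coeff_mult_0)
qed (simp_all add: dual_eval_simps ring_mapD[OF ring_map_eval_at])

lemma coeff_1_mult: "coeff (p * q) 1 = coeff p 0 * coeff q 1 + coeff p 1 * coeff (q :: 'k::field poly) 0"
  by (simp add: coeff_mult)

context positive_alg begin

lemma zero_pt_decomposition:
  assumes "f \<in> B" "h \<in> zero_pt m k \<Gamma>"
  shows "f * h - const (const (eval_at \<Gamma> (lk f 0))) * h \<in> zero_pt_sq \<Gamma>"
  using zero_pt_sqI[OF PC_residue[OF assms(1)] assms(2)] by (simp add: left_diff_distrib)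

text \<open>Derivatives of products of functions vanishing at the point are zero.\<close>

lemma coeff_1_zero_pt_sq: "f \<in> zero_pt_sq \<Gamma> \<Longrightarrow> coeff (dual_eval \<Gamma> \<alpha> \<beta> f) 1 = 0"
proof -
  assume "f \<in> zero_pt_sq \<Gamma>"
  then have "f \<in> {f. coeff (dual_eval \<Gamma> \<alpha> \<beta> f) 1 = 0}"
  proof (rule zero_pt_sq_induct)
    fix f g assume f: "f \<in> zero_pt m k \<Gamma>" and g: "g \<in> zero_pt m k \<Gamma>"
    have "coeff (dual_eval \<Gamma> \<alpha> \<beta> h) 0 = 0" if "h \<in> zero_pt m k \<Gamma>" for h
      unfolding coeff_0_dual_eval[OF zero_pt_B[OF that]] using that by (simp add: zero_pt_def)
    from this[OF f] this[OF g] show "f * g \<in> {f. coeff (dual_eval \<Gamma> \<alpha> \<beta> f) 1 = 0}"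
      by (simp only: ring_mapD(3)[OF ring_map_dual_eval] coeff_1_mult mem_Collect_eq) simp
  qed (simp add: ring_mapD(2)[OF ring_map_dual_eval])
  then show ?thesis by simp
qed

text \<open>Elements of \<open>I\<close> have no constant coefficient, so modulo \<open>\<MM>\<^sup>2\<close> only the linear part remains.\<close>

lemma linear_part: assumes "f \<in> I"
  shows "f = (\<Sum>j<k. const (lin_coeff f j) * indet j) + order2_part k f" "order2_part k f \<in> zero_pt_sq \<Gamma>"
proof -
  have fB: "f \<in> B" using assms ideal_inD(1)[OF I_ideal_in] by blast
  show "f = (\<Sum>j<k. const (lin_coeff f j) * indet j) + order2_part k f"
    using linear_decomposition[OF fB] I_lk0[OF assms] by (simp only: lin_coeff_def const_simps) simp
  show "order2_part k f \<in> zero_pt_sq \<Gamma>" using x_power2_zero_pt_sq order2_part_x_power2[OF fB] by blast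
qed

lemma G_I: "g \<in> set G \<Longrightarrow> g \<in> I" unfolding I_span_in using span_in_superset[OF subB] by blast

text \<open>A direction in the kernel of the linear coefficient matrix at \<open>\<Gamma>\<close> is tangent to the zero set of \<open>I\<close>: the derivative of a generator
  is the value of its linear part in that direction.\<close>

lemma coeff_1_I:
  assumes ker: "\<And>i. i < length G \<Longrightarrow> (\<Sum>j<k. lin_mat_K k G \<Gamma> $$ (i, j) * \<beta> j) = 0" and f: "f \<in> I"
  shows "coeff (dual_eval \<Gamma> \<alpha> \<beta> f) 1 = 0"
proof -
  let ?\<psi> = "dual_eval \<Gamma> \<alpha> \<beta>"
  note \<psi> = ring_mapD[OF ring_map_dual_eval, of \<Gamma> \<alpha> \<beta>]
  define J where "J = {f \<in> B. coeff (?\<psi> f) 0 = 0 \<and> coeff (?\<psi> f) 1 = 0}"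
  have J: "ideal_in B J" unfolding ideal_in_def
  proof (intro conjI ballI)
    show "0 \<in> J" by (simp add: J_def \<psi> subring_setD[OF subB])
    fix x y assume "x \<in> J" "y \<in> J"
    then show "x + y \<in> J" using subring_setD(5)[OF subB, of x y] by (simp add: J_def \<psi>)
  next
    fix x b assume "x \<in> J" "b \<in> B"
    then show "b * x \<in> J" using subring_setD(4)[OF subB, of b x]
      unfolding J_def by (simp only: \<psi> coeff_1_mult coeff_mult_0 mem_Collect_eq) simp
  qed (auto simp: J_def)
  have "g \<in> J" if g: "g \<in> set G" for g
  proof -
    obtain i where i: "i < length G" "g = G ! i" using g by (auto simp: in_set_conv_nth)
    have gI: "g \<in> I" by (rule G_I[OF g])
    have gB: "g \<in> B" using g GB by blast
    have c: "coeff (?\<psi> (const (lin_coeff g j) * indet j)) 1 = lin_mat_K k G \<Gamma> $$ (i, j) * \<beta> j" if "j < k" for j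
    proof -
      have "lin_coeff g j \<in> A" unfolding lin_coeff_def by (rule lk_AC[OF gB])
      then have "coeff (?\<psi> (const (lin_coeff g j))) 0 = eval_at \<Gamma> (lin_coeff g j)"
        by (subst coeff_0_dual_eval[OF const_mpol_over[OF subA]]) simp_all
      then show ?thesis using that i unfolding \<psi>(3) coeff_1_mult dual_eval_simps
        by (simp add: lin_mat_K_def LA_index)
    qed
    have "coeff (?\<psi> g) 1 = coeff (?\<psi> ((\<Sum>j<k. const (lin_coeff g j) * indet j) + order2_part k g)) 1"
      using linear_part(1)[OF gI] by simp
    also have "\<dots> = (\<Sum>j<k. coeff (?\<psi> (const (lin_coeff g j) * indet j)) 1)"
      unfolding \<psi>(2) \<psi>(8) coeff_add coeff_sum coeff_1_zero_pt_sq[OF linear_part(2)[OF gI]] by simp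
    also have "\<dots> = (\<Sum>j<k. lin_mat_K k G \<Gamma> $$ (i, j) * \<beta> j)" by (rule sum.cong[OF refl]) (rule c, simp)
    also have "\<dots> = 0" by (rule ker[OF i(1)])
    finally have "coeff (?\<psi> g) 1 = 0" .
    moreover have "coeff (?\<psi> g) 0 = 0"
      unfolding coeff_0_dual_eval[OF gB] I_lk0[OF gI] by (rule ring_mapD(4)[OF ring_map_eval_at])
    ultimately show ?thesis using gB by (simp add: J_def)
  qed
  then have "I \<subseteq> J" unfolding I_span_in by (intro span_in_minimal[OF J] subsetI)
  then show ?thesis using f by (auto simp: J_def)
qed

text \<open>The candidate basis: the functions \<open>a\<^sub>i - \<gamma>\<^sub>i\<close> followed by the variables listed in \<open>L\<close>.\<close>

definition cot_vec :: "'k vec \<Rightarrow> nat list \<Rightarrow> nat \<Rightarrow> 'k mpol mpol" where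
  "cot_vec \<Gamma> L i = (if i < m then const (indet i - const (\<Gamma> $ i)) else indet (L ! (i - m)))"

lemma cot_vec_zero_pt: assumes "set L \<subseteq> {..<k}" "i < m + length L" shows "cot_vec \<Gamma> L i \<in> zero_pt m k \<Gamma>"
proof (cases "i < m")
  case True
  then have "cot_vec \<Gamma> L i \<in> B" using zero_pt_generators_PC[of \<Gamma> m k] by (auto simp: cot_vec_def)
  then show ?thesis using True by (simp add: zero_pt_def cot_vec_def ring_mapD[OF ring_map_eval_at])
next
  case False
  then have "L ! (i - m) \<in> set L" using assms(2) by simp
  then have "L ! (i - m) < k" using assms(1) by blast
  then show ?thesis using indet_zero_pt False by (simp add: cot_vec_def)
qed

text \<open>The classes that are combinations of the candidates form an ideal \<open>V\<close>, since on \<open>\<MM>/\<MM>\<^sup>2\<close> every polynomial acts by its value at the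
  zero point. The relations from Cramer's rule read \<open>\<delta>(\<Gamma>) x\<^sub>t + \<dots> = 0\<close> with variables of \<open>L\<close> in place of the dots, so \<open>V\<close> also contains
  the eliminated variables, and hence all generators of \<open>\<MM>\<close>.\<close>

lemma cot_vec_span:
  assumes len: "length is = r" "length js = r" and r: "set is \<subseteq> {..<length G}" "set js \<subseteq> {..<k}"
    and nz: "det (minor_matrix (lin_mat_K k G \<Gamma>) is js) \<noteq> 0" and L: "set L = {..<k} - set js" and f: "f \<in> zero_pt m k \<Gamma>"
  shows "\<exists>v. f - (\<Sum>i<m + length L. const (const (v i)) * cot_vec \<Gamma> L i) \<in> ideal_sum I (zero_pt_sq \<Gamma>)"
proof -
  let ?S = "ideal_sum I (zero_pt_sq \<Gamma>)" and ?N = "m + length L" and ?z = "cot_vec \<Gamma> L"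
  have S: "ideal_in B ?S" by (rule ideal_sum_ideal_in[OF I_ideal_in zero_pt_sq_ideal_in subB])
  have SI: "x \<in> ?S" if "x \<in> I" for x using ideal_sum_left[OF zero_pt_sq_ideal_in] that by blast
  have SM: "x \<in> ?S" if "x \<in> zero_pt_sq \<Gamma>" for x using ideal_sum_right[OF I_ideal_in] that by blast
  have ptt: "ideal_in B (zero_pt m k \<Gamma>)" by (rule prime_inD(1)[OF zero_pt_prime])
  have Lk: "set L \<subseteq> {..<k}" using L by blast
  have zpt: "?z i \<in> zero_pt m k \<Gamma>" if "i < ?N" for i by (rule cot_vec_zero_pt[OF Lk that])
  have M2pt: "zero_pt_sq \<Gamma> \<subseteq> zero_pt m k \<Gamma>"
  proof
    fix x assume "x \<in> zero_pt_sq \<Gamma>"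
    then show "x \<in> zero_pt m k \<Gamma>"
    proof (rule zero_pt_sq_induct)
      fix f g assume "f \<in> zero_pt m k \<Gamma>" "g \<in> zero_pt m k \<Gamma>"
      then show "f * g \<in> zero_pt m k \<Gamma>" by (intro ideal_inD(4)[OF ptt] zero_pt_B)
    qed (rule ideal_inD(3)[OF ptt])
  qed
  have Spt: "x \<in> zero_pt m k \<Gamma>" if "x \<in> ?S" for x
    using that I_zero_pt M2pt ideal_inD(3)[OF ptt] unfolding ideal_sum_def by blast
  define lc where "lc = (\<lambda>v. \<Sum>i<?N. const (const (v i :: 'k)) * ?z i)"
  define V where "V = {f \<in> zero_pt m k \<Gamma>. \<exists>v. f - lc v \<in> ?S}"
  have lc_add: "lc (\<lambda>i. v i + u i) = lc v + lc u" for v u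
    by (simp add: lc_def const_simps distrib_right sum.distrib)
  have lc_scale: "lc (\<lambda>i. c * v i) = const (const c) * lc v" for c v
    by (simp add: lc_def const_simps sum_distrib_left mult.assoc)
  have lc0: "lc (\<lambda>i. 0) = 0" by (simp add: lc_def const_simps)
  have VS: "x \<in> V" if "x \<in> ?S" for x
    unfolding V_def using Spt[OF that] that lc0 by (auto intro!: exI[of _ "\<lambda>i. 0"])
  have Vadd: "x + y \<in> V" if "x \<in> V" "y \<in> V" for x y
  proof -
    from that obtain v u where vu: "x - lc v \<in> ?S" "y - lc u \<in> ?S" unfolding V_def by blast
    have "x + y - lc (\<lambda>i. v i + u i) = (x - lc v) + (y - lc u)" unfolding lc_add by simp
    then have "x + y - lc (\<lambda>i. v i + u i) \<in> ?S" using ideal_inD(3)[OF S vu] by (simp only:)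
    moreover have "x + y \<in> zero_pt m k \<Gamma>" using that unfolding V_def by (intro ideal_inD(3)[OF ptt]) auto
    ultimately show ?thesis unfolding V_def by blast
  qed
  have Vscale: "const (const c) * x \<in> V" if "x \<in> V" for c x
  proof -
    from that obtain v where v: "x - lc v \<in> ?S" unfolding V_def by blast
    have "const (const c) * x - lc (\<lambda>i. c * v i) = const (const c) * (x - lc v)"
      unfolding lc_scale by (simp add: right_diff_distrib)
    then have "const (const c) * x - lc (\<lambda>i. c * v i) \<in> ?S" using ideal_inD(4)[OF S v cc_PC] by simp
    moreover have "const (const c) * x \<in> zero_pt m k \<Gamma>" using that unfolding V_def by (intro ideal_inD(4)[OF ptt] cc_PC) auto
    ultimately show ?thesis unfolding V_def by blast
  qed
  have Vpt: "x \<in> zero_pt m k \<Gamma>" if "x \<in> V" for x using that by (simp add: V_def)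
  have V: "ideal_in B V" unfolding ideal_in_def
  proof (intro conjI ballI)
    show "V \<subseteq> B" using Vpt zero_pt_B by blast
    show "0 \<in> V" by (rule VS[OF ideal_inD(2)[OF S]])
    fix x y assume "x \<in> V" "y \<in> V" then show "x + y \<in> V" by (rule Vadd)
  next
    fix x b assume x: "x \<in> V" and b: "b \<in> B"
    have "b * x - const (const (eval_at \<Gamma> (lk b 0))) * x \<in> V" by (rule VS[OF SM[OF zero_pt_decomposition[OF b Vpt[OF x]]]])
    from Vadd[OF this Vscale[OF x, of "eval_at \<Gamma> (lk b 0)"]] show "b * x \<in> V" by simp
  qed
  have zV: "?z i \<in> V" if "i < ?N" for i
  proof -
    have "const (const (if i' = i then (1 :: 'k) else 0)) * ?z i' = (if i' = i then ?z i' else 0)" for i' by (simp add: const_simps)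
    then have "lc (\<lambda>i'. if i' = i then 1 else 0) = ?z i" using that by (simp add: lc_def)
    then have "?z i - lc (\<lambda>i'. if i' = i then 1 else 0) \<in> ?S" using ideal_inD(2)[OF S] by simp
    then show ?thesis unfolding V_def using zpt[OF that] by blast
  qed
  have xV1: "indet j \<in> V" if j: "j < k" "j \<notin> set js" for j
  proof -
    have "j \<in> set L" using j L by simp
    then obtain a where "a < length L" "L ! a = j" by (auto simp: in_set_conv_nth)
    then show ?thesis using zV[of "m + a"] by (simp add: cot_vec_def)
  qed
  have D: "det (minor_matrix (lin_mat_K k G \<Gamma>) is js) = eval_at \<Gamma> (det (minor_matrix LA is js))"
    unfolding lin_mat_K_def by (rule det_minor_matrix_map[OF ring_map_eval_at]) (use len r in simp_all)
  have nzA: "det (minor_matrix LA is js) \<noteq> 0" using nz ring_mapD(4)[OF ring_map_eval_at, of \<Gamma>] unfolding D by auto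
  obtain g where g: "\<And>t. t \<in> set js \<Longrightarrow> g t \<in> I"
    "\<And>t t'. t \<in> set js \<Longrightarrow> t' \<in> set js \<Longrightarrow> lin_coeff (g t) t' = (if t = t' then det (minor_matrix LA is js) else 0)"
    using cramer_relations(3)[OF len r refl nzA] by blast
  have xV2: "indet t \<in> V" if t: "t \<in> set js" for t
  proof -
    let ?e = "\<lambda>j. const (const (eval_at \<Gamma> (lin_coeff (g t) j))) * indet j"
    let ?l = "\<lambda>j. const (lin_coeff (g t) j) * indet j"
    have tk: "t < k" using t r(2) by blast
    have gI: "g t \<in> I" by (rule g(1)[OF t])
    have gB: "g t \<in> B" using gI ideal_inD(1)[OF I_ideal_in] by blast
    have "(\<Sum>j<k. ?l j) = g t + const (const (-1)) * order2_part k (g t)"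
      using linear_part(1)[OF gI] by (simp add: const_simps algebra_simps)
    then have 1: "(\<Sum>j<k. ?l j) \<in> V"
      using Vadd[OF VS[OF SI[OF gI]] Vscale[OF VS[OF SM[OF linear_part(2)[OF gI]]], of "-1"]] by (simp only:)
    have 2: "?l j - ?e j \<in> V" if "j < k" for j
      using zero_pt_decomposition[OF const_mpol_over[OF subA] indet_zero_pt[OF that], of "lin_coeff (g t) j" \<Gamma>] lk_AC[OF gB]
      by (intro VS SM) (simp add: lin_coeff_def)
    have "(\<Sum>j<k. ?l j - ?e j) \<in> V" by (rule ideal_in_sum[OF V 2]) simp
    then have "(\<Sum>j<k. ?l j) - (\<Sum>j<k. ?e j) \<in> V" by (simp add: sum_subtractf)
    from ideal_in_diff[OF subB V 1 this] have 3: "(\<Sum>j<k. ?e j) \<in> V" by simp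
    have 4: "(\<Sum>j\<in>{..<k} - {t}. ?e j) \<in> V"
    proof (rule ideal_in_sum[OF V])
      fix j assume j: "j \<in> {..<k} - {t}"
      show "?e j \<in> V"
      proof (cases "j \<in> set js")
        case True
        then have "lin_coeff (g t) j = 0" using g(2)[OF t True] j by simp
        then show ?thesis using ideal_inD(2)[OF V] by (simp add: ring_mapD(4)[OF ring_map_eval_at] const_simps)
      next
        case False
        then show ?thesis using j by (intro Vscale xV1) auto
      qed
    qed
    have "(\<Sum>j<k. ?e j) = ?e t + (\<Sum>j\<in>{..<k} - {t}. ?e j)" by (rule sum.remove) (use tk in auto)
    then have "?e t \<in> V" using ideal_in_diff[OF subB V 3 4] by simp
    then have 5: "const (const (eval_at \<Gamma> (det (minor_matrix LA is js)))) * indet t \<in> V" using g(2)[OF t t] by simp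
    have "const (const (inverse (eval_at \<Gamma> (det (minor_matrix LA is js))))) * (const (const (eval_at \<Gamma> (det (minor_matrix LA is js)))) * indet t) = indet t"
      using nz unfolding D by (simp only: mult.assoc[symmetric] const_simps(5)[symmetric]) (simp add: const_simps)
    then show ?thesis using Vscale[OF 5, of "inverse (eval_at \<Gamma> (det (minor_matrix LA is js)))"] by (simp only:)
  qed
  have gens: "{const (indet i - const (\<Gamma> $ i)) | i. i < m} \<union> {indet j | j. j < k} \<subseteq> V"
  proof -
    have "const (indet i - const (\<Gamma> $ i)) \<in> V" if "i < m" for i
      using zV[of i] that by (simp add: cot_vec_def)
    moreover have "indet j \<in> V" if "j < k" for j using xV1[OF that] xV2 by blast
    ultimately show ?thesis by blast
  qed
  have "zero_pt m k \<Gamma> = span_in B ({const (indet i - const (\<Gamma> $ i)) | i. i < m} \<union> {indet j | j. j < k})"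
    using P_zero_point_eq[of m k \<Gamma>] by simp
  then have "f \<in> V" using span_in_minimal[OF V gens] f by blast
  then show ?thesis unfolding V_def lc_def by blast
qed

text \<open>Apply derivatives along tangent directions to the combination. All directions in the \<open>a\<^sub>i\<close> are tangent; and for each \<open>j\<close> in \<open>L\<close> the
  expansion of the column \<open>j\<close> by the columns of the minor is a kernel vector that is nonzero at \<open>j\<close> and zero at the other members of \<open>L\<close>.\<close>

lemma cot_vec_indep:
  assumes len: "length is = r" "length js = r" and r: "set is \<subseteq> {..<length G}" "set js \<subseteq> {..<k}"
    and nz: "det (minor_matrix (lin_mat_K k G \<Gamma>) is js) \<noteq> 0" and mx: "\<not> has_minor (lin_mat_K k G \<Gamma>) (Suc r)"
    and L: "set L = {..<k} - set js" "distinct L"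
    and v: "(\<Sum>i<m + length L. const (const (v i)) * cot_vec \<Gamma> L i) \<in> ideal_sum I (zero_pt_sq \<Gamma>)" and i: "i < m + length L"
  shows "v i = 0"
proof -
  let ?M = "lin_mat_K k G \<Gamma>"
  have dims: "dim_row ?M = length G" "dim_col ?M = k" by (simp_all add: lin_mat_K_def)
  have sum_eq: "(\<Sum>i<m. v i * \<alpha> i) + (\<Sum>a<length L. v (m + a) * \<beta> (L ! a)) = 0"
    if ker: "\<And>i. i < length G \<Longrightarrow> (\<Sum>j<k. ?M $$ (i, j) * \<beta> j) = 0" for \<alpha> \<beta>
  proof -
    let ?\<psi> = "dual_eval \<Gamma> \<alpha> \<beta>"
    note \<psi> = ring_mapD[OF ring_map_dual_eval, of \<Gamma> \<alpha> \<beta>]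
    obtain x y where xy: "(\<Sum>i<m + length L. const (const (v i)) * cot_vec \<Gamma> L i) = x + y" "x \<in> I" "y \<in> zero_pt_sq \<Gamma>"
      using v unfolding ideal_sum_def by blast
    have "coeff (?\<psi> (\<Sum>i<m + length L. const (const (v i)) * cot_vec \<Gamma> L i)) 1 = 0"
      using coeff_1_zero_pt_sq[OF xy(3), of \<alpha> \<beta>] coeff_1_I[where \<alpha> = \<alpha>, OF ker xy(2)]
      unfolding xy(1) \<psi>(2) coeff_add by simp
    moreover have "coeff (?\<psi> (const (const (v i)) * cot_vec \<Gamma> L i)) 1 = (if i < m then v i * \<alpha> i else v i * \<beta> (L ! (i - m)))" for i
      unfolding \<psi>(3) dual_eval_simps by (simp add: cot_vec_def const_simps \<psi> dual_eval_simps)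
    ultimately have "(\<Sum>i<m + length L. if i < m then v i * \<alpha> i else v i * \<beta> (L ! (i - m))) = 0"
      unfolding \<psi>(8) coeff_sum by simp
    moreover have "(\<Sum>i<m + n. h i) = (\<Sum>i<m. h i) + (\<Sum>a<n. h (m + a))" for n and h :: "nat \<Rightarrow> 'k"
      by (induct n) simp_all
    ultimately show ?thesis by simp
  qed
  show ?thesis
  proof (cases "i < m")
    case True
    have "(\<Sum>i'<m. v i' * (if i' = i then 1 else 0)) + (\<Sum>a<length L. v (m + a) * 0) = 0"
      by (rule sum_eq) simp
    moreover have "(\<Sum>i'<m. v i' * (if i' = i then 1 else 0)) = (\<Sum>i'<m. if i' = i then v i' else 0)"
      by (rule sum.cong) simp_all
    ultimately show ?thesis using True by simp
  next
    case False
    define a where "a = i - m"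
    have a: "a < length L" "i = m + a" using False i by (auto simp: a_def)
    define j where "j = L ! a"
    have "j \<in> set L" using a by (simp add: j_def)
    then have jk: "j < k" and jn: "j \<notin> set js" using L by auto
    let ?D = "det (minor_matrix ?M is js)"
    have van: "det (minor_matrix ?M (is @ [i]) (js @ [j])) = 0" if "i < dim_row ?M" for i
      using mx has_minorI[of "is @ [i]" "Suc r" "js @ [j]" ?M] len r that jk dims by auto
    obtain c where c: "\<And>i. i < length G \<Longrightarrow> ?D * ?M $$ (i, j) = (\<Sum>b<r. c b * ?M $$ (i, js ! b))"
      using column_expansion[of UNIV ?M "is" r js j, OF subring_UNIV UNIV_I len _ _ _ van] r jk unfolding dims by blast
    \<comment> \<open>The kernel vector given by the expansion of column \<open>j\<close>.\<close>
    define \<beta> where "\<beta> = (\<lambda>x. (if x = j then ?D else 0) - (\<Sum>b<r. if js ! b = x then c b else 0))"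
    have jsk: "js ! b < k" if "b < r" for b using subsetD[OF r(2) nth_mem, of b] that len by simp
    have ker: "(\<Sum>x<k. ?M $$ (i, x) * \<beta> x) = 0" if i: "i < length G" for i
    proof -
      have "(\<Sum>x<k. ?M $$ (i, x) * \<beta> x) = (\<Sum>x<k. (if x = j then ?D * ?M $$ (i, x) else 0) - (\<Sum>b<r. if js ! b = x then c b * ?M $$ (i, x) else 0))"
      proof (rule sum.cong[OF refl])
        fix x
        have "(\<Sum>b<r. if js ! b = x then c b * ?M $$ (i, x) else 0) = ?M $$ (i, x) * (\<Sum>b<r. if js ! b = x then c b else 0)"
          unfolding sum_distrib_left by (rule sum.cong[OF refl]) (simp only: mult.commute[of "?M $$ (i, x)"] if_distribR if_distrib[of "\<lambda>y. y * ?M $$ (i, x)"] mult_zero_left)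
        moreover have "?M $$ (i, x) * (if x = j then ?D else 0) = (if x = j then ?D * ?M $$ (i, x) else 0)"
          by (simp only: mult.commute[of "?M $$ (i, x)"] if_distrib[of "\<lambda>y. y * ?M $$ (i, x)"] mult_zero_left)
        ultimately show "?M $$ (i, x) * \<beta> x = (if x = j then ?D * ?M $$ (i, x) else 0) - (\<Sum>b<r. if js ! b = x then c b * ?M $$ (i, x) else 0)"
          unfolding \<beta>_def right_diff_distrib by (simp only:)
      qed
      also have "\<dots> = ?D * ?M $$ (i, j) - (\<Sum>x<k. \<Sum>b<r. if js ! b = x then c b * ?M $$ (i, x) else 0)"
        using jk by (simp add: sum_subtractf)
      also have "(\<Sum>x<k. \<Sum>b<r. if js ! b = x then c b * ?M $$ (i, x) else 0) = (\<Sum>b<r. \<Sum>x<k. if js ! b = x then c b * ?M $$ (i, x) else 0)"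
        by (rule sum.swap)
      also have "\<dots> = (\<Sum>b<r. c b * ?M $$ (i, js ! b))"
        by (rule sum.cong) (use jsk in simp_all)
      finally show ?thesis using c[OF i] by simp
    qed
    have \<beta>L: "\<beta> (L ! a') = (if a' = a then ?D else 0)" if "a' < length L" for a'
    proof -
      have "L ! a' \<in> set L" using that by simp
      then have "L ! a' \<notin> set js" using L by blast
      moreover have "js ! b \<in> set js" if "b < r" for b using that len(2) by simp
      ultimately have "js ! b \<noteq> L ! a'" if "b < r" for b using that by (metis (no_types))
      moreover have "L ! a' = j \<longleftrightarrow> a' = a" unfolding j_def using nth_eq_iff_index_eq[OF L(2) that a(1)] .
      ultimately show ?thesis by (simp add: \<beta>_def)
    qed
    have "(\<Sum>i'<m. v i' * 0) + (\<Sum>a'<length L. v (m + a') * \<beta> (L ! a')) = 0" by (rule sum_eq[OF ker])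
    moreover have "(\<Sum>a'<length L. v (m + a') * \<beta> (L ! a')) = (\<Sum>a'<length L. if a' = a then v (m + a') * ?D else 0)"
      by (rule sum.cong) (simp_all add: \<beta>L)
    moreover have "(\<Sum>a'<length L. if a' = a then v (m + a') * ?D else 0) = v (m + a) * ?D"
      using sum.delta'[of "{..<length L}" a "\<lambda>a'. v (m + a') * ?D"] a(1) by simp
    moreover have "(\<Sum>i'<m. v i' * 0) = 0" by simp
    ultimately have "v (m + a) * ?D = 0" by (simp only: add_0_left)
    then have "v (m + a) = 0" using nz by (simp only: mult_eq_0_iff) blast
    then show ?thesis unfolding a(2) .
  qed
qed

text \<open>A minor of maximal size \<open>\<rho>\<close> leaves \<open>k - \<rho>\<close> variables, so there are \<open>m + k - \<rho>\<close> basis vectors.\<close>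

lemma zero_point_cot_basis:
  shows "\<exists>z. cot_basis \<iota> Q (MM \<Gamma>) z (m + k - rank_K (lin_mat_K k G \<Gamma>))" "rank_K (lin_mat_K k G \<Gamma>) \<le> k"
proof -
  let ?M = "lin_mat_K k G \<Gamma>" and ?r = "rank_K (lin_mat_K k G \<Gamma>)"
  have dims: "dim_row ?M = length G" "dim_col ?M = k" by (simp_all add: lin_mat_K_def)
  obtain "is" js where len: "length is = ?r" "length js = ?r" and r: "set is \<subseteq> {..<length G}" "set js \<subseteq> {..<k}"
    and nz: "det (minor_matrix ?M is js) \<noteq> 0"
    using has_minor_iff_rank_K(2)[of ?M] unfolding has_minor_def dims by blast
  have mx: "\<not> has_minor ?M (Suc ?r)" by (simp add: has_minor_iff_rank_K(1))
  have dj: "distinct js"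
  proof (rule det_minor_matrix_rows_distinct[of js "is" "transpose_mat ?M"])
    show "det (minor_matrix (transpose_mat ?M) js is) \<noteq> 0"
      using det_minor_matrix_transpose[of "is" js ?M] len r nz dims by simp
  qed (use len in simp)
  have cjs: "card (set js) = ?r" using distinct_card[OF dj] len by simp
  show rk: "?r \<le> k" using card_mono[OF _ r(2)] cjs by simp
  define L where "L = sorted_list_of_set ({..<k} - set js)"
  have L: "set L = {..<k} - set js" "distinct L" by (simp_all add: L_def)
  have lenL: "length L = k - ?r" using card_Diff_subset[OF _ r(2)] cjs by (simp add: L_def)
  have N: "m + length L = m + k - ?r" using rk lenL by simp
  have Lk: "set L \<subseteq> {..<k}" using L by blast
  let ?N = "m + length L"
  have zB: "cot_vec \<Gamma> L i \<in> B" if "i < ?N" for i by (rule zero_pt_B[OF cot_vec_zero_pt[OF Lk that]])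
  have lcB: "const (const (v i)) * cot_vec \<Gamma> L i \<in> B" if "i < ?N" for v i by (rule subring_setD(4)[OF subB cc_PC zB[OF that]])
  have sB: "(\<Sum>i<?N. const (const (v i)) * cot_vec \<Gamma> L i) \<in> B" for v by (rule subring_sum[OF subB lcB]) simp
  have fs: "(\<Oplus>\<^bsub>Q\<^esub>i\<in>{..<?N}. \<iota> (v i) \<otimes>\<^bsub>Q\<^esub> \<pi> (cot_vec \<Gamma> L i)) = \<pi> (\<Sum>i<?N. const (const (v i)) * cot_vec \<Gamma> L i)" for v
  proof -
    have "(\<Oplus>\<^bsub>Q\<^esub>i\<in>{..<?N}. \<iota> (v i) \<otimes>\<^bsub>Q\<^esub> \<pi> (cot_vec \<Gamma> L i)) = (\<Oplus>\<^bsub>Q\<^esub>i\<in>{..<?N}. \<pi> (const (const (v i)) * cot_vec \<Gamma> L i))"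
    proof (rule Q.finsum_cong')
      show "(\<lambda>i. \<pi> (const (const (v i)) * cot_vec \<Gamma> L i)) \<in> {..<?N} \<rightarrow> carrier Q" using \<pi>_closed[OF lcB] by simp
      fix i assume "i \<in> {..<?N}"
      then show "\<iota> (v i) \<otimes>\<^bsub>Q\<^esub> \<pi> (cot_vec \<Gamma> L i) = \<pi> (const (const (v i)) * cot_vec \<Gamma> L i)"
        unfolding \<iota>_def by (intro \<pi>_simps(1)[OF cc_PC zB]) simp
    qed simp
    then show ?thesis using \<pi>_sum[of "{..<?N}" "\<lambda>i. const (const (v i)) * cot_vec \<Gamma> L i"] lcB by simp
  qed
  have "cot_basis \<iota> Q (MM \<Gamma>) (\<lambda>i. \<pi> (cot_vec \<Gamma> L i)) ?N"
    unfolding cot_basis_def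
  proof (intro conjI allI impI ballI)
    fix i assume "i < ?N" then show "\<pi> (cot_vec \<Gamma> L i) \<in> MM \<Gamma>" unfolding MM_def by (intro imageI cot_vec_zero_pt[OF Lk])
  next
    fix x assume "x \<in> MM \<Gamma>"
    then obtain f where f: "f \<in> zero_pt m k \<Gamma>" "x = \<pi> f" unfolding MM_def by blast
    obtain v where v: "f - (\<Sum>i<?N. const (const (v i)) * cot_vec \<Gamma> L i) \<in> ideal_sum I (zero_pt_sq \<Gamma>)"
      using cot_vec_span[OF len r nz L(1) f(1)] by blast
    have "\<pi> (f - (\<Sum>i<?N. const (const (v i)) * cot_vec \<Gamma> L i)) \<in> MM \<Gamma> \<cdot>\<^bsub>Q\<^esub> MM \<Gamma>"
      using \<pi>_MM_prod_iff[OF subring_setD(3)[OF subB zero_pt_B[OF f(1)] sB[of v]], of \<Gamma>] v by (rule iffD2)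
    then show "\<exists>v. x \<ominus>\<^bsub>Q\<^esub> (\<Oplus>\<^bsub>Q\<^esub>i\<in>{..<?N}. \<iota> (v i) \<otimes>\<^bsub>Q\<^esub> \<pi> (cot_vec \<Gamma> L i)) \<in> MM \<Gamma> \<cdot>\<^bsub>Q\<^esub> MM \<Gamma>"
      unfolding fs f(2) by (intro exI[of _ v]) (simp only: \<pi>_simps(3)[OF zero_pt_B[OF f(1)] sB[of v]])
  next
    fix v i assume v: "(\<Oplus>\<^bsub>Q\<^esub>i\<in>{..<?N}. \<iota> (v i) \<otimes>\<^bsub>Q\<^esub> \<pi> (cot_vec \<Gamma> L i)) \<in> MM \<Gamma> \<cdot>\<^bsub>Q\<^esub> MM \<Gamma>" and i: "i < ?N"
    have 1: "\<pi> (\<Sum>i<?N. const (const (v i)) * cot_vec \<Gamma> L i) \<in> MM \<Gamma> \<cdot>\<^bsub>Q\<^esub> MM \<Gamma>"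
      using v unfolding fs[of v] .
    have 2: "(\<Sum>i<?N. const (const (v i)) * cot_vec \<Gamma> L i) \<in> ideal_sum I (zero_pt_sq \<Gamma>)"
      by (rule iffD1[OF \<pi>_MM_prod_iff[OF sB[of v]] 1])
    show "v i = 0" by (rule cot_vec_indep[of "is" ?r js \<Gamma> L v i, OF len r nz mx L 2 i])
  qed
  then show "\<exists>z. cot_basis \<iota> Q (MM \<Gamma>) z (m + k - rank_K (lin_mat_K k G \<Gamma>))"
    unfolding N by (rule exI[of _ "\<lambda>i. \<pi> (cot_vec \<Gamma> L i)"])
qed

lemma Cot_dim_eq: "Cot_dim m k I \<Gamma> = m + k - rank_K (lin_mat_K k G \<Gamma>)"
proof -
  obtain z where z: "cot_basis \<iota> Q (MM \<Gamma>) z (m + k - rank_K (lin_mat_K k G \<Gamma>))"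
    using zero_point_cot_basis(1)[of \<Gamma>] by (rule exE)
  have "ideal (MM \<Gamma>) Q" using MM_maximal by (rule maximalideal.axioms)
  from cotangent_dim_eqI[OF Q.is_cring this \<iota>_hom z] show ?thesis
    unfolding Cot_dim_def R_of_K_\<iota> R_ring_Q R_zero_point_MM .
qed

lemma embcodim_loc: "embcodim (R_loc_of_K m k I \<Gamma>) (R_loc m k I \<Gamma>)
  = int (m + k - rank_K (lin_mat_K k G \<Gamma>)) - int (loc_dim m k I \<Gamma>)"
proof -
  obtain z where z: "cot_basis \<iota> Q (MM \<Gamma>) z (m + k - rank_K (lin_mat_K k G \<Gamma>))"
    using zero_point_cot_basis(1)[of \<Gamma>] by (rule exE)
  have "R_loc_of_K m k I \<Gamma> = (\<lambda>c. loc_frac Q (MM \<Gamma>) (\<iota> c) \<one>\<^bsub>Q\<^esub>)"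
    by (rule ext) (simp only: R_loc_of_K_def R_of_K_\<iota> R_ring_Q R_zero_point_MM)
  moreover have "R_loc m k I \<Gamma> = localization Q (MM \<Gamma>)"
    by (simp only: R_loc_def R_ring_Q R_zero_point_MM)
  ultimately show ?thesis
    unfolding embcodim_def loc_dim_def
    using localize.cotangent_dim_L[OF localize_MM \<iota>_hom MM_residue z] by (simp only:)
qed

end

section \<open>Minimal primes and irreducible components\<close>

text \<open>The closed subset of the spectrum defined by \<open>S\<close>.\<close>

definition primes_above :: "('a, 'b) ring_scheme \<Rightarrow> 'a set \<Rightarrow> 'a set set" where
  "primes_above R S = {\<pp>. primeideal \<pp> R \<and> S \<subseteq> \<pp>}"

lemma closedin_Spec: "closedin (Spec R) Z \<longleftrightarrow> (\<exists>S \<subseteq> carrier R. Z = primes_above R S)"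
proof
  assume Z: "closedin (Spec R) Z"
  then obtain S where S: "S \<subseteq> carrier R" "topspace (Spec R) - Z = {\<pp>. primeideal \<pp> R \<and> \<not> S \<subseteq> \<pp>}"
    unfolding closedin_def openin_Spec by (elim conjE exE)
  have Zs: "Z \<subseteq> {\<pp>. primeideal \<pp> R}" using Z unfolding closedin_def topspace_Spec by (rule conjunct1)
  have "Z = topspace (Spec R) - (topspace (Spec R) - Z)" using Zs unfolding topspace_Spec by blast
  also have "\<dots> = primes_above R S" unfolding S(2) unfolding topspace_Spec primes_above_def by blast
  finally show "\<exists>S \<subseteq> carrier R. Z = primes_above R S" using S(1) by (intro exI[of _ S] conjI)
next
  assume "\<exists>S \<subseteq> carrier R. Z = primes_above R S"
  then obtain S where S: "S \<subseteq> carrier R" "Z = primes_above R S" by (elim exE conjE)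
  have "topspace (Spec R) - Z = {\<pp>. primeideal \<pp> R \<and> \<not> S \<subseteq> \<pp>}"
    unfolding topspace_Spec S(2) primes_above_def by blast
  then have "openin (Spec R) (topspace (Spec R) - Z)" unfolding openin_Spec using S(1) by (intro exI[of _ S] conjI)
  then show "closedin (Spec R) Z" unfolding closedin_def by (simp add: topspace_Spec S(2) primes_above_def Collect_mono)
qed

lemma irreducible_in_subtopology:
  assumes "C \<subseteq> topspace X"
  shows "irreducible_in (subtopology X C) Z \<longleftrightarrow> irreducible_in X Z \<and> Z \<subseteq> C"
proof
  assume Z: "irreducible_in (subtopology X C) Z"
  then have ZC: "Z \<subseteq> C" "Z \<subseteq> topspace X" "Z \<noteq> {}" by (auto simp: irreducible_in_def)
  have "Z \<subseteq> F \<or> Z \<subseteq> G" if FG: "closedin X F" "closedin X G" "Z \<subseteq> F \<union> G" for F G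
  proof -
    have "closedin (subtopology X C) (F \<inter> C)" "closedin (subtopology X C) (G \<inter> C)"
      using FG unfolding closedin_subtopology by blast+
    moreover have "Z \<subseteq> (F \<inter> C) \<union> (G \<inter> C)" using FG(3) ZC(1) by blast
    ultimately have "Z \<subseteq> F \<inter> C \<or> Z \<subseteq> G \<inter> C" using Z unfolding irreducible_in_def by presburger
    then show ?thesis by blast
  qed
  then show "irreducible_in X Z \<and> Z \<subseteq> C" using ZC unfolding irreducible_in_def by presburger
next
  assume Z: "irreducible_in X Z \<and> Z \<subseteq> C"
  have "Z \<subseteq> F \<or> Z \<subseteq> G" if FG: "closedin (subtopology X C) F" "closedin (subtopology X C) G" "Z \<subseteq> F \<union> G" for F G
  proof -
    obtain F' where F': "closedin X F'" "F = F' \<inter> C" using FG(1) unfolding closedin_subtopology by (elim exE conjE)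
    obtain G' where G': "closedin X G'" "G = G' \<inter> C" using FG(2) unfolding closedin_subtopology by (elim exE conjE)
    have "Z \<subseteq> F' \<union> G'" using FG(3) F'(2) G'(2) by blast
    then have "Z \<subseteq> F' \<or> Z \<subseteq> G'" using Z F'(1) G'(1) unfolding irreducible_in_def by presburger
    then show ?thesis using Z F'(2) G'(2) by blast
  qed
  then show "irreducible_in (subtopology X C) Z" using Z assms unfolding irreducible_in_def by (simp; blast)
qed

context cring begin

lemma primes_above_irreducible: assumes q: "primeideal q R" shows "closedin (Spec R) (primes_above R q)" "irreducible_in (Spec R) (primes_above R q)"
proof -
  interpret q: primeideal q R by (rule q)
  show "closedin (Spec R) (primes_above R q)" unfolding closedin_Spec using q.a_subset by (intro exI[of _ q] conjI refl)
  have qV: "q \<in> primes_above R q" using q by (simp add: primes_above_def)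
  have "primes_above R q \<subseteq> F" if F: "closedin (Spec R) F" "q \<in> F" for F
  proof -
    obtain S where "S \<subseteq> carrier R" "F = primes_above R S" using F(1) unfolding closedin_Spec by (elim exE conjE)
    then show ?thesis using F(2) unfolding primes_above_def by blast
  qed
  moreover have "primes_above R q \<subseteq> topspace (Spec R)" unfolding topspace_Spec primes_above_def by blast
  ultimately show "irreducible_in (Spec R) (primes_above R q)" using qV unfolding irreducible_in_def by blast
qed

text \<open>If \<open>ab\<close> lies in all members of \<open>Z\<close>, then the closed sets of \<open>a\<close> and of \<open>b\<close> cover \<open>Z\<close>, and one of them contains \<open>Z\<close>.\<close>

lemma Inter_irreducible_prime: assumes Z: "irreducible_in (Spec R) Z" shows "primeideal (\<Inter>Z) R"
proof (rule primeidealI)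
  have ne: "Z \<noteq> {}" and pr: "\<And>z. z \<in> Z \<Longrightarrow> primeideal z R" using Z unfolding irreducible_in_def topspace_Spec by blast+
  have id: "ideal z R" if "z \<in> Z" for z by (rule primeideal.axioms(1)[OF pr[OF that]])
  show "ideal (\<Inter>Z) R" by (rule i_Intersect[OF id ne])
  show "cring R" by (rule is_cring)
  obtain z where z: "z \<in> Z" using ne by blast
  have "z \<subseteq> carrier R" "carrier R \<noteq> z"
    using primeideal.I_notcarr[OF pr[OF z]] ideal.Icarr[OF id[OF z]] by blast+
  then show "carrier R \<noteq> \<Inter>Z" using z by blast
  fix a b assume ab: "a \<in> carrier R" "b \<in> carrier R" "a \<otimes> b \<in> \<Inter>Z"
  have c: "closedin (Spec R) (primes_above R {a})" "closedin (Spec R) (primes_above R {b})"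
    unfolding closedin_Spec using ab(1,2) by blast+
  have "Z \<subseteq> primes_above R {a} \<union> primes_above R {b}"
  proof
    fix z assume z: "z \<in> Z"
    then have "a \<otimes> b \<in> z" using ab(3) by blast
    then have "a \<in> z \<or> b \<in> z" by (rule primeideal.I_prime[OF pr[OF z] ab(1,2)])
    then show "z \<in> primes_above R {a} \<union> primes_above R {b}" using pr[OF z] by (simp add: primes_above_def)
  qed
  then have "Z \<subseteq> primes_above R {a} \<or> Z \<subseteq> primes_above R {b}" using Z c unfolding irreducible_in_def by presburger
  then show "a \<in> \<Inter>Z \<or> b \<in> \<Inter>Z" unfolding primes_above_def by blast
qed

lemma closed_eq_primes_above_Inter: assumes "closedin (Spec R) Z" "Z \<noteq> {}" shows "Z = primes_above R (\<Inter>Z)"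
proof -
  obtain S where S: "S \<subseteq> carrier R" "Z = primes_above R S" using assms(1) unfolding closedin_Spec by (elim exE conjE)
  show ?thesis
  proof
    show "Z \<subseteq> primes_above R (\<Inter>Z)" unfolding S(2) primes_above_def by blast
    have s: "S \<subseteq> \<Inter>Z" unfolding S(2) primes_above_def by blast
    show "primes_above R (\<Inter>Z) \<subseteq> Z"
    proof
      fix p assume "p \<in> primes_above R (\<Inter>Z)"
      then have "primeideal p R" "S \<subseteq> p" using s unfolding primes_above_def by auto
      then show "p \<in> Z" unfolding S(2) primes_above_def by blast
    qed
  qed
qed

definition minimal_prime :: "'a set \<Rightarrow> bool" where
  "minimal_prime q \<longleftrightarrow> primeideal q R \<and> (\<forall>q'. primeideal q' R \<longrightarrow> q' \<subseteq> q \<longrightarrow> q' = q)"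

text \<open>An irreducible set that contains \<open>V(q)\<close> has a generic prime inside \<open>q\<close>, which equals \<open>q\<close> by minimality.\<close>

lemma minimal_prime_component: assumes q: "minimal_prime q" shows "primes_above R q \<in> irreducible_components (Spec R)"
  unfolding irreducible_components_def
proof (intro CollectI conjI allI impI)
  have qp: "primeideal q R" using q by (simp add: minimal_prime_def)
  show "irreducible_in (Spec R) (primes_above R q)" by (rule primes_above_irreducible(2)[OF qp])
  fix Z assume Z: "irreducible_in (Spec R) Z \<and> primes_above R q \<subseteq> Z"
  have "q \<in> Z" using Z qp unfolding primes_above_def by blast
  then have "\<Inter>Z \<subseteq> q" by blast
  then have "\<Inter>Z = q" using q Inter_irreducible_prime[of Z] Z unfolding minimal_prime_def by presburger
  moreover have "Z \<subseteq> {\<pp>. primeideal \<pp> R}" using Z unfolding irreducible_in_def topspace_Spec by blast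
  ultimately have "Z \<subseteq> primes_above R q" unfolding primes_above_def by blast
  then show "Z = primes_above R q" using Z by blast
qed

text \<open>Zorn's lemma for the complements of the primes inside \<open>p\<close>: the intersection of a chain of primes is prime.\<close>

lemma minimal_prime_exists: assumes p: "primeideal p R" shows "\<exists>q \<subseteq> p. minimal_prime q"
proof -
  define \<A> where "\<A> = {carrier R - q | q. primeideal q R \<and> q \<subseteq> p}"
  have pc: "q \<subseteq> carrier R" if "primeideal q R" for q
    using ideal.Icarr[OF primeideal.axioms(1)[OF that]] by blast
  have "\<exists>M\<in>\<A>. \<forall>X\<in>\<A>. M \<subseteq> X \<longrightarrow> X = M"
  proof (rule subset_Zorn)
    fix \<C> assume ch: "subset.chain \<A> \<C>"
    show "\<exists>U\<in>\<A>. \<forall>X\<in>\<C>. X \<subseteq> U"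
    proof (cases "\<C> = {}")
      case True
      have "carrier R - p \<in> \<A>" using p unfolding \<A>_def by blast
      then show ?thesis using True by blast
    next
      case False
      define Z where "Z = {carrier R - X | X. X \<in> \<C>}"
      have CA: "\<C> \<subseteq> \<A>" and tot: "X \<subseteq> Y \<or> Y \<subseteq> X" if "X \<in> \<C>" "Y \<in> \<C>" for X Y
        using ch that unfolding subset_chain_def by blast+
      have CA: "X \<in> \<A>" if "X \<in> \<C>" for X using ch that unfolding subset_chain_def by blast
      have Zp: "primeideal z R \<and> z \<subseteq> p" if "z \<in> Z" for z
      proof -
        from that obtain X where X: "X \<in> \<C>" "z = carrier R - X" unfolding Z_def by blast
        from CA[OF X(1)] obtain q where q: "X = carrier R - q" "primeideal q R" "q \<subseteq> p" unfolding \<A>_def by blast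
        have "z = q" unfolding X(2) q(1) using pc[OF q(2)] by blast
        then show ?thesis using q by blast
      qed
      have Zne: "Z \<noteq> {}" using False unfolding Z_def by blast
      have Ztot: "z \<subseteq> z' \<or> z' \<subseteq> z" if zz: "z \<in> Z" "z' \<in> Z" for z z'
      proof -
        obtain X X' where X: "X \<in> \<C>" "z = carrier R - X" "X' \<in> \<C>" "z' = carrier R - X'" using zz unfolding Z_def by blast
        show ?thesis using tot[OF X(1,3)] unfolding X(2,4) by blast
      qed
      have "primeideal (\<Inter>Z) R"
      proof (rule primeidealI)
        show "ideal (\<Inter>Z) R" by (rule i_Intersect[OF _ Zne]) (use Zp primeideal.axioms(1) in blast)
        show "cring R" by (rule is_cring)
        obtain z where z: "z \<in> Z" using Zne by blast
        have zp: "primeideal z R" using Zp[OF z] by (rule conjunct1)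
        then show "carrier R \<noteq> \<Inter>Z" using z pc[OF zp] primeideal.I_notcarr[OF zp] by blast
        fix a b assume ab: "a \<in> carrier R" "b \<in> carrier R" "a \<otimes> b \<in> \<Inter>Z"
        show "a \<in> \<Inter>Z \<or> b \<in> \<Inter>Z"
        proof (rule ccontr)
          assume "\<not> ?thesis"
          then obtain z z' where z: "z \<in> Z" "a \<notin> z" "z' \<in> Z" "b \<notin> z'" by blast
          obtain y where y: "y \<in> Z" "a \<notin> y" "b \<notin> y" using Ztot[OF z(1,3)] z by blast
          have "a \<otimes> b \<in> y" using ab(3) y(1) by blast
          then have "a \<in> y \<or> b \<in> y" by (rule primeideal.I_prime[OF conjunct1[OF Zp[OF y(1)]] ab(1,2)])
          then show False using y by blast
        qed
      qed
      moreover have "\<Inter>Z \<subseteq> p" using Zne Zp by blast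
      ultimately have "carrier R - \<Inter>Z \<in> \<A>" unfolding \<A>_def by blast
      moreover have "X \<subseteq> carrier R - \<Inter>Z" if X: "X \<in> \<C>" for X
      proof -
        have "X \<subseteq> carrier R" using CA[OF X] unfolding \<A>_def by blast
        moreover have "carrier R - X \<in> Z" using X unfolding Z_def by blast
        ultimately show ?thesis by blast
      qed
      ultimately show ?thesis by (intro bexI[of _ "carrier R - \<Inter>Z"] ballI)
    qed
  qed
  then obtain M where M: "M \<in> \<A>" "\<And>X. X \<in> \<A> \<Longrightarrow> M \<subseteq> X \<Longrightarrow> X = M" by blast
  from M(1) obtain q where q: "M = carrier R - q" "primeideal q R" "q \<subseteq> p" unfolding \<A>_def by blast
  have "q' = q" if q': "primeideal q' R" "q' \<subseteq> q" for q'
  proof -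
    have "carrier R - q' \<in> \<A>" unfolding \<A>_def using q' q(3) by blast
    then have "carrier R - q' = carrier R - q" using M(2)[of "carrier R - q'"] q'(2) unfolding q(1) by blast
    then show ?thesis using pc[OF q'(1)] pc[OF q(2)] by blast
  qed
  then have "minimal_prime q" using q(2) unfolding minimal_prime_def by blast
  then show ?thesis using q(3) by blast
qed

text \<open>The sets \<open>V(f i)\<close> form a chain of closed irreducible sets in reversed order.\<close>

lemma topological_dim_component_ge:
  assumes f: "spec_chain R r f" and q: "primeideal q R" "q \<subseteq> f 0"
  shows "enat r \<le> topological_dim (subtopology (Spec R) (primes_above R q))"
proof -
  have qf: "q \<subseteq> f i" if "i \<le> r" for i using spec_chain_subset[OF f _ that, of 0] q(2) by auto
  have fp: "primeideal (f i) R" if "i \<le> r" for i using f that by (simp add: spec_chain_def)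
  have C: "primes_above R q \<subseteq> topspace (Spec R)" unfolding topspace_Spec primes_above_def by blast
  have sub: "primes_above R (f i) \<subseteq> primes_above R q" if "i \<le> r" for i using qf[OF that] unfolding primes_above_def by blast
  have "(\<forall>i\<le>r. closedin (subtopology (Spec R) (primes_above R q)) (primes_above R (f (r - i))) \<and>
      irreducible_in (subtopology (Spec R) (primes_above R q)) (primes_above R (f (r - i)))) \<and>
      (\<forall>i<r. primes_above R (f (r - i)) \<subset> primes_above R (f (r - Suc i)))"
  proof (intro conjI allI impI)
    fix i assume "i \<le> r"
    have ri: "r - i \<le> r" by simp
    show "closedin (subtopology (Spec R) (primes_above R q)) (primes_above R (f (r - i)))"
      unfolding closedin_closed_subtopology[OF primes_above_irreducible(1)[OF q(1)]]
      using primes_above_irreducible(1)[OF fp[OF ri]] sub[OF ri] by (rule conjI)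
    show "irreducible_in (subtopology (Spec R) (primes_above R q)) (primes_above R (f (r - i)))"
      unfolding irreducible_in_subtopology[OF C]
      using primes_above_irreducible(2)[OF fp[OF ri]] sub[OF ri] by (rule conjI)
  next
    fix i assume i: "i < r"
    then have e: "Suc (r - Suc i) = r - i" by simp
    have s: "f (r - Suc i) \<subset> f (r - i)" using f i unfolding spec_chain_def e[symmetric] by simp
    have "f (r - Suc i) \<in> primes_above R (f (r - Suc i))" "f (r - Suc i) \<notin> primes_above R (f (r - i))"
      using s fp[of "r - Suc i"] by (auto simp: primes_above_def)
    moreover have "primes_above R (f (r - i)) \<subseteq> primes_above R (f (r - Suc i))" using s unfolding primes_above_def by blast
    ultimately show "primes_above R (f (r - i)) \<subset> primes_above R (f (r - Suc i))" by blast
  qed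
  then have "\<exists>Z. (\<forall>i\<le>r. closedin (subtopology (Spec R) (primes_above R q)) (Z i) \<and>
      irreducible_in (subtopology (Spec R) (primes_above R q)) (Z i)) \<and> (\<forall>i<r. Z i \<subset> Z (Suc i))"
    by (rule exI[where x = "\<lambda>i. primes_above R (f (r - i))"])
  then show ?thesis unfolding topological_dim_def by (intro Sup_upper CollectI exI[of _ r] conjI refl)
qed

text \<open>A chain of closed irreducible subsets of \<open>V(q)\<close> yields a chain of primes in reversed order by taking intersections. It lies over \<open>q\<close>,
  so its first member can be replaced by \<open>q\<close>.\<close>

lemma topological_dim_component_chain:
  assumes d: "enat d \<le> topological_dim (subtopology (Spec R) (primes_above R q))" and q: "primeideal q R"
  shows "\<exists>f. spec_chain R d f \<and> f 0 = q"
proof (cases d)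
  case 0
  then show ?thesis using q by (intro exI[of _ "\<lambda>_. q"]) (simp add: spec_chain_def)
next
  case (Suc e)
  let ?X = "subtopology (Spec R) (primes_above R q)"
  let ?ch = "\<lambda>r Z. (\<forall>i\<le>r. closedin ?X (Z i) \<and> irreducible_in ?X (Z i)) \<and> (\<forall>i<r. Z i \<subset> Z (Suc i))"
  \<comment> \<open>A supremum of lengths that is at least \<open>d = e + 1\<close> cannot be bounded by \<open>e\<close>.\<close>
  have "\<exists>r\<ge>d. \<exists>Z. ?ch r Z"
  proof (rule ccontr)
    assume n: "\<not> ?thesis"
    have "topological_dim ?X \<le> enat e" unfolding topological_dim_def
    proof (rule Sup_least)
      fix x assume "x \<in> {enat r | r. \<exists>Z. ?ch r Z}"
      then obtain r where r: "x = enat r" "\<exists>Z. ?ch r Z" by blast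
      have "\<not> d \<le> r" using n r(2) by blast
      then show "x \<le> enat e" using r(1) Suc by simp
    qed
    with d have "enat d \<le> enat e" by (rule order_trans)
    then show False using Suc by simp
  qed
  then obtain r Z where r: "d \<le> r" and Z: "?ch r Z" by blast
  have C: "primes_above R q \<subseteq> topspace (Spec R)" unfolding topspace_Spec primes_above_def by blast
  have Zi: "irreducible_in (Spec R) (Z i)" "Z i \<subseteq> primes_above R q" "closedin (Spec R) (Z i)" "Z i \<noteq> {}" if "i \<le> r" for i
  proof -
    have a: "closedin ?X (Z i)" "irreducible_in ?X (Z i)" using Z that by simp_all
    show "irreducible_in (Spec R) (Z i)" "Z i \<subseteq> primes_above R q" using a(2) unfolding irreducible_in_subtopology[OF C] by simp_all
    show "closedin (Spec R) (Z i)" using a(1) unfolding closedin_closed_subtopology[OF primes_above_irreducible(1)[OF q]] by (rule conjunct1)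
    show "Z i \<noteq> {}" using a(2) unfolding irreducible_in_def by (rule conjunct1)
  qed
  define g where "g = (\<lambda>i. \<Inter>(Z (r - i)))"
  have gp: "primeideal (g i) R" for i unfolding g_def by (rule Inter_irreducible_prime[OF Zi(1)]) simp
  have qg: "q \<subseteq> g i" for i using Zi(2)[of "r - i"] unfolding g_def primes_above_def by auto
  have gs: "g i \<subset> g (Suc i)" if i: "i < r" for i
  proof -
    have e: "Suc (r - Suc i) = r - i" using i by simp
    have s: "Z (r - Suc i) \<subset> Z (r - i)" using Z i unfolding e[symmetric] by simp
    have "g i \<noteq> g (Suc i)"
    proof
      assume g: "g i = g (Suc i)"
      have "Z (r - i) = primes_above R (g i)" unfolding g_def by (rule closed_eq_primes_above_Inter[OF Zi(3,4)]) simp_all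
      moreover have "Z (r - Suc i) = primes_above R (g (Suc i))" unfolding g_def by (rule closed_eq_primes_above_Inter[OF Zi(3,4)]) simp_all
      ultimately show False using s g by simp
    qed
    moreover have "g i \<subseteq> g (Suc i)" using s unfolding g_def by blast
    ultimately show ?thesis by blast
  qed
  have "spec_chain R d (g(0 := q))" unfolding spec_chain_def
  proof (intro conjI allI impI)
    fix i show "primeideal ((g(0 := q)) i) R" using gp q by simp
  next
    fix i assume "i < d"
    then have s: "g i \<subset> g (Suc i)" using gs r by simp
    show "(g(0 := q)) i \<subset> (g(0 := q)) (Suc i)" using s qg[of i] by auto
  qed
  then show ?thesis by (intro exI[of _ "g(0 := q)"]) simp
qed

text \<open>The first prime of the given chain contains a minimal prime, whose component has dimension at least \<open>d\<close>; so has the component of \<open>q\<close>.\<close>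

lemma equidimensional_chain:
  assumes eq: "equidimensional (Spec R)" and f: "spec_chain R d f" and q: "minimal_prime q"
  shows "\<exists>f. spec_chain R d f \<and> f 0 = q"
proof -
  have "primeideal (f 0) R" using f by (simp add: spec_chain_def)
  then obtain q' where q': "q' \<subseteq> f 0" "minimal_prime q'" using minimal_prime_exists by blast
  have pq: "primeideal q R" "primeideal q' R" using q q'(2) by (simp_all add: minimal_prime_def)
  have "topological_dim (subtopology (Spec R) (primes_above R q')) = topological_dim (subtopology (Spec R) (primes_above R q))"
    using eq minimal_prime_component[OF q] minimal_prime_component[OF q'(2)] unfolding equidimensional_def by blast
  then have "enat d \<le> topological_dim (subtopology (Spec R) (primes_above R q))"
    using topological_dim_component_ge[OF f pq(2) q'(1)] by simp
  then show ?thesis by (rule topological_dim_component_chain[OF _ pq(1)])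
qed

end

section \<open>Local dimension along the zero section\<close>

lemma finite_ks_bound: "\<exists>N. \<forall>t\<in>ks f. wt w k t < N"
proof
  show "\<forall>t\<in>ks f. wt w k t < Suc (Max (wt w k ` ks f))" by (auto simp: less_Suc_eq_le)
qed

text \<open>The bound \<open>N\<close> on the weights makes the convolution a finite sum.\<close>

lemma gpart_mult:
  assumes f: "\<And>t. t \<in> ks f \<Longrightarrow> wt w k t < N" and g: "\<And>t. t \<in> ks g \<Longrightarrow> wt w k t < N"
  shows "gpart w k e (f * g) = (\<Sum>(a, c)\<in>{(a, c) \<in> {..<N} \<times> {..<N}. a + c = e}. gpart w k a f * gpart w k c g)"
proof -
  have "f * g = (\<Sum>a<N. gpart w k a f) * (\<Sum>c<N. gpart w k c g)"
    using sum_gpart_bounded[of f w k N] sum_gpart_bounded[of g w k N] f g by simp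
  also have "\<dots> = (\<Sum>(a, c)\<in>{..<N} \<times> {..<N}. gpart w k a f * gpart w k c g)"
    by (simp add: sum_product sum.cartesian_product)
  finally have "gpart w k e (f * g) = (\<Sum>(a, c)\<in>{..<N} \<times> {..<N}. gpart w k e (gpart w k a f * gpart w k c g))"
    by (simp add: gpart_sum split_def)
  also have "\<dots> = (\<Sum>(a, c)\<in>{..<N} \<times> {..<N}. if a + c = e then gpart w k a f * gpart w k c g else 0)"
    using gpart_homog[OF homog_mult[OF homog_gpart homog_gpart], of w k e _ f _ g] by simp
  also have "\<dots> = (\<Sum>p\<in>{..<N} \<times> {..<N}. if fst p + snd p = e then gpart w k (fst p) f * gpart w k (snd p) g else 0)"
    by (simp only: split_def)
  also have "\<dots> = (\<Sum>p\<in>{p \<in> {..<N} \<times> {..<N}. fst p + snd p = e}. gpart w k (fst p) f * gpart w k (snd p) g)"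
    by (rule sum.inter_filter[symmetric]) simp
  finally show ?thesis by (simp only: split_def prod.collapse)
qed

text \<open>The largest homogeneous ideal inside \<open>q\<close>.\<close>

definition homog_core :: "(nat \<Rightarrow> nat) \<Rightarrow> nat \<Rightarrow> 'a::comm_ring_1 mpol set \<Rightarrow> 'a mpol set" where
  "homog_core w k q = {f \<in> q. \<forall>e. gpart w k e f \<in> q}"

text \<open>If \<open>f\<close> and \<open>g\<close> are outside, consider their parts of lowest weight that are not in \<open>q\<close>. In the corresponding part of \<open>f g\<close> all other
  products lie in \<open>q\<close>, so the product of these two parts would lie in \<open>q\<close> as well.\<close>

lemma homog_core_prime:
  assumes C: "subring_set C" and q: "prime_in (mpol_over C l) q" shows "prime_in (mpol_over C l) (homog_core w k q)"
proof -
  let ?B = "mpol_over C l"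
  have B: "subring_set ?B" by (rule subring_mpol_over[OF C])
  note qt = prime_inD(1)[OF q]
  have all: "f \<in> homog_core w k q" if "\<And>e. gpart w k e f \<in> q" for f
  proof -
    have "(\<Sum>e\<in>wt w k ` ks f. gpart w k e f) \<in> q" by (rule ideal_in_sum[OF qt that])
    then have "f \<in> q" using sum_gpart[of f w k] by simp
    then show ?thesis using that by (simp add: homog_core_def)
  qed
  have sub: "homog_core w k q \<subseteq> ?B" using ideal_inD(1)[OF qt] by (auto simp: homog_core_def)
  have "ideal_in ?B (homog_core w k q)" unfolding ideal_in_def
  proof (intro conjI ballI sub)
    show "0 \<in> homog_core w k q" using ideal_inD(2)[OF qt] by (simp add: homog_core_def)
    fix x y assume "x \<in> homog_core w k q" "y \<in> homog_core w k q"
    then show "x + y \<in> homog_core w k q" using ideal_inD(3)[OF qt] by (simp add: homog_core_def gpart_add)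
  next
    fix x b assume x: "x \<in> homog_core w k q" and b: "b \<in> ?B"
    obtain N1 N2 where N: "\<forall>t\<in>ks b. wt w k t < N1" "\<forall>t\<in>ks x. wt w k t < N2"
      using finite_ks_bound[of b w k] finite_ks_bound[of x w k] by blast
    show "b * x \<in> homog_core w k q"
    proof (rule all)
      fix e
      have "gpart w k e (b * x) = (\<Sum>(a, c)\<in>{(a, c) \<in> {..<max N1 N2} \<times> {..<max N1 N2}. a + c = e}. gpart w k a b * gpart w k c x)"
        by (rule gpart_mult) (use N in \<open>auto simp: less_max_iff_disj\<close>)
      also have "\<dots> \<in> q"
      proof (rule ideal_in_sum[OF qt])
        fix p assume "p \<in> {(a, c) \<in> {..<max N1 N2} \<times> {..<max N1 N2}. a + c = e}"
        have "gpart w k (fst p) b * gpart w k (snd p) x \<in> q"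
          by (rule ideal_inD(4)[OF qt _ gpart_mpol_over[OF b]]) (use x in \<open>simp add: homog_core_def\<close>)
        then show "(case p of (a, c) \<Rightarrow> gpart w k a b * gpart w k c x) \<in> q" by (simp add: split_def)
      qed
      finally show "gpart w k e (b * x) \<in> q" .
    qed
  qed
  moreover have "1 \<notin> homog_core w k q" using prime_inD(2)[OF q] by (simp add: homog_core_def)
  moreover have "f \<in> homog_core w k q \<or> g \<in> homog_core w k q" if f: "f \<in> ?B" and g: "g \<in> ?B" and fg: "f * g \<in> homog_core w k q" for f g
  proof (rule ccontr)
    assume n: "\<not> ?thesis"
    have ex: "\<exists>a. gpart w k a h \<notin> q \<and> (\<forall>a'<a. gpart w k a' h \<in> q)" if "h \<notin> homog_core w k q" for h
    proof -
      have "\<exists>a. gpart w k a h \<notin> q" using all[of h] that by blast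
      then show ?thesis using exists_least_iff[of "\<lambda>a. gpart w k a h \<notin> q"] by simp
    qed
    obtain a0 where a0: "gpart w k a0 f \<notin> q" "\<And>a. a < a0 \<Longrightarrow> gpart w k a f \<in> q" using ex[of f] n by blast
    obtain c0 where c0: "gpart w k c0 g \<notin> q" "\<And>c. c < c0 \<Longrightarrow> gpart w k c g \<in> q" using ex[of g] n by blast
    obtain N1 N2 where N: "\<forall>t\<in>ks f. wt w k t < N1" "\<forall>t\<in>ks g. wt w k t < N2"
      using finite_ks_bound[of f w k] finite_ks_bound[of g w k] by blast
    define N where "N = max (max N1 N2) (Suc (max a0 c0))"
    let ?S = "{(a, c) \<in> {..<N} \<times> {..<N}. a + c = a0 + c0}"
    have fin: "finite ?S" by (rule finite_subset[of _ "{..<N} \<times> {..<N}"]) auto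
    have in0: "(a0, c0) \<in> ?S" by (auto simp: N_def less_max_iff_disj)
    have "gpart w k (a0 + c0) (f * g) = (\<Sum>(a, c)\<in>?S. gpart w k a f * gpart w k c g)"
      by (rule gpart_mult) (use N in \<open>auto simp: N_def less_max_iff_disj\<close>)
    also have "\<dots> = gpart w k a0 f * gpart w k c0 g + (\<Sum>(a, c)\<in>?S - {(a0, c0)}. gpart w k a f * gpart w k c g)"
      by (subst sum.remove[OF fin in0]) simp
    finally have e: "gpart w k a0 f * gpart w k c0 g = gpart w k (a0 + c0) (f * g) - (\<Sum>(a, c)\<in>?S - {(a0, c0)}. gpart w k a f * gpart w k c g)"
      by simp
    have "(\<Sum>(a, c)\<in>?S - {(a0, c0)}. gpart w k a f * gpart w k c g) \<in> q"
    proof (rule ideal_in_sum[OF qt])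
      fix p assume p: "p \<in> ?S - {(a0, c0)}"
      obtain a c where ac: "p = (a, c)" by (cases p)
      have "a + c = a0 + c0" "a \<noteq> a0 \<or> c \<noteq> c0" using p ac by auto
      then have "a < a0 \<or> c < c0" by linarith
      then have "gpart w k a f * gpart w k c g \<in> q"
      proof
        assume "a < a0" then show ?thesis by (rule ideal_inD(5)[OF qt a0(2) gpart_mpol_over[OF g]])
      next
        assume "c < c0" then show ?thesis by (rule ideal_inD(4)[OF qt c0(2) gpart_mpol_over[OF f]])
      qed
      then show "(case p of (a, c) \<Rightarrow> gpart w k a f * gpart w k c g) \<in> q" using ac by simp
    qed
    moreover have "gpart w k (a0 + c0) (f * g) \<in> q" using fg by (simp add: homog_core_def)
    ultimately have "gpart w k a0 f * gpart w k c0 g \<in> q" unfolding e using ideal_in_diff[OF B qt] by blast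
    then show False using prime_inD(3)[OF q gpart_mpol_over[OF f] gpart_mpol_over[OF g]] a0(1) c0(1) by blast
  qed
  ultimately show ?thesis unfolding prime_in_def by blast
qed

lemma eval_hom_eval_hom: assumes "ring_map \<kappa>" shows "eval_hom \<kappa> u (eval_hom const v c) = eval_hom \<kappa> (\<lambda>j. eval_hom \<kappa> u (v j)) c"
proof -
  note h = ring_mapD[OF eval_hom_ring_map[OF assms], of u]
  have "eval_hom \<kappa> u (eval_hom const v c) = (\<Sum>t\<in>ks c. \<kappa> (lk c t) * (\<Prod>i\<in>ks t. eval_hom \<kappa> u (v i) ^ lk t i))"
    unfolding eval_hom_def[of const v c] h(8) h(3) h(9) h(7) eval_hom_const[OF assms] ..
  then show ?thesis unfolding eval_hom_def[of \<kappa> "\<lambda>j. eval_hom \<kappa> u (v j)"] .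
qed

text \<open>A function \<open>c \<in> A\<close> that vanishes at \<open>\<Gamma>\<close> lies in the ideal of the zero point of \<open>P\<close> without variables \<open>x\<^sub>j\<close>, whose generators have
  constant coefficients \<open>a\<^sub>i - \<gamma>\<^sub>i\<close>.\<close>

lemma A_point_eq:
  fixes \<Gamma> :: "'k::field vec"
  shows "A_point m \<Gamma> = {c \<in> AC m. eval_at \<Gamma> c = 0}"
proof -
  let ?H = "{indet i - const (\<Gamma> $ i) | i. i < m}"
  have A: "subring_set (AC m :: 'k mpol set)" by (rule subring_AC)
  have HA: "?H \<subseteq> AC m"
  proof -
    have "indet i - const (\<Gamma> $ i) \<in> AC m" if "i < m" for i
      by (intro subring_setD(3)[OF A] indet_mpol_over[OF subring_UNIV] const_mpol_over[OF subring_UNIV] that UNIV_I)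
    then show ?thesis by blast
  qed
  have eq: "A_point m \<Gamma> = span_in (AC m) ?H"
    unfolding A_point_def A_ring_eq by (rule genideal_eq_span_in[OF A HA])
  have J: "ideal_in (AC m) (span_in (AC m) ?H)" by (rule span_in_ideal_in[OF A HA])
  have "prime_in (AC m) {c \<in> AC m. eval_at \<Gamma> c = 0}" by (rule hom_kernel_prime[OF A ring_map_eval_at])
  then have 1: "span_in (AC m) ?H \<subseteq> {c \<in> AC m. eval_at \<Gamma> c = 0}"
  proof (intro span_in_minimal prime_inD(1))
    show "?H \<subseteq> {c \<in> AC m. eval_at \<Gamma> c = 0}" using HA by (auto simp: ring_mapD[OF ring_map_eval_at])
  qed
  let ?J = "{f \<in> PC m 0. lk f 0 \<in> span_in (AC m) ?H}"
  have B: "subring_set (PC m 0 :: 'k mpol mpol set)" by (rule subring_PC)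
  have tJ: "ideal_in (PC m 0) ?J" unfolding ideal_in_def
  proof (intro conjI ballI)
    show "0 \<in> ?J" using ideal_inD(2)[OF J] subring_setD(2)[OF B] by simp
    fix x y assume "x \<in> ?J" "y \<in> ?J"
    then show "x + y \<in> ?J" using ideal_inD(3)[OF J] subring_setD(5)[OF B] by (simp add: lookup_add)
  next
    fix x b :: "'k mpol mpol" assume "x \<in> ?J" "b \<in> PC m 0"
    then show "b * x \<in> ?J" using ideal_inD(4)[OF J _ lk_AC[of b m 0 0]] subring_setD(4)[OF B]
      by (simp add: ring_mapD(3)[OF ring_map_lk0])
  qed auto
  have "P_zero_point m 0 \<Gamma> \<subseteq> ?J" unfolding P_zero_point_eq(1)
  proof (rule span_in_minimal[OF tJ])
    have "const (indet i - const (\<Gamma> $ i)) \<in> ?J" if "i < m" for i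
    proof -
      have "const (indet i - const (\<Gamma> $ i)) \<in> PC m 0" using zero_pt_generators_PC[of \<Gamma> m 0] that by auto
      moreover have "indet i - const (\<Gamma> $ i) \<in> span_in (AC m) ?H" using span_in_superset[OF A, of ?H] that by blast
      ultimately show ?thesis by simp
    qed
    then show "{const (indet i - const (\<Gamma> $ i)) |i. i < m} \<union> {indet j |j. j < (0::nat)} \<subseteq> ?J" by auto
  qed
  then have 2: "zero_pt m 0 \<Gamma> \<subseteq> ?J" unfolding P_zero_point_eq(2) .
  have "c \<in> span_in (AC m) ?H" if c: "c \<in> AC m" "eval_at \<Gamma> c = 0" for c
  proof -
    have "const c \<in> zero_pt m 0 \<Gamma>" using const_mpol_over[OF A c(1)] c(2) by (simp add: zero_pt_def)
    then have "const c \<in> ?J" using 2 by blast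
    then show ?thesis by simp
  qed
  then show ?thesis unfolding eq using 1 by blast
qed

lemma Sup_enat_attained:
  assumes "\<exists>r. P r" "\<And>r. P r \<Longrightarrow> r \<le> N"
  shows "\<exists>l. Sup {enat r | r. P r} = enat l \<and> P l \<and> (\<forall>r. P r \<longrightarrow> r \<le> l)"
proof -
  obtain l where l: "P l" "\<And>r. P r \<Longrightarrow> r \<le> l"
    using assms ex_has_greatest_nat[of P _ "\<lambda>x. x" "Suc N"] by (metis less_Suc_eq_le)
  have "Sup {enat r | r. P r} = enat l"
  proof (rule antisym)
    show "Sup {enat r | r. P r} \<le> enat l" by (rule Sup_least) (use l(2) in auto)
    show "enat l \<le> Sup {enat r | r. P r}" by (rule Sup_upper) (use l(1) in auto)
  qed
  then show ?thesis using l by blast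
qed

context positive_alg begin

abbreviation "\<rho> \<Gamma> \<equiv> rank_K (lin_mat_K k G \<Gamma>)"

lemma chain_subset_0: "prime_chain r p \<Longrightarrow> p 0 \<subseteq> p r" by (rule prime_chain_mono[where i = 0 and j = r and r = r]) simp_all

text \<open>A minor of size \<open>\<rho>(\<Gamma>)\<close> with nonzero value at \<open>\<Gamma>\<close> lies outside the ideal of the zero point, hence outside all primes of the chain.\<close>

lemma minor_chain_bound_zero_point:
  assumes p: "prime_chain r p" "p r \<subseteq> zero_pt m k \<Gamma>" shows "r + \<rho> \<Gamma> \<le> m + k"
proof -
  let ?M = "lin_mat_K k G \<Gamma>"
  have dims: "dim_row ?M = length G" "dim_col ?M = k" by (simp_all add: lin_mat_K_def)
  obtain "is" js where len: "length is = \<rho> \<Gamma>" "length js = \<rho> \<Gamma>" and r: "set is \<subseteq> {..<length G}" "set js \<subseteq> {..<k}"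
    and nz: "det (minor_matrix ?M is js) \<noteq> 0"
    using has_minor_iff_rank_K(2)[of ?M] unfolding has_minor_def dims by blast
  have D: "det (minor_matrix ?M is js) = eval_at \<Gamma> (det (minor_matrix LA is js))"
    unfolding lin_mat_K_def by (rule det_minor_matrix_map[OF ring_map_eval_at]) (use len r in simp_all)
  have "const (det (minor_matrix LA is js)) \<notin> zero_pt m k \<Gamma>" using nz unfolding D zero_pt_def by simp
  then have "const (det (minor_matrix LA is js)) \<notin> p 0" using p(2) chain_subset_0[OF p(1)] by blast
  from minor_chain_bound[OF len r this p(1)] show ?thesis .
qed

text \<open>By the upper bound the lengths of the chains are bounded, so the Krull dimension of the local ring is finite and attained.\<close>

lemma loc_dim_attained:
  "\<exists>p. prime_chain (loc_dim m k I \<Gamma>) p \<and> p (loc_dim m k I \<Gamma>) \<subseteq> zero_pt m k \<Gamma>"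
  "\<And>r p. prime_chain r p \<Longrightarrow> p r \<subseteq> zero_pt m k \<Gamma> \<Longrightarrow> r \<le> loc_dim m k I \<Gamma>"
proof -
  let ?P = "\<lambda>r. \<exists>p. prime_chain r p \<and> p r \<subseteq> zero_pt m k \<Gamma>"
  have "krull_dim (R_loc m k I \<Gamma>) = Sup {enat r | r. \<exists>f. spec_chain Q r f \<and> f r \<subseteq> MM \<Gamma>}"
    unfolding R_loc_def R_ring_Q R_zero_point_MM by (rule localize.krull_dim_L[OF localize_MM])
  also have "\<dots> = Sup {enat r | r. ?P r}"
    unfolding MM_def spec_chain_iff_prime_chain[OF prime_inD(1)[OF zero_pt_prime] I_zero_pt] ..
  finally have k: "krull_dim (R_loc m k I \<Gamma>) = Sup {enat r | r. ?P r}" .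
  have "\<exists>r. ?P r"
  proof -
    have "prime_chain 0 (\<lambda>_. zero_pt m k \<Gamma>)" using zero_pt_prime I_zero_pt by (simp add: prime_chain_def)
    then show ?thesis by blast
  qed
  moreover have "r \<le> m + k" if "?P r" for r
  proof -
    from that obtain p where "prime_chain r p" "p r \<subseteq> zero_pt m k \<Gamma>" by blast
    from minor_chain_bound_zero_point[OF this] show ?thesis by simp
  qed
  ultimately obtain l where l: "Sup {enat r | r. ?P r} = enat l" "?P l" "\<forall>r. ?P r \<longrightarrow> r \<le> l"
    using Sup_enat_attained[of ?P "m + k"] by blast
  have ld: "loc_dim m k I \<Gamma> = l" unfolding loc_dim_def k l(1) by simp
  show "?P (loc_dim m k I \<Gamma>)" unfolding ld by (rule l(2))
  show "r \<le> loc_dim m k I \<Gamma>" if "prime_chain r p" "p r \<subseteq> zero_pt m k \<Gamma>" for r p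
    unfolding ld using l(3) that by blast
qed

lemma loc_dim_le: "loc_dim m k I \<Gamma> + \<rho> \<Gamma> \<le> m + k"
  using loc_dim_attained(1)[of \<Gamma>] minor_chain_bound_zero_point by blast

lemma chain_le_dim:
  assumes d: "krull_dim (R_ring m k I) = enat d" and p: "prime_chain r p" shows "r \<le> d"
proof -
  have "enat r \<le> Sup {enat r | r. \<exists>p. prime_chain r p}" by (rule Sup_upper) (use p in blast)
  then show ?thesis using d unfolding R_ring_Q krull_dim_Q by simp
qed

lemma chain_dim_exists:
  assumes d: "krull_dim (R_ring m k I) = enat d" shows "\<exists>p. prime_chain d p"
proof -
  have "prime_chain 0 (\<lambda>_. x_ideal m k)" using x_ideal_prime I_x_ideal by (simp add: prime_chain_def)
  then obtain l where l: "Sup {enat r | r. \<exists>p. prime_chain r p} = enat l" "\<exists>p. prime_chain l p"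
    using Sup_enat_attained[of "\<lambda>r. \<exists>p. prime_chain r p" d] chain_le_dim[OF d] by blast
  then show ?thesis using d unfolding R_ring_Q krull_dim_Q by simp
qed

lemma loc_dim_le_dim: "krull_dim (R_ring m k I) = enat d \<Longrightarrow> loc_dim m k I \<Gamma> \<le> d"
  using loc_dim_attained(1)[of \<Gamma>] chain_le_dim by blast

text \<open>The empty minor is \<open>1\<close>, so the upper bound applies to every chain.\<close>

lemma dim_le: assumes d: "krull_dim (R_ring m k I) = enat d" shows "d \<le> m + k"
proof -
  obtain p where p: "prime_chain d p" using chain_dim_exists[OF d] by blast
  have "prime_in B (p 0)" using p by (simp add: prime_chain_def)
  then have "const (det (minor_matrix LA [] [])) \<notin> p 0"
    using prime_inD(2)[of B "p 0"] by (simp add: minor_matrix_def det_def' const_simps)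
  from minor_chain_bound[of "[]" 0 "[]", OF _ _ _ _ this p] show ?thesis by simp
qed

lemma rank_A_minor: "has_minor LA r \<longleftrightarrow> r \<le> rank_A m LA" "has_minor LA (rank_A m LA)"
  using has_minor_iff_rank_A[of LA m] LA_in by simp_all

lemma rank_K_le_rank_A: "\<rho> \<Gamma> \<le> rank_A m LA"
proof -
  have "has_minor (map_mat (eval_at \<Gamma>) LA) (\<rho> \<Gamma>)"
    using has_minor_iff_rank_K(2)[of "lin_mat_K k G \<Gamma>"] unfolding lin_mat_K_def .
  then have "has_minor LA (\<rho> \<Gamma>)" by (rule has_minor_map[OF ring_map_eval_at])
  then show ?thesis by (simp only: rank_A_minor)
qed

lemma Sing0_eq: "Sing0 m k I = {\<Gamma> \<in> carrier_vec m. int (\<rho> \<Gamma>) < int (m + k) - int (loc_dim m k I \<Gamma>)}"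
  unfolding Sing0_def embcodim_loc using zero_point_cot_basis(2) by (auto simp: of_nat_diff trans_le_add2)

text \<open>Elements of \<open>I\<close> have no constant coefficient, so the map \<open>R \<rightarrow> A\<close> sends the class of \<open>f\<close> to the constant coefficient of \<open>f\<close>.\<close>

lemma zero_section_eq: "zero_section m k I = MM ` carrier_vec m"
proof -
  have zm: "zero_map (\<pi> f) = lk f 0" for f
  proof -
    have "\<pi> f = {i + f | i. i \<in> I}" by (auto simp: a_r_coset_def')
    then have "(\<lambda>f. lk f 0) ` (\<pi> f) = (\<lambda>i. lk i 0 + lk f 0) ` I" by (force simp: lookup_add)
    also have "\<dots> = {lk f 0}" using I_lk0 ideal_inD(2)[OF I_ideal_in] by force
    finally show ?thesis unfolding zero_map_def by simp
  qed
  have "{X \<in> carrier Q. zero_map X \<in> A_point m \<Gamma>} = MM \<Gamma>" for \<Gamma>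
  proof
    show "{X \<in> carrier Q. zero_map X \<in> A_point m \<Gamma>} \<subseteq> MM \<Gamma>"
      unfolding carrier_Q MM_def zero_pt_def A_point_eq using zm by auto
    show "MM \<Gamma> \<subseteq> {X \<in> carrier Q. zero_map X \<in> A_point m \<Gamma>}"
    proof
      fix X assume "X \<in> MM \<Gamma>"
      then obtain f where f: "f \<in> zero_pt m k \<Gamma>" "X = \<pi> f" unfolding MM_def by blast
      have fB: "f \<in> B" by (rule zero_pt_B[OF f(1)])
      show "X \<in> {X \<in> carrier Q. zero_map X \<in> A_point m \<Gamma>}"
        using f \<pi>_closed[OF fB] lk_AC[OF fB, of 0] by (simp add: A_point_eq zm zero_pt_def)
    qed
  qed
  then show ?thesis unfolding zero_section_def R_ring_Q by simp
qed

lemma zero_section_singular: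
  assumes "Sing0 m k I = carrier_vec m"
  shows "zero_section m k I \<subseteq> singular_locus (R_of_K m k I) (R_ring m k I)"
proof
  fix M assume "M \<in> zero_section m k I"
  then obtain \<Gamma> where \<Gamma>: "\<Gamma> \<in> carrier_vec m" "M = MM \<Gamma>" unfolding zero_section_eq by blast
  have "embcodim (R_loc_of_K m k I \<Gamma>) (R_loc m k I \<Gamma>) > 0" using \<Gamma>(1) assms by (auto simp: Sing0_def)
  moreover have "R_loc_of_K m k I \<Gamma> = (\<lambda>c. loc_frac Q (MM \<Gamma>) (\<iota> c) \<one>\<^bsub>Q\<^esub>)"
    by (rule ext) (simp only: R_loc_of_K_def R_of_K_\<iota> R_ring_Q R_zero_point_MM)
  moreover have "R_loc m k I \<Gamma> = localization Q (MM \<Gamma>)"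
    by (simp only: R_loc_def R_ring_Q R_zero_point_MM)
  ultimately have "embcodim (\<lambda>c. loc_frac Q (MM \<Gamma>) (\<iota> c) \<one>\<^bsub>Q\<^esub>) (localization Q (MM \<Gamma>)) > 0" by (simp only:)
  moreover have "MM \<Gamma> \<in> rational_points \<iota> Q"
    unfolding rational_points_def using MM_maximal MM_residue by blast
  ultimately show "M \<in> singular_locus (R_of_K m k I) (R_ring m k I)"
    unfolding singular_locus_def R_of_K_\<iota> R_ring_Q \<Gamma>(2) by blast
qed

text \<open>The value of a minor of \<open>L\<^sub>A(G)\<close> at \<open>\<Gamma>\<close> is the corresponding minor of \<open>L\<^sub>K(G\<^sub>\<Gamma>)\<close>.\<close>

lemma zero_set_minors: "zero_set m (minors_ideal m r LA) = {\<Gamma> \<in> carrier_vec m. \<rho> \<Gamma> < r}"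
proof -
  let ?ok = "\<lambda>S T. S \<subseteq> {..<dim_row LA} \<and> T \<subseteq> {..<dim_col LA} \<and> card S = r \<and> card T = r"
  let ?H = "{det (submatrix LA S T) | S T. ?ok S T}"
  have sp: "length (sorted_elems S) = r" "length (sorted_elems T) = r" "set (sorted_elems S) = S" "set (sorted_elems T) = T"
    "submatrix LA S T = minor_matrix LA (sorted_elems S) (sorted_elems T)" if "?ok S T" for S T
    using that sorted_elems[of S] sorted_elems[of T] finite_subset[of S "{..<dim_row LA}"] finite_subset[of T "{..<dim_col LA}"]
      submatrix_minor_matrix[of S LA T] by simp_all
  have HA: "?H \<subseteq> A"
  proof
    fix x assume "x \<in> ?H"
    then obtain S T where ST: "?ok S T" and x: "x = det (submatrix LA S T)" by blast
    note s = sp[OF ST]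
    have i1: "sorted_elems S ! a < length G" if "a < r" for a using nth_mem[of a "sorted_elems S"] that s ST by auto
    have i2: "sorted_elems T ! a < k" if "a < r" for a using nth_mem[of a "sorted_elems T"] that s ST by auto
    show "x \<in> A" unfolding x s(5)
    proof (rule subring_det[OF subA, of _ r])
      show "minor_matrix LA (sorted_elems S) (sorted_elems T) \<in> carrier_mat r r" using s by (simp add: minor_matrix_def)
      show "minor_matrix LA (sorted_elems S) (sorted_elems T) $$ (a, b) \<in> A" if "a < r" "b < r" for a b
        using LA_in[OF i1[OF that(1)] i2[OF that(2)]] that s by (simp add: minor_matrix_def)
    qed
  qed
  have J: "minors_ideal m r LA = span_in A ?H"
    unfolding minors_ideal_def A_ring_eq by (rule genideal_eq_span_in[OF subA HA])
  have "(\<forall>f\<in>minors_ideal m r LA. eval_at \<Gamma> f = 0) \<longleftrightarrow> \<rho> \<Gamma> < r" for \<Gamma>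
  proof -
    have pr: "prime_in A {c \<in> A. eval_at \<Gamma> c = 0}" by (rule hom_kernel_prime[OF subA ring_map_eval_at])
    have "(\<forall>f\<in>minors_ideal m r LA. eval_at \<Gamma> f = 0) \<longleftrightarrow> (\<forall>f\<in>?H. eval_at \<Gamma> f = 0)"
    proof
      assume a: "\<forall>f\<in>?H. eval_at \<Gamma> f = 0"
      have "?H \<subseteq> {c \<in> A. eval_at \<Gamma> c = 0}" using HA a by blast
      then have "span_in A ?H \<subseteq> {c \<in> A. eval_at \<Gamma> c = 0}" by (rule span_in_minimal[OF prime_inD(1)[OF pr]])
      then show "\<forall>f\<in>minors_ideal m r LA. eval_at \<Gamma> f = 0" unfolding J by blast
    next
      assume "\<forall>f\<in>minors_ideal m r LA. eval_at \<Gamma> f = 0"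
      then show "\<forall>f\<in>?H. eval_at \<Gamma> f = 0" unfolding J using span_in_superset[OF subA, of ?H] by blast
    qed
    also have "\<dots> \<longleftrightarrow> (\<forall>S T. ?ok S T \<longrightarrow> eval_at \<Gamma> (det (submatrix LA S T)) = 0)" by blast
    also have "\<dots> \<longleftrightarrow> (\<forall>S T. ?ok S T \<longrightarrow> det (submatrix (lin_mat_K k G \<Gamma>) S T) = 0)"
    proof -
      have "det (submatrix (lin_mat_K k G \<Gamma>) S T) = eval_at \<Gamma> (det (submatrix LA S T))" if "?ok S T" for S T
      proof -
        note s = sp[OF that]
        have "submatrix (lin_mat_K k G \<Gamma>) S T = minor_matrix (lin_mat_K k G \<Gamma>) (sorted_elems S) (sorted_elems T)"
          by (rule submatrix_minor_matrix) (use that in \<open>simp_all add: lin_mat_K_def\<close>)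
        moreover have "det (minor_matrix (lin_mat_K k G \<Gamma>) (sorted_elems S) (sorted_elems T)) = eval_at \<Gamma> (det (minor_matrix LA (sorted_elems S) (sorted_elems T)))"
          unfolding lin_mat_K_def by (rule det_minor_matrix_map[OF ring_map_eval_at]) (use s that in simp_all)
        ultimately show ?thesis using s(5) by simp
      qed
      then show ?thesis by (simp cong: imp_cong)
    qed
    also have "\<dots> \<longleftrightarrow> \<not> has_minor (lin_mat_K k G \<Gamma>) r"
      unfolding has_minor_iff_submatrix by (simp add: lin_mat_K_def) blast
    also have "\<dots> \<longleftrightarrow> \<rho> \<Gamma> < r" unfolding has_minor_iff_rank_K(1) by (rule not_le)
    finally show ?thesis .
  qed
  then show ?thesis unfolding zero_set_def by simp
qed

text \<open>Take a minimal prime \<open>q\<close> over \<open>I\<close> inside \<open>\<langle>x\<rangle>\<close>. Its homogeneous core is a prime that still contains the homogeneous ideal \<open>I\<close>, so it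
  equals \<open>q\<close> by minimality.\<close>

lemma minimal_prime_in_x_ideal:
  assumes d: "krull_dim (R_ring m k I) = enat d" and eq: "equidimensional (Spec (R_ring m k I))"
  shows "\<exists>q p. prime_in B q \<and> homog_ideal w k q \<and> I \<subseteq> q \<and> q \<subseteq> x_ideal m k \<and> prime_chain d p \<and> p 0 = q"
proof -
  have xp: "primeideal ((\<lambda>f. \<pi> f) ` x_ideal m k) Q" by (rule img_prime[OF x_ideal_prime I_x_ideal])
  obtain q' where q': "q' \<subseteq> (\<lambda>f. \<pi> f) ` x_ideal m k" "Q.minimal_prime q'"
    using Q.minimal_prime_exists[OF xp] by blast
  have q'p: "primeideal q' Q" using q'(2) by (simp add: Q.minimal_prime_def)
  obtain p where p: "prime_chain d p" using chain_dim_exists[OF d] by blast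
  have pB: "p d \<subseteq> B" by (rule ideal_inD(1)[OF prime_inD(1)]) (use p in \<open>simp add: prime_chain_def\<close>)
  have BB: "ideal_in B B" unfolding ideal_in_def by (simp add: subring_setD[OF subB])
  have "\<exists>p. prime_chain d p \<and> p d \<subseteq> B" using p pB by (intro exI[of _ p] conjI)
  then have "\<exists>f. spec_chain Q d f \<and> f d \<subseteq> (\<lambda>f. \<pi> f) ` B"
    by (rule iffD2[OF spec_chain_iff_prime_chain[OF BB ideal_inD(1)[OF I_ideal_in]]])
  then obtain f0 where f0: "spec_chain Q d f0" by (elim exE conjE)
  obtain f where f: "spec_chain Q d f" "f 0 = q'"
    using Q.equidimensional_chain[OF eq[unfolded R_ring_Q] f0 q'(2)] by (elim exE conjE)
  define q where "q = pre q'"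
  have q: "prime_in B q" unfolding q_def by (rule pre_prime[OF q'p])
  have Iq: "I \<subseteq> q" unfolding q_def by (rule pre_I[OF q'p])
  have img: "(\<lambda>f. \<pi> f) ` q = q'" unfolding q_def by (rule img_pre[OF prime_carrier[OF q'p]])
  have qB: "q \<subseteq> B" by (rule ideal_inD(1)[OF prime_inD(1)[OF q]])
  have qx: "q \<subseteq> x_ideal m k"
  proof
    fix g assume g: "g \<in> q"
    then have gB: "g \<in> B" using qB by blast
    have "\<pi> g \<in> q'" using g unfolding q_def pre_def by simp
    then have "\<pi> g \<in> (\<lambda>f. \<pi> f) ` x_ideal m k" using q'(1) by blast
    then show "g \<in> x_ideal m k" by (rule iffD1[OF mem_img_iff[OF prime_inD(1)[OF x_ideal_prime] I_x_ideal gB]])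
  qed
  let ?c = "homog_core w k q"
  have c: "prime_in B ?c" by (rule homog_core_prime[OF subA q])
  have Ic: "I \<subseteq> ?c" using Iq I_homog_ideal unfolding homog_core_def homog_ideal_def by blast
  have cq: "?c \<subseteq> q" by (auto simp: homog_core_def)
  have "primeideal ((\<lambda>f. \<pi> f) ` ?c) Q" by (rule img_prime[OF c Ic])
  moreover have "(\<lambda>f. \<pi> f) ` ?c \<subseteq> q'" using cq unfolding img[symmetric] by blast
  ultimately have ce: "(\<lambda>f. \<pi> f) ` ?c = q'" using q'(2) unfolding Q.minimal_prime_def by blast
  have qc: "g \<in> ?c" if g: "g \<in> q" for g
  proof -
    have gc: "\<pi> g \<in> (\<lambda>f. \<pi> f) ` ?c" unfolding ce img[symmetric] by (rule imageI[OF g])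
    show ?thesis by (rule iffD1[OF mem_img_iff[OF prime_inD(1)[OF c] Ic subsetD[OF qB g]] gc])
  qed
  have qh: "homog_ideal w k q" unfolding homog_ideal_def using qc by (simp add: homog_core_def)
  have pf: "primeideal (f i) Q" if "i \<le> d" for i using f(1) that by (simp add: spec_chain_def)
  have "prime_chain d (\<lambda>i. pre (f i))" unfolding prime_chain_def
  proof (intro conjI allI impI)
    fix i assume "i \<le> d" then show "prime_in B (pre (f i))" by (intro pre_prime pf)
  next
    fix i assume i: "i < d"
    then have s: "f i \<subset> f (Suc i)" using f(1) by (simp add: spec_chain_def)
    have e: "(\<lambda>f. \<pi> f) ` pre (f i') = f i'" if "i' \<le> d" for i' by (rule img_pre[OF prime_carrier[OF pf[OF that]]])
    have "pre (f i) \<noteq> pre (f (Suc i))"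
    proof
      assume a: "pre (f i) = pre (f (Suc i))"
      have "f i = (\<lambda>f. \<pi> f) ` pre (f (Suc i))" unfolding a[symmetric] by (rule e[symmetric]) (use i in simp)
      also have "\<dots> = f (Suc i)" by (rule e) (use i in simp)
      finally have "f i = f (Suc i)" .
      with less_imp_neq[OF s] show False by (rule notE)
    qed
    moreover have "pre (f i) \<subseteq> pre (f (Suc i))" using s unfolding pre_def by blast
    ultimately show "pre (f i) \<subset> pre (f (Suc i))" by blast
  next
    show "I \<subseteq> pre (f 0)" using Iq unfolding q_def f(2) .
  qed
  moreover have "pre (f 0) = q" unfolding f(2) q_def ..
  ultimately show ?thesis using q qh Iq qx by (intro exI[of _ q] exI[of _ "\<lambda>i. pre (f i)"] conjI)
qed

text \<open>The ideals \<open>\<langle>x, a\<^sub>1 - \<gamma>\<^sub>1, \<dots>, a\<^sub>i - \<gamma>\<^sub>i\<rangle>\<close>, realized as kernels of the homomorphisms that kill all \<open>x\<^sub>j\<close> and specialize the first \<open>i\<close>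
  coordinates; the next function \<open>a\<^sub>i - \<gamma>\<^sub>i\<close> makes each inclusion strict.\<close>

lemma chain_over_x_ideal:
  "\<exists>K. (\<forall>i\<le>m. prime_in B (K i)) \<and> (\<forall>i<m. K i \<subset> K (Suc i)) \<and> x_ideal m k \<subseteq> K 0 \<and> K m \<subseteq> zero_pt m k \<Gamma>"
proof -
  define v where "v = (\<lambda>i j. if j < i then const (\<Gamma> $ j) else indet j :: 'k mpol)"
  define h where "h = (\<lambda>i (f :: 'k mpol mpol). eval_hom const (v i) (lk f 0))"
  have rh: "ring_map (h i)" for i unfolding h_def by (rule ring_map_comp[OF eval_hom_ring_map[OF ring_map_const] ring_map_lk0])
  define K where "K = (\<lambda>i. {f \<in> B. h i f = 0})"
  have step: "h (Suc i) f = eval_hom const (\<lambda>j. if j = i then const (\<Gamma> $ j) else indet j) (h i f)" for i f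
    unfolding h_def eval_hom_eval_hom[OF ring_map_const]
    by (rule arg_cong[where f = "\<lambda>v. eval_hom const v (lk f 0)"])
      (auto simp: fun_eq_iff v_def eval_hom_const[OF ring_map_const] eval_hom_indet[OF ring_map_const])
  have "K i \<subset> K (Suc i)" if i: "i < m" for i
  proof -
    let ?e = "const (indet i - const (\<Gamma> $ i)) :: 'k mpol mpol"
    have eB: "?e \<in> B" using zero_pt_generators_PC[of \<Gamma> m k] i by auto
    have hv: "h i' ?e = v i' i - const (\<Gamma> $ i)" for i'
      unfolding h_def by (simp add: ring_mapD[OF eval_hom_ring_map[OF ring_map_const]] eval_hom_const[OF ring_map_const] eval_hom_indet[OF ring_map_const])
    have "lk (indet i - const (\<Gamma> $ i) :: 'k mpol) (Poly_Mapping.single i 1) = 1"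
    proof -
      have "Poly_Mapping.single i (1::nat) \<noteq> 0" by (metis lookup_single_eq lookup_zero one_neq_zero)
      then show ?thesis by (simp add: lookup_minus lookup_const indet_def)
    qed
    then have "indet i - const (\<Gamma> $ i) \<noteq> (0 :: 'k mpol)" by (metis lookup_zero zero_neq_one)
    then have "?e \<notin> K i" "?e \<in> K (Suc i)" using eB by (simp_all add: K_def hv v_def)
    moreover have "K i \<subseteq> K (Suc i)"
      unfolding K_def using step ring_mapD(4)[OF eval_hom_ring_map[OF ring_map_const]] by auto
    ultimately show ?thesis by blast
  qed
  moreover have "prime_in B (K i)" for i unfolding K_def by (rule hom_kernel_prime[OF subB rh])
  moreover have "x_ideal m k \<subseteq> K 0"
    unfolding x_ideal_def K_def h_def using ring_mapD(4)[OF eval_hom_ring_map[OF ring_map_const]] by auto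
  moreover have "K m \<subseteq> zero_pt m k \<Gamma>"
  proof
    fix f assume "f \<in> K m"
    then have f: "f \<in> B" "eval_hom const (v m) (lk f 0) = 0" by (simp_all add: K_def h_def)
    have "(\<lambda>j. eval_hom (\<lambda>x. x) (($) \<Gamma>) (v m j)) = ($) \<Gamma>"
      by (auto simp: fun_eq_iff v_def eval_hom_const[OF ring_map_id] eval_hom_indet[OF ring_map_id])
    then have "eval_at \<Gamma> (lk f 0) = eval_at \<Gamma> (eval_hom const (v m) (lk f 0))"
      unfolding eval_at_eval_hom eval_hom_eval_hom[OF ring_map_id] by simp
    then show "f \<in> zero_pt m k \<Gamma>" unfolding f(2) zero_pt_def using f(1) ring_mapD(4)[OF ring_map_eval_at] by simp
  qed
  ultimately show ?thesis by (intro exI[of _ K]) simp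
qed

text \<open>Let \<open>q\<close> be the prime of the previous lemma. Nonzero elements of \<open>A\<close> are not in \<open>q\<close>, so a nonzero minor of maximal size bounds the chain
  of length \<open>d\<close>. For the local dimension, the graded chain of length \<open>t\<close> below \<open>\<langle>x\<rangle>\<close> is followed by the \<open>m\<close> specialization steps, and
  \<open>d \<le> m + t\<close>.\<close>

lemma equidimensional_case:
  assumes d: "krull_dim (R_ring m k I) = enat d" and eq: "equidimensional (Spec (R_ring m k I))"
  shows "d + rank_A m LA \<le> m + k" "loc_dim m k I \<Gamma> = d"
proof -
  obtain q p where q: "prime_in B q" "homog_ideal w k q" "I \<subseteq> q" "q \<subseteq> x_ideal m k" and p: "prime_chain d p" "p 0 = q"
    using minimal_prime_in_x_ideal[OF d eq] by (elim exE conjE)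
  have qA: "c = 0" if "const c \<in> q" for c
  proof -
    have "const c \<in> x_ideal m k" using that q(4) by blast
    then show ?thesis by (simp add: x_ideal_def)
  qed
  show "d + rank_A m LA \<le> m + k"
  proof -
    obtain "is" js where len: "length is = rank_A m LA" "length js = rank_A m LA"
      and r: "set is \<subseteq> {..<length G}" "set js \<subseteq> {..<k}" and nz: "det (minor_matrix LA is js) \<noteq> 0"
      using rank_A_minor(2) unfolding has_minor_def LA_dims by blast
    have "const (det (minor_matrix LA is js)) \<notin> p 0" unfolding p(2) using qA nz by blast
    from minor_chain_bound[OF len r this p(1)] show ?thesis .
  qed
  have qA': "c = 0" if "c \<in> A" "const c \<in> q" for c by (rule qA[OF that(2)])
  have "\<exists>L. distinct L \<and> set L \<subseteq> {..<k} \<and> alg_indep const A (map indet L) q \<and>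
    (\<forall>p r. p 0 = q \<longrightarrow> (\<forall>i\<le>r. prime_in B (p i)) \<longrightarrow> (\<forall>i<r. p i \<subset> p (Suc i)) \<longrightarrow> r \<le> m + length L)"
    by (rule alg_indep_maximal_bound[OF q(1) qA'])
  then obtain L where L: "distinct L" "set L \<subseteq> {..<k}" "alg_indep const A (map indet L) q"
    and bound: "\<forall>p r. p 0 = q \<longrightarrow> (\<forall>i\<le>r. prime_in B (p i)) \<longrightarrow> (\<forall>i<r. p i \<subset> p (Suc i)) \<longrightarrow> r \<le> m + length L"
    by (elim exE conjE)
  have dL: "d \<le> m + length L"
    by (rule bound[THEN spec[of _ p], THEN spec[of _ d], THEN mp, THEN mp, THEN mp]) (use p in \<open>simp_all add: prime_chain_def\<close>)
  let ?t = "length L"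
  have "\<exists>p. (\<forall>i\<le>?t. prime_in B (p i)) \<and> (\<forall>i<?t. p i \<subset> p (Suc i)) \<and> q \<subseteq> p 0 \<and> p ?t \<subseteq> x_ideal m k"
    by (rule graded_chain[OF prime_inD(1)[OF q(1)] q(2) w_pos L])
  then obtain P where P: "\<forall>i\<le>?t. prime_in B (P i)" "\<forall>i<?t. P i \<subset> P (Suc i)" "q \<subseteq> P 0" "P ?t \<subseteq> x_ideal m k"
    by (elim exE conjE)
  obtain K where K: "\<forall>i\<le>m. prime_in B (K i)" "\<forall>i<m. K i \<subset> K (Suc i)" "x_ideal m k \<subseteq> K 0" "K m \<subseteq> zero_pt m k \<Gamma>"
    using chain_over_x_ideal[of \<Gamma>] by (elim exE conjE)
  \<comment> \<open>The last member of the graded chain is only known to lie inside \<open>\<langle>x\<rangle>\<close>, so it is replaced by the first specialization ideal.\<close>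
  define c where "c = (\<lambda>i. if i < ?t then P i else K (i - ?t))"
  have "prime_chain (?t + m) c" unfolding prime_chain_def
  proof (intro conjI allI impI)
    fix i assume "i \<le> ?t + m" then show "prime_in B (c i)" using P(1) K(1) by (simp add: c_def)
  next
    fix i assume i: "i < ?t + m"
    show "c i \<subset> c (Suc i)"
    proof (cases "i < ?t")
      case True
      then have s: "P i \<subset> P (Suc i)" using P(2) by blast
      show ?thesis
      proof (cases "Suc i < ?t")
        case True then show ?thesis using s by (simp add: c_def)
      next
        case False
        then have e: "Suc i = ?t" using \<open>i < ?t\<close> by simp
        have "P i \<subset> K 0" using s P(4) K(3) unfolding e by blast
        then show ?thesis using True e by (simp add: c_def)
      qed
    next
      case False
      then have "K (i - ?t) \<subset> K (Suc (i - ?t))" using K(2) i by simp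
      then show ?thesis using False by (simp add: c_def Suc_diff_le)
    qed
  next
    show "I \<subseteq> c 0" using q(3) P(3) I_x_ideal K(3) by (auto simp: c_def)
  qed
  moreover have "c (?t + m) \<subseteq> zero_pt m k \<Gamma>" using K(4) by (simp add: c_def)
  ultimately have "?t + m \<le> loc_dim m k I \<Gamma>" by (rule loc_dim_attained(2))
  then show "loc_dim m k I \<Gamma> = d" using dL loc_dim_le_dim[OF d, of \<Gamma>] by simp
qed

end

theorem theorem6p1:
  fixes m k n d :: nat
    and W :: "nat list"
    and I :: "'k::field mpol mpol set"
    and G :: "'k mpol mpol list"
  assumes "n = m + k"
    and "positive_algebra m k W I"
    and "krull_dim (R_ring m k I) = enat d"
    and "set G \<subseteq> carrier (P_ring m k)"
    and "\<forall>g\<in>set G. W_homogeneous W g"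
    and "I = genideal (P_ring m k) (set G)"
  shows
    "(\<forall>\<Gamma>\<in>carrier_vec m.
        int (rank_K (lin_mat_K k G \<Gamma>)) = int n - int (Cot_dim m k I \<Gamma>) \<and>
        int n - int (Cot_dim m k I \<Gamma>) \<le> int n - int (loc_dim m k I \<Gamma>)) \<and>
     Sing0 m k I =
       {\<Gamma> \<in> carrier_vec m. int (rank_K (lin_mat_K k G \<Gamma>)) < int n - int (loc_dim m k I \<Gamma>)} \<and>
     (int (rank_A m (lin_mat_A k G)) < int n - int d \<longrightarrow>
        Sing0 m k I = carrier_vec m \<and>
        zero_section m k I \<subseteq> singular_locus (R_of_K m k I) (R_ring m k I)) \<and>
     (int (rank_A m (lin_mat_A k G)) = int n - int d \<longrightarrow>
        zero_set m (minors_ideal m (n - d) (lin_mat_A k G)) \<subseteq> Sing0 m k I) \<and>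
     (equidimensional (Spec (R_ring m k I)) \<longrightarrow>
        int (rank_A m (lin_mat_A k G)) \<le> int n - int d \<and>
        Sing0 m k I = zero_set m (minors_ideal m (n - d) (lin_mat_A k G)))"
proof -
  interpret positive_alg m k W I G by unfold_locales (rule assms)+
  note d = assms(3)
  have cot: "int (\<rho> \<Gamma>) = int n - int (Cot_dim m k I \<Gamma>)" for \<Gamma>
    unfolding Cot_dim_eq assms(1) using zero_point_cot_basis(2)[of \<Gamma>] by (simp add: of_nat_diff)
  have ld: "int n - int (Cot_dim m k I \<Gamma>) \<le> int n - int (loc_dim m k I \<Gamma>)" for \<Gamma>
    using loc_dim_le[of \<Gamma>] cot[of \<Gamma>] assms(1) by simp
  have S: "Sing0 m k I = {\<Gamma> \<in> carrier_vec m. int (\<rho> \<Gamma>) < int n - int (loc_dim m k I \<Gamma>)}"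
    using Sing0_eq assms(1) by simp
  have dn: "d \<le> n" using dim_le[OF d] assms(1) by simp
  have Zs: "zero_set m (minors_ideal m (n - d) LA) = {\<Gamma> \<in> carrier_vec m. int (\<rho> \<Gamma>) < int n - int d}"
    unfolding zero_set_minors using dn by auto
  have c: "Sing0 m k I = carrier_vec m" if "int (rank_A m LA) < int n - int d"
  proof -
    have "int (\<rho> \<Gamma>) < int n - int (loc_dim m k I \<Gamma>)" for \<Gamma>
      using that rank_K_le_rank_A[of \<Gamma>] loc_dim_le_dim[OF d, of \<Gamma>] by linarith
    then show ?thesis unfolding S by blast
  qed
  have dd: "zero_set m (minors_ideal m (n - d) LA) \<subseteq> Sing0 m k I"
  proof -
    have "int (\<rho> \<Gamma>) < int n - int (loc_dim m k I \<Gamma>)" if "int (\<rho> \<Gamma>) < int n - int d" for \<Gamma>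
      using that loc_dim_le_dim[OF d, of \<Gamma>] by linarith
    then show ?thesis unfolding S Zs by blast
  qed
  have e: "int (rank_A m LA) \<le> int n - int d \<and> Sing0 m k I = zero_set m (minors_ideal m (n - d) LA)"
    if "equidimensional (Spec (R_ring m k I))"
    unfolding S Zs using equidimensional_case[OF d that] assms(1) by auto
  show ?thesis
    by (intro conjI ballI impI cot ld S c zero_section_singular dd conjunct1[OF e] conjunct2[OF e])
qed

end
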